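(* Let $R$ be a commutative noetherian semilocal ring. Suppose $M$ is a finitely generated $R$-module which gives an NCR of $R$ and which is locally a generator outside a closed subscheme of $\operatorname{Spec}(R)$ of dimension at most one; that is, there is a closed subset $Z\subset\operatorname{Spec}(R)$ with $\dim Z\le 1$ such that $M_{\mathfrak p}$ is a generator of $\operatorname{mod} R_{\mathfrak p}$ for every prime $\mathfrak p\notin Z$. Then $K_0(R)$ is a finitely generated abelian group.
   Context: For a commutative noetherian ring $R$, $\operatorname{mod} R$ is the category of finitely generated $R$-modules and $K_0(R)$ is the Grothendieck group of the abelian category $\operatorname{mod} R$ (generated by classes of all finitely generated modules, with relations from all short exact sequences). A finitely generated $R$-module $M$ gives a non-commutative resolution (NCR) of $R$ if $M$ is faithful and $\operatorname{End}_R(M)$ has finite global dimension. A module $M\in\operatorname{mod} R$ is a generator of $\operatorname{mod} R$ if there is a surjection from a finite direct sum of copies of $M$ onto $R$ (equivalently, $R$ is a direct summand of a finite direct sum of copies of $M$). *)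

theory Defs
  imports "HOL-Algebra.Algebra" "HOL-Library.Extended_Nat"
begin

section \<open>Modules over not necessarily commutative rings\<close>

text \<open>
  The library locale \<^locale>\<open>module\<close> requires a commutative base ring. Endomorphism rings need the
  version below; it has the same axioms over an arbitrary ring. Right modules over \<open>R\<close> are
  left modules over \<open>opposite_ring R\<close>.
\<close>

locale left_module = R?: ring R + M?: abelian_group M
  for R :: "('a, 'r) ring_scheme" (structure) and M :: "('a, 'b, 'x) module_scheme" (structure) +
  assumes smult_closed [simp, intro]:
      "\<lbrakk>a \<in> carrier R; x \<in> carrier M\<rbrakk> \<Longrightarrow> a \<odot>\<^bsub>M\<^esub> x \<in> carrier M"
    and smult_l_distr:
      "\<lbrakk>a \<in> carrier R; b \<in> carrier R; x \<in> carrier M\<rbrakk> \<Longrightarrow>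
        (a \<oplus> b) \<odot>\<^bsub>M\<^esub> x = a \<odot>\<^bsub>M\<^esub> x \<oplus>\<^bsub>M\<^esub> b \<odot>\<^bsub>M\<^esub> x"
    and smult_r_distr:
      "\<lbrakk>a \<in> carrier R; x \<in> carrier M; y \<in> carrier M\<rbrakk> \<Longrightarrow>
        a \<odot>\<^bsub>M\<^esub> (x \<oplus>\<^bsub>M\<^esub> y) = a \<odot>\<^bsub>M\<^esub> x \<oplus>\<^bsub>M\<^esub> a \<odot>\<^bsub>M\<^esub> y"
    and smult_assoc1:
      "\<lbrakk>a \<in> carrier R; b \<in> carrier R; x \<in> carrier M\<rbrakk> \<Longrightarrow>
        (a \<otimes> b) \<odot>\<^bsub>M\<^esub> x = a \<odot>\<^bsub>M\<^esub> (b \<odot>\<^bsub>M\<^esub> x)"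
    and smult_one [simp]:
      "x \<in> carrier M \<Longrightarrow> \<one> \<odot>\<^bsub>M\<^esub> x = x"

lemma module_imp_left_module: "module R M \<Longrightarrow> left_module R M"
  by (intro left_module.intro left_module_axioms.intro)
     (auto simp: module_def module_axioms_def cring_def)

definition opposite_ring :: "('a, 'r) ring_scheme \<Rightarrow> ('a, 'r) ring_scheme" where
  "opposite_ring R = R\<lparr>monoid.mult := (\<lambda>x y. y \<otimes>\<^bsub>R\<^esub> x)\<rparr>"

definition mod_hom ::
  "('a, 'r) ring_scheme \<Rightarrow> ('a, 'm, 'x) module_scheme \<Rightarrow> ('a, 'n, 'y) module_scheme \<Rightarrow> ('m \<Rightarrow> 'n) set" where
  "mod_hom R M N = {f \<in> carrier M \<rightarrow> carrier N.
     (\<forall>x\<in>carrier M. \<forall>y\<in>carrier M. f (x \<oplus>\<^bsub>M\<^esub> y) = f x \<oplus>\<^bsub>N\<^esub> f y) \<and>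
     (\<forall>a\<in>carrier R. \<forall>x\<in>carrier M. f (a \<odot>\<^bsub>M\<^esub> x) = a \<odot>\<^bsub>N\<^esub> f x)}"

text \<open>
  Module records extend ring records; the multiplicative fields play no role for modules
  and are left undefined in the constructions below.
\<close>

definition regular_module :: "('a, 'r) ring_scheme \<Rightarrow> ('a, 'a) module" where
  "regular_module R = \<lparr>carrier = carrier R, monoid.mult = undefined, monoid.one = undefined,
     ring.zero = \<zero>\<^bsub>R\<^esub>, ring.add = (\<lambda>x y. x \<oplus>\<^bsub>R\<^esub> y), smult = (\<lambda>a x. a \<otimes>\<^bsub>R\<^esub> x)\<rparr>"

definition copower :: "'i set \<Rightarrow> ('a, 'm, 'x) module_scheme \<Rightarrow> ('a, 'i \<Rightarrow> 'm) module" where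
  "copower I M = \<lparr>carrier = {v \<in> I \<rightarrow>\<^sub>E carrier M. finite {i \<in> I. v i \<noteq> \<zero>\<^bsub>M\<^esub>}},
     monoid.mult = undefined, monoid.one = undefined,
     ring.zero = (\<lambda>i\<in>I. \<zero>\<^bsub>M\<^esub>),
     ring.add = (\<lambda>v w. \<lambda>i\<in>I. v i \<oplus>\<^bsub>M\<^esub> w i),
     smult = (\<lambda>a v. \<lambda>i\<in>I. a \<odot>\<^bsub>M\<^esub> v i)\<rparr>"

definition finitely_generated_module :: "('a, 'r) ring_scheme \<Rightarrow> ('a, 'm, 'x) module_scheme \<Rightarrow> bool" where
  "finitely_generated_module R M \<longleftrightarrow>
     (\<exists>A \<subseteq> carrier M. finite A \<and> (\<lambda>H. submodule H R M) hull A = carrier M)"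

definition faithful_module :: "('a, 'r) ring_scheme \<Rightarrow> ('a, 'm, 'x) module_scheme \<Rightarrow> bool" where
  "faithful_module R M \<longleftrightarrow>
     (\<forall>a\<in>carrier R. (\<forall>x\<in>carrier M. a \<odot>\<^bsub>M\<^esub> x = \<zero>\<^bsub>M\<^esub>) \<longrightarrow> a = \<zero>\<^bsub>R\<^esub>)"

definition is_generator :: "('a, 'r) ring_scheme \<Rightarrow> ('a, 'm, 'x) module_scheme \<Rightarrow> bool" where
  "is_generator R M \<longleftrightarrow>
     (\<exists>n::nat. \<exists>f \<in> mod_hom R (copower {..<n} M) (regular_module R).
        f ` carrier (copower {..<n} M) = carrier R)"

text \<open>
  Endomorphisms are taken extensional, so that each one is represented by exactly one function.
\<close>

definition End_ring :: "('a, 'r) ring_scheme \<Rightarrow> ('a, 'm, 'x) module_scheme \<Rightarrow> ('m \<Rightarrow> 'm) ring" where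
  "End_ring R M = \<lparr>carrier = mod_hom R M M \<inter> extensional (carrier M),
     monoid.mult = (\<lambda>f g. compose (carrier M) f g),
     monoid.one = (\<lambda>x\<in>carrier M. x),
     ring.zero = (\<lambda>x\<in>carrier M. \<zero>\<^bsub>M\<^esub>),
     ring.add = (\<lambda>f g. \<lambda>x\<in>carrier M. f x \<oplus>\<^bsub>M\<^esub> g x)\<rparr>"


section \<open>Projective and global dimension\<close>

text \<open>
  Projective means: direct summand of a free module. An index set inside the carrier type of
  \<open>P\<close> suffices, since \<open>P\<close> is a quotient of the free module on its own elements.
\<close>

definition projective_module :: "('a, 'r) ring_scheme \<Rightarrow> ('a, 'p, 'x) module_scheme \<Rightarrow> bool" where
  "projective_module R P \<longleftrightarrow> left_module R P \<and>
     (\<exists>I :: 'p set. \<exists>s \<in> mod_hom R P (copower I (regular_module R)).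
        \<exists>q \<in> mod_hom R (copower I (regular_module R)) P. \<forall>x\<in>carrier P. q (s x) = x)"

text \<open>
  A fixed type of elements takes the place of ``all modules'' over a ring with elements in
  \<open>'a\<close>. It contains, up to isomorphism, every finitely generated module: the elements of a
  quotient of \<open>R\<^sup>n\<close> are cosets, that is, sets of functions from indices to \<open>'a\<close>. Moreover, if
  \<open>'a\<close> has two elements, the type has an infinite cardinality not below that of \<open>'a\<close>, so
  free covers of modules living in it live in it again and projective resolutions can be
  taken inside it. (If \<open>'a\<close> has one element, all modules are zero.) As the global dimension is
  attained on cyclic modules (Auslander), the supremum defining it is not affected by the
  restriction to this type.
\<close>

type_synonym 'a mod_univ = "(nat \<Rightarrow> 'a) set"

text \<open>
  \<open>0 \<rightarrow> P n \<rightarrow> \<dots> \<rightarrow> P 0 \<rightarrow> N \<rightarrow> 0\<close> is exact with projective \<open>P i\<close>; here \<open>e : P 0 \<rightarrow> N\<close> is the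
  augmentation and \<open>d i : P (i + 1) \<rightarrow> P i\<close>.
\<close>

definition projective_resolution ::
  "('a, 'r) ring_scheme \<Rightarrow> ('a, 'u) module \<Rightarrow> nat \<Rightarrow> (nat \<Rightarrow> ('a, 'u) module) \<Rightarrow>
   (nat \<Rightarrow> 'u \<Rightarrow> 'u) \<Rightarrow> ('u \<Rightarrow> 'u) \<Rightarrow> bool" where
  "projective_resolution R N n P d e \<longleftrightarrow>
     (\<forall>i\<le>n. projective_module R (P i)) \<and>
     e \<in> mod_hom R (P 0) N \<and> e ` carrier (P 0) = carrier N \<and>
     (\<forall>i<n. d i \<in> mod_hom R (P (Suc i)) (P i)) \<and>
     (\<forall>i<n. d i ` carrier (P (Suc i)) =
        (case i of 0 \<Rightarrow> a_kernel (P 0) N e | Suc j \<Rightarrow> a_kernel (P (Suc j)) (P j) (d j))) \<and>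
     (case n of 0 \<Rightarrow> inj_on e (carrier (P 0)) | Suc j \<Rightarrow> inj_on (d j) (carrier (P (Suc j))))"

definition projective_dimension :: "('a, 'r) ring_scheme \<Rightarrow> ('a, 'u) module \<Rightarrow> enat" where
  "projective_dimension R N = (INF n \<in> {n. \<exists>P d e. projective_resolution R N n P d e}. enat n)"

definition left_global_dimension :: "('a, 'r) ring_scheme \<Rightarrow> enat" where
  "left_global_dimension R =
     (SUP N \<in> {N :: ('a, 'a mod_univ) module. left_module R N}. projective_dimension R N)"

text \<open>
  Over \<open>End\<^sub>R(M)\<close> we use right modules, the target of the functor \<open>Hom\<^sub>R(M, -)\<close>. For \<open>R\<close>
  noetherian and \<open>M\<close> finitely generated this ring is noetherian on both sides, so its left
  and right global dimensions agree.
\<close>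

definition right_global_dimension :: "('a, 'r) ring_scheme \<Rightarrow> enat" where
  "right_global_dimension R = left_global_dimension (opposite_ring R)"

definition gives_NCR :: "('a, 'r) ring_scheme \<Rightarrow> ('a, 'm, 'x) module_scheme \<Rightarrow> bool" where
  "gives_NCR R M \<longleftrightarrow> module R M \<and> finitely_generated_module R M \<and> faithful_module R M \<and>
     right_global_dimension (End_ring R M) < \<infinity>"


section \<open>Spectrum, dimension, localization\<close>

definition semilocal_ring :: "('a, 'r) ring_scheme \<Rightarrow> bool" where
  "semilocal_ring R \<longleftrightarrow> cring R \<and> finite {I. maximalideal I R}"

definition Spec :: "('a, 'r) ring_scheme \<Rightarrow> 'a set set" where
  "Spec R = {p. primeideal p R}"

definition closed_in_Spec :: "('a, 'r) ring_scheme \<Rightarrow> 'a set set \<Rightarrow> bool" where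
  "closed_in_Spec R Z \<longleftrightarrow> (\<exists>I. ideal I R \<and> Z = {p \<in> Spec R. I \<subseteq> p})"

text \<open>
  The dimension of a closed set of primes, as the supremum of the lengths of chains of primes
  in it. The empty set gets dimension \<open>0\<close> instead of \<open>-\<infinity>\<close>.
\<close>

definition krull_dimension :: "'a set set \<Rightarrow> enat" where
  "krull_dimension Z =
     (SUP n \<in> {n. \<exists>p :: nat \<Rightarrow> 'a set. (\<forall>i\<le>n. p i \<in> Z) \<and> (\<forall>i<n. p i \<subset> p (Suc i))}. enat n)"

text \<open>
  Fractions \<open>m/s\<close> with \<open>m \<in> M\<close> and \<open>s \<in> S\<close> are classes of pairs. The unions in the operations
  below run over sets that are all equal, which picks out the common value.
\<close>

definition frac_rel ::
  "('a, 'r) ring_scheme \<Rightarrow> 'a set \<Rightarrow> ('a, 'm, 'x) module_scheme \<Rightarrow> (('m \<times> 'a) \<times> ('m \<times> 'a)) set" where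
  "frac_rel R S M = {((m, s), (n, t)). m \<in> carrier M \<and> s \<in> S \<and> n \<in> carrier M \<and> t \<in> S \<and>
     (\<exists>u\<in>S. u \<odot>\<^bsub>M\<^esub> (t \<odot>\<^bsub>M\<^esub> m) = u \<odot>\<^bsub>M\<^esub> (s \<odot>\<^bsub>M\<^esub> n))}"

definition fraction ::
  "('a, 'r) ring_scheme \<Rightarrow> 'a set \<Rightarrow> ('a, 'm, 'x) module_scheme \<Rightarrow> 'm \<Rightarrow> 'a \<Rightarrow> ('m \<times> 'a) set" where
  "fraction R S M m s = frac_rel R S M `` {(m, s)}"

definition localize_ring :: "('a, 'r) ring_scheme \<Rightarrow> 'a set \<Rightarrow> ('a \<times> 'a) set ring" where
  "localize_ring R S = \<lparr>
     carrier = (carrier R \<times> S) // frac_rel R S (regular_module R),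
     monoid.mult = (\<lambda>U V. \<Union>(a, s)\<in>U. \<Union>(b, t)\<in>V.
       fraction R S (regular_module R) (a \<otimes>\<^bsub>R\<^esub> b) (s \<otimes>\<^bsub>R\<^esub> t)),
     monoid.one = fraction R S (regular_module R) \<one>\<^bsub>R\<^esub> \<one>\<^bsub>R\<^esub>,
     ring.zero = fraction R S (regular_module R) \<zero>\<^bsub>R\<^esub> \<one>\<^bsub>R\<^esub>,
     ring.add = (\<lambda>U V. \<Union>(a, s)\<in>U. \<Union>(b, t)\<in>V.
       fraction R S (regular_module R) (t \<otimes>\<^bsub>R\<^esub> a \<oplus>\<^bsub>R\<^esub> s \<otimes>\<^bsub>R\<^esub> b) (s \<otimes>\<^bsub>R\<^esub> t))\<rparr>"

definition localize_module ::
  "('a, 'r) ring_scheme \<Rightarrow> 'a set \<Rightarrow> ('a, 'm, 'x) module_scheme \<Rightarrow>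
   (('a \<times> 'a) set, ('m \<times> 'a) set) module" where
  "localize_module R S M = \<lparr>
     carrier = (carrier M \<times> S) // frac_rel R S M,
     monoid.mult = undefined, monoid.one = undefined,
     ring.zero = fraction R S M \<zero>\<^bsub>M\<^esub> \<one>\<^bsub>R\<^esub>,
     ring.add = (\<lambda>U V. \<Union>(m, s)\<in>U. \<Union>(n, t)\<in>V.
       fraction R S M (t \<odot>\<^bsub>M\<^esub> m \<oplus>\<^bsub>M\<^esub> s \<odot>\<^bsub>M\<^esub> n) (s \<otimes>\<^bsub>R\<^esub> t)),
     smult = (\<lambda>U V. \<Union>(a, s)\<in>U. \<Union>(n, t)\<in>V. fraction R S M (a \<odot>\<^bsub>M\<^esub> n) (s \<otimes>\<^bsub>R\<^esub> t))\<rparr>"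

definition generator_at :: "('a, 'r) ring_scheme \<Rightarrow> ('a, 'm, 'x) module_scheme \<Rightarrow> 'a set \<Rightarrow> bool" where
  "generator_at R M p \<longleftrightarrow>
     is_generator (localize_ring R (carrier R - p)) (localize_module R (carrier R - p) M)"


section \<open>The Grothendieck group\<close>

definition short_exact ::
  "('a, 'r) ring_scheme \<Rightarrow> ('a, 'l) module \<Rightarrow> ('l \<Rightarrow> 'm) \<Rightarrow> ('a, 'm) module \<Rightarrow> ('m \<Rightarrow> 'n) \<Rightarrow>
   ('a, 'n) module \<Rightarrow> bool" where
  "short_exact R A f B g C \<longleftrightarrow> f \<in> mod_hom R A B \<and> g \<in> mod_hom R B C \<and>
     inj_on f (carrier A) \<and> f ` carrier A = a_kernel B C g \<and> g ` carrier B = carrier C"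

definition fg_modules :: "('a, 'r) ring_scheme \<Rightarrow> ('a, 'a mod_univ) module set" where
  "fg_modules R = {N. module R N \<and> finitely_generated_module R N}"

text \<open>
  Isomorphic modules need not be identified beforehand: an isomorphism \<open>A \<cong> B\<close> is a short exact
  sequence \<open>0 \<rightarrow> A \<rightarrow> B \<rightarrow> 0 \<rightarrow> 0\<close>.
\<close>

definition K0_relations :: "('a, 'r) ring_scheme \<Rightarrow> (('a, 'a mod_univ) module \<Rightarrow>\<^sub>0 int) set" where
  "K0_relations R =
     {Poly_Mapping.single B 1 - Poly_Mapping.single A 1 - Poly_Mapping.single C 1 | A B C.
        A \<in> fg_modules R \<and> B \<in> fg_modules R \<and> C \<in> fg_modules R \<and>
        (\<exists>f g. short_exact R A f B g C)}"

definition K0 :: "('a, 'r) ring_scheme \<Rightarrow> (('a, 'a mod_univ) module \<Rightarrow>\<^sub>0 int) set monoid" where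
  "K0 R = free_Abelian_group (fg_modules R) Mod
     generate (free_Abelian_group (fg_modules R)) (K0_relations R)"

definition finitely_generated_abelian_group :: "('g, 'x) monoid_scheme \<Rightarrow> bool" where
  "finitely_generated_abelian_group G \<longleftrightarrow>
     comm_group G \<and> (\<exists>A \<subseteq> carrier G. finite A \<and> generate G A = carrier G)"

end

theory Submission
  imports Defs
begin

text \<open>
  Let \<open>\<Lambda>\<close> be the endomorphism ring of \<open>M\<close>, and \<open>A\<close> its opposite ring, so that right modules over \<open>\<Lambda>\<close>
  are left modules over \<open>A\<close>. The functor \<open>Hom(M, -)\<close> takes direct summands of powers of \<open>M\<close> to finitely
  generated projective \<open>A\<close>-modules. For every finitely generated \<open>R\<close>-module \<open>N\<close> the \<open>A\<close>-module \<open>Hom(M, N)\<close>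
  has a finite projective resolution, which comes from a finite complex of summands of powers of \<open>M\<close> that
  ends in \<open>N\<close>. This complex need not be exact, but its homology is killed by the trace ideal of \<open>M\<close>, the
  sum of the images of all homomorphisms from \<open>M\<close> to \<open>R\<close>: for such a homomorphism \<open>g\<close> and \<open>y\<close> in \<open>N\<close>, the
  element \<open>g(x)y\<close> is the image of \<open>x\<close> under a homomorphism from \<open>M\<close> to \<open>N\<close>. By devissage, the Grothendieck
  group is generated by the classes of summands of powers of \<open>M\<close> and of the modules \<open>R/p\<close> for primes \<open>p\<close>
  above the trace ideal (\<open>class_in_all\<close>).

  The second family is finite. If \<open>M\<close> is a generator at \<open>p\<close>, then \<open>p\<close> does not contain the trace ideal
  (\<open>trace_ideal_not_below\<close>), so the primes above the trace ideal lie in the given closed set. A point of a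
  closed set of dimension at most one is minimal or a maximal ideal of \<open>R\<close>. There are finitely many
  minimal ones since \<open>R\<close> is noetherian, and finitely many maximal ideals since \<open>R\<close> is semilocal
  (\<open>finite_closed_dim_one\<close>).

  The first family can be replaced by a finite one. As \<open>A\<close> is finitely generated over the semilocal ring
  \<open>R\<close>, it has finitely many simple modules up to isomorphism, and the largest semisimple quotient of
  \<open>Hom(M, Y)\<close>, for \<open>Y\<close> a summand of a power of \<open>M\<close>, is a finite direct sum of these. Its multiplicities form
  a vector of natural numbers. If the vector of \<open>Y'\<close> is bounded by that of \<open>Y\<close>, projectivity and
  Nakayama's lemma show that \<open>Y'\<close> is a direct summand of \<open>Y\<close> (\<open>split_of_tops\<close>). By Dickson's lemma there is a
  finite set of nonzero summands such that every nonzero \<open>Y\<close> splits off one of them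
  (\<open>finitely_many_summands\<close>). Splitting off repeatedly comes to an end because powers of \<open>M\<close> are
  noetherian, so the classes of this finite set generate those of all summands (\<open>class_in_summands\<close>).
\<close>

section \<open>Submodules, homomorphisms and quotients\<close>

context left_module begin

lemma smult_l_null [simp]: "x \<in> carrier M \<Longrightarrow> \<zero> \<odot>\<^bsub>M\<^esub> x = \<zero>\<^bsub>M\<^esub>"
  by (metis M.add.r_cancel_one' R.l_zero R.zero_closed smult_closed smult_l_distr)

lemma smult_r_null [simp]: "a \<in> carrier R \<Longrightarrow> a \<odot>\<^bsub>M\<^esub> \<zero>\<^bsub>M\<^esub> = \<zero>\<^bsub>M\<^esub>"
  by (metis M.add.r_cancel_one' M.l_zero M.zero_closed smult_closed smult_r_distr)

lemma smult_l_minus: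
  assumes "a \<in> carrier R" "x \<in> carrier M" shows "(\<ominus> a) \<odot>\<^bsub>M\<^esub> x = \<ominus>\<^bsub>M\<^esub> (a \<odot>\<^bsub>M\<^esub> x)"
proof -
  have "(\<ominus> a) \<odot>\<^bsub>M\<^esub> x \<oplus>\<^bsub>M\<^esub> a \<odot>\<^bsub>M\<^esub> x = \<zero>\<^bsub>M\<^esub>"
    using assms by (metis R.add.inv_closed R.l_neg smult_l_distr smult_l_null)
  then show ?thesis using assms M.minus_equality by (metis R.a_inv_closed smult_closed)
qed

lemma smult_r_minus:
  assumes "a \<in> carrier R" "x \<in> carrier M" shows "a \<odot>\<^bsub>M\<^esub> (\<ominus>\<^bsub>M\<^esub> x) = \<ominus>\<^bsub>M\<^esub> (a \<odot>\<^bsub>M\<^esub> x)"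
proof -
  have "a \<odot>\<^bsub>M\<^esub> (\<ominus>\<^bsub>M\<^esub> x) \<oplus>\<^bsub>M\<^esub> a \<odot>\<^bsub>M\<^esub> x = \<zero>\<^bsub>M\<^esub>"
    using assms by (metis M.add.inv_closed M.l_neg smult_r_distr smult_r_null)
  then show ?thesis using assms M.minus_equality by (metis M.a_inv_closed smult_closed)
qed

lemma uminus_zero: "\<ominus>\<^bsub>M\<^esub> \<zero>\<^bsub>M\<^esub> = \<zero>\<^bsub>M\<^esub>"
  by (metis M.l_zero M.r_neg M.a_inv_closed M.zero_closed)

lemma minus_zero: "x \<in> carrier M \<Longrightarrow> x \<ominus>\<^bsub>M\<^esub> \<zero>\<^bsub>M\<^esub> = x"
  by (simp add: a_minus_def uminus_zero)

lemma minus_self: "x \<in> carrier M \<Longrightarrow> x \<ominus>\<^bsub>M\<^esub> x = \<zero>\<^bsub>M\<^esub>"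
  by (simp add: a_minus_def M.r_neg)

lemma minus_plus: "x \<in> carrier M \<Longrightarrow> y \<in> carrier M \<Longrightarrow> (x \<ominus>\<^bsub>M\<^esub> y) \<oplus>\<^bsub>M\<^esub> y = x"
  by (simp add: a_minus_def M.a_assoc M.l_neg)

lemma plus_minus: "x \<in> carrier M \<Longrightarrow> y \<in> carrier M \<Longrightarrow> (x \<oplus>\<^bsub>M\<^esub> y) \<ominus>\<^bsub>M\<^esub> y = x"
  by (simp add: a_minus_def M.a_assoc M.r_neg)

lemma minus_eq_zero_iff: "x \<in> carrier M \<Longrightarrow> y \<in> carrier M \<Longrightarrow> x \<ominus>\<^bsub>M\<^esub> y = \<zero>\<^bsub>M\<^esub> \<longleftrightarrow> x = y"
  using minus_plus[of x y] minus_self[of x] by auto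

lemma minus_minus_cancel:
  assumes "x \<in> carrier M" "y \<in> carrier M" "z \<in> carrier M"
  shows "(z \<ominus>\<^bsub>M\<^esub> y) \<ominus>\<^bsub>M\<^esub> (x \<ominus>\<^bsub>M\<^esub> y) = z \<ominus>\<^bsub>M\<^esub> x"
proof -
  have "(z \<ominus>\<^bsub>M\<^esub> y) \<ominus>\<^bsub>M\<^esub> (x \<ominus>\<^bsub>M\<^esub> y) = (z \<ominus>\<^bsub>M\<^esub> x) \<oplus>\<^bsub>M\<^esub> (y \<oplus>\<^bsub>M\<^esub> \<ominus>\<^bsub>M\<^esub> y)"
    using assms by (simp add: a_minus_def M.minus_add M.a_ac)
  then show ?thesis using assms by (simp add: M.r_neg)
qed

lemma smult_m_one: "x \<in> carrier M \<Longrightarrow> (\<ominus> \<one>) \<odot>\<^bsub>M\<^esub> x = \<ominus>\<^bsub>M\<^esub> x"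
  by (simp add: smult_l_minus)

lemma finsum_smult_l:
  "\<lbrakk>finite I; a \<in> carrier R; f \<in> I \<rightarrow> carrier M\<rbrakk> \<Longrightarrow>
     a \<odot>\<^bsub>M\<^esub> (\<Oplus>\<^bsub>M\<^esub>i\<in>I. f i) = (\<Oplus>\<^bsub>M\<^esub>i\<in>I. a \<odot>\<^bsub>M\<^esub> f i)"
  by (induct set: finite) (simp_all add: Pi_def smult_r_distr)

lemma submodI:
  assumes "H \<subseteq> carrier M" "\<zero>\<^bsub>M\<^esub> \<in> H"
    and "\<And>x y. x \<in> H \<Longrightarrow> y \<in> H \<Longrightarrow> x \<oplus>\<^bsub>M\<^esub> y \<in> H"
    and "\<And>a x. a \<in> carrier R \<Longrightarrow> x \<in> H \<Longrightarrow> a \<odot>\<^bsub>M\<^esub> x \<in> H"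
  shows "submodule H R M"
proof -
  have "inv\<^bsub>add_monoid M\<^esub> x \<in> H" if "x \<in> H" for x
    using smult_m_one[of x] assms(1) assms(4)[of "\<ominus> \<one>" x] that unfolding a_inv_def by auto
  then show ?thesis
    by (intro submodule.intro subgroup.intro) (use assms in \<open>auto simp: submodule_axioms_def\<close>)
qed

lemma submodD:
  assumes "submodule H R M"
  shows "H \<subseteq> carrier M" "\<zero>\<^bsub>M\<^esub> \<in> H"
    "\<And>x. x \<in> H \<Longrightarrow> x \<in> carrier M"
    "\<And>x y. x \<in> H \<Longrightarrow> y \<in> H \<Longrightarrow> x \<oplus>\<^bsub>M\<^esub> y \<in> H"
    "\<And>x. x \<in> H \<Longrightarrow> \<ominus>\<^bsub>M\<^esub> x \<in> H"
    "\<And>x y. x \<in> H \<Longrightarrow> y \<in> H \<Longrightarrow> x \<ominus>\<^bsub>M\<^esub> y \<in> H"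
    "\<And>a x. a \<in> carrier R \<Longrightarrow> x \<in> H \<Longrightarrow> a \<odot>\<^bsub>M\<^esub> x \<in> H"
proof -
  interpret H: submodule H R M by fact
  show "H \<subseteq> carrier M" "\<zero>\<^bsub>M\<^esub> \<in> H" "\<And>x. x \<in> H \<Longrightarrow> x \<in> carrier M"
    "\<And>x y. x \<in> H \<Longrightarrow> y \<in> H \<Longrightarrow> x \<oplus>\<^bsub>M\<^esub> y \<in> H"
    "\<And>a x. a \<in> carrier R \<Longrightarrow> x \<in> H \<Longrightarrow> a \<odot>\<^bsub>M\<^esub> x \<in> H"
    using H.subset H.one_closed H.m_closed by auto
  show *: "\<And>x. x \<in> H \<Longrightarrow> \<ominus>\<^bsub>M\<^esub> x \<in> H" using H.m_inv_closed by (simp add: a_inv_def)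
  show "\<And>x y. x \<in> H \<Longrightarrow> y \<in> H \<Longrightarrow> x \<ominus>\<^bsub>M\<^esub> y \<in> H"
    using H.m_closed * by (simp add: a_minus_def)
qed

lemma submod_carrier: "submodule (carrier M) R M" by (rule submodI) auto
lemma submod_zero: "submodule {\<zero>\<^bsub>M\<^esub>} R M" by (rule submodI) auto

lemma submod_Inter:
  assumes "\<And>H. H \<in> \<H> \<Longrightarrow> submodule H R M" shows "submodule (carrier M \<inter> \<Inter>\<H>) R M"
  by (rule submodI) (use assms submodD in auto)

lemma submod_Int: "submodule H R M \<Longrightarrow> submodule K R M \<Longrightarrow> submodule (H \<inter> K) R M"
  by (rule submodI) (use submodD in auto)

lemma submod_sum:
  assumes H: "submodule H R M" and K: "submodule K R M"
  shows "submodule {x \<oplus>\<^bsub>M\<^esub> y |x y. x \<in> H \<and> y \<in> K} R M"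
proof (rule submodI, goal_cases)
  case 1 then show ?case using submodD(3)[OF H] submodD(3)[OF K] by auto
next
  case 2 then show ?case using submodD(2)[OF H] submodD(2)[OF K] by force
next
  case (3 x y)
  then obtain a b c d where "x = a \<oplus>\<^bsub>M\<^esub> b" "y = c \<oplus>\<^bsub>M\<^esub> d" "a \<in> H" "c \<in> H" "b \<in> K" "d \<in> K" by auto
  moreover from this have "x \<oplus>\<^bsub>M\<^esub> y = (a \<oplus>\<^bsub>M\<^esub> c) \<oplus>\<^bsub>M\<^esub> (b \<oplus>\<^bsub>M\<^esub> d)"
    using submodD(3)[OF H] submodD(3)[OF K] by (simp add: M.a_ac)
  ultimately show ?case using submodD(4)[OF H] submodD(4)[OF K] by blast
next
  case (4 a x)
  then obtain b c where "x = b \<oplus>\<^bsub>M\<^esub> c" "b \<in> H" "c \<in> K" by auto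
  moreover from this 4 have "a \<odot>\<^bsub>M\<^esub> x = a \<odot>\<^bsub>M\<^esub> b \<oplus>\<^bsub>M\<^esub> a \<odot>\<^bsub>M\<^esub> c"
    using submodD(3)[OF H] submodD(3)[OF K] smult_r_distr by auto
  ultimately show ?case using submodD(7)[OF H] submodD(7)[OF K] 4 by blast
qed

lemma submod_cyclic:
  assumes x: "x \<in> carrier M" shows "submodule {a \<odot>\<^bsub>M\<^esub> x |a. a \<in> carrier R} R M"
proof (rule submodI, goal_cases)
  case 1 then show ?case using x by auto
next
  case 2 then show ?case using x by (metis (mono_tags, lifting) R.zero_closed mem_Collect_eq smult_l_null)
next
  case (3 y z)
  then obtain a b where "y = a \<odot>\<^bsub>M\<^esub> x" "z = b \<odot>\<^bsub>M\<^esub> x" "a \<in> carrier R" "b \<in> carrier R" by auto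
  then have "y \<oplus>\<^bsub>M\<^esub> z = (a \<oplus> b) \<odot>\<^bsub>M\<^esub> x" "a \<oplus> b \<in> carrier R" using x by (auto simp: smult_l_distr)
  then show ?case by blast
next
  case (4 a y)
  then obtain b where "y = b \<odot>\<^bsub>M\<^esub> x" "b \<in> carrier R" by auto
  then have "a \<odot>\<^bsub>M\<^esub> y = (a \<otimes> b) \<odot>\<^bsub>M\<^esub> x" "a \<otimes> b \<in> carrier R" using x 4 by (auto simp: smult_assoc1)
  then show ?case by blast
qed

lemma submodule_left_module:
  assumes "submodule H R M" shows "left_module R (M\<lparr>carrier := H\<rparr>)"
proof -
  note D = submodD[OF assms]
  have "abelian_group (M\<lparr>carrier := H\<rparr>)"
  proof (rule abelian_groupI)
    fix x assume "x \<in> carrier (M\<lparr>carrier := H\<rparr>)"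
    then have "\<ominus>\<^bsub>M\<^esub> x \<in> H" "\<ominus>\<^bsub>M\<^esub> x \<oplus>\<^bsub>M\<^esub> x = \<zero>\<^bsub>M\<^esub>" using D(3,5) M.l_neg by auto
    then show "\<exists>y\<in>carrier (M\<lparr>carrier := H\<rparr>). y \<oplus>\<^bsub>M\<lparr>carrier := H\<rparr>\<^esub> x = \<zero>\<^bsub>M\<lparr>carrier := H\<rparr>\<^esub>" by auto
  qed (use D in \<open>auto simp: M.a_ac\<close>)
  then show ?thesis
    by (intro left_module.intro left_module_axioms.intro)
      (use D in \<open>auto simp: smult_l_distr smult_r_distr smult_assoc1 R.ring_axioms\<close>)
qed

lemma submodule_restrict_iff:
  assumes "submodule H R M"
  shows "submodule K R (M\<lparr>carrier := H\<rparr>) \<longleftrightarrow> submodule K R M \<and> K \<subseteq> H"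
proof -
  interpret H: left_module R "M\<lparr>carrier := H\<rparr>" by (rule submodule_left_module[OF assms])
  show ?thesis
  proof safe
    assume K: "submodule K R (M\<lparr>carrier := H\<rparr>)"
    note D = H.submodD[OF K]
    show "submodule K R M" by (rule submodI) (use D submodD(1)[OF assms] in auto)
    show "x \<in> K \<Longrightarrow> x \<in> H" for x using D by auto
  next
    assume K: "submodule K R M" "K \<subseteq> H"
    note D = submodD[OF K(1)]
    show "submodule K R (M\<lparr>carrier := H\<rparr>)" by (rule H.submodI) (use D K(2) in auto)
  qed
qed

end

definition span :: "('a, 'r) ring_scheme \<Rightarrow> ('a, 'v, 'x) module_scheme \<Rightarrow> 'v set \<Rightarrow> 'v set" where
  "span A V G = (\<lambda>H. submodule H A V) hull G"

lemma span_inc: "x \<in> G \<Longrightarrow> x \<in> span A V G"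
  unfolding span_def by (rule hull_inc)

lemma span_mono: "G \<subseteq> H \<Longrightarrow> span A V G \<subseteq> span A V H"
  unfolding span_def by (rule hull_mono)

context left_module begin

lemma span_submodule: assumes "G \<subseteq> carrier M" shows "submodule (span R M G) R M"
proof -
  have "span R M G = carrier M \<inter> \<Inter>{H. submodule H R M \<and> G \<subseteq> H}"
    unfolding span_def hull_def using submod_carrier assms by blast
  then show ?thesis using submod_Inter[of "{H. submodule H R M \<and> G \<subseteq> H}"] by auto
qed

lemma span_least: "G \<subseteq> H \<Longrightarrow> submodule H R M \<Longrightarrow> span R M G \<subseteq> H"
  unfolding span_def by (rule hull_minimal)

lemma span_insert:
  assumes x: "x \<in> carrier M" and G: "G \<subseteq> carrier M"
  shows "span R M (insert x G) = {a \<odot>\<^bsub>M\<^esub> x \<oplus>\<^bsub>M\<^esub> y |a y. a \<in> carrier R \<and> y \<in> span R M G}"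
proof -
  note S = submodD[OF span_submodule[OF G]]
  let ?T = "{u \<oplus>\<^bsub>M\<^esub> y |u y. u \<in> {a \<odot>\<^bsub>M\<^esub> x |a. a \<in> carrier R} \<and> y \<in> span R M G}"
  have T: "submodule ?T R M" by (rule submod_sum[OF submod_cyclic[OF x] span_submodule[OF G]])
  have eq: "?T = {a \<odot>\<^bsub>M\<^esub> x \<oplus>\<^bsub>M\<^esub> y |a y. a \<in> carrier R \<and> y \<in> span R M G}" by auto
  have "x \<in> ?T" using x S(2) smult_one[OF x]
    by (intro CollectI exI[of _ x] exI[of _ "\<zero>\<^bsub>M\<^esub>"]) (auto intro: exI[of _ "\<one>"])
  moreover have "y \<in> ?T" if "y \<in> G" for y
    using that G x span_inc[OF that, of R M]
    by (intro CollectI exI[of _ "\<zero>\<^bsub>M\<^esub>"] exI[of _ y]) (auto intro: exI[of _ "\<zero>"])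
  ultimately have "span R M (insert x G) \<subseteq> ?T" by (intro span_least[OF _ T]) auto
  moreover have "?T \<subseteq> span R M (insert x G)"
  proof -
    note S' = submodD[OF span_submodule[of "insert x G"]]
    have "x \<in> span R M (insert x G)" by (rule span_inc) simp
    moreover have "span R M G \<subseteq> span R M (insert x G)" by (rule span_mono) auto
    ultimately show ?thesis using S'(4,7) x G by blast
  qed
  ultimately show ?thesis using eq by auto
qed

lemma span_empty: "span R M {} = {\<zero>\<^bsub>M\<^esub>}"
  using span_least[OF _ submod_zero, of "{}"] submodD(2)[OF span_submodule[of "{}"]] by auto

lemma fg_submodule_iff:
  assumes H: "submodule H R M"
  shows "finitely_generated_module R (M\<lparr>carrier := H\<rparr>) \<longleftrightarrow> (\<exists>G. finite G \<and> G \<subseteq> H \<and> span R M G = H)"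
proof -
  interpret H: left_module R "M\<lparr>carrier := H\<rparr>" by (rule submodule_left_module[OF H])
  have "span R (M\<lparr>carrier := H\<rparr>) G = span R M G" if "G \<subseteq> H" for G
  proof
    have G: "G \<subseteq> carrier M" using that submodD(1)[OF H] by auto
    show "span R (M\<lparr>carrier := H\<rparr>) G \<subseteq> span R M G"
      by (rule H.span_least) (use that H G in \<open>auto simp: submodule_restrict_iff span_submodule span_inc intro: span_least[THEN subsetD]\<close>)
    show "span R M G \<subseteq> span R (M\<lparr>carrier := H\<rparr>) G"
      by (rule span_least) (use that H H.span_submodule[of G] in \<open>auto simp: submodule_restrict_iff span_inc\<close>)
  qed
  then show ?thesis unfolding finitely_generated_module_def span_def[symmetric] by auto
qed

end

subsection \<open>Homomorphisms\<close>

lemma mod_homI: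
  assumes "\<And>x. x \<in> carrier V \<Longrightarrow> f x \<in> carrier W"
    and "\<And>x y. \<lbrakk>x \<in> carrier V; y \<in> carrier V\<rbrakk> \<Longrightarrow> f (x \<oplus>\<^bsub>V\<^esub> y) = f x \<oplus>\<^bsub>W\<^esub> f y"
    and "\<And>a x. \<lbrakk>a \<in> carrier A; x \<in> carrier V\<rbrakk> \<Longrightarrow> f (a \<odot>\<^bsub>V\<^esub> x) = a \<odot>\<^bsub>W\<^esub> f x"
  shows "f \<in> mod_hom A V W"
  using assms by (auto simp: mod_hom_def)

lemma mod_homD:
  assumes "f \<in> mod_hom A V W"
  shows "\<And>x. x \<in> carrier V \<Longrightarrow> f x \<in> carrier W"
    and "\<And>x y. \<lbrakk>x \<in> carrier V; y \<in> carrier V\<rbrakk> \<Longrightarrow> f (x \<oplus>\<^bsub>V\<^esub> y) = f x \<oplus>\<^bsub>W\<^esub> f y"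
    and "\<And>a x. \<lbrakk>a \<in> carrier A; x \<in> carrier V\<rbrakk> \<Longrightarrow> f (a \<odot>\<^bsub>V\<^esub> x) = a \<odot>\<^bsub>W\<^esub> f x"
  using assms by (auto simp: mod_hom_def)

lemma mod_hom_comp: "f \<in> mod_hom A V W \<Longrightarrow> g \<in> mod_hom A W G \<Longrightarrow> (\<lambda>x. g (f x)) \<in> mod_hom A V G"
  by (auto simp: mod_hom_def Pi_iff)

lemma mod_hom_id: "(\<lambda>x. x) \<in> mod_hom A V V"
  by (auto simp: mod_hom_def)

lemma mod_hom_dom: "f \<in> mod_hom A V W \<Longrightarrow> H \<subseteq> carrier V \<Longrightarrow> f \<in> mod_hom A (V\<lparr>carrier := H\<rparr>) W"
  by (auto simp: mod_hom_def Pi_iff subset_iff)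

lemma mod_hom_cod: "f \<in> mod_hom A V W \<Longrightarrow> (\<And>x. x \<in> carrier V \<Longrightarrow> f x \<in> K) \<Longrightarrow> f \<in> mod_hom A V (W\<lparr>carrier := K\<rparr>)"
  by (auto simp: mod_hom_def Pi_iff)

lemma mod_hom_cod': "f \<in> mod_hom A V (W\<lparr>carrier := K\<rparr>) \<Longrightarrow> K \<subseteq> carrier W \<Longrightarrow> f \<in> mod_hom A V W"
  by (auto simp: mod_hom_def Pi_iff)

locale module_pair = V: left_module A V + W: left_module A W
  for A :: "('a, 'r) ring_scheme" and V :: "('a, 'v, 'x) module_scheme" and W :: "('a, 'w, 'y) module_scheme"
begin

lemma hom_zero: assumes "f \<in> mod_hom A V W" shows "f \<zero>\<^bsub>V\<^esub> = \<zero>\<^bsub>W\<^esub>"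
proof -
  have "f \<zero>\<^bsub>V\<^esub> = f (\<zero>\<^bsub>A\<^esub> \<odot>\<^bsub>V\<^esub> \<zero>\<^bsub>V\<^esub>)" by simp
  also have "\<dots> = \<zero>\<^bsub>A\<^esub> \<odot>\<^bsub>W\<^esub> f \<zero>\<^bsub>V\<^esub>" using mod_homD[OF assms] by blast
  finally show ?thesis using mod_homD(1)[OF assms, of "\<zero>\<^bsub>V\<^esub>"] by simp
qed

lemma hom_uminus: assumes "f \<in> mod_hom A V W" "x \<in> carrier V" shows "f (\<ominus>\<^bsub>V\<^esub> x) = \<ominus>\<^bsub>W\<^esub> f x"
  using mod_homD[OF assms(1)] assms(2) V.smult_m_one[of x] W.smult_m_one[of "f x"]
  by (metis V.R.a_inv_closed V.R.one_closed)

lemma hom_minus: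
  assumes "f \<in> mod_hom A V W" "x \<in> carrier V" "y \<in> carrier V" shows "f (x \<ominus>\<^bsub>V\<^esub> y) = f x \<ominus>\<^bsub>W\<^esub> f y"
  using mod_homD[OF assms(1)] assms hom_uminus by (simp add: a_minus_def)

lemma hom_finsum:
  assumes f: "f \<in> mod_hom A V W" and "finite I" "x \<in> I \<rightarrow> carrier V"
  shows "f (\<Oplus>\<^bsub>V\<^esub>i\<in>I. x i) = (\<Oplus>\<^bsub>W\<^esub>i\<in>I. f (x i))"
  using assms(2,3)
proof (induct set: finite)
  case empty then show ?case using hom_zero[OF f] by simp
next
  case (insert i F)
  then show ?case using mod_homD[OF f] by (simp add: Pi_def)
qed

lemma hom_kernel_submodule:
  assumes "f \<in> mod_hom A V W" shows "submodule {x \<in> carrier V. f x = \<zero>\<^bsub>W\<^esub>} A V"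
  by (rule V.submodI) (use mod_homD[OF assms] hom_zero[OF assms] in auto)

lemma hom_image_submodule:
  assumes f: "f \<in> mod_hom A V W" and H: "submodule H A V" shows "submodule (f ` H) A W"
proof (rule W.submodI)
  note D = V.submodD[OF H]
  show "f ` H \<subseteq> carrier W" using mod_homD[OF f] D by auto
  show "\<zero>\<^bsub>W\<^esub> \<in> f ` H" using hom_zero[OF f] D(2) by (metis imageI)
  show "x \<oplus>\<^bsub>W\<^esub> y \<in> f ` H" if "x \<in> f ` H" "y \<in> f ` H" for x y
    using that mod_homD(2)[OF f] D(3,4) by (smt (verit) imageE image_eqI)
  show "a \<odot>\<^bsub>W\<^esub> x \<in> f ` H" if "a \<in> carrier A" "x \<in> f ` H" for a x
    using that mod_homD(3)[OF f] D(3,7) by (smt (verit) imageE image_eqI)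
qed

lemma hom_vimage_submodule:
  assumes f: "f \<in> mod_hom A V W" and K: "submodule K A W" shows "submodule {x \<in> carrier V. f x \<in> K} A V"
  by (rule V.submodI) (use mod_homD[OF f] hom_zero[OF f] W.submodD[OF K] in auto)

lemma hom_inj_iff:
  assumes f: "f \<in> mod_hom A V W"
  shows "inj_on f (carrier V) \<longleftrightarrow> (\<forall>x\<in>carrier V. f x = \<zero>\<^bsub>W\<^esub> \<longrightarrow> x = \<zero>\<^bsub>V\<^esub>)"
proof
  assume "inj_on f (carrier V)"
  then show "\<forall>x\<in>carrier V. f x = \<zero>\<^bsub>W\<^esub> \<longrightarrow> x = \<zero>\<^bsub>V\<^esub>"
    using hom_zero[OF f] by (metis V.M.zero_closed inj_onD)
next
  assume *: "\<forall>x\<in>carrier V. f x = \<zero>\<^bsub>W\<^esub> \<longrightarrow> x = \<zero>\<^bsub>V\<^esub>"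
  show "inj_on f (carrier V)"
  proof (rule inj_onI)
    fix x y assume xy: "x \<in> carrier V" "y \<in> carrier V" "f x = f y"
    then have "f (x \<ominus>\<^bsub>V\<^esub> y) = \<zero>\<^bsub>W\<^esub>" using hom_minus[OF f] mod_homD(1)[OF f] by (simp add: W.M.r_neg a_minus_def)
    with * xy show "x = y" using V.minus_eq_zero_iff by blast
  qed
qed

lemma zero_hom: "(\<lambda>x. \<zero>\<^bsub>W\<^esub>) \<in> mod_hom A V W"
  by (rule mod_homI) auto

lemma add_hom:
  assumes "f \<in> mod_hom A V W" "g \<in> mod_hom A V W" shows "(\<lambda>x. f x \<oplus>\<^bsub>W\<^esub> g x) \<in> mod_hom A V W"
  by (rule mod_homI) (use mod_homD[OF assms(1)] mod_homD[OF assms(2)] in \<open>auto simp: W.M.a_ac W.smult_r_distr\<close>)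

lemma minus_hom:
  assumes "f \<in> mod_hom A V W" "g \<in> mod_hom A V W" shows "(\<lambda>x. f x \<ominus>\<^bsub>W\<^esub> g x) \<in> mod_hom A V W"
  by (rule mod_homI) (use mod_homD[OF assms(1)] mod_homD[OF assms(2)] in
    \<open>auto simp: W.M.a_ac W.smult_r_distr W.M.minus_add W.smult_r_minus a_minus_def\<close>)

text \<open>
  Homomorphisms that are given by a formula on representatives. For an additive relation,
  well-definedness need only be checked at zero.
\<close>

lemma hom_of_relation:
  assumes total: "\<And>x. x \<in> carrier V \<Longrightarrow> \<exists>y. \<Gamma> x y"
    and carr: "\<And>x y. \<Gamma> x y \<Longrightarrow> x \<in> carrier V \<and> y \<in> carrier W"
    and add: "\<And>x y x' y'. \<lbrakk>\<Gamma> x y; \<Gamma> x' y'\<rbrakk> \<Longrightarrow> \<Gamma> (x \<oplus>\<^bsub>V\<^esub> x') (y \<oplus>\<^bsub>W\<^esub> y')"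
    and smult: "\<And>a x y. \<lbrakk>a \<in> carrier A; \<Gamma> x y\<rbrakk> \<Longrightarrow> \<Gamma> (a \<odot>\<^bsub>V\<^esub> x) (a \<odot>\<^bsub>W\<^esub> y)"
    and zero: "\<And>y. \<Gamma> \<zero>\<^bsub>V\<^esub> y \<Longrightarrow> y = \<zero>\<^bsub>W\<^esub>"
  obtains f where "f \<in> mod_hom A V W" "\<And>x y. \<Gamma> x y \<Longrightarrow> f x = y"
proof -
  have uniq: "y = y'" if "\<Gamma> x y" "\<Gamma> x y'" for x y y'
  proof -
    have m: "\<ominus>\<^bsub>A\<^esub> \<one>\<^bsub>A\<^esub> \<in> carrier A" by simp
    have "\<Gamma> (x \<oplus>\<^bsub>V\<^esub> (\<ominus>\<^bsub>A\<^esub> \<one>\<^bsub>A\<^esub>) \<odot>\<^bsub>V\<^esub> x) (y \<oplus>\<^bsub>W\<^esub> (\<ominus>\<^bsub>A\<^esub> \<one>\<^bsub>A\<^esub>) \<odot>\<^bsub>W\<^esub> y')"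
      by (rule add[OF that(1) smult[OF m that(2)]])
    then have "\<Gamma> \<zero>\<^bsub>V\<^esub> (y \<ominus>\<^bsub>W\<^esub> y')"
      using carr[OF that(1)] carr[OF that(2)] by (simp add: V.smult_m_one W.smult_m_one V.M.r_neg a_minus_def)
    then show ?thesis using zero carr[OF that(1)] carr[OF that(2)] W.minus_eq_zero_iff by blast
  qed
  define f where "f x = (THE y. \<Gamma> x y)" for x
  have f: "f x = y" if "\<Gamma> x y" for x y
    unfolding f_def using that uniq by (blast intro: the_equality)
  have \<Gamma>: "\<Gamma> x (f x)" if "x \<in> carrier V" for x using total[OF that] f by auto
  show thesis
  proof
    show "f \<in> mod_hom A V W"
      by (rule mod_homI) (use \<Gamma> carr add smult f in \<open>auto dest: total\<close>)
  qed (fact f)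
qed

end

subsection \<open>Quotients\<close>

text \<open>
  The module structure carried along a map of elements. It is a quotient if the fibres of \<open>\<pi>\<close> are the
  cosets of a submodule, and an isomorphic copy if \<open>\<pi>\<close> is injective. The type of \<open>\<pi> x\<close> is arbitrary, so
  modules can be moved into the type over which the Grothendieck group is formed.
\<close>

definition push_module :: "('v \<Rightarrow> 'w) \<Rightarrow> ('a, 'v, 'x) module_scheme \<Rightarrow> ('a, 'w) module" where
  "push_module \<pi> V = \<lparr>carrier = \<pi> ` carrier V, monoid.mult = undefined, monoid.one = undefined,
     ring.zero = \<pi> \<zero>\<^bsub>V\<^esub>,
     ring.add = (\<lambda>a b. \<pi> (inv_into (carrier V) \<pi> a \<oplus>\<^bsub>V\<^esub> inv_into (carrier V) \<pi> b)),
     smult = (\<lambda>r a. \<pi> (r \<odot>\<^bsub>V\<^esub> inv_into (carrier V) \<pi> a))\<rparr>"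

lemma (in left_module) push_module:
  fixes \<pi> :: "'b \<Rightarrow> 'w"
  assumes W: "submodule W R M"
    and \<pi>: "\<And>x y. \<lbrakk>x \<in> carrier M; y \<in> carrier M\<rbrakk> \<Longrightarrow> \<pi> x = \<pi> y \<longleftrightarrow> x \<ominus>\<^bsub>M\<^esub> y \<in> W"
  shows "left_module R (push_module \<pi> M)" 
    and "\<pi> \<in> mod_hom R M (push_module \<pi> M)" and "\<pi> ` carrier M = carrier (push_module \<pi> M)"
    and "\<And>x. x \<in> carrier M \<Longrightarrow> \<pi> x = \<zero>\<^bsub>push_module \<pi> M\<^esub> \<longleftrightarrow> x \<in> W"
proof -
  let ?Q = "push_module \<pi> M"
  note W' = submodD[OF W]
  let ?i = "inv_into (carrier M) \<pi>"
  have i: "?i (\<pi> x) \<in> carrier M" "\<pi> (?i (\<pi> x)) = \<pi> x" if "x \<in> carrier M" for x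
    using that by (auto simp: inv_into_into f_inv_into_f)
  have add: "\<pi> x \<oplus>\<^bsub>?Q\<^esub> \<pi> y = \<pi> (x \<oplus>\<^bsub>M\<^esub> y)" if xy: "x \<in> carrier M" "y \<in> carrier M" for x y
  proof -
    have "?i (\<pi> x) \<ominus>\<^bsub>M\<^esub> x \<in> W" "?i (\<pi> y) \<ominus>\<^bsub>M\<^esub> y \<in> W" using xy i \<pi> by blast+
    then have "(?i (\<pi> x) \<ominus>\<^bsub>M\<^esub> x) \<oplus>\<^bsub>M\<^esub> (?i (\<pi> y) \<ominus>\<^bsub>M\<^esub> y) \<in> W" using W'(4) by blast
    moreover have "(?i (\<pi> x) \<ominus>\<^bsub>M\<^esub> x) \<oplus>\<^bsub>M\<^esub> (?i (\<pi> y) \<ominus>\<^bsub>M\<^esub> y) = (?i (\<pi> x) \<oplus>\<^bsub>M\<^esub> ?i (\<pi> y)) \<ominus>\<^bsub>M\<^esub> (x \<oplus>\<^bsub>M\<^esub> y)"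
      using xy i by (simp add: a_minus_def M.a_ac M.minus_add)
    ultimately show ?thesis using \<pi>[of "?i (\<pi> x) \<oplus>\<^bsub>M\<^esub> ?i (\<pi> y)" "x \<oplus>\<^bsub>M\<^esub> y"] xy i by (simp add: push_module_def)
  qed
  have sm: "a \<odot>\<^bsub>?Q\<^esub> \<pi> x = \<pi> (a \<odot>\<^bsub>M\<^esub> x)" if xy: "x \<in> carrier M" "a \<in> carrier R" for a x
  proof -
    have "?i (\<pi> x) \<ominus>\<^bsub>M\<^esub> x \<in> W" using xy i \<pi> by blast
    then have "a \<odot>\<^bsub>M\<^esub> (?i (\<pi> x) \<ominus>\<^bsub>M\<^esub> x) \<in> W" using W'(7) xy by blast
    moreover have "a \<odot>\<^bsub>M\<^esub> (?i (\<pi> x) \<ominus>\<^bsub>M\<^esub> x) = a \<odot>\<^bsub>M\<^esub> ?i (\<pi> x) \<ominus>\<^bsub>M\<^esub> a \<odot>\<^bsub>M\<^esub> x"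
      using xy i by (simp add: a_minus_def smult_r_distr smult_r_minus)
    ultimately show ?thesis using \<pi>[of "a \<odot>\<^bsub>M\<^esub> ?i (\<pi> x)" "a \<odot>\<^bsub>M\<^esub> x"] xy i by (simp add: push_module_def)
  qed
  have c: "carrier ?Q = \<pi> ` carrier M" and z: "\<zero>\<^bsub>?Q\<^esub> = \<pi> \<zero>\<^bsub>M\<^esub>" by (simp_all add: push_module_def)
  have "abelian_group ?Q"
  proof (rule abelian_groupI)
    fix x assume "x \<in> carrier ?Q"
    then obtain u where u: "x = \<pi> u" "u \<in> carrier M" using c by auto
    then have "\<pi> (\<ominus>\<^bsub>M\<^esub> u) \<oplus>\<^bsub>?Q\<^esub> x = \<zero>\<^bsub>?Q\<^esub>" by (simp add: add z M.l_neg)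
    then show "\<exists>y\<in>carrier ?Q. y \<oplus>\<^bsub>?Q\<^esub> x = \<zero>\<^bsub>?Q\<^esub>" using u c by auto
  qed (auto simp: c z add M.a_ac)
  then show "left_module R ?Q"
    by (intro left_module.intro left_module_axioms.intro)
      (auto simp: c z add sm smult_l_distr smult_r_distr smult_assoc1 R.ring_axioms)
  show "\<pi> \<in> mod_hom R M ?Q" by (rule mod_homI) (auto simp: c add sm)
  show "\<pi> ` carrier M = carrier ?Q" using c by simp
  show "\<pi> x = \<zero>\<^bsub>?Q\<^esub> \<longleftrightarrow> x \<in> W" if "x \<in> carrier M" for x
    using that \<pi>[of x "\<zero>\<^bsub>M\<^esub>"] z by (simp add: minus_zero)
qed

definition quotient_module :: "('a, 'v, 'x) module_scheme \<Rightarrow> 'v set \<Rightarrow> ('a, 'v set) module" where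
  "quotient_module V W = push_module (\<lambda>x. {y \<in> carrier V. y \<ominus>\<^bsub>V\<^esub> x \<in> W}) V"

lemma (in left_module) coset_eq_iff:
  assumes W: "submodule W R M" and x: "x \<in> carrier M" and y: "y \<in> carrier M"
  shows "{z \<in> carrier M. z \<ominus>\<^bsub>M\<^esub> x \<in> W} = {z \<in> carrier M. z \<ominus>\<^bsub>M\<^esub> y \<in> W} \<longleftrightarrow> x \<ominus>\<^bsub>M\<^esub> y \<in> W"
proof
  assume "{z \<in> carrier M. z \<ominus>\<^bsub>M\<^esub> x \<in> W} = {z \<in> carrier M. z \<ominus>\<^bsub>M\<^esub> y \<in> W}"
  moreover have "x \<ominus>\<^bsub>M\<^esub> x \<in> W" using x submodD(2)[OF W] by (simp add: a_minus_def M.r_neg)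
  ultimately show "x \<ominus>\<^bsub>M\<^esub> y \<in> W" using x by blast
next
  assume a: "x \<ominus>\<^bsub>M\<^esub> y \<in> W"
  have "z \<ominus>\<^bsub>M\<^esub> y = (z \<ominus>\<^bsub>M\<^esub> x) \<oplus>\<^bsub>M\<^esub> (x \<ominus>\<^bsub>M\<^esub> y)" "z \<ominus>\<^bsub>M\<^esub> x = (z \<ominus>\<^bsub>M\<^esub> y) \<ominus>\<^bsub>M\<^esub> (x \<ominus>\<^bsub>M\<^esub> y)" if "z \<in> carrier M" for z
    using that x y minus_minus_cancel[of x y z] minus_plus[of "z \<ominus>\<^bsub>M\<^esub> y" "x \<ominus>\<^bsub>M\<^esub> y"] by simp_all
  then show "{z \<in> carrier M. z \<ominus>\<^bsub>M\<^esub> x \<in> W} = {z \<in> carrier M. z \<ominus>\<^bsub>M\<^esub> y \<in> W}"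
    using a submodD(4,6)[OF W] by (metis (no_types, lifting) Collect_cong)
qed

lemma (in left_module) quotient_module:
  assumes W: "submodule W R M"
  obtains \<pi> where "left_module R (quotient_module M W)" "\<pi> \<in> mod_hom R M (quotient_module M W)"
    "\<pi> ` carrier M = carrier (quotient_module M W)"
    "\<And>x. x \<in> carrier M \<Longrightarrow> \<pi> x = \<zero>\<^bsub>quotient_module M W\<^esub> \<longleftrightarrow> x \<in> W"
  using push_module[OF W coset_eq_iff[OF W]] unfolding quotient_module_def by blast

lemma regular_left_module: assumes "ring A" shows "left_module A (regular_module A)"
proof -
  interpret ring A by fact
  have "abelian_group (regular_module A)"
    by (rule abelian_groupI) (auto simp: regular_module_def a_ac intro: bexI[of _ "\<ominus>\<^bsub>A\<^esub> _"] l_neg)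
  then show ?thesis
    by (intro left_module.intro left_module_axioms.intro) (auto simp: ring_axioms regular_module_def m_assoc l_distr r_distr)
qed

lemma copower_left_module: assumes "left_module A V" shows "left_module A (copower I V)"
proof -
  interpret left_module A V by fact
  have "abelian_group (copower I V)"
  proof (rule abelian_groupI)
    fix x assume x: "x \<in> carrier (copower I V)"
    have "{i \<in> I. \<ominus>\<^bsub>V\<^esub> x i \<noteq> \<zero>\<^bsub>V\<^esub>} = {i \<in> I. x i \<noteq> \<zero>\<^bsub>V\<^esub>}"
      using x by (auto simp: copower_def PiE_iff)
    then have "(\<lambda>i\<in>I. \<ominus>\<^bsub>V\<^esub> x i) \<in> carrier (copower I V)" "(\<lambda>i\<in>I. \<ominus>\<^bsub>V\<^esub> x i) \<oplus>\<^bsub>copower I V\<^esub> x = \<zero>\<^bsub>copower I V\<^esub>"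
      using x by (auto simp: copower_def PiE_iff M.l_neg fun_eq_iff restrict_def extensional_def cong: conj_cong)
    then show "\<exists>y\<in>carrier (copower I V). y \<oplus>\<^bsub>copower I V\<^esub> x = \<zero>\<^bsub>copower I V\<^esub>" by blast
  next
    fix x y assume xy: "x \<in> carrier (copower I V)" "y \<in> carrier (copower I V)"
    have "{i \<in> I. x i \<oplus>\<^bsub>V\<^esub> y i \<noteq> \<zero>\<^bsub>V\<^esub>} \<subseteq> {i \<in> I. x i \<noteq> \<zero>\<^bsub>V\<^esub>} \<union> {i \<in> I. y i \<noteq> \<zero>\<^bsub>V\<^esub>}" by auto
    then have "finite {i \<in> I. x i \<oplus>\<^bsub>V\<^esub> y i \<noteq> \<zero>\<^bsub>V\<^esub>}"
      using xy by (auto simp: copower_def intro: finite_subset)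
    then show "x \<oplus>\<^bsub>copower I V\<^esub> y \<in> carrier (copower I V)"
      using xy by (auto simp: copower_def PiE_iff cong: conj_cong)
  qed (auto simp: copower_def PiE_iff M.a_ac fun_eq_iff restrict_def extensional_def)
  moreover have "a \<odot>\<^bsub>copower I V\<^esub> x \<in> carrier (copower I V)" if "a \<in> carrier A" "x \<in> carrier (copower I V)" for a x
  proof -
    have "{i \<in> I. a \<odot>\<^bsub>V\<^esub> x i \<noteq> \<zero>\<^bsub>V\<^esub>} \<subseteq> {i \<in> I. x i \<noteq> \<zero>\<^bsub>V\<^esub>}" using that by auto
    then have "finite {i \<in> I. a \<odot>\<^bsub>V\<^esub> x i \<noteq> \<zero>\<^bsub>V\<^esub>}"
      using that by (auto simp: copower_def intro: finite_subset)
    then show ?thesis using that by (auto simp: copower_def PiE_iff cong: conj_cong)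
  qed
  ultimately show ?thesis
    by (intro left_module.intro left_module_axioms.intro)
      (auto simp: R.ring_axioms copower_def PiE_iff smult_l_distr smult_r_distr smult_assoc1 fun_eq_iff restrict_def extensional_def)
qed

section \<open>Noetherian and semilocal rings\<close>

definition maximal_submodule :: "'v set \<Rightarrow> ('a, 'r) ring_scheme \<Rightarrow> ('a, 'v, 'x) module_scheme \<Rightarrow> bool" where
  "maximal_submodule N A V \<longleftrightarrow> submodule N A V \<and> N \<noteq> carrier V \<and>
     (\<forall>K. submodule K A V \<longrightarrow> N \<subseteq> K \<longrightarrow> K = N \<or> K = carrier V)"

context left_module begin

lemma submod_Union_chain:
  assumes "\<C> \<noteq> {}" "subset.chain {H. submodule H R M} \<C>"
  shows "submodule (\<Union>\<C>) R M"
proof -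
  have sub: "submodule H R M" if "H \<in> \<C>" for H using that assms(2) by (auto simp: subset.chain_def)
  have tot: "H \<subseteq> K \<or> K \<subseteq> H" if "H \<in> \<C>" "K \<in> \<C>" for H K using that assms(2) by (auto simp: subset.chain_def)
  show ?thesis
  proof (rule submodI)
    show "\<zero>\<^bsub>M\<^esub> \<in> \<Union>\<C>" using assms(1) sub submodD(2) by blast
    show "\<Union>\<C> \<subseteq> carrier M" using sub submodD(1) by blast
    show "x \<oplus>\<^bsub>M\<^esub> y \<in> \<Union>\<C>" if xy: "x \<in> \<Union>\<C>" "y \<in> \<Union>\<C>" for x y
    proof -
      obtain H K where "H \<in> \<C>" "K \<in> \<C>" "x \<in> H" "y \<in> K" using xy by auto
      with tot[of H K] obtain L where "L \<in> \<C>" "x \<in> L" "y \<in> L" by blast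
      then show ?thesis using sub submodD(4) by blast
    qed
    show "a \<odot>\<^bsub>M\<^esub> x \<in> \<Union>\<C>" if "a \<in> carrier R" "x \<in> \<Union>\<C>" for a x using that sub submodD(7) by blast
  qed
qed

text \<open>
  Zorn's lemma applies because a finite generating set contained in the union of a chain is contained
  in a member of the chain.
\<close>

lemma ex_maximal_submodule:
  assumes G: "finite G" "G \<subseteq> carrier M" "span R M G = carrier M"
    and W: "submodule W R M" "W \<noteq> carrier M"
  obtains N where "maximal_submodule N R M" "W \<subseteq> N"
proof -
  let ?A = "{N. submodule N R M \<and> N \<noteq> carrier M \<and> W \<subseteq> N}"
  have "\<exists>N\<in>?A. \<forall>K\<in>?A. N \<subseteq> K \<longrightarrow> K = N"
  proof (rule subset_Zorn_nonempty)
    show "?A \<noteq> {}" using W by auto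
    fix \<C> assume C: "\<C> \<noteq> {}" "subset.chain ?A \<C>"
    then have C': "subset.chain {H. submodule H R M} \<C>" by (auto simp: subset.chain_def)
    have "\<Union>\<C> \<noteq> carrier M"
    proof
      assume "\<Union>\<C> = carrier M"
      then obtain H where H: "H \<in> \<C>" "G \<subseteq> H"
        using finite_subset_Union_chain[OF G(1) _ C(1) C'] G(2) by auto
      then have "submodule H R M" "H \<noteq> carrier M" using C(2) by (auto simp: subset.chain_def)
      then show False using span_least[OF H(2)] G(3) submodD(1) by blast
    qed
    moreover have "W \<subseteq> \<Union>\<C>"
    proof -
      obtain H where "H \<in> \<C>" using C(1) by auto
      moreover from this have "W \<subseteq> H" using C(2) by (auto simp: subset.chain_def)
      ultimately show ?thesis by blast
    qed
    ultimately show "\<Union>\<C> \<in> ?A" using submod_Union_chain[OF C(1) C'] by simp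
  qed
  then obtain N where N: "N \<in> ?A" "\<forall>K\<in>?A. N \<subseteq> K \<longrightarrow> K = N" by blast
  have "K = N \<or> K = carrier M" if "submodule K R M" "N \<subseteq> K" for K
  proof (cases "K = carrier M")
    case False
    then have "K \<in> ?A" using that N(1) by auto
    then show ?thesis using N(2) that(2) by simp
  qed simp
  then have "maximal_submodule N R M" unfolding maximal_submodule_def using N(1) by simp
  then show thesis using that[of N] N(1) by simp
qed

text \<open>
  The maximum principle of noetherian modules: the union of a chain is finitely generated, hence equal
  to a member of the chain.
\<close>

lemma ex_max_fg_submodule:
  assumes fg: "\<And>W. submodule W R M \<Longrightarrow> \<exists>G. finite G \<and> G \<subseteq> W \<and> span R M G = W"
    and S: "\<W> \<noteq> {}" "\<And>W. W \<in> \<W> \<Longrightarrow> submodule W R M"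
  shows "\<exists>W\<in>\<W>. \<forall>K\<in>\<W>. W \<subseteq> K \<longrightarrow> K = W"
proof (rule subset_Zorn_nonempty[OF S(1)])
    fix \<C> assume C: "\<C> \<noteq> {}" "subset.chain \<W> \<C>"
    then have C': "subset.chain {H. submodule H R M} \<C>" using S(2) by (auto simp: subset.chain_def)
    have U: "submodule (\<Union>\<C>) R M" by (rule submod_Union_chain[OF C(1) C'])
    obtain G where G: "finite G" "G \<subseteq> \<Union>\<C>" "span R M G = \<Union>\<C>" using fg[OF U] by blast
    obtain H where H: "H \<in> \<C>" "G \<subseteq> H"
      using finite_subset_Union_chain[OF G(1,2) C(1) C'] by blast
    have "\<Union>\<C> \<subseteq> H" using span_least[OF H(2)] G(3) H(1) C S(2) by (auto simp: subset.chain_def)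
    then have "\<Union>\<C> = H" using H(1) by blast
    then show "\<Union>\<C> \<in> \<W>" using H(1) C(2) by (auto simp: subset.chain_def)
qed

end

lemma (in cring) ring_idealI:
  assumes "I \<subseteq> carrier R" "\<zero> \<in> I" "\<And>x y. x \<in> I \<Longrightarrow> y \<in> I \<Longrightarrow> x \<oplus> y \<in> I"
    "\<And>a x. a \<in> carrier R \<Longrightarrow> x \<in> I \<Longrightarrow> a \<otimes> x \<in> I"
  shows "ideal I R"
proof (rule idealI)
  have "\<ominus> x \<in> I" if "x \<in> I" for x
    using assms(1) assms(4)[of "\<ominus> \<one>" x] that by (auto simp: l_minus)
  then show "subgroup I (add_monoid R)"
    by (intro subgroup.intro) (use assms in \<open>auto simp: a_inv_def\<close>)
  show "ring R" by (rule ring_axioms)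
  show l: "x \<otimes> a \<in> I" if "a \<in> I" "x \<in> carrier R" for a x using assms(4) that by blast
  show "a \<otimes> x \<in> I" if "a \<in> I" "x \<in> carrier R" for a x
    using l[OF that] m_comm[of a x] assms(1) that by auto
qed

lemma (in cring) ring_idealD:
  assumes "ideal I R"
  shows "I \<subseteq> carrier R" "\<zero> \<in> I" "\<And>x. x \<in> I \<Longrightarrow> x \<in> carrier R"
    "\<And>x y. x \<in> I \<Longrightarrow> y \<in> I \<Longrightarrow> x \<oplus> y \<in> I"
    "\<And>x y. x \<in> I \<Longrightarrow> y \<in> I \<Longrightarrow> x \<ominus> y \<in> I"
    "\<And>a x. a \<in> carrier R \<Longrightarrow> x \<in> I \<Longrightarrow> a \<otimes> x \<in> I" "\<And>a x. a \<in> carrier R \<Longrightarrow> x \<in> I \<Longrightarrow> x \<otimes> a \<in> I"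
proof -
  interpret ideal I R by fact
  show "I \<subseteq> carrier R" "\<zero> \<in> I" "\<And>x. x \<in> I \<Longrightarrow> x \<in> carrier R"
    "\<And>x y. x \<in> I \<Longrightarrow> y \<in> I \<Longrightarrow> x \<oplus> y \<in> I"
    "\<And>a x. a \<in> carrier R \<Longrightarrow> x \<in> I \<Longrightarrow> a \<otimes> x \<in> I" "\<And>a x. a \<in> carrier R \<Longrightarrow> x \<in> I \<Longrightarrow> x \<otimes> a \<in> I"
    using a_subset I_l_closed I_r_closed by (auto simp: Icarr)
  show "\<And>x y. x \<in> I \<Longrightarrow> y \<in> I \<Longrightarrow> x \<ominus> y \<in> I" by (simp add: a_minus_def)
qed

lemma ideal_iff_submodule:
  assumes "cring R" shows "ideal I R \<longleftrightarrow> submodule I R (regular_module R)"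
proof -
  interpret cring R by fact
  interpret M: left_module R "regular_module R" by (rule regular_left_module) (rule ring_axioms)
  have sel: "carrier (regular_module R) = carrier R" "ring.zero (regular_module R) = \<zero>\<^bsub>R\<^esub>"
    "ring.add (regular_module R) = ring.add R" "smult (regular_module R) = monoid.mult R"
    by (auto simp: regular_module_def fun_eq_iff)
  show ?thesis
  proof
    assume I: "ideal I R"
    show "submodule I R (regular_module R)"
      by (rule M.submodI) (use ring_idealD[OF I] in \<open>auto simp: sel\<close>)
  next
    assume I: "submodule I R (regular_module R)"
    show "ideal I R"
      by (rule ring_idealI) (use M.submodD[OF I] in \<open>auto simp: sel\<close>)
  qed
qed

lemma regular_span_one:
  assumes R: "cring R"
  shows "span R (regular_module R) {\<one>\<^bsub>R\<^esub>} = carrier R"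
proof
  interpret cring R by fact
  interpret M: left_module R "regular_module R" by (rule regular_left_module) (rule ring_axioms)
  have c: "carrier (regular_module R) = carrier R" by (simp add: regular_module_def)
  show "span R (regular_module R) {\<one>\<^bsub>R\<^esub>} \<subseteq> carrier R"
    by (rule M.span_least) (use M.submod_carrier c in auto)
  have S: "ideal (span R (regular_module R) {\<one>\<^bsub>R\<^esub>}) R"
    unfolding ideal_iff_submodule[OF R] by (rule M.span_submodule) (simp add: c)
  show "carrier R \<subseteq> span R (regular_module R) {\<one>\<^bsub>R\<^esub>}"
    using ring_idealD(6)[OF S _ span_inc[of "\<one>\<^bsub>R\<^esub>" "{\<one>\<^bsub>R\<^esub>}" R "regular_module R"]] by fastforce
qed

lemma maximal_submodule_regular:
  assumes R: "cring R" and N: "maximal_submodule N R (regular_module R)"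
  shows "maximalideal N R"
proof -
  interpret cring R by fact
  interpret M: left_module R "regular_module R" by (rule regular_left_module) (rule ring_axioms)
  have c: "carrier (regular_module R) = carrier R" by (simp add: regular_module_def)
  show ?thesis
    using N unfolding maximal_submodule_def maximalideal_def maximalideal_axioms_def ideal_iff_submodule[OF R] c
    by (auto dest: M.submodD(1))
qed

text \<open>
  The simple module \<open>M/N\<close> is generated by the class of \<open>x\<close>, hence isomorphic to the quotient of \<open>R\<close> by
  this left ideal.
\<close>

lemma (in left_module) annihilator_maximal:
  assumes N: "maximal_submodule N R M" and x: "x \<in> carrier M" "x \<notin> N"
  shows "maximal_submodule {a \<in> carrier R. a \<odot>\<^bsub>M\<^esub> x \<in> N} R (regular_module R)" (is "maximal_submodule ?m R ?RR")
proof -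
  interpret Q: left_module R ?RR by (rule regular_left_module[OF R.ring_axioms])
  have sel: "carrier ?RR = carrier R" "\<zero>\<^bsub>?RR\<^esub> = \<zero>" "a \<oplus>\<^bsub>?RR\<^esub> b = a \<oplus> b" "a \<odot>\<^bsub>?RR\<^esub> b = a \<otimes> b" for a b
    by (auto simp: regular_module_def)
  have Ns: "submodule N R M" using N by (simp add: maximal_submodule_def)
  note N' = submodD[OF Ns]
  have m: "submodule ?m R ?RR"
    by (rule Q.submodI) (use N' x smult_l_distr smult_assoc1 in \<open>auto simp: sel\<close>)
  have "\<one> \<notin> ?m" using x by simp
  then have ne: "?m \<noteq> carrier ?RR" using sel R.one_closed by blast
  have "I = carrier ?RR" if I: "submodule I R ?RR" "?m \<subseteq> I" "I \<noteq> ?m" for I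
  proof -
    note I' = Q.submodD[OF I(1), unfolded sel]
    obtain s where s: "s \<in> I" "s \<notin> ?m" using I by blast
    then have sc: "s \<in> carrier R" and sx: "s \<odot>\<^bsub>M\<^esub> x \<notin> N" using I'(3) by auto
    have sxc: "s \<odot>\<^bsub>M\<^esub> x \<in> carrier M" using sc x by simp
    let ?T = "{y \<oplus>\<^bsub>M\<^esub> z |y z. y \<in> {a \<odot>\<^bsub>M\<^esub> (s \<odot>\<^bsub>M\<^esub> x) |a. a \<in> carrier R} \<and> z \<in> N}"
    have T: "submodule ?T R M" by (rule submod_sum[OF submod_cyclic[OF sxc] Ns])
    have "N \<subseteq> ?T"
    proof
      fix k assume k: "k \<in> N"
      then have "k = \<zero> \<odot>\<^bsub>M\<^esub> (s \<odot>\<^bsub>M\<^esub> x) \<oplus>\<^bsub>M\<^esub> k" using sxc N' by simp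
      then show "k \<in> ?T" using k R.zero_closed by blast
    qed
    moreover have "s \<odot>\<^bsub>M\<^esub> x \<in> ?T"
    proof -
      have "s \<odot>\<^bsub>M\<^esub> x = \<one> \<odot>\<^bsub>M\<^esub> (s \<odot>\<^bsub>M\<^esub> x) \<oplus>\<^bsub>M\<^esub> \<zero>\<^bsub>M\<^esub>" using sxc by simp
      then show ?thesis using N'(2) R.one_closed by blast
    qed
    ultimately have "?T = carrier M" using N T sx unfolding maximal_submodule_def by blast
    then obtain a k where ak: "x = a \<odot>\<^bsub>M\<^esub> (s \<odot>\<^bsub>M\<^esub> x) \<oplus>\<^bsub>M\<^esub> k" "a \<in> carrier R" "k \<in> N" using x by blast
    have kc: "k \<in> carrier M" using ak N' by auto
    have asx: "a \<odot>\<^bsub>M\<^esub> (s \<odot>\<^bsub>M\<^esub> x) = (a \<otimes> s) \<odot>\<^bsub>M\<^esub> x" using ak sc x by (simp add: smult_assoc1)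
    have "(\<one> \<ominus> a \<otimes> s) \<odot>\<^bsub>M\<^esub> x = x \<ominus>\<^bsub>M\<^esub> (a \<otimes> s) \<odot>\<^bsub>M\<^esub> x"
      using ak sc x by (simp add: a_minus_def smult_l_distr smult_l_minus)
    also have "\<dots> = k"
      using plus_minus[of k "(a \<otimes> s) \<odot>\<^bsub>M\<^esub> x"] ak(1,2) kc sc x asx M.a_comm
      by (metis R.m_closed smult_closed)
    finally have "\<one> \<ominus> a \<otimes> s \<in> I" using ak sc I(2) by auto
    moreover have "a \<otimes> s \<in> I" using I'(7) ak s by auto
    ultimately have "(\<one> \<ominus> a \<otimes> s) \<oplus> a \<otimes> s \<in> I" using I'(4) by blast
    moreover have "(\<one> \<ominus> a \<otimes> s) \<oplus> a \<otimes> s = \<one>"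
      using ak sc by (simp add: a_minus_def R.a_assoc R.l_neg)
    ultimately have one: "\<one> \<in> I" by simp
    have "r \<in> I" if "r \<in> carrier R" for r using I'(7)[OF that one] that by simp
    then show ?thesis using I'(1) sel by auto
  qed
  then show ?thesis unfolding maximal_submodule_def using m ne by blast
qed

lemma ex_maximalideal:
  assumes R: "cring R" and I: "ideal I R" "I \<noteq> carrier R"
  obtains m where "maximalideal m R" "I \<subseteq> m"
proof -
  interpret cring R by fact
  interpret M: left_module R "regular_module R" by (rule regular_left_module) (rule ring_axioms)
  have c: "carrier (regular_module R) = carrier R" by (simp add: regular_module_def)
  note regular_span_one[OF R]
  then obtain N where N: "maximal_submodule N R (regular_module R)" "I \<subseteq> N"
    using M.ex_maximal_submodule[of "{\<one>\<^bsub>R\<^esub>}" I] I c ideal_iff_submodule[OF R] by auto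
  have "maximalideal N R" by (rule maximal_submodule_regular[OF R N(1)])
  then show thesis using that N by blast
qed

text \<open>
  If every \<open>I\<close> had an element outside the prime \<open>p\<close>, the product of these elements would lie in the
  intersection but not in \<open>p\<close>.
\<close>

lemma prime_contains_Inter:
  assumes p: "primeideal p R" and "finite \<U>" "\<And>I. I \<in> \<U> \<Longrightarrow> ideal I R" "carrier R \<inter> \<Inter>\<U> \<subseteq> p"
  shows "\<exists>I\<in>\<U>. I \<subseteq> p"
  using assms(2-4)
proof (induct set: finite)
  interpret primeideal p R by fact
  case empty then show ?case using I_notcarr a_subset by auto
next
  interpret primeideal p R by fact
  case (insert I \<U>)
  show ?case
  proof (cases "I \<subseteq> p")
    case False
    then obtain x where x: "x \<in> I" "x \<notin> p" by auto
    have xc: "x \<in> carrier R" using ring_idealD(3) insert(4) x(1) by blast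
    have "y \<in> p" if y: "y \<in> carrier R \<inter> \<Inter>\<U>" for y
    proof -
      have "x \<otimes>\<^bsub>R\<^esub> y \<in> carrier R \<inter> \<Inter>(insert I \<U>)"
        using y x xc insert(4) ring_idealD(6,7) by auto
      then show "y \<in> p" using insert(5) I_prime[of x y] xc y x(2) by blast
    qed
    then have "carrier R \<inter> \<Inter>\<U> \<subseteq> p" by blast
    then have "\<exists>I\<in>\<U>. I \<subseteq> p" using insert(3) insert(4) by simp
    then show ?thesis by blast
  qed auto
qed

definition jacobson :: "('a, 'r) ring_scheme \<Rightarrow> 'a set" where
  "jacobson R = {r \<in> carrier R. \<forall>m. maximalideal m R \<longrightarrow> r \<in> m}"

text \<open>
  Modulo its Jacobson radical a semilocal ring is a finite product of fields, and there ideals are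
  intersections of maximal ideals. In elementary terms: let \<open>U\<close> be the intersection of the maximal
  ideals that do not contain \<open>I\<close>. Then \<open>I + U = R\<close>, and \<open>I'U\<close> lies in every maximal ideal, hence in \<open>I\<close>.
\<close>

lemma ideal_eq_by_maximal:
  fixes R :: "('a, 'r) ring_scheme" (structure)
  assumes R: "semilocal_ring R" and I: "ideal I R" "ideal I' R" "I \<subseteq> I'" "jacobson R \<subseteq> I"
    and m: "\<And>m. maximalideal m R \<Longrightarrow> I \<subseteq> m \<Longrightarrow> I' \<subseteq> m"
  shows "I = I'"
proof
  interpret cring R using R by (simp add: semilocal_ring_def)
  let ?U = "{m. maximalideal m R \<and> \<not> I \<subseteq> m}"
  have finU: "finite ?U" using R unfolding semilocal_ring_def by (auto intro: finite_subset)
  have idU: "ideal m R" if "m \<in> ?U" for m using that by (auto simp: maximalideal_def)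
  let ?V = "carrier R \<inter> \<Inter>?U"
  have V: "ideal ?V R"
    by (rule ring_idealI) (use ring_idealD[OF idU] in auto)
  have sum: "ideal (I <+>\<^bsub>R\<^esub> ?V) R" by (rule add_ideals[OF I(1) V])
  have "I <+>\<^bsub>R\<^esub> ?V = carrier R"
  proof (rule ccontr)
    assume "I <+>\<^bsub>R\<^esub> ?V \<noteq> carrier R"
    then obtain m where mm: "maximalideal m R" "I <+>\<^bsub>R\<^esub> ?V \<subseteq> m"
      using ex_maximalideal[OF is_cring sum] by blast
    have "I \<subseteq> m"
    proof
      fix x assume "x \<in> I"
      then have "x \<oplus> \<zero> \<in> I <+>\<^bsub>R\<^esub> ?V" using ring_idealD(2)[OF V] by (auto simp: set_add_def' )
      then show "x \<in> m" using mm(2) ring_idealD(3)[OF I(1) \<open>x \<in> I\<close>] by auto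
    qed
    have "?V \<subseteq> m"
    proof
      fix x assume x: "x \<in> ?V"
      then have "\<zero> \<oplus> x \<in> I <+>\<^bsub>R\<^esub> ?V" using ring_idealD(2)[OF I(1)]
        unfolding set_add_def' by blast
      then show "x \<in> m" using mm(2) x by auto
    qed
    then obtain m' where "m' \<in> ?U" "m' \<subseteq> m"
      using prime_contains_Inter[OF maximalideal_prime[OF mm(1)] finU idU] by blast
    then have "maximalideal m' R" "\<not> I \<subseteq> m'" by auto
    then have "m = m'" using maximalideal.I_maximal[of m' R m] \<open>m' \<subseteq> m\<close> mm(1)
      ring_idealD(1)[of m] maximalideal.I_notcarr[OF mm(1)] by (auto simp: maximalideal_def)
    then show False using \<open>I \<subseteq> m\<close> \<open>\<not> I \<subseteq> m'\<close> by simp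
  qed
  then obtain a u where au: "a \<in> I" "u \<in> ?V" "\<one> = a \<oplus> u" 
    unfolding set_add_def' using one_closed by blast
  show "I' \<subseteq> I"
  proof
    fix r assume r: "r \<in> I'"
    have c: "r \<in> carrier R" "a \<in> carrier R" "u \<in> carrier R" using r au ring_idealD(3)[OF I(1)] ring_idealD(3)[OF I(2)] by auto
    have "r \<otimes> u \<in> m'" if m': "maximalideal m' R" for m'
    proof -
      have im: "ideal m' R" using m' by (simp add: maximalideal_def)
      show ?thesis
      proof (cases "I \<subseteq> m'")
        case True
        then have "r \<in> m'" using m[OF m'] r by auto
        then show ?thesis using ring_idealD(7)[OF im] c by auto
      next
        case False
        then have "u \<in> m'" using au m' by auto
        then show ?thesis using ring_idealD(6)[OF im] c by auto
      qed
    qed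
    then have "r \<otimes> u \<in> I" using I(4) c unfolding jacobson_def by auto
    moreover have "r = r \<otimes> a \<oplus> r \<otimes> u" using c au(3) by (metis r_distr r_one)
    moreover have "r \<otimes> a \<in> I" using ring_idealD(6)[OF I(1)] c au by auto
    ultimately show "r \<in> I" using ring_idealD(4)[OF I(1)] by metis
  qed
qed (fact I(3))

subsection \<open>Leading coefficient ideals\<close>

text \<open>
  The module analogue of the leading coefficients in Hilbert's basis theorem: the coefficients of \<open>x\<close> in
  the elements of \<open>W\<close> that lie in \<open>Rx + U\<close>. Both ascending and descending chains of submodules of a
  finitely generated module are controlled by chains of such ideals.
\<close>

definition lead :: "('a, 'r) ring_scheme \<Rightarrow> ('a, 'v, 'x) module_scheme \<Rightarrow> 'v \<Rightarrow> 'v set \<Rightarrow> 'v set \<Rightarrow> 'a set" where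
  "lead R V x U W = {r \<in> carrier R. \<exists>u\<in>U. r \<odot>\<^bsub>V\<^esub> x \<oplus>\<^bsub>V\<^esub> u \<in> W}"

lemma lead_ideal:
  assumes R: "cring R" and V: "left_module R V" and x: "x \<in> carrier V" and U: "submodule U R V" and W: "submodule W R V"
  shows "ideal (lead R V x U W) R"
proof -
  interpret cring R by fact
  interpret V: left_module R V by fact
  note U' = V.submodD[OF U] and W' = V.submodD[OF W]
  show ?thesis
  proof (rule ring_idealI)
    show "\<zero>\<^bsub>R\<^esub> \<in> lead R V x U W" using U'(2) W'(2) x by (auto simp: lead_def intro!: bexI[of _ "\<zero>\<^bsub>V\<^esub>"])
  next
    fix r s assume "r \<in> lead R V x U W" "s \<in> lead R V x U W"
    then obtain u v where *: "u \<in> U" "v \<in> U" "r \<odot>\<^bsub>V\<^esub> x \<oplus>\<^bsub>V\<^esub> u \<in> W" "s \<odot>\<^bsub>V\<^esub> x \<oplus>\<^bsub>V\<^esub> v \<in> W" "r \<in> carrier R" "s \<in> carrier R"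
      by (auto simp: lead_def)
    then have "(r \<oplus>\<^bsub>R\<^esub> s) \<odot>\<^bsub>V\<^esub> x \<oplus>\<^bsub>V\<^esub> (u \<oplus>\<^bsub>V\<^esub> v) = (r \<odot>\<^bsub>V\<^esub> x \<oplus>\<^bsub>V\<^esub> u) \<oplus>\<^bsub>V\<^esub> (s \<odot>\<^bsub>V\<^esub> x \<oplus>\<^bsub>V\<^esub> v)"
      using x U'(3) by (simp add: V.smult_l_distr V.M.a_ac)
    then have "(r \<oplus>\<^bsub>R\<^esub> s) \<odot>\<^bsub>V\<^esub> x \<oplus>\<^bsub>V\<^esub> (u \<oplus>\<^bsub>V\<^esub> v) \<in> W" using W'(4)[OF *(3,4)] by simp
    then show "r \<oplus>\<^bsub>R\<^esub> s \<in> lead R V x U W" using * U'(4)[OF *(1,2)] by (auto simp: lead_def)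
  next
    fix a r assume "a \<in> carrier R" "r \<in> lead R V x U W"
    then obtain u where *: "u \<in> U" "r \<odot>\<^bsub>V\<^esub> x \<oplus>\<^bsub>V\<^esub> u \<in> W" "r \<in> carrier R" "a \<in> carrier R" by (auto simp: lead_def)
    then have "(a \<otimes>\<^bsub>R\<^esub> r) \<odot>\<^bsub>V\<^esub> x \<oplus>\<^bsub>V\<^esub> a \<odot>\<^bsub>V\<^esub> u = a \<odot>\<^bsub>V\<^esub> (r \<odot>\<^bsub>V\<^esub> x \<oplus>\<^bsub>V\<^esub> u)"
      using x U'(3) by (simp add: V.smult_r_distr V.smult_assoc1)
    then have "(a \<otimes>\<^bsub>R\<^esub> r) \<odot>\<^bsub>V\<^esub> x \<oplus>\<^bsub>V\<^esub> a \<odot>\<^bsub>V\<^esub> u \<in> W" using W'(7)[OF *(4,2)] by simp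
    then show "a \<otimes>\<^bsub>R\<^esub> r \<in> lead R V x U W" using * U'(7)[OF *(4,1)] by (auto simp: lead_def)
  qed (auto simp: lead_def)
qed

lemma lead_mono: "W \<subseteq> W' \<Longrightarrow> lead R V x U W \<subseteq> lead R V x U W'"
  by (auto simp: lead_def)

lemma (in left_module) add_minus_add:
  assumes "c \<in> carrier M" "y \<in> carrier M" "u \<in> carrier M"
  shows "(c \<oplus>\<^bsub>M\<^esub> y) \<ominus>\<^bsub>M\<^esub> (c \<oplus>\<^bsub>M\<^esub> u) = y \<ominus>\<^bsub>M\<^esub> u"
proof -
  have "c \<oplus>\<^bsub>M\<^esub> z = z \<ominus>\<^bsub>M\<^esub> (\<ominus>\<^bsub>M\<^esub> c)" if "z \<in> carrier M" for z
    using that assms(1) by (simp add: a_minus_def M.a_comm)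
  then show ?thesis using minus_minus_cancel[of u "\<ominus>\<^bsub>M\<^esub> c" y] assms by simp
qed

text \<open>
  An element of \<open>W'\<close> can be changed by an element of \<open>W\<close> with the same coefficient of \<open>x\<close>; the
  difference lies in \<open>W'\<close> and in the span of \<open>G\<close>.
\<close>

lemma (in left_module) lead_determines:
  assumes G: "G \<subseteq> carrier M" and x: "x \<in> carrier M" and W: "submodule W R M" and W': "submodule W' R M" and sub: "W \<subseteq> W'"
    and span: "W' \<subseteq> span R M (insert x G)"
    and lead: "lead R M x (span R M G) W' \<subseteq> lead R M x (span R M G) W"
    and U: "W' \<inter> span R M G \<subseteq> W"
  shows "W = W'"
proof (rule antisym[OF sub], rule subsetI)
  fix w assume w: "w \<in> W'"
  note SU = submodD[OF span_submodule[OF G]]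
  obtain a y where ay: "w = a \<odot>\<^bsub>M\<^esub> x \<oplus>\<^bsub>M\<^esub> y" "a \<in> carrier R" "y \<in> span R M G"
    using w span span_insert[OF x G] by auto
  then have "a \<in> lead R M x (span R M G) W'" using w by (auto simp: lead_def)
  then obtain u where u: "u \<in> span R M G" "a \<odot>\<^bsub>M\<^esub> x \<oplus>\<^bsub>M\<^esub> u \<in> W" using lead by (auto simp: lead_def)
  have yc: "y \<in> carrier M" "u \<in> carrier M" using ay u SU(3) by auto
  have eq: "w \<ominus>\<^bsub>M\<^esub> (a \<odot>\<^bsub>M\<^esub> x \<oplus>\<^bsub>M\<^esub> u) = y \<ominus>\<^bsub>M\<^esub> u"
    unfolding ay(1) by (rule add_minus_add) (use yc x ay in auto)
  have "w \<ominus>\<^bsub>M\<^esub> (a \<odot>\<^bsub>M\<^esub> x \<oplus>\<^bsub>M\<^esub> u) \<in> W'" using w u sub submodD(6)[OF W'] by auto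
  then have "y \<ominus>\<^bsub>M\<^esub> u \<in> W' \<inter> span R M G" using eq ay u SU(6) by auto
  then have "(y \<ominus>\<^bsub>M\<^esub> u) \<oplus>\<^bsub>M\<^esub> (a \<odot>\<^bsub>M\<^esub> x \<oplus>\<^bsub>M\<^esub> u) \<in> W" using U u submodD(4)[OF W] by auto
  moreover have "(y \<ominus>\<^bsub>M\<^esub> u) \<oplus>\<^bsub>M\<^esub> (a \<odot>\<^bsub>M\<^esub> x \<oplus>\<^bsub>M\<^esub> u) = w"
    using minus_plus[of w "a \<odot>\<^bsub>M\<^esub> x \<oplus>\<^bsub>M\<^esub> u"] eq yc x ay by simp
  ultimately show "w \<in> W" by simp
qed

text \<open>
  Over a noetherian ring the leading coefficients form a finitely generated ideal. Lifts of its
  generators, together with generators of the part of \<open>W\<close> in the span of \<open>G\<close>, generate \<open>W\<close>.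
\<close>

lemma noetherian_span:
  assumes R: "cring R" "noetherian_ring R" and V: "left_module R V"
    and "finite G" "G \<subseteq> carrier V" "submodule W R V" "W \<subseteq> span R V G"
  shows "\<exists>F. finite F \<and> F \<subseteq> W \<and> span R V F = W"
  using assms(4-)
proof (induct arbitrary: W set: finite)
  interpret V: left_module R V by fact
  case empty
  then have "W = {\<zero>\<^bsub>V\<^esub>}" unfolding V.span_empty using V.submodD(2)[OF empty(2)] by blast
  then show ?case using V.span_empty by (intro exI[of _ "{}"]) simp
next
  interpret cring R by fact
  interpret N: noetherian_ring R by fact
  interpret V: left_module R V by fact
  case (insert x G)
  let ?U = "span R V G"
  have x: "x \<in> carrier V" and G: "G \<subseteq> carrier V" using insert by auto
  note W = insert(5)
  have U: "submodule ?U R V" by (rule V.span_submodule[OF G])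
  obtain F where F: "finite F" "F \<subseteq> W \<inter> ?U" "span R V F = W \<inter> ?U"
    using insert(3)[OF G V.submod_Int[OF W U]] by auto
  obtain B where B: "B \<subseteq> carrier R" "finite B" "lead R V x ?U W = Idl\<^bsub>R\<^esub> B"
    using N.finetely_gen[OF lead_ideal[OF R(1) V x U W]] by blast
  have "B \<subseteq> lead R V x ?U W" using B genideal_self by auto
  then have "\<forall>b\<in>B. \<exists>u. u \<in> ?U \<and> b \<odot>\<^bsub>V\<^esub> x \<oplus>\<^bsub>V\<^esub> u \<in> W" by (auto simp: lead_def)
  then obtain u where u: "\<And>b. b \<in> B \<Longrightarrow> u b \<in> ?U \<and> b \<odot>\<^bsub>V\<^esub> x \<oplus>\<^bsub>V\<^esub> u b \<in> W" by metis
  let ?F = "F \<union> (\<lambda>b. b \<odot>\<^bsub>V\<^esub> x \<oplus>\<^bsub>V\<^esub> u b) ` B"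
  have FW: "?F \<subseteq> W" using F(2) u by auto
  have Fc: "?F \<subseteq> carrier V" using FW V.submodD(1)[OF W] by auto
  have sF: "submodule (span R V ?F) R V" by (rule V.span_submodule[OF Fc])
  have "span R V ?F = W"
  proof (rule V.lead_determines[OF G x sF W])
    show "span R V ?F \<subseteq> W" by (rule V.span_least[OF FW W])
    show "W \<subseteq> span R V (insert x G)" by fact
    show "W \<inter> ?U \<subseteq> span R V ?F" using F(3) span_mono[of F ?F R V] by auto
    have "B \<subseteq> lead R V x ?U (span R V ?F)"
    proof
      fix b assume b: "b \<in> B"
      then have "b \<odot>\<^bsub>V\<^esub> x \<oplus>\<^bsub>V\<^esub> u b \<in> span R V ?F" by (intro span_inc) simp
      then show "b \<in> lead R V x ?U (span R V ?F)" using u[OF b] b B(1) unfolding lead_def by blast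
    qed
    then show "lead R V x ?U W \<subseteq> lead R V x ?U (span R V ?F)"
      unfolding B(3) by (rule genideal_minimal[OF lead_ideal[OF R(1) V x U sF]])
  qed
  moreover have "finite ?F" using F(1) B(2) by simp
  ultimately show ?case using FW by (intro exI[of _ ?F]) simp
qed

lemma fg_submodule:
  assumes R: "cring R" "noetherian_ring R" and V: "left_module R V" "finitely_generated_module R V"
    and W: "submodule W R V"
  shows "\<exists>F. finite F \<and> F \<subseteq> W \<and> span R V F = W"
proof -
  interpret V: left_module R V by fact
  obtain G where "finite G" "G \<subseteq> carrier V" "span R V G = carrier V"
    using V(2) unfolding finitely_generated_module_def span_def by auto
  then show ?thesis using noetherian_span[OF R V(1) _ _ W, of G] V.submodD(1)[OF W] by auto
qed

text \<open>
  Modulo the Jacobson radical a finitely generated module has finite length. In place of the length of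
  \<open>V/W\<close>, the measure \<open>\<mu> W\<close> counts, for every generator, the maximal ideals that contain the
  corresponding leading coefficient ideal of \<open>W\<close>. If \<open>W\<close> shrinks but still contains \<open>JV\<close>, one of these
  ideals shrinks, and since it contains the radical it lies in more maximal ideals.
\<close>

lemma semilocal_length:
  assumes R: "semilocal_ring R" and V: "left_module R V" "finitely_generated_module R V"
  obtains \<mu> :: "'v set \<Rightarrow> nat" and B where
    "\<And>W W'. \<lbrakk>submodule W R V; submodule W' R V; W' \<subset> W; \<And>r x. r \<in> jacobson R \<Longrightarrow> x \<in> carrier V \<Longrightarrow> r \<odot>\<^bsub>V\<^esub> x \<in> W'\<rbrakk>
       \<Longrightarrow> \<mu> W < \<mu> W'" and "\<And>W. \<mu> W \<le> B"
proof -
  interpret cring R using R by (simp add: semilocal_ring_def)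
  interpret V: left_module R V by fact
  obtain G where G: "finite G" "G \<subseteq> carrier V" "span R V G = carrier V"
    using V(2) unfolding finitely_generated_module_def span_def by auto
  obtain xs where xs: "set xs = G" using G(1) finite_list by auto
  define U where "U j = span R V (set (take j xs))" for j
  define L where "L j W = lead R V (xs ! j) (U j) W" for j W
  define P where "P j W = {m. maximalideal m R \<and> L j W \<subseteq> m}" for j W
  define \<mu> where "\<mu> W = (\<Sum>j<length xs. card (P j W))" for W
  have fin: "finite {m. maximalideal m R}" using R by (simp add: semilocal_ring_def)
  have finP: "finite (P j W)" for j W by (rule finite_subset[OF _ fin]) (auto simp: P_def)
  have takeG: "set (take j xs) \<subseteq> carrier V" for j using set_take_subset[of j xs] xs G(2) by blast
  have U: "submodule (U j) R V" for j unfolding U_def by (rule V.span_submodule[OF takeG])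
  have xc: "xs ! j \<in> carrier V" if "j < length xs" for j using that xs G(2) by (auto simp: subset_iff)
  have L: "ideal (L j W) R" if "submodule W R V" "j < length xs" for j W
    unfolding L_def by (rule lead_ideal[OF is_cring V(1) xc[OF that(2)] U that(1)])
  show thesis
  proof
    show "\<mu> W \<le> length xs * card {m. maximalideal m R}" for W
    proof -
      have "\<mu> W \<le> (\<Sum>j<length xs. card {m. maximalideal m R})"
        unfolding \<mu>_def by (rule sum_mono, rule card_mono[OF fin]) (auto simp: P_def)
      then show ?thesis by simp
    qed
    fix W W' assume W: "submodule W R V" "submodule W' R V" "W' \<subset> W"
      and J: "\<And>r x. r \<in> jacobson R \<Longrightarrow> x \<in> carrier V \<Longrightarrow> r \<odot>\<^bsub>V\<^esub> x \<in> W'"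
    have sub: "P j W \<subseteq> P j W'" for j
      unfolding P_def L_def using lead_mono[of W' W R V "xs ! j" "U j"] W(3) by blast
    show "\<mu> W < \<mu> W'"
    proof (rule ccontr)
      assume "\<not> \<mu> W < \<mu> W'"
      then have "\<mu> W' \<le> \<mu> W" by simp
      then have card: "card (P j W) = card (P j W')" if "j < length xs" for j
      proof (rule_tac ccontr)
        assume "card (P j W) \<noteq> card (P j W')" "\<mu> W' \<le> \<mu> W"
        then have "card (P j W) < card (P j W')" using card_mono[OF finP sub] le_neq_implies_less by blast
        then have "\<mu> W < \<mu> W'" unfolding \<mu>_def
          by (intro sum_strict_mono_ex1) (use that card_mono[OF finP sub] in auto)
        then show False using \<open>\<mu> W' \<le> \<mu> W\<close> by simp
      qed
      have Leq: "L j W' = L j W" if j: "j < length xs" for j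
      proof (rule ideal_eq_by_maximal[OF R L[OF W(2) j] L[OF W(1) j]])
        show "L j W' \<subseteq> L j W" unfolding L_def by (rule lead_mono) (use W(3) in auto)
        show "jacobson R \<subseteq> L j W'"
        proof
          fix r assume r: "r \<in> jacobson R"
          then have "r \<odot>\<^bsub>V\<^esub> (xs ! j) \<in> W'" "r \<in> carrier R" using J[OF r xc[OF j]] by (auto simp: jacobson_def)
          then show "r \<in> L j W'" unfolding L_def lead_def using V.submodD(2)[OF U] xc[OF j] by force
        qed
        have "P j W = P j W'" by (rule card_subset_eq[OF finP sub card[OF j]])
        then show "L j W \<subseteq> m" if "maximalideal m R" "L j W' \<subseteq> m" for m using that unfolding P_def by blast
      qed
      have "W' \<inter> U j = W \<inter> U j" if "j \<le> length xs" for j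
        using that
      proof (induct j)
        case 0
        then show ?case using V.span_empty V.submodD(2)[OF W(1)] V.submodD(2)[OF W(2)] by (auto simp: U_def)
      next
        case (Suc j)
        then have j: "j < length xs" by simp
        have UI: "U (Suc j) = span R V (insert (xs ! j) (set (take j xs)))"
          unfolding U_def using j by (simp add: take_Suc_conv_app_nth)
        show ?case
        proof (rule V.lead_determines[OF takeG xc[OF j]])
          show "submodule (W' \<inter> U (Suc j)) R V" "submodule (W \<inter> U (Suc j)) R V" using W U V.submod_Int by auto
          show "W' \<inter> U (Suc j) \<subseteq> W \<inter> U (Suc j)" using W(3) by auto
          show "W \<inter> U (Suc j) \<subseteq> span R V (insert (xs ! j) (set (take j xs)))" using UI by auto
          show "W \<inter> U (Suc j) \<inter> span R V (set (take j xs)) \<subseteq> W' \<inter> U (Suc j)"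
            using Suc by (auto simp: U_def)
          show "lead R V (xs ! j) (span R V (set (take j xs))) (W \<inter> U (Suc j))
             \<subseteq> lead R V (xs ! j) (span R V (set (take j xs))) (W' \<inter> U (Suc j))"
          proof
            fix r assume r: "r \<in> lead R V (xs ! j) (span R V (set (take j xs))) (W \<inter> U (Suc j))"
            then have "r \<in> L j W" unfolding L_def lead_def U_def by auto
            then have "r \<in> L j W'" using Leq[OF j] by simp
            then obtain u where u: "r \<in> carrier R" "u \<in> U j" "r \<odot>\<^bsub>V\<^esub> (xs ! j) \<oplus>\<^bsub>V\<^esub> u \<in> W'" by (auto simp: L_def lead_def)
            moreover from u have "r \<odot>\<^bsub>V\<^esub> (xs ! j) \<oplus>\<^bsub>V\<^esub> u \<in> U (Suc j)"
              unfolding UI V.span_insert[OF xc[OF j] takeG] using U_def by auto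
            ultimately show "r \<in> lead R V (xs ! j) (span R V (set (take j xs))) (W' \<inter> U (Suc j))"
              by (auto simp: lead_def U_def)
          qed
        qed
      qed
      from this[of "length xs"] have "W' = W"
        using V.submodD(1)[OF W(1)] V.submodD(1)[OF W(2)] G(3) xs by (auto simp: U_def)
      then show False using W(3) by simp
    qed
  qed
qed

text \<open>
  Nakayama's lemma: adding \<open>JV\<close> to a proper submodule \<open>W\<close> does not give all of \<open>V\<close>. If \<open>K\<close> is a
  maximal submodule above \<open>W\<close>, then \<open>V/K\<close> is simple, hence killed by a maximal ideal.
\<close>

lemma nakayama:
  assumes R: "cring R" and V: "left_module R V" "finitely_generated_module R V"
    and W: "submodule W R V" "W \<noteq> carrier V"
  obtains K where "submodule K R V" "K \<noteq> carrier V" "W \<subseteq> K"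
    "\<And>r x. r \<in> jacobson R \<Longrightarrow> x \<in> carrier V \<Longrightarrow> r \<odot>\<^bsub>V\<^esub> x \<in> K"
proof -
  interpret cring R by fact
  interpret V: left_module R V by fact
  obtain G where G: "finite G" "G \<subseteq> carrier V" "span R V G = carrier V"
    using V(2) unfolding finitely_generated_module_def span_def by auto
  obtain K where K: "maximal_submodule K R V" "W \<subseteq> K" using V.ex_maximal_submodule[OF G W] by blast
  have Ks: "submodule K R V" "K \<noteq> carrier V" using K by (auto simp: maximal_submodule_def)
  note K' = V.submodD[OF Ks(1)]
  have "r \<odot>\<^bsub>V\<^esub> x \<in> K" if r: "r \<in> jacobson R" and x: "x \<in> carrier V" for r x
  proof (cases "x \<in> K")
    case True then show ?thesis using K' r by (auto simp: jacobson_def)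
  next
    case False
    have "maximalideal {s \<in> carrier R. s \<odot>\<^bsub>V\<^esub> x \<in> K} R"
      by (rule maximal_submodule_regular[OF R V.annihilator_maximal[OF K(1) x False]])
    then show ?thesis using r unfolding jacobson_def by blast
  qed
  then show thesis using that[OF Ks K(2)] by blast
qed

subsection \<open>Restriction of scalars\<close>

definition restrict_scalars :: "('r \<Rightarrow> 'a) \<Rightarrow> ('a, 'v, 'x) module_scheme \<Rightarrow> ('r, 'v) module" where
  "restrict_scalars \<rho> V = \<lparr>carrier = carrier V, monoid.mult = undefined, monoid.one = undefined,
     ring.zero = \<zero>\<^bsub>V\<^esub>, ring.add = ring.add V, smult = (\<lambda>r x. \<rho> r \<odot>\<^bsub>V\<^esub> x)\<rparr>"

lemma restrict_scalars_simps [simp]: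
  "carrier (restrict_scalars \<rho> V) = carrier V" "\<zero>\<^bsub>restrict_scalars \<rho> V\<^esub> = \<zero>\<^bsub>V\<^esub>"
  "x \<oplus>\<^bsub>restrict_scalars \<rho> V\<^esub> y = x \<oplus>\<^bsub>V\<^esub> y" "r \<odot>\<^bsub>restrict_scalars \<rho> V\<^esub> x = \<rho> r \<odot>\<^bsub>V\<^esub> x"
  by (simp_all add: restrict_scalars_def)

lemma restrict_scalars_left_module:
  assumes R: "ring R" and V: "left_module A V" and \<rho>: "\<rho> \<in> ring_hom R A"
  shows "left_module R (restrict_scalars \<rho> V)"
proof -
  interpret R: ring R by fact
  interpret V: left_module A V by fact
  note \<rho>' = ring_hom_closed[OF \<rho>] ring_hom_add[OF \<rho>] ring_hom_mult[OF \<rho>] ring_hom_one[OF \<rho>]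
  have "abelian_group (restrict_scalars \<rho> V)"
  proof (rule abelian_groupI)
    fix x assume "x \<in> carrier (restrict_scalars \<rho> V)"
    then show "\<exists>y\<in>carrier (restrict_scalars \<rho> V). y \<oplus>\<^bsub>restrict_scalars \<rho> V\<^esub> x = \<zero>\<^bsub>restrict_scalars \<rho> V\<^esub>"
      by (auto intro!: bexI[of _ "\<ominus>\<^bsub>V\<^esub> x"] simp: V.M.l_neg)
  qed (auto simp: V.M.a_ac)
  then show ?thesis
    by (intro left_module.intro left_module_axioms.intro)
      (auto simp: \<rho>' R.ring_axioms V.smult_l_distr V.smult_r_distr V.smult_assoc1)
qed

lemma restrict_scalars_submodule:
  assumes R: "ring R" and V: "left_module A V" and \<rho>: "\<rho> \<in> ring_hom R A" and W: "submodule W A V"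
  shows "submodule W R (restrict_scalars \<rho> V)"
proof -
  interpret RV: left_module R "restrict_scalars \<rho> V" by (rule restrict_scalars_left_module[OF R V \<rho>])
  interpret V: left_module A V by fact
  show ?thesis by (rule RV.submodI) (use V.submodD[OF W] ring_hom_closed[OF \<rho>] in auto)
qed

text \<open>
  Here \<open>N\<close> is maximal among submodules over \<open>A\<close>, while Nakayama's lemma over \<open>R\<close> gives a submodule \<open>K\<close>
  over \<open>R\<close>. The elements \<open>y\<close> with \<open>Ay\<close> contained in \<open>K\<close> form a proper \<open>A\<close>-submodule above \<open>N\<close>, which is
  therefore \<open>N\<close>.
\<close>

lemma maximal_contains_jacobson:
  assumes R: "cring R" and V: "left_module A V" and \<rho>: "\<rho> \<in> ring_hom R A"
    and central: "\<And>r a. r \<in> carrier R \<Longrightarrow> a \<in> carrier A \<Longrightarrow> \<rho> r \<otimes>\<^bsub>A\<^esub> a = a \<otimes>\<^bsub>A\<^esub> \<rho> r"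
    and fg: "finitely_generated_module R (restrict_scalars \<rho> V)"
    and N: "maximal_submodule N A V" and r: "r \<in> jacobson R" and x: "x \<in> carrier V"
  shows "\<rho> r \<odot>\<^bsub>V\<^esub> x \<in> N"
proof -
  interpret cring R by fact
  interpret V: left_module A V by fact
  interpret RV: left_module R "restrict_scalars \<rho> V" by (rule restrict_scalars_left_module[OF ring_axioms V \<rho>])
  have Ns: "submodule N A V" "N \<noteq> carrier V" using N by (auto simp: maximal_submodule_def)
  obtain K where K: "submodule K R (restrict_scalars \<rho> V)" "K \<noteq> carrier V" "N \<subseteq> K"
    "\<And>r x. r \<in> jacobson R \<Longrightarrow> x \<in> carrier V \<Longrightarrow> \<rho> r \<odot>\<^bsub>V\<^esub> x \<in> K"
    using nakayama[OF R RV.left_module_axioms fg restrict_scalars_submodule[OF ring_axioms V \<rho> Ns(1)]] Ns(2) by auto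
  note K' = RV.submodD[OF K(1), simplified]
  have rc: "r \<in> carrier R" if "r \<in> jacobson R" for r using that by (simp add: jacobson_def)
  let ?L = "{y \<in> carrier V. \<forall>a\<in>carrier A. a \<odot>\<^bsub>V\<^esub> y \<in> K}"
  have L: "submodule ?L A V"
  proof (rule V.submodI)
    show "a \<odot>\<^bsub>V\<^esub> y \<in> ?L" if a: "a \<in> carrier A" and y: "y \<in> ?L" for a y
    proof -
      have yc: "y \<in> carrier V" using y by simp
      have "b \<odot>\<^bsub>V\<^esub> (a \<odot>\<^bsub>V\<^esub> y) \<in> K" if "b \<in> carrier A" for b
      proof -
        have "(b \<otimes>\<^bsub>A\<^esub> a) \<odot>\<^bsub>V\<^esub> y \<in> K" using y V.R.m_closed[OF that a] by blast
        then show ?thesis by (simp only: V.smult_assoc1[OF that a yc])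
      qed
      then show ?thesis using a yc by simp
    qed
    show "\<zero>\<^bsub>V\<^esub> \<in> ?L" using K'(2) by simp
    show "y \<oplus>\<^bsub>V\<^esub> z \<in> ?L" if "y \<in> ?L" "z \<in> ?L" for y z
      using that K'(4) V.smult_r_distr by simp
  qed simp
  have "N \<subseteq> ?L" using V.submodD(3,7)[OF Ns(1)] K(3) by (simp add: subset_iff)
  moreover have "?L \<noteq> carrier V"
  proof
    assume "?L = carrier V"
    then have "\<one>\<^bsub>A\<^esub> \<odot>\<^bsub>V\<^esub> y \<in> K" if "y \<in> carrier V" for y using that V.R.one_closed by blast
    then have "carrier V \<subseteq> K" by (simp add: subset_iff)
    then show False using K(2) K'(1) by simp
  qed
  ultimately have "?L = N" using N L unfolding maximal_submodule_def by blast
  moreover have "a \<odot>\<^bsub>V\<^esub> (\<rho> r \<odot>\<^bsub>V\<^esub> x) \<in> K" if a: "a \<in> carrier A" for a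
  proof -
    have "a \<odot>\<^bsub>V\<^esub> (\<rho> r \<odot>\<^bsub>V\<^esub> x) = \<rho> r \<odot>\<^bsub>V\<^esub> (a \<odot>\<^bsub>V\<^esub> x)"
      using V.smult_assoc1[OF a ring_hom_closed[OF \<rho> rc[OF r]] x] V.smult_assoc1[OF ring_hom_closed[OF \<rho> rc[OF r]] a x]
        central[OF rc[OF r] a] by simp
    then show ?thesis using K(4)[OF r, of "a \<odot>\<^bsub>V\<^esub> x"] a x by simp
  qed
  ultimately show ?thesis using x ring_hom_closed[OF \<rho> rc[OF r]] by blast
qed

subsection \<open>Closed subsets of dimension at most one\<close>

text \<open>
  A noetherian ring has finitely many minimal primes above an ideal. By noetherian induction: if \<open>I\<close> is
  proper and not prime, with \<open>ab\<close> in \<open>I\<close> but neither \<open>a\<close> nor \<open>b\<close>, then a prime above \<open>I\<close> lies above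
  \<open>I + (a)\<close> or above \<open>I + (b)\<close>.
\<close>

lemma finite_primes_above:
  assumes R: "cring R" "noetherian_ring R" and I: "ideal I R"
  shows "\<exists>F. finite F \<and> F \<subseteq> {p \<in> Spec R. I \<subseteq> p} \<and> (\<forall>p\<in>Spec R. I \<subseteq> p \<longrightarrow> (\<exists>q\<in>F. q \<subseteq> p))"
proof (rule ccontr)
  interpret cring R by fact
  interpret M: left_module R "regular_module R" by (rule regular_left_module) (rule ring_axioms)
  have c: "carrier (regular_module R) = carrier R" by (simp add: regular_module_def)
  have fg: "finitely_generated_module R (regular_module R)"
    unfolding finitely_generated_module_def span_def[symmetric] using regular_span_one[OF R(1)] c
    by (intro exI[of _ "{\<one>\<^bsub>R\<^esub>}"]) auto
  define good where "good I \<longleftrightarrow> (\<exists>F. finite F \<and> F \<subseteq> {p \<in> Spec R. I \<subseteq> p} \<and> (\<forall>p\<in>Spec R. I \<subseteq> p \<longrightarrow> (\<exists>q\<in>F. q \<subseteq> p)))" for I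
  assume "\<not> (\<exists>F. finite F \<and> F \<subseteq> {p \<in> Spec R. I \<subseteq> p} \<and> (\<forall>p\<in>Spec R. I \<subseteq> p \<longrightarrow> (\<exists>q\<in>F. q \<subseteq> p)))"
  then have "\<not> good I" by (simp only: good_def not_False_eq_True)
  then have ne: "{I. ideal I R \<and> \<not> good I} \<noteq> {}" using I by blast
  have sub: "submodule I R (regular_module R)" if "I \<in> {I. ideal I R \<and> \<not> good I}" for I
    using that ideal_iff_submodule[OF R(1)] by simp
  have "\<exists>N\<in>{I. ideal I R \<and> \<not> good I}. \<forall>K\<in>{I. ideal I R \<and> \<not> good I}. N \<subseteq> K \<longrightarrow> K = N"
    by (rule M.ex_max_fg_submodule[OF _ ne]) (use fg_submodule[OF R M.left_module_axioms fg] sub in simp_all)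
  then obtain N where N: "N \<in> {I. ideal I R \<and> \<not> good I}" "\<forall>K\<in>{I. ideal I R \<and> \<not> good I}. N \<subseteq> K \<longrightarrow> K = N"
    by (elim bexE)
  have Ni: "ideal N R" and Nb: "\<not> good N" using N(1) by simp_all
  note N' = ring_idealD[OF Ni]
  have "N \<noteq> carrier R"
  proof
    assume a: "N = carrier R"
    have "\<not> N \<subseteq> p" if "p \<in> Spec R" for p
      using that primeideal.I_notcarr[of p R] ring_idealD(1)[of p] unfolding a Spec_def
      by (auto simp: primeideal_def)
    then have "good N" unfolding good_def by (intro exI[of _ "{}"]) auto
    with Nb show False by simp
  qed
  moreover have "\<not> primeideal N R"
  proof
    assume "primeideal N R"
    then have "good N" unfolding good_def by (intro exI[of _ "{N}"]) (auto simp: Spec_def)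
    with Nb show False by simp
  qed
  ultimately obtain a b where ab: "a \<in> carrier R" "b \<in> carrier R" "a \<otimes>\<^bsub>R\<^esub> b \<in> N" "a \<notin> N" "b \<notin> N"
    using primeidealI[OF Ni R(1)] by metis
  have *: "good (N <+>\<^bsub>R\<^esub> PIdl\<^bsub>R\<^esub> c)" "\<And>p. p \<in> Spec R \<Longrightarrow> N \<subseteq> p \<Longrightarrow> c \<in> p \<Longrightarrow> N <+>\<^bsub>R\<^esub> PIdl\<^bsub>R\<^esub> c \<subseteq> p" "N \<subseteq> N <+>\<^bsub>R\<^esub> PIdl\<^bsub>R\<^esub> c"
    if c: "c \<in> carrier R" "c \<notin> N" for c
  proof -
    have P: "ideal (PIdl\<^bsub>R\<^esub> c) R" by (rule cgenideal_ideal[OF c(1)])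
    have S: "ideal (N <+>\<^bsub>R\<^esub> PIdl\<^bsub>R\<^esub> c) R" by (rule add_ideals[OF Ni P])
    show sub: "N \<subseteq> N <+>\<^bsub>R\<^esub> PIdl\<^bsub>R\<^esub> c"
    proof
      fix x assume x: "x \<in> N"
      have "x = x \<oplus>\<^bsub>R\<^esub> \<zero>\<^bsub>R\<^esub>" using N'(3)[OF x] by simp
      then show "x \<in> N <+>\<^bsub>R\<^esub> PIdl\<^bsub>R\<^esub> c" using x ring_idealD(2)[OF P] unfolding set_add_def' by blast
    qed
    have "c = \<zero>\<^bsub>R\<^esub> \<oplus>\<^bsub>R\<^esub> c" using c by simp
    then have "c \<in> N <+>\<^bsub>R\<^esub> PIdl\<^bsub>R\<^esub> c" using N'(2) cgenideal_self[OF c(1)] unfolding set_add_def' by blast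
    then have "N <+>\<^bsub>R\<^esub> PIdl\<^bsub>R\<^esub> c \<noteq> N" using c by auto
    then have "N <+>\<^bsub>R\<^esub> PIdl\<^bsub>R\<^esub> c \<notin> {I. ideal I R \<and> \<not> good I}"
      using N(2)[rule_format, of "N <+>\<^bsub>R\<^esub> PIdl\<^bsub>R\<^esub> c"] sub by metis
    then show "good (N <+>\<^bsub>R\<^esub> PIdl\<^bsub>R\<^esub> c)" using S by simp
    show "N <+>\<^bsub>R\<^esub> PIdl\<^bsub>R\<^esub> c \<subseteq> p" if "p \<in> Spec R" "N \<subseteq> p" "c \<in> p" for p
    proof -
      have p: "ideal p R" using that by (auto simp: Spec_def primeideal_def)
      have "PIdl\<^bsub>R\<^esub> c \<subseteq> p" by (rule cgenideal_minimal[OF p that(3)])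
      then show ?thesis using that(2) ring_idealD(4)[OF p] unfolding set_add_def' by blast
    qed
  qed
  obtain F1 where F1: "finite F1" "F1 \<subseteq> {p \<in> Spec R. N <+>\<^bsub>R\<^esub> PIdl\<^bsub>R\<^esub> a \<subseteq> p}"
    "\<And>p. p \<in> Spec R \<Longrightarrow> N <+>\<^bsub>R\<^esub> PIdl\<^bsub>R\<^esub> a \<subseteq> p \<Longrightarrow> \<exists>q\<in>F1. q \<subseteq> p" using *(1)[OF ab(1,4)] unfolding good_def by metis
  obtain F2 where F2: "finite F2" "F2 \<subseteq> {p \<in> Spec R. N <+>\<^bsub>R\<^esub> PIdl\<^bsub>R\<^esub> b \<subseteq> p}"
    "\<And>p. p \<in> Spec R \<Longrightarrow> N <+>\<^bsub>R\<^esub> PIdl\<^bsub>R\<^esub> b \<subseteq> p \<Longrightarrow> \<exists>q\<in>F2. q \<subseteq> p" using *(1)[OF ab(2,5)] unfolding good_def by metis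
  have "\<exists>q\<in>F1 \<union> F2. q \<subseteq> p" if p: "p \<in> Spec R" "N \<subseteq> p" for p
  proof -
    have "primeideal p R" "a \<otimes>\<^bsub>R\<^esub> b \<in> p" using p ab(3) by (auto simp: Spec_def)
    then consider "a \<in> p" | "b \<in> p" using primeideal.I_prime ab(1,2) by metis
    then show ?thesis
    proof cases
      case 1 show ?thesis using F1(3)[OF p(1) *(2)[OF ab(1,4) p 1]] by blast
    next
      case 2 show ?thesis using F2(3)[OF p(1) *(2)[OF ab(2,5) p 2]] by blast
    qed
  qed
  moreover have "F1 \<union> F2 \<subseteq> {p \<in> Spec R. N \<subseteq> p}" using F1(2) F2(2) *(3)[OF ab(1,4)] *(3)[OF ab(2,5)] by blast
  ultimately have "good N" using F1(1) F2(1) unfolding good_def by (intro exI[of _ "F1 \<union> F2"]) auto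
  with Nb show False by simp
qed

text \<open>
  A point of \<open>Z\<close> that is neither one of the finitely many minimal ones nor a maximal ideal would be the
  middle of a chain of length two.
\<close>

lemma finite_closed_dim_one:
  assumes R: "cring R" "noetherian_ring R" "semilocal_ring R" and Z: "closed_in_Spec R Z" "krull_dimension Z \<le> 1"
  shows "finite Z"
proof -
  interpret cring R by fact
  obtain I where I: "ideal I R" "Z = {p \<in> Spec R. I \<subseteq> p}" using Z by (auto simp: closed_in_Spec_def)
  from finite_primes_above[OF R(1,2) I(1)] obtain F where F0: "finite F" "F \<subseteq> {p \<in> Spec R. I \<subseteq> p}"
    "\<forall>p\<in>Spec R. I \<subseteq> p \<longrightarrow> (\<exists>q\<in>F. q \<subseteq> p)" by (elim exE conjE)
  have F: "finite F" "F \<subseteq> Z" "\<And>p. p \<in> Z \<Longrightarrow> \<exists>q\<in>F. q \<subseteq> p"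
    using F0 unfolding I(2) by simp_all
  have "p \<in> F \<union> {m. maximalideal m R}" if p: "p \<in> Z" for p
  proof (rule ccontr)
    assume n: "p \<notin> F \<union> {m. maximalideal m R}"
    obtain q where q: "q \<in> F" "q \<subseteq> p" using F(3)[OF p] by blast
    have pp: "primeideal p R" using p I(2) by (simp add: Spec_def)
    then have "ideal p R" "p \<noteq> carrier R" using primeideal.I_notcarr by (auto simp: primeideal_def)
    then obtain m where m: "maximalideal m R" "p \<subseteq> m" using ex_maximalideal[OF R(1)] by blast
    have "m \<in> Z" using m p maximalideal_prime[OF m(1)] I(2) by (auto simp: Spec_def)
    have "q \<subset> p" "p \<subset> m" using q m n by auto
    let ?c = "\<lambda>i::nat. if i = 0 then q else if i = 1 then p else m"
    have "q \<in> Z" using q(1) F(2) by blast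
    then have "(\<forall>i\<le>2. ?c i \<in> Z) \<and> (\<forall>i<2. ?c i \<subset> ?c (Suc i))"
      using \<open>m \<in> Z\<close> p \<open>q \<subset> p\<close> \<open>p \<subset> m\<close> by simp
    then have "enat 2 \<le> krull_dimension Z"
      unfolding krull_dimension_def by (intro SUP_upper CollectI exI[of _ ?c])
    then have "enat 2 \<le> enat 1" using Z(2) unfolding one_enat_def by (rule order_trans)
    then show False by simp
  qed
  then have "Z \<subseteq> F \<union> {m. maximalideal m R}" by blast
  then show ?thesis using F(1) R(3) by (auto simp: semilocal_ring_def intro: finite_subset)
qed

section \<open>Classes in the Grothendieck group\<close>

lemma left_module_imp_module: "cring R \<Longrightarrow> left_module R V \<Longrightarrow> module R V"
  by (intro module.intro module_axioms.intro)
     (auto simp: left_module_def left_module_axioms_def)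

lemma (in left_module) span_combination:
  assumes xs: "set xs \<subseteq> carrier M" and x: "x \<in> span R M (set xs)"
  shows "\<exists>r\<in>{..<length xs} \<rightarrow> carrier R. x = (\<Oplus>\<^bsub>M\<^esub>i\<in>{..<length xs}. r i \<odot>\<^bsub>M\<^esub> xs ! i)"
proof -
  let ?n = "length xs"
  let ?S = "{(\<Oplus>\<^bsub>M\<^esub>i\<in>{..<?n}. r i \<odot>\<^bsub>M\<^esub> xs ! i) |r. r \<in> {..<?n} \<rightarrow> carrier R}"
  have xc: "xs ! i \<in> carrier M" if "i < ?n" for i using that xs by auto
  have S: "submodule ?S R M"
  proof (rule submodI)
    show "?S \<subseteq> carrier M" using xc by (auto intro!: M.finsum_closed)
    have "(\<Oplus>\<^bsub>M\<^esub>i\<in>{..<?n}. \<zero>\<^bsub>R\<^esub> \<odot>\<^bsub>M\<^esub> xs ! i) = (\<Oplus>\<^bsub>M\<^esub>i\<in>{..<?n}. \<zero>\<^bsub>M\<^esub>)"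
      by (rule M.finsum_cong') (use xc in auto)
    then have "\<zero>\<^bsub>M\<^esub> = (\<Oplus>\<^bsub>M\<^esub>i\<in>{..<?n}. (\<lambda>i. \<zero>\<^bsub>R\<^esub>) i \<odot>\<^bsub>M\<^esub> xs ! i)" by simp
    then show "\<zero>\<^bsub>M\<^esub> \<in> ?S" by (intro CollectI exI[of _ "\<lambda>i. \<zero>\<^bsub>R\<^esub>"]) auto
  next
    fix y z assume "y \<in> ?S" "z \<in> ?S"
    then obtain r s where rs: "y = (\<Oplus>\<^bsub>M\<^esub>i\<in>{..<?n}. r i \<odot>\<^bsub>M\<^esub> xs ! i)" "z = (\<Oplus>\<^bsub>M\<^esub>i\<in>{..<?n}. s i \<odot>\<^bsub>M\<^esub> xs ! i)"
      "r \<in> {..<?n} \<rightarrow> carrier R" "s \<in> {..<?n} \<rightarrow> carrier R" by blast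
    have "y \<oplus>\<^bsub>M\<^esub> z = (\<Oplus>\<^bsub>M\<^esub>i\<in>{..<?n}. r i \<odot>\<^bsub>M\<^esub> xs ! i \<oplus>\<^bsub>M\<^esub> s i \<odot>\<^bsub>M\<^esub> xs ! i)"
      unfolding rs(1,2) by (rule M.finsum_addf[symmetric]) (use rs(3,4) xc in auto)
    also have "\<dots> = (\<Oplus>\<^bsub>M\<^esub>i\<in>{..<?n}. (r i \<oplus> s i) \<odot>\<^bsub>M\<^esub> xs ! i)"
      by (rule M.finsum_cong') (use rs(3,4) xc in \<open>auto simp: smult_l_distr Pi_iff\<close>)
    finally show "y \<oplus>\<^bsub>M\<^esub> z \<in> ?S"
      using rs(3,4) by (intro CollectI exI[of _ "\<lambda>i. r i \<oplus> s i"]) auto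
  next
    fix a y assume a: "a \<in> carrier R" and "y \<in> ?S"
    then obtain r where rs: "y = (\<Oplus>\<^bsub>M\<^esub>i\<in>{..<?n}. r i \<odot>\<^bsub>M\<^esub> xs ! i)" "r \<in> {..<?n} \<rightarrow> carrier R" by blast
    have "a \<odot>\<^bsub>M\<^esub> y = (\<Oplus>\<^bsub>M\<^esub>i\<in>{..<?n}. a \<odot>\<^bsub>M\<^esub> (r i \<odot>\<^bsub>M\<^esub> xs ! i))"
      unfolding rs(1) by (rule finsum_smult_l) (use rs(2) xc a in auto)
    also have "\<dots> = (\<Oplus>\<^bsub>M\<^esub>i\<in>{..<?n}. (a \<otimes> r i) \<odot>\<^bsub>M\<^esub> xs ! i)"
      by (rule M.finsum_cong') (use rs(2) xc a in \<open>auto simp: smult_assoc1 Pi_iff\<close>)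
    finally show "a \<odot>\<^bsub>M\<^esub> y \<in> ?S"
      using rs(2) a by (intro CollectI exI[of _ "\<lambda>i. a \<otimes> r i"]) auto
  qed
  have "set xs \<subseteq> ?S"
  proof
    fix y assume "y \<in> set xs"
    then obtain j where j: "j < ?n" "y = xs ! j" by (auto simp: in_set_conv_nth)
    have "(\<Oplus>\<^bsub>M\<^esub>i\<in>{..<?n}. (if j = i then \<one> else \<zero>) \<odot>\<^bsub>M\<^esub> xs ! i) = (\<Oplus>\<^bsub>M\<^esub>i\<in>{..<?n}. if j = i then xs ! i else \<zero>\<^bsub>M\<^esub>)"
      by (rule M.finsum_cong') (use xc in auto)
    also have "\<dots> = xs ! j" by (rule M.add.finprod_singleton) (use j xc in auto)
    finally show "y \<in> ?S" using j by (intro CollectI exI[of _ "\<lambda>i. if j = i then \<one> else \<zero>"]) auto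
  qed
  then have "x \<in> ?S" using span_least[OF _ S] x by auto
  then show ?thesis by auto
qed

text \<open>
  A class modulo \<open>W\<close> is represented by the set of all coefficient vectors, with respect to a finite
  generating family, of its elements.
\<close>

lemma universe_copy:
  fixes A :: "('a, 'r) ring_scheme" and V :: "('a, 'v, 'x) module_scheme"
  assumes V: "left_module A V" "finitely_generated_module A V" and W: "submodule W A V"
  obtains Q :: "('a, 'a mod_univ) module" and \<pi> where "left_module A Q" "\<pi> \<in> mod_hom A V Q"
    "\<pi> ` carrier V = carrier Q" "\<forall>x\<in>carrier V. \<pi> x = \<zero>\<^bsub>Q\<^esub> \<longleftrightarrow> x \<in> W"
proof -
  interpret V: left_module A V by fact
  obtain G where G: "finite G" "G \<subseteq> carrier V" "span A V G = carrier V"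
    using V(2) unfolding finitely_generated_module_def span_def by auto
  obtain xs where xs: "set xs = G" using G(1) finite_list by auto
  define comb where "comb r = (\<Oplus>\<^bsub>V\<^esub>i\<in>{..<length xs}. r i \<odot>\<^bsub>V\<^esub> xs ! i)" for r
  define \<pi> where "\<pi> x = {r \<in> {..<length xs} \<rightarrow> carrier A. comb r \<ominus>\<^bsub>V\<^esub> x \<in> W}" for x
  have xc: "xs ! i \<in> carrier V" if "i < length xs" for i using that xs G by auto
  have cc: "comb r \<in> carrier V" if "r \<in> {..<length xs} \<rightarrow> carrier A" for r
    unfolding comb_def using that xc by (intro V.M.finsum_closed) auto
  have \<pi>: "\<pi> x = \<pi> y \<longleftrightarrow> x \<ominus>\<^bsub>V\<^esub> y \<in> W" if xy: "x \<in> carrier V" "y \<in> carrier V" for x y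
  proof
    assume eq: "\<pi> x = \<pi> y"
    have "set xs \<subseteq> carrier V" "x \<in> span A V (set xs)" using xs G xy by auto
    then obtain r where r: "r \<in> {..<length xs} \<rightarrow> carrier A" "x = comb r"
      using V.span_combination[of xs x] unfolding comb_def by auto
    then have "r \<in> \<pi> x" using V.minus_self[OF xy(1)] V.submodD(2)[OF W] by (simp add: \<pi>_def)
    then have "r \<in> \<pi> y" using eq by simp
    then show "x \<ominus>\<^bsub>V\<^esub> y \<in> W" using r(2) by (simp add: \<pi>_def)
  next
    assume "x \<ominus>\<^bsub>V\<^esub> y \<in> W"
    then have *: "{z \<in> carrier V. z \<ominus>\<^bsub>V\<^esub> x \<in> W} = {z \<in> carrier V. z \<ominus>\<^bsub>V\<^esub> y \<in> W}" using V.coset_eq_iff[OF W xy] by simp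
    have "z \<ominus>\<^bsub>V\<^esub> x \<in> W \<longleftrightarrow> z \<ominus>\<^bsub>V\<^esub> y \<in> W" if "z \<in> carrier V" for z
      using that * by (metis (mono_tags, lifting) mem_Collect_eq)
    then show "\<pi> x = \<pi> y" unfolding \<pi>_def using cc by blast
  qed
  have ker: "\<forall>x\<in>carrier V. \<pi> x = \<zero>\<^bsub>push_module \<pi> V\<^esub> \<longleftrightarrow> x \<in> W"
    using V.push_module(4)[OF W \<pi>] by simp
  show thesis by (rule that[OF V.push_module(1-3)[OF W \<pi>] ker])
qed

lemma fg_image:
  assumes V: "left_module A V" "finitely_generated_module A V" and W: "left_module A W"
    and f: "f \<in> mod_hom A V W" "f ` carrier V = carrier W"
  shows "finitely_generated_module A W"
proof -
  interpret V: left_module A V by fact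
  interpret W: left_module A W by fact
  interpret VW: module_pair A V W by (simp add: module_pair.intro V W)
  obtain G where G: "finite G" "G \<subseteq> carrier V" "span A V G = carrier V"
    using V(2) unfolding finitely_generated_module_def span_def by auto
  have fG: "f ` G \<subseteq> carrier W" using G(2) f(2) by blast
  have S: "submodule (span A W (f ` G)) A W" by (rule W.span_submodule[OF fG])
  have "G \<subseteq> {x \<in> carrier V. f x \<in> span A W (f ` G)}" using G(2) by (auto intro: span_inc)
  then have "span A V G \<subseteq> {x \<in> carrier V. f x \<in> span A W (f ` G)}"
    by (rule V.span_least[OF _ VW.hom_vimage_submodule[OF f(1) S]])
  then have "f x \<in> span A W (f ` G)" if "x \<in> carrier V" for x using that unfolding G(3) by auto
  then have "carrier W \<subseteq> span A W (f ` G)" unfolding f(2)[symmetric] by auto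
  then have "span A W (f ` G) = carrier W" using W.submodD(1)[OF S] by simp
  then show ?thesis unfolding finitely_generated_module_def span_def[symmetric]
    using G(1) fG by (intro exI[of _ "f ` G"]) simp
qed

lemma inv_hom:
  assumes V: "left_module A V" and f: "f \<in> mod_hom A V W" "bij_betw f (carrier V) (carrier W)"
  shows "inv_into (carrier V) f \<in> mod_hom A W V"
    and "bij_betw (inv_into (carrier V) f) (carrier W) (carrier V)"
    and "\<And>x. x \<in> carrier V \<Longrightarrow> inv_into (carrier V) f (f x) = x"
    and "\<And>y. y \<in> carrier W \<Longrightarrow> f (inv_into (carrier V) f y) = y"
    and "\<And>y. y \<in> carrier W \<Longrightarrow> inv_into (carrier V) f y \<in> carrier V"
proof -
  interpret V: left_module A V by fact
  have inj: "inj_on f (carrier V)" and im: "f ` carrier V = carrier W" using f(2) by (auto simp: bij_betw_def)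
  show b: "bij_betw (inv_into (carrier V) f) (carrier W) (carrier V)" by (rule bij_betw_inv_into[OF f(2)])
  show l: "\<And>x. x \<in> carrier V \<Longrightarrow> inv_into (carrier V) f (f x) = x" using inj by simp
  show r: "\<And>y. y \<in> carrier W \<Longrightarrow> f (inv_into (carrier V) f y) = y" using im by (simp add: f_inv_into_f)
  show c: "\<And>y. y \<in> carrier W \<Longrightarrow> inv_into (carrier V) f y \<in> carrier V" using im by (simp add: inv_into_into)
  show "inv_into (carrier V) f \<in> mod_hom A W V"
  proof (rule mod_homI)
    fix x y assume "x \<in> carrier W" "y \<in> carrier W"
    then show "inv_into (carrier V) f (x \<oplus>\<^bsub>W\<^esub> y) = inv_into (carrier V) f x \<oplus>\<^bsub>V\<^esub> inv_into (carrier V) f y"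
      using mod_homD(2)[OF f(1) c c, of x y] r l[of "inv_into (carrier V) f x \<oplus>\<^bsub>V\<^esub> inv_into (carrier V) f y"] c by simp
  next
    fix a x assume "a \<in> carrier A" "x \<in> carrier W"
    then show "inv_into (carrier V) f (a \<odot>\<^bsub>W\<^esub> x) = a \<odot>\<^bsub>V\<^esub> inv_into (carrier V) f x"
      using mod_homD(3)[OF f(1) _ c, of a x] r l[of "a \<odot>\<^bsub>V\<^esub> inv_into (carrier V) f x"] c by simp
  qed (use c in simp)
qed

lemma fg_modules_copy:
  fixes R :: "('a, 'r) ring_scheme" and V :: "('a, 'v, 'x) module_scheme"
  assumes R: "cring R" and V: "left_module R V" "finitely_generated_module R V"
  obtains N f where "N \<in> fg_modules R" "f \<in> mod_hom R V N" "bij_betw f (carrier V) (carrier N)"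
proof -
  interpret V: left_module R V by fact
  obtain Q :: "('a, 'a mod_univ) module" and \<pi> where Q: "left_module R Q" "\<pi> \<in> mod_hom R V Q"
    "\<pi> ` carrier V = carrier Q" "\<forall>x\<in>carrier V. \<pi> x = \<zero>\<^bsub>Q\<^esub> \<longleftrightarrow> x \<in> {\<zero>\<^bsub>V\<^esub>}"
    by (rule universe_copy[OF V V.submod_zero])
  interpret VQ: module_pair R V Q by (simp add: module_pair.intro V Q)
  have "Q \<in> fg_modules R"
    unfolding fg_modules_def using left_module_imp_module[OF R Q(1)] fg_image[OF V Q(1-3)] by simp
  moreover have "bij_betw \<pi> (carrier V) (carrier Q)"
    unfolding bij_betw_def using VQ.hom_inj_iff[OF Q(2)] Q(3,4) by simp
  ultimately show thesis using that Q(2) by blast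
qed

text \<open>
  The subgroup \<open>H\<close> collects formal combinations of modules whose class is already known to lie in a
  given subgroup of the Grothendieck group. A finite set generates the Grothendieck group if every such
  \<open>H\<close> that contains the set contains all modules.
\<close>

locale K0_subgroup =
  fixes R :: "('a, 'r) ring_scheme" and H :: "(('a, 'a mod_univ) module \<Rightarrow>\<^sub>0 int) set"
  assumes R: "cring R" "noetherian_ring R"
    and H0: "0 \<in> H" and H_add: "\<And>x y. x \<in> H \<Longrightarrow> y \<in> H \<Longrightarrow> x + y \<in> H" and H_uminus: "\<And>x. x \<in> H \<Longrightarrow> - x \<in> H"
    and H_rel: "K0_relations R \<subseteq> H"
begin

lemma H_diff: "x \<in> H \<Longrightarrow> y \<in> H \<Longrightarrow> x - y \<in> H"
  using H_add[OF _ H_uminus, of x y] by simp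

text \<open>
  The elements of \<open>V\<close> may have any type, while formal combinations are formed over one fixed type; so \<open>V\<close>
  is first replaced by an isomorphic copy there.
\<close>

definition class_in :: "('a, 'v, 'x) module_scheme \<Rightarrow> bool" where
  "class_in V \<longleftrightarrow> left_module R V \<and> (\<exists>N\<in>fg_modules R. Poly_Mapping.single N 1 \<in> H \<and>
     (\<exists>f\<in>mod_hom R V N. bij_betw f (carrier V) (carrier N)))"

lemma fg_modulesD: "N \<in> fg_modules R \<Longrightarrow> left_module R N" "N \<in> fg_modules R \<Longrightarrow> finitely_generated_module R N"
  by (auto simp: fg_modules_def intro: module_imp_left_module)

lemma class_inD:
  assumes "class_in V" shows "left_module R V" "finitely_generated_module R V"
proof -
  obtain N f where N: "N \<in> fg_modules R" "f \<in> mod_hom R V N" "bij_betw f (carrier V) (carrier N)"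
    and V: "left_module R V"
    using assms unfolding class_in_def by blast
  show "left_module R V" by fact
  show "finitely_generated_module R V"
    using fg_image[OF fg_modulesD[OF N(1)] V inv_hom(1)[OF V N(2,3)]] inv_hom(2)[OF V N(2,3)]
    by (simp add: bij_betw_def)
qed

lemma K0_relation_copies:
  assumes B: "left_module R B" and C: "left_module R C"
    and g: "g \<in> mod_hom R B C" "g ` carrier B = carrier C" and W: "W = {x \<in> carrier B. g x = \<zero>\<^bsub>C\<^esub>}"
    and A': "A' \<in> fg_modules R" "a \<in> mod_hom R (B\<lparr>carrier := W\<rparr>) A'" "bij_betw a W (carrier A')"
    and B': "B' \<in> fg_modules R" "b \<in> mod_hom R B B'" "bij_betw b (carrier B) (carrier B')"
    and C': "C' \<in> fg_modules R" "c \<in> mod_hom R C C'" "bij_betw c (carrier C) (carrier C')"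
  shows "Poly_Mapping.single B' 1 - Poly_Mapping.single A' 1 - Poly_Mapping.single C' 1 \<in> H"
proof -
  interpret B: left_module R B by fact
  interpret BC: module_pair R B C by (simp add: module_pair.intro B C)
  have Ws: "submodule W R B" unfolding W by (rule BC.hom_kernel_submodule[OF g(1)])
  have A: "left_module R (B\<lparr>carrier := W\<rparr>)" by (rule B.submodule_left_module[OF Ws])
  interpret CC: module_pair R C C' by (simp add: module_pair.intro C fg_modulesD C')
  have A'3: "bij_betw a (carrier (B\<lparr>carrier := W\<rparr>)) (carrier A')" using A'(3) by simp
  let ?ai = "inv_into (carrier (B\<lparr>carrier := W\<rparr>)) a" and ?bi = "inv_into (carrier B) b"
  note ai = inv_hom[OF A A'(2) A'3] and bi = inv_hom[OF B B'(2,3)]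
  let ?f = "\<lambda>x. b (?ai x)" and ?g = "\<lambda>y. c (g (?bi y))"
  have incl: "?ai \<in> mod_hom R A' B" by (rule mod_hom_cod'[OF ai(1)]) (use B.submodD(1)[OF Ws] in simp)
  have f: "?f \<in> mod_hom R A' B'" by (rule mod_hom_comp[OF incl B'(2)])
  have g': "?g \<in> mod_hom R B' C'" by (rule mod_hom_comp[OF mod_hom_comp[OF bi(1) g(1)] C'(2)])
  have Wc: "W \<subseteq> carrier B" using B.submodD(1)[OF Ws] .
  have im_ai: "?ai ` carrier A' = W" using ai(2) by (simp add: bij_betw_def)
  have "inj_on ?f (carrier A')"
  proof (rule inj_onI)
    fix x y assume xy: "x \<in> carrier A'" "y \<in> carrier A'" "b (?ai x) = b (?ai y)"
    have "?ai x \<in> carrier B" "?ai y \<in> carrier B" using im_ai Wc xy by blast+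
    then have "?ai x = ?ai y" using inj_onD[OF bij_betw_imp_inj_on[OF B'(3)] xy(3)] by blast
    then show "x = y" using inj_onD[OF bij_betw_imp_inj_on[OF ai(2)] _ xy(1,2)] by blast
  qed
  moreover have "?f ` carrier A' = a_kernel B' C' ?g"
  proof -
    have "?f ` carrier A' = b ` ?ai ` carrier A'" by (rule image_image[symmetric])
    also have "\<dots> = b ` W" by (simp only: im_ai)
    also have "\<dots> = a_kernel B' C' ?g"
    proof
      show "b ` W \<subseteq> a_kernel B' C' ?g"
      proof
        fix y assume "y \<in> b ` W"
        then obtain x where x: "y = b x" "x \<in> carrier B" "g x = \<zero>\<^bsub>C\<^esub>" using W by blast
        then show "y \<in> a_kernel B' C' ?g"
          using mod_homD(1)[OF B'(2)] bi(3) CC.hom_zero[OF C'(2)] by (simp add: a_kernel_def kernel_def)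
      qed
      show "a_kernel B' C' ?g \<subseteq> b ` W"
      proof
        fix y assume "y \<in> a_kernel B' C' ?g"
        then have y: "y \<in> carrier B'" "c (g (?bi y)) = \<zero>\<^bsub>C'\<^esub>" by (auto simp: a_kernel_def kernel_def)
        have "g (?bi y) \<in> carrier C" using mod_homD(1)[OF g(1)] bi(5)[OF y(1)] by simp
        moreover have "inj_on c (carrier C)" using C'(3) by (simp add: bij_betw_def)
        ultimately have "g (?bi y) = \<zero>\<^bsub>C\<^esub>" using CC.hom_inj_iff[OF C'(2)] y(2) by blast
        then show "y \<in> b ` W" using bi(4,5)[OF y(1)] unfolding W by force
      qed
    qed
    finally show ?thesis .
  qed
  moreover have "?g ` carrier B' = carrier C'"
  proof -
    have "?g ` carrier B' = c ` g ` ?bi ` carrier B'" by (simp add: image_image)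
    then show ?thesis using bi(2) g(2) C'(3) by (simp add: bij_betw_def)
  qed
  ultimately have "short_exact R A' ?f B' ?g C'" unfolding short_exact_def using f g' by simp
  then have "Poly_Mapping.single B' 1 - Poly_Mapping.single A' 1 - Poly_Mapping.single C' 1 \<in> K0_relations R"
    unfolding K0_relations_def using A'(1) B'(1) C'(1) by blast
  then show ?thesis using H_rel by blast
qed

lemma class_in_iso:
  assumes V: "class_in V" and W: "left_module R W" "f \<in> mod_hom R V W" "bij_betw f (carrier V) (carrier W)"
  shows "class_in W"
proof -
  obtain N g where N: "N \<in> fg_modules R" "Poly_Mapping.single N 1 \<in> H" "g \<in> mod_hom R V N" "bij_betw g (carrier V) (carrier N)"
    using V unfolding class_in_def by blast
  note i = inv_hom[OF class_inD(1)[OF V] W(2,3)]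
  have "(\<lambda>y. g (inv_into (carrier V) f y)) \<in> mod_hom R W N" by (rule mod_hom_comp[OF i(1) N(3)])
  moreover have "bij_betw (\<lambda>y. g (inv_into (carrier V) f y)) (carrier W) (carrier N)"
    using bij_betw_trans[OF i(2) N(4)] by (simp add: comp_def)
  ultimately show ?thesis unfolding class_in_def using W(1) N by blast
qed

lemma class_in_middle:
  assumes B: "left_module R B" "finitely_generated_module R B" and g: "g \<in> mod_hom R B C" "g ` carrier B = carrier C"
    and W: "class_in (B\<lparr>carrier := {x \<in> carrier B. g x = \<zero>\<^bsub>C\<^esub>}\<rparr>)" and C: "class_in C"
  shows "class_in B"
proof -
  let ?W = "{x \<in> carrier B. g x = \<zero>\<^bsub>C\<^esub>}"
  obtain A' a where A': "A' \<in> fg_modules R" "Poly_Mapping.single A' 1 \<in> H" "a \<in> mod_hom R (B\<lparr>carrier := ?W\<rparr>) A'" "bij_betw a ?W (carrier A')"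
    using W unfolding class_in_def by auto
  obtain C' c where C': "C' \<in> fg_modules R" "Poly_Mapping.single C' 1 \<in> H" "c \<in> mod_hom R C C'" "bij_betw c (carrier C) (carrier C')"
    using C unfolding class_in_def by blast
  obtain B' b where B': "B' \<in> fg_modules R" "b \<in> mod_hom R B B'" "bij_betw b (carrier B) (carrier B')"
    using fg_modules_copy[OF R(1) B] by blast
  have "Poly_Mapping.single B' 1 - Poly_Mapping.single A' 1 - Poly_Mapping.single C' 1 \<in> H"
    by (rule K0_relation_copies[OF B(1) class_inD(1)[OF C] g refl A'(1,3,4) B' C'(1,3,4)])
  from H_add[OF H_add[OF this A'(2)] C'(2)] have "Poly_Mapping.single B' 1 \<in> H" by simp
  then show ?thesis unfolding class_in_def using B B' by blast
qed

lemma class_in_image: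
  assumes B: "class_in B" and C: "left_module R C" and g: "g \<in> mod_hom R B C" "g ` carrier B = carrier C"
    and W: "class_in (B\<lparr>carrier := {x \<in> carrier B. g x = \<zero>\<^bsub>C\<^esub>}\<rparr>)"
  shows "class_in C"
proof -
  let ?W = "{x \<in> carrier B. g x = \<zero>\<^bsub>C\<^esub>}"
  note BB = class_inD[OF B]
  obtain A' a where A': "A' \<in> fg_modules R" "Poly_Mapping.single A' 1 \<in> H" "a \<in> mod_hom R (B\<lparr>carrier := ?W\<rparr>) A'" "bij_betw a ?W (carrier A')"
    using W unfolding class_in_def by auto
  obtain B' b where B': "B' \<in> fg_modules R" "Poly_Mapping.single B' 1 \<in> H" "b \<in> mod_hom R B B'" "bij_betw b (carrier B) (carrier B')"
    using B unfolding class_in_def by blast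
  obtain C' c where C': "C' \<in> fg_modules R" "c \<in> mod_hom R C C'" "bij_betw c (carrier C) (carrier C')"
    using fg_modules_copy[OF R(1) C fg_image[OF BB C g]] by blast
  have "Poly_Mapping.single B' 1 - Poly_Mapping.single A' 1 - Poly_Mapping.single C' 1 \<in> H"
    by (rule K0_relation_copies[OF BB(1) C g refl A'(1,3,4) B'(1,3,4) C'])
  from H_diff[OF H_diff[OF B'(2) A'(2)] this] have "Poly_Mapping.single C' 1 \<in> H" by simp
  then show ?thesis unfolding class_in_def using C C' by blast
qed

text \<open>
  For \<open>V = 0\<close> the sequence \<open>V \<rightarrow> V \<rightarrow> V\<close> is short exact, so the negative of its class is a relation.
\<close>

lemma class_in_zero:
  assumes V: "left_module R V" "carrier V = {\<zero>\<^bsub>V\<^esub>}" shows "class_in V"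
proof -
  interpret V: left_module R V by fact
  have "finitely_generated_module R V"
    unfolding finitely_generated_module_def span_def[symmetric] using V(2) V.span_empty by (intro exI[of _ "{}"]) auto
  then obtain N f where N: "N \<in> fg_modules R" "f \<in> mod_hom R V N" "bij_betw f (carrier V) (carrier N)"
    using fg_modules_copy[OF R(1) V(1)] by blast
  have W: "{x \<in> carrier V. (\<lambda>x. x) x = \<zero>\<^bsub>V\<^esub>} = carrier V" using V(2) by auto
  have *: "f \<in> mod_hom R (V\<lparr>carrier := carrier V\<rparr>) N" by (rule mod_hom_dom[OF N(2)]) simp
  have "Poly_Mapping.single N 1 - Poly_Mapping.single N 1 - Poly_Mapping.single N 1 \<in> H"
    by (rule K0_relation_copies[OF V(1) V(1) mod_hom_id _ W[symmetric] N(1) * N(3) N N]) simp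
  then have "Poly_Mapping.single N 1 \<in> H" using H_uminus by fastforce
  then show ?thesis unfolding class_in_def using V N by blast
qed

text \<open>
  The definition of \<open>class_in\<close> speaks of some copy of \<open>N\<close>. The class of \<open>N\<close> itself differs from it by the
  relation of \<open>0 \<rightarrow> N \<rightarrow> N' \<rightarrow> 0 \<rightarrow> 0\<close>.
\<close>

lemma class_in_fg_modules:
  assumes N: "N \<in> fg_modules R" "class_in N" shows "Poly_Mapping.single N 1 \<in> H"
proof -
  obtain N' f where N': "N' \<in> fg_modules R" "Poly_Mapping.single N' 1 \<in> H" "f \<in> mod_hom R N N'" "bij_betw f (carrier N) (carrier N')"
    using N(2) unfolding class_in_def by blast
  interpret N: left_module R N by (rule fg_modulesD[OF N(1)])
  let ?Z = "N\<lparr>carrier := {\<zero>\<^bsub>N\<^esub>}\<rparr>"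
  have Z: "left_module R ?Z" by (rule N.submodule_left_module[OF N.submod_zero])
  have "class_in ?Z" by (rule class_in_zero[OF Z]) simp
  then obtain Z' z where Z': "Z' \<in> fg_modules R" "Poly_Mapping.single Z' 1 \<in> H" "z \<in> mod_hom R ?Z Z'" "bij_betw z (carrier ?Z) (carrier Z')"
    unfolding class_in_def by blast
  interpret NZ: module_pair R N ?Z by (simp add: module_pair.intro N.left_module_axioms Z)
  have g: "(\<lambda>x. \<zero>\<^bsub>N\<^esub>) \<in> mod_hom R N ?Z" using NZ.zero_hom by simp
  have gi: "(\<lambda>x. \<zero>\<^bsub>N\<^esub>) ` carrier N = carrier ?Z" using N.M.zero_closed by auto
  have W: "carrier N = {x \<in> carrier N. (\<lambda>x. \<zero>\<^bsub>N\<^esub>) x = \<zero>\<^bsub>?Z\<^esub>}" by simp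
  have i: "(\<lambda>x. x) \<in> mod_hom R (N\<lparr>carrier := carrier N\<rparr>) N" by (rule mod_hom_dom[OF mod_hom_id]) simp
  have ib: "bij_betw (\<lambda>x. x) (carrier N) (carrier N)" by (simp add: bij_betw_def inj_on_def)
  have "Poly_Mapping.single N' 1 - Poly_Mapping.single N 1 - Poly_Mapping.single Z' 1 \<in> H"
    by (rule K0_relation_copies[OF N.left_module_axioms Z g gi W N(1) i ib N'(1,3,4) Z'(1,3,4)])
  from H_diff[OF H_diff[OF N'(2) Z'(2)] this] show ?thesis by simp
qed

subsection \<open>Devissage\<close>

text \<open>
  Let \<open>W\<close> be maximal among the submodules of \<open>C\<close> whose class lies in \<open>H\<close>. If \<open>W\<close> is not all of \<open>C\<close>,
  choose \<open>x\<close> outside \<open>W\<close> such that the ideal of all \<open>r\<close> with \<open>rx\<close> in \<open>W\<close> is maximal. This ideal \<open>p\<close> is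
  prime and contains \<open>\<tau>\<close>, and \<open>(Rx + W)/W\<close> is isomorphic to \<open>R/p\<close>, so \<open>Rx + W\<close> contradicts the choice
  of \<open>W\<close>.
\<close>

lemma devissage:
  assumes C: "left_module R C" "finitely_generated_module R C"
    and \<tau>: "\<And>t x. t \<in> \<tau> \<Longrightarrow> x \<in> carrier C \<Longrightarrow> t \<odot>\<^bsub>C\<^esub> x = \<zero>\<^bsub>C\<^esub>" "\<tau> \<subseteq> carrier R"
    and p: "\<And>p. p \<in> Spec R \<Longrightarrow> \<tau> \<subseteq> p \<Longrightarrow> class_in (quotient_module (regular_module R) p)"
  shows "class_in C"
proof -
  interpret R: cring R by (rule R)
  interpret C: left_module R C by fact
  interpret M: left_module R "regular_module R" by (rule regular_left_module) (rule R.ring_axioms)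
  have c: "carrier (regular_module R) = carrier R" by (simp add: regular_module_def)
  have fg: "finitely_generated_module R (regular_module R)"
    unfolding finitely_generated_module_def span_def[symmetric] using regular_span_one[OF R(1)] c
    by (intro exI[of _ "{\<one>\<^bsub>R\<^esub>}"]) auto
  let ?S = "{W. submodule W R C \<and> class_in (C\<lparr>carrier := W\<rparr>)}"
  have "class_in (C\<lparr>carrier := {\<zero>\<^bsub>C\<^esub>}\<rparr>)"
    by (rule class_in_zero) (use C.submodule_left_module[OF C.submod_zero] in auto)
  then have ne: "?S \<noteq> {}" using C.submod_zero by blast
  have "\<exists>W\<in>?S. \<forall>K\<in>?S. W \<subseteq> K \<longrightarrow> K = W"
    by (rule C.ex_max_fg_submodule[OF _ ne]) (use fg_submodule[OF R C] in simp_all)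
  then obtain W where W: "submodule W R C" "class_in (C\<lparr>carrier := W\<rparr>)"
    and max: "\<And>K. submodule K R C \<Longrightarrow> class_in (C\<lparr>carrier := K\<rparr>) \<Longrightarrow> W \<subseteq> K \<Longrightarrow> K = W"
    by blast
  note W' = C.submodD[OF W(1)]
  show ?thesis
  proof (cases "W = carrier C")
    case True
    have "class_in (C\<lparr>carrier := carrier C\<rparr>)" using W True by simp
    then show ?thesis by (rule class_in_iso[OF _ C(1), of _ "\<lambda>x. x"]) (auto simp: mod_hom_def bij_betw_def)
  next
    case False
    define ann where "ann x = {r \<in> carrier R. r \<odot>\<^bsub>C\<^esub> x \<in> W}" for x
    have ann: "ideal (ann x) R" if "x \<in> carrier C" for x
      unfolding ann_def by (rule R.ring_idealI) (use that W' C.smult_l_distr C.smult_assoc1 in auto)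
    let ?A = "ann ` (carrier C - W)"
    have ne: "?A \<noteq> {}" using False W'(1) by blast
    have "\<exists>I\<in>?A. \<forall>K\<in>?A. I \<subseteq> K \<longrightarrow> K = I"
      by (rule M.ex_max_fg_submodule[OF _ ne])
        (use fg_submodule[OF R M.left_module_axioms fg] ann ideal_iff_submodule[OF R(1)] in auto)
    then obtain x where x: "x \<in> carrier C" "x \<notin> W"
      and xmax: "\<And>y. y \<in> carrier C \<Longrightarrow> y \<notin> W \<Longrightarrow> ann x \<subseteq> ann y \<Longrightarrow> ann y = ann x" by blast
    have prime: "primeideal (ann x) R"
    proof (rule primeidealI[OF ann[OF x(1)] R(1)])
      show "carrier R \<noteq> ann x" using x C.smult_one[OF x(1)] unfolding ann_def by (metis (mono_tags, lifting) R.one_closed mem_Collect_eq)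
      fix a b assume ab: "a \<in> carrier R" "b \<in> carrier R" "a \<otimes>\<^bsub>R\<^esub> b \<in> ann x"
      show "a \<in> ann x \<or> b \<in> ann x"
      proof (cases "b \<odot>\<^bsub>C\<^esub> x \<in> W")
        case True then show ?thesis using ab by (simp add: ann_def)
      next
        case False
        have "ann x \<subseteq> ann (b \<odot>\<^bsub>C\<^esub> x)"
        proof
          fix r assume r: "r \<in> ann x"
          then have rc: "r \<in> carrier R" "r \<odot>\<^bsub>C\<^esub> x \<in> W" by (auto simp: ann_def)
          have "r \<odot>\<^bsub>C\<^esub> (b \<odot>\<^bsub>C\<^esub> x) = b \<odot>\<^bsub>C\<^esub> (r \<odot>\<^bsub>C\<^esub> x)"
            using C.smult_assoc1[OF rc(1) ab(2) x(1)] C.smult_assoc1[OF ab(2) rc(1) x(1)] R.m_comm[OF rc(1) ab(2)] by simp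
          then show "r \<in> ann (b \<odot>\<^bsub>C\<^esub> x)" using W'(7)[OF ab(2) rc(2)] rc(1) by (simp add: ann_def)
        qed
        then have "ann (b \<odot>\<^bsub>C\<^esub> x) = ann x" using xmax False ab x by simp
        moreover have "a \<in> ann (b \<odot>\<^bsub>C\<^esub> x)" using ab x(1) C.smult_assoc1[OF ab(1,2) x(1)] by (simp add: ann_def)
        ultimately show ?thesis by simp
      qed
    qed
    have "\<tau> \<subseteq> ann x" using \<tau> x W'(2) by (auto simp: ann_def)
    then have Rp: "class_in (quotient_module (regular_module R) (ann x))" (is "class_in ?Q")
      using p prime by (simp add: Spec_def)
    have ps: "submodule (ann x) R (regular_module R)" using ann[OF x(1)] ideal_iff_submodule[OF R(1)] by simp
    obtain \<pi> where Q: "left_module R ?Q" and \<pi>: "\<pi> \<in> mod_hom R (regular_module R) ?Q"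
      "\<pi> ` carrier R = carrier ?Q" "\<And>r. r \<in> carrier R \<Longrightarrow> \<pi> r = \<zero>\<^bsub>?Q\<^esub> \<longleftrightarrow> r \<in> ann x"
      using M.quotient_module[OF ps] unfolding c by metis
    note \<pi>D = mod_homD[OF \<pi>(1), unfolded c]
    let ?W1 = "{y \<oplus>\<^bsub>C\<^esub> w |y w. y \<in> {r \<odot>\<^bsub>C\<^esub> x |r. r \<in> carrier R} \<and> w \<in> W}"
    have W1: "submodule ?W1 R C" by (rule C.submod_sum[OF C.submod_cyclic[OF x(1)] W(1)])
    let ?B = "C\<lparr>carrier := ?W1\<rparr>"
    have B: "left_module R ?B" by (rule C.submodule_left_module[OF W1])
    have Bfg: "finitely_generated_module R ?B"
      unfolding C.fg_submodule_iff[OF W1] by (rule fg_submodule[OF R C W1])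
    interpret BQ: module_pair R ?B ?Q by (rule module_pair.intro[OF B Q])
    define \<Gamma> where "\<Gamma> y q \<longleftrightarrow> (\<exists>r\<in>carrier R. \<exists>w\<in>W. y = r \<odot>\<^bsub>C\<^esub> x \<oplus>\<^bsub>C\<^esub> w \<and> q = \<pi> r)" for y q
    obtain g where g: "g \<in> mod_hom R ?B ?Q" "\<And>y q. \<Gamma> y q \<Longrightarrow> g y = q"
    proof (rule BQ.hom_of_relation[of \<Gamma>])
      show "\<exists>q. \<Gamma> y q" if "y \<in> carrier ?B" for y using that unfolding \<Gamma>_def by auto
      show "y \<in> carrier ?B \<and> q \<in> carrier ?Q" if "\<Gamma> y q" for y q using that \<pi>D(1) unfolding \<Gamma>_def by auto
      show "\<Gamma> (y \<oplus>\<^bsub>?B\<^esub> y') (q \<oplus>\<^bsub>?Q\<^esub> q')" if yq: "\<Gamma> y q" "\<Gamma> y' q'" for y q y' q'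
      proof -
        obtain r w where rw: "r \<in> carrier R" "w \<in> W" "y = r \<odot>\<^bsub>C\<^esub> x \<oplus>\<^bsub>C\<^esub> w" "q = \<pi> r" using yq(1) unfolding \<Gamma>_def by blast
        obtain r' w' where rw': "r' \<in> carrier R" "w' \<in> W" "y' = r' \<odot>\<^bsub>C\<^esub> x \<oplus>\<^bsub>C\<^esub> w'" "q' = \<pi> r'" using yq(2) unfolding \<Gamma>_def by blast
        have "y \<oplus>\<^bsub>C\<^esub> y' = (r \<oplus>\<^bsub>R\<^esub> r') \<odot>\<^bsub>C\<^esub> x \<oplus>\<^bsub>C\<^esub> (w \<oplus>\<^bsub>C\<^esub> w')"
          using rw rw' x W'(3) by (simp add: C.smult_l_distr C.M.a_ac)
        moreover have "q \<oplus>\<^bsub>?Q\<^esub> q' = \<pi> (r \<oplus>\<^bsub>R\<^esub> r')" using \<pi>D(2)[of r r'] rw rw' by (simp add: regular_module_def)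
        ultimately show ?thesis unfolding \<Gamma>_def using rw rw' W'(4)[of w w'] R.a_closed[of r r'] by auto
      qed
      show "\<Gamma> (a \<odot>\<^bsub>?B\<^esub> y) (a \<odot>\<^bsub>?Q\<^esub> q)" if a: "a \<in> carrier R" and yq: "\<Gamma> y q" for a y q
      proof -
        obtain r w where rw: "r \<in> carrier R" "w \<in> W" "y = r \<odot>\<^bsub>C\<^esub> x \<oplus>\<^bsub>C\<^esub> w" "q = \<pi> r" using yq unfolding \<Gamma>_def by blast
        have "a \<odot>\<^bsub>C\<^esub> y = (a \<otimes>\<^bsub>R\<^esub> r) \<odot>\<^bsub>C\<^esub> x \<oplus>\<^bsub>C\<^esub> a \<odot>\<^bsub>C\<^esub> w"
          using rw a x W'(3) by (simp add: C.smult_r_distr C.smult_assoc1)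
        moreover have "a \<odot>\<^bsub>?Q\<^esub> q = \<pi> (a \<otimes>\<^bsub>R\<^esub> r)" using \<pi>D(3)[of a r] rw a by (simp add: regular_module_def)
        ultimately show ?thesis unfolding \<Gamma>_def using rw W'(7)[of a w] a R.m_closed[of a r] by auto
      qed
      show "q = \<zero>\<^bsub>?Q\<^esub>" if yq: "\<Gamma> \<zero>\<^bsub>?B\<^esub> q" for q
      proof -
        obtain r w where rw: "r \<in> carrier R" "w \<in> W" "\<zero>\<^bsub>C\<^esub> = r \<odot>\<^bsub>C\<^esub> x \<oplus>\<^bsub>C\<^esub> w" "q = \<pi> r" using yq unfolding \<Gamma>_def by auto
        then have "r \<odot>\<^bsub>C\<^esub> x = \<ominus>\<^bsub>C\<^esub> w" using C.M.minus_equality[of "r \<odot>\<^bsub>C\<^esub> x" w] x W'(3) by simp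
        then have "r \<in> ann x" using rw W'(5) by (simp add: ann_def)
        then show ?thesis using \<pi>(3) rw by simp
      qed
    qed blast
    have gv: "g (r \<odot>\<^bsub>C\<^esub> x \<oplus>\<^bsub>C\<^esub> w) = \<pi> r" if "r \<in> carrier R" "w \<in> W" for r w
      by (rule g(2)) (use that in \<open>auto simp: \<Gamma>_def\<close>)
    have surj: "g ` carrier ?B = carrier ?Q"
    proof
      show "g ` carrier ?B \<subseteq> carrier ?Q" using mod_homD(1)[OF g(1)] by blast
      show "carrier ?Q \<subseteq> g ` carrier ?B"
      proof
        fix q assume "q \<in> carrier ?Q"
        then obtain r where r: "r \<in> carrier R" "q = \<pi> r" using \<pi>(2) by blast
        then have "q = g (r \<odot>\<^bsub>C\<^esub> x \<oplus>\<^bsub>C\<^esub> \<zero>\<^bsub>C\<^esub>)" using gv[OF r(1) W'(2)] by simp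
        moreover have "r \<odot>\<^bsub>C\<^esub> x \<oplus>\<^bsub>C\<^esub> \<zero>\<^bsub>C\<^esub> \<in> carrier ?B" using r W'(2) by auto
        ultimately show "q \<in> g ` carrier ?B" by blast
      qed
    qed
    have kin: "r \<odot>\<^bsub>C\<^esub> x \<oplus>\<^bsub>C\<^esub> w \<in> W \<longleftrightarrow> r \<in> ann x" if "r \<in> carrier R" "w \<in> W" for r w
    proof
      assume "r \<odot>\<^bsub>C\<^esub> x \<oplus>\<^bsub>C\<^esub> w \<in> W"
      then have "(r \<odot>\<^bsub>C\<^esub> x \<oplus>\<^bsub>C\<^esub> w) \<ominus>\<^bsub>C\<^esub> w \<in> W" using W'(6) that by blast
      then show "r \<in> ann x" using C.plus_minus[of "r \<odot>\<^bsub>C\<^esub> x" w] that x W'(3) by (simp add: ann_def)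
    qed (use that W'(4) in \<open>auto simp: ann_def\<close>)
    have WB: "W \<subseteq> ?W1"
    proof
      fix w assume w: "w \<in> W"
      then have "w = \<zero>\<^bsub>R\<^esub> \<odot>\<^bsub>C\<^esub> x \<oplus>\<^bsub>C\<^esub> w" using x W'(3) by simp
      then show "w \<in> ?W1" using w R.zero_closed by blast
    qed
    have ker: "{y \<in> carrier ?B. g y = \<zero>\<^bsub>?Q\<^esub>} = W"
    proof
      show "{y \<in> carrier ?B. g y = \<zero>\<^bsub>?Q\<^esub>} \<subseteq> W"
        using gv kin \<pi>(3) by auto
      show "W \<subseteq> {y \<in> carrier ?B. g y = \<zero>\<^bsub>?Q\<^esub>}"
      proof
        fix w assume w: "w \<in> W"
        then obtain r v where "r \<in> carrier R" "v \<in> W" "w = r \<odot>\<^bsub>C\<^esub> x \<oplus>\<^bsub>C\<^esub> v" using WB by blast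
        then show "w \<in> {y \<in> carrier ?B. g y = \<zero>\<^bsub>?Q\<^esub>}" using gv kin \<pi>(3) w WB by auto
      qed
    qed
    have "class_in ?B"
      by (rule class_in_middle[OF B Bfg g(1) surj _ Rp], unfold ker) (use W(2) in simp)
    then have "?W1 = W" by (rule max[OF W1 _ WB])
    moreover have "x \<in> ?W1"
    proof -
      have "x = \<one>\<^bsub>R\<^esub> \<odot>\<^bsub>C\<^esub> x \<oplus>\<^bsub>C\<^esub> \<zero>\<^bsub>C\<^esub>" using x by simp
      then show ?thesis using W'(2) R.one_closed by blast
    qed
    ultimately show ?thesis using x(2) by simp
  qed
qed

end

section \<open>Finite direct powers\<close>

definition copower_inj :: "nat \<Rightarrow> ('a, 'v, 'x) module_scheme \<Rightarrow> nat \<Rightarrow> 'v \<Rightarrow> nat \<Rightarrow> 'v" where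
  "copower_inj n V j x = (\<lambda>i\<in>{..<n}. if i = j then x else \<zero>\<^bsub>V\<^esub>)"

lemma copower_carrier: "carrier (copower {..<n::nat} V) = {..<n} \<rightarrow>\<^sub>E carrier V"
  by (auto simp: copower_def)

lemma copower_simps:
  "\<zero>\<^bsub>copower I V\<^esub> = (\<lambda>i\<in>I. \<zero>\<^bsub>V\<^esub>)" "v \<oplus>\<^bsub>copower I V\<^esub> w = (\<lambda>i\<in>I. v i \<oplus>\<^bsub>V\<^esub> w i)"
  "a \<odot>\<^bsub>copower I V\<^esub> v = (\<lambda>i\<in>I. a \<odot>\<^bsub>V\<^esub> v i)"
  by (simp_all add: copower_def)

lemma copower_proj_hom: "i \<in> I \<Longrightarrow> (\<lambda>v. v i) \<in> mod_hom A (copower I V) V"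
  by (rule mod_homI) (auto simp: copower_def)

lemma (in left_module) finsum_in_submodule:
  assumes H: "submodule H R M" and "finite J" "f \<in> J \<rightarrow> H" shows "(\<Oplus>\<^bsub>M\<^esub>j\<in>J. f j) \<in> H"
  using assms(2,3)
proof (induct set: finite)
  case empty then show ?case using submodD(2)[OF H] by simp
next
  case (insert j J)
  then show ?case using submodD(3,4)[OF H] by (simp add: Pi_def)
qed

lemma (in left_module) copower_inj_hom:
  assumes "j < n" shows "copower_inj n M j \<in> mod_hom R M (copower {..<n} M)"
  by (rule mod_homI) (auto simp: copower_carrier copower_simps copower_inj_def fun_eq_iff restrict_def PiE_iff extensional_def)

lemma (in left_module) copower_decomp:
  assumes v: "v \<in> carrier (copower {..<n} M)"
  shows "v = (\<Oplus>\<^bsub>copower {..<n} M\<^esub>j\<in>{..<n}. copower_inj n M j (v j))"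
proof -
  let ?C = "copower {..<n} M"
  interpret C: left_module R ?C by (rule copower_left_module) (rule left_module_axioms)
  interpret CM: module_pair R ?C M by (simp add: module_pair.intro C.left_module_axioms left_module_axioms)
  have vj: "v j \<in> carrier M" if "j < n" for j using v that by (auto simp: copower_carrier)
  have ij: "(\<lambda>j. copower_inj n M j (v j)) \<in> {..<n} \<rightarrow> carrier ?C"
    using mod_homD(1)[OF copower_inj_hom] vj by auto
  let ?s = "\<Oplus>\<^bsub>?C\<^esub>j\<in>{..<n}. copower_inj n M j (v j)"
  have s: "?s \<in> carrier ?C" by (rule C.M.finsum_closed[OF ij])
  show ?thesis
  proof (rule extensionalityI[of _ "{..<n}"])
    show "v \<in> extensional {..<n}" "?s \<in> extensional {..<n}" using v s unfolding copower_carrier PiE_iff by blast+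
    fix i assume i: "i \<in> {..<n}"
    have "?s i = (\<Oplus>\<^bsub>M\<^esub>j\<in>{..<n}. copower_inj n M j (v j) i)"
      using CM.hom_finsum[OF copower_proj_hom[OF i, of R M] finite_lessThan ij] .
    also have "\<dots> = (\<Oplus>\<^bsub>M\<^esub>j\<in>{..<n}. if i = j then v j else \<zero>\<^bsub>M\<^esub>)"
      by (rule M.finsum_cong') (use i vj in \<open>auto simp: copower_inj_def\<close>)
    also have "\<dots> = v i" by (rule M.add.finprod_singleton) (use i vj in auto)
    finally show "v i = ?s i" by simp
  qed
qed

lemma copower_hom:
  assumes V: "left_module A V" and W: "left_module A W" and \<phi>: "\<And>j. j < n \<Longrightarrow> \<phi> j \<in> mod_hom A V W"
  shows "(\<lambda>v. \<Oplus>\<^bsub>W\<^esub>j\<in>{..<n}. \<phi> j (v j)) \<in> mod_hom A (copower {..<n} V) W"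
    and "\<And>j x. j < n \<Longrightarrow> x \<in> carrier V \<Longrightarrow> (\<Oplus>\<^bsub>W\<^esub>i\<in>{..<n}. \<phi> i (copower_inj n V j x i)) = \<phi> j x"
proof -
  interpret V: left_module A V by fact
  interpret W: left_module A W by fact
  interpret VW: module_pair A V W by (rule module_pair.intro[OF V W])
  have c: "\<phi> j (v j) \<in> carrier W" if "v \<in> carrier (copower {..<n} V)" "j < n" for v j
    using that mod_homD(1)[OF \<phi>] by (auto simp: copower_carrier)
  show "(\<lambda>v. \<Oplus>\<^bsub>W\<^esub>j\<in>{..<n}. \<phi> j (v j)) \<in> mod_hom A (copower {..<n} V) W"
  proof (rule mod_homI)
    fix v w assume vw: "v \<in> carrier (copower {..<n} V)" "w \<in> carrier (copower {..<n} V)"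
    have "(\<Oplus>\<^bsub>W\<^esub>j\<in>{..<n}. \<phi> j ((v \<oplus>\<^bsub>copower {..<n} V\<^esub> w) j)) = (\<Oplus>\<^bsub>W\<^esub>j\<in>{..<n}. \<phi> j (v j) \<oplus>\<^bsub>W\<^esub> \<phi> j (w j))"
      by (rule W.M.finsum_cong') (use vw c mod_homD(2)[OF \<phi>] in \<open>auto simp: copower_simps copower_carrier PiE_iff\<close>)
    also have "\<dots> = (\<Oplus>\<^bsub>W\<^esub>j\<in>{..<n}. \<phi> j (v j)) \<oplus>\<^bsub>W\<^esub> (\<Oplus>\<^bsub>W\<^esub>j\<in>{..<n}. \<phi> j (w j))"
      by (rule W.M.finsum_addf) (use vw c in auto)
    finally show "(\<Oplus>\<^bsub>W\<^esub>j\<in>{..<n}. \<phi> j ((v \<oplus>\<^bsub>copower {..<n} V\<^esub> w) j)) = (\<Oplus>\<^bsub>W\<^esub>j\<in>{..<n}. \<phi> j (v j)) \<oplus>\<^bsub>W\<^esub> (\<Oplus>\<^bsub>W\<^esub>j\<in>{..<n}. \<phi> j (w j))" .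
  next
    fix a v assume av: "a \<in> carrier A" "v \<in> carrier (copower {..<n} V)"
    have "(\<Oplus>\<^bsub>W\<^esub>j\<in>{..<n}. \<phi> j ((a \<odot>\<^bsub>copower {..<n} V\<^esub> v) j)) = (\<Oplus>\<^bsub>W\<^esub>j\<in>{..<n}. a \<odot>\<^bsub>W\<^esub> \<phi> j (v j))"
      by (rule W.M.finsum_cong') (use av c mod_homD(3)[OF \<phi>] in \<open>auto simp: copower_simps copower_carrier PiE_iff\<close>)
    also have "\<dots> = a \<odot>\<^bsub>W\<^esub> (\<Oplus>\<^bsub>W\<^esub>j\<in>{..<n}. \<phi> j (v j))"
      by (rule W.finsum_smult_l[symmetric]) (use av c in auto)
    finally show "(\<Oplus>\<^bsub>W\<^esub>j\<in>{..<n}. \<phi> j ((a \<odot>\<^bsub>copower {..<n} V\<^esub> v) j)) = a \<odot>\<^bsub>W\<^esub> (\<Oplus>\<^bsub>W\<^esub>j\<in>{..<n}. \<phi> j (v j))" .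
  qed (use c in auto)
  fix j x assume jx: "j < n" "x \<in> carrier V"
  have "(\<Oplus>\<^bsub>W\<^esub>i\<in>{..<n}. \<phi> i (copower_inj n V j x i)) = (\<Oplus>\<^bsub>W\<^esub>i\<in>{..<n}. if j = i then \<phi> i x else \<zero>\<^bsub>W\<^esub>)"
    by (rule W.M.finsum_cong') (use jx mod_homD(1)[OF \<phi>] VW.hom_zero[OF \<phi>] in \<open>auto simp: copower_inj_def\<close>)
  also have "\<dots> = \<phi> j x" by (rule W.M.add.finprod_singleton) (use jx mod_homD(1)[OF \<phi>] in auto)
  finally show "(\<Oplus>\<^bsub>W\<^esub>i\<in>{..<n}. \<phi> i (copower_inj n V j x i)) = \<phi> j x" .
qed

lemma copower_fg:
  assumes V: "left_module A V" "finitely_generated_module A V"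
  shows "finitely_generated_module A (copower {..<n::nat} V)"
proof -
  let ?C = "copower {..<n} V"
  interpret V: left_module A V by fact
  interpret C: left_module A ?C by (rule copower_left_module[OF V(1)])
  interpret VC: module_pair A V ?C by (rule module_pair.intro[OF V(1) C.left_module_axioms])
  obtain G where G: "finite G" "G \<subseteq> carrier V" "span A V G = carrier V"
    using V(2) unfolding finitely_generated_module_def span_def by auto
  let ?G = "(\<Union>j<n. copower_inj n V j ` G)"
  have Gc: "?G \<subseteq> carrier ?C" using G(2) mod_homD(1)[OF V.copower_inj_hom] by blast
  have S: "submodule (span A ?C ?G) A ?C" by (rule C.span_submodule[OF Gc])
  have inS: "copower_inj n V j x \<in> span A ?C ?G" if "j < n" "x \<in> carrier V" for j x
  proof -
    have "span A V G \<subseteq> {x \<in> carrier V. copower_inj n V j x \<in> span A ?C ?G}"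
    proof (rule V.span_least[OF _ VC.hom_vimage_submodule[OF V.copower_inj_hom[OF that(1)] S]])
      show "G \<subseteq> {x \<in> carrier V. copower_inj n V j x \<in> span A ?C ?G}"
        using G(2) that(1) by (auto intro!: span_inc)
    qed
    then show ?thesis using that(2) G(3) by auto
  qed
  have "carrier ?C \<subseteq> span A ?C ?G"
  proof
    fix v assume v: "v \<in> carrier ?C"
    have "(\<Oplus>\<^bsub>?C\<^esub>j\<in>{..<n}. copower_inj n V j (v j)) \<in> span A ?C ?G"
      by (rule C.finsum_in_submodule[OF S]) (use v inS in \<open>auto simp: copower_carrier\<close>)
    then show "v \<in> span A ?C ?G" using V.copower_decomp[OF v] by simp
  qed
  then have "span A ?C ?G = carrier ?C" using C.submodD(1)[OF S] by simp
  then show ?thesis unfolding finitely_generated_module_def span_def[symmetric]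
    using G(1) Gc by (intro exI[of _ ?G]) simp
qed

section \<open>The trace ideal\<close>

text \<open>
  This ideal is all of \<open>R\<close> exactly if \<open>M\<close> is a generator; in general it measures the failure.
\<close>

definition trace_ideal :: "('a, 'r) ring_scheme \<Rightarrow> ('a, 'm, 'x) module_scheme \<Rightarrow> 'a set" where
  "trace_ideal R M = Idl\<^bsub>R\<^esub> {g x |g x. g \<in> mod_hom R M (regular_module R) \<and> x \<in> carrier M}"

locale fraction_setup = R?: cring R + M?: left_module R M
  for R :: "('a, 'r) ring_scheme" (structure) and M :: "('a, 'm, 'x) module_scheme" (structure) +
  fixes S :: "'a set"
  assumes S_sub: "S \<subseteq> carrier R" and S_one: "\<one> \<in> S" and S_mult: "s \<in> S \<Longrightarrow> t \<in> S \<Longrightarrow> s \<otimes> t \<in> S"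
begin

lemma S_carrier [simp]: "s \<in> S \<Longrightarrow> s \<in> carrier R" using S_sub by auto

lemma frac_rel_iff: "((m, s), (n, t)) \<in> frac_rel R S M \<longleftrightarrow>
   m \<in> carrier M \<and> s \<in> S \<and> n \<in> carrier M \<and> t \<in> S \<and> (\<exists>u\<in>S. (u \<otimes> t) \<odot>\<^bsub>M\<^esub> m = (u \<otimes> s) \<odot>\<^bsub>M\<^esub> n)"
  unfolding frac_rel_def using smult_assoc1 by (auto cong: conj_cong)

lemma frac_equiv: "equiv (carrier M \<times> S) (frac_rel R S M)"
proof (rule equivI)
  show "frac_rel R S M \<subseteq> (carrier M \<times> S) \<times> (carrier M \<times> S)" unfolding frac_rel_def by auto
  show "refl_on (carrier M \<times> S) (frac_rel R S M)"
    by (rule refl_onI) (auto simp: frac_rel_iff intro: bexI[OF _ S_one])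
  show "sym (frac_rel R S M)"
    by (rule symI) (auto simp: frac_rel_iff, metis)
  show "trans (frac_rel R S M)"
  proof (rule transI)
    fix x y z assume xy: "(x, y) \<in> frac_rel R S M" and yz: "(y, z) \<in> frac_rel R S M"
    obtain m s n t k w where e: "x = (m, s)" "y = (n, t)" "z = (k, w)" by (metis surj_pair)
    obtain u where u: "m \<in> carrier M" "s \<in> S" "n \<in> carrier M" "t \<in> S" "u \<in> S" "(u \<otimes> t) \<odot>\<^bsub>M\<^esub> m = (u \<otimes> s) \<odot>\<^bsub>M\<^esub> n"
      using xy unfolding e frac_rel_iff by blast
    obtain v where v: "k \<in> carrier M" "w \<in> S" "v \<in> S" "(v \<otimes> w) \<odot>\<^bsub>M\<^esub> n = (v \<otimes> t) \<odot>\<^bsub>M\<^esub> k"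
      using yz unfolding e frac_rel_iff by blast
    have "(((u \<otimes> v) \<otimes> t) \<otimes> w) \<odot>\<^bsub>M\<^esub> m = (v \<otimes> w) \<odot>\<^bsub>M\<^esub> ((u \<otimes> t) \<odot>\<^bsub>M\<^esub> m)"
      using u(1-5) v(1-3) by (simp add: smult_assoc1[symmetric] m_ac)
    also have "\<dots> = (v \<otimes> w) \<odot>\<^bsub>M\<^esub> ((u \<otimes> s) \<odot>\<^bsub>M\<^esub> n)" unfolding u(6) ..
    also have "\<dots> = (u \<otimes> s) \<odot>\<^bsub>M\<^esub> ((v \<otimes> w) \<odot>\<^bsub>M\<^esub> n)"
      using u(1-5) v(1-3) by (simp add: smult_assoc1[symmetric] m_ac)
    also have "\<dots> = (u \<otimes> s) \<odot>\<^bsub>M\<^esub> ((v \<otimes> t) \<odot>\<^bsub>M\<^esub> k)" unfolding v(4) ..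
    also have "\<dots> = (((u \<otimes> v) \<otimes> t) \<otimes> s) \<odot>\<^bsub>M\<^esub> k"
      using u(1-5) v(1-3) by (simp add: smult_assoc1[symmetric] m_ac)
    finally have "(((u \<otimes> v) \<otimes> t) \<otimes> w) \<odot>\<^bsub>M\<^esub> m = (((u \<otimes> v) \<otimes> t) \<otimes> s) \<odot>\<^bsub>M\<^esub> k" .
    then show "(x, z) \<in> frac_rel R S M" unfolding e frac_rel_iff using u v S_mult by blast
  qed
qed

lemma fraction_eq_iff:
  assumes "m \<in> carrier M" "s \<in> S" "n \<in> carrier M" "t \<in> S"
  shows "fraction R S M m s = fraction R S M n t \<longleftrightarrow> ((m, s), (n, t)) \<in> frac_rel R S M"
  unfolding fraction_def using eq_equiv_class_iff[OF frac_equiv, of "(m, s)" "(n, t)"] assms by simp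

lemma mem_fraction: "(n, t) \<in> fraction R S M m s \<longleftrightarrow> ((m, s), (n, t)) \<in> frac_rel R S M"
  by (simp add: fraction_def)

lemma fraction_self: "m \<in> carrier M \<Longrightarrow> s \<in> S \<Longrightarrow> (m, s) \<in> fraction R S M m s"
  unfolding mem_fraction frac_rel_iff using S_one by auto

lemma fraction_carrier: "m \<in> carrier M \<Longrightarrow> s \<in> S \<Longrightarrow> fraction R S M m s \<in> carrier (localize_module R S M)"
  by (simp add: localize_module_def fraction_def quotientI)

lemma fraction_ex:
  assumes "U \<in> carrier (localize_module R S M)"
  obtains m s where "m \<in> carrier M" "s \<in> S" "U = fraction R S M m s"
  using assms by (auto simp: localize_module_def fraction_def elim!: quotientE)

text \<open>
  The operations on fractions are defined as unions over representatives; well-definedness says that all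
  sets in such a union are equal.
\<close>

lemma UN_const: "\<lbrakk>x \<in> U; y \<in> V; \<And>a s b t. (a, s) \<in> U \<Longrightarrow> (b, t) \<in> V \<Longrightarrow> f a s b t = c\<rbrakk> \<Longrightarrow>
    (\<Union>(a, s)\<in>U. \<Union>(b, t)\<in>V. f a s b t) = c"
  by (auto split: prod.splits) (metis surj_pair)

lemma fraction_add:
  assumes m: "m \<in> carrier M" "s \<in> S" "n \<in> carrier M" "t \<in> S"
  shows "fraction R S M m s \<oplus>\<^bsub>localize_module R S M\<^esub> fraction R S M n t
    = fraction R S M (t \<odot>\<^bsub>M\<^esub> m \<oplus>\<^bsub>M\<^esub> s \<odot>\<^bsub>M\<^esub> n) (s \<otimes> t)"
proof -
  have "fraction R S M (t' \<odot>\<^bsub>M\<^esub> m' \<oplus>\<^bsub>M\<^esub> s' \<odot>\<^bsub>M\<^esub> n') (s' \<otimes> t') = fraction R S M (t \<odot>\<^bsub>M\<^esub> m \<oplus>\<^bsub>M\<^esub> s \<odot>\<^bsub>M\<^esub> n) (s \<otimes> t)"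
    if h: "(m', s') \<in> fraction R S M m s" "(n', t') \<in> fraction R S M n t" for m' s' n' t'
  proof -
    obtain u where u: "m' \<in> carrier M" "s' \<in> S" "u \<in> S" "(u \<otimes> s') \<odot>\<^bsub>M\<^esub> m = (u \<otimes> s) \<odot>\<^bsub>M\<^esub> m'"
      using h(1) unfolding mem_fraction frac_rel_iff by blast
    obtain v where v: "n' \<in> carrier M" "t' \<in> S" "v \<in> S" "(v \<otimes> t') \<odot>\<^bsub>M\<^esub> n = (v \<otimes> t) \<odot>\<^bsub>M\<^esub> n'"
      using h(2) unfolding mem_fraction frac_rel_iff by blast
    have "((u \<otimes> v) \<otimes> (s \<otimes> t)) \<odot>\<^bsub>M\<^esub> (t' \<odot>\<^bsub>M\<^esub> m' \<oplus>\<^bsub>M\<^esub> s' \<odot>\<^bsub>M\<^esub> n')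
       = (v \<otimes> t \<otimes> t') \<odot>\<^bsub>M\<^esub> ((u \<otimes> s) \<odot>\<^bsub>M\<^esub> m') \<oplus>\<^bsub>M\<^esub> (u \<otimes> s \<otimes> s') \<odot>\<^bsub>M\<^esub> ((v \<otimes> t) \<odot>\<^bsub>M\<^esub> n')"
      using u(1-3) v(1-3) m by (simp add: smult_r_distr smult_assoc1[symmetric] m_ac)
    also have "\<dots> = (v \<otimes> t \<otimes> t') \<odot>\<^bsub>M\<^esub> ((u \<otimes> s') \<odot>\<^bsub>M\<^esub> m) \<oplus>\<^bsub>M\<^esub> (u \<otimes> s \<otimes> s') \<odot>\<^bsub>M\<^esub> ((v \<otimes> t') \<odot>\<^bsub>M\<^esub> n)"
      unfolding u(4) v(4) ..
    also have "\<dots> = ((u \<otimes> v) \<otimes> (s' \<otimes> t')) \<odot>\<^bsub>M\<^esub> (t \<odot>\<^bsub>M\<^esub> m \<oplus>\<^bsub>M\<^esub> s \<odot>\<^bsub>M\<^esub> n)"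
      using u(1-3) v(1-3) m by (simp add: smult_r_distr smult_assoc1[symmetric] m_ac)
    finally have "\<exists>w\<in>S. (w \<otimes> (s \<otimes> t)) \<odot>\<^bsub>M\<^esub> (t' \<odot>\<^bsub>M\<^esub> m' \<oplus>\<^bsub>M\<^esub> s' \<odot>\<^bsub>M\<^esub> n') = (w \<otimes> (s' \<otimes> t')) \<odot>\<^bsub>M\<^esub> (t \<odot>\<^bsub>M\<^esub> m \<oplus>\<^bsub>M\<^esub> s \<odot>\<^bsub>M\<^esub> n)"
      using S_mult[OF u(3) v(3)] by blast
    then show ?thesis using u v m S_mult by (subst fraction_eq_iff) (simp_all add: frac_rel_iff)
  qed
  then show ?thesis unfolding localize_module_def
    by (simp, intro UN_const[OF fraction_self[OF m(1,2)] fraction_self[OF m(3,4)]])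
qed

lemma fraction_smult:
  assumes m: "a \<in> carrier R" "s \<in> S" "n \<in> carrier M" "t \<in> S"
  shows "fraction R S (regular_module R) a s \<odot>\<^bsub>localize_module R S M\<^esub> fraction R S M n t
    = fraction R S M (a \<odot>\<^bsub>M\<^esub> n) (s \<otimes> t)"
proof -
  interpret Q: fraction_setup R "regular_module R" S
    by (intro fraction_setup.intro fraction_setup_axioms.intro regular_left_module) (use ring_axioms is_cring S_sub S_one S_mult in auto)
  have sel: "carrier (regular_module R) = carrier R" "smult (regular_module R) = monoid.mult R"
    by (auto simp: regular_module_def fun_eq_iff)
  have "fraction R S M (a' \<odot>\<^bsub>M\<^esub> n') (s' \<otimes> t') = fraction R S M (a \<odot>\<^bsub>M\<^esub> n) (s \<otimes> t)"
    if h: "(a', s') \<in> fraction R S (regular_module R) a s" "(n', t') \<in> fraction R S M n t" for a' s' n' t'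
  proof -
    obtain u where u: "a' \<in> carrier R" "s' \<in> S" "u \<in> S" "(u \<otimes> s') \<otimes> a = (u \<otimes> s) \<otimes> a'"
      using h(1) unfolding Q.mem_fraction Q.frac_rel_iff sel by blast
    obtain v where v: "n' \<in> carrier M" "t' \<in> S" "v \<in> S" "(v \<otimes> t') \<odot>\<^bsub>M\<^esub> n = (v \<otimes> t) \<odot>\<^bsub>M\<^esub> n'"
      using h(2) unfolding mem_fraction frac_rel_iff by blast
    have "((u \<otimes> v) \<otimes> (s \<otimes> t)) \<odot>\<^bsub>M\<^esub> (a' \<odot>\<^bsub>M\<^esub> n') = ((u \<otimes> s) \<otimes> a') \<odot>\<^bsub>M\<^esub> ((v \<otimes> t) \<odot>\<^bsub>M\<^esub> n')"
      using u(1-3) v(1-3) m by (simp add: smult_assoc1[symmetric] m_ac)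
    also have "\<dots> = ((u \<otimes> s') \<otimes> a) \<odot>\<^bsub>M\<^esub> ((v \<otimes> t') \<odot>\<^bsub>M\<^esub> n)" using u(4) v(4) by simp
    also have "\<dots> = ((u \<otimes> v) \<otimes> (s' \<otimes> t')) \<odot>\<^bsub>M\<^esub> (a \<odot>\<^bsub>M\<^esub> n)"
      using u(1-3) v(1-3) m by (simp add: smult_assoc1[symmetric] m_ac)
    finally have "\<exists>w\<in>S. (w \<otimes> (s \<otimes> t)) \<odot>\<^bsub>M\<^esub> (a' \<odot>\<^bsub>M\<^esub> n') = (w \<otimes> (s' \<otimes> t')) \<odot>\<^bsub>M\<^esub> (a \<odot>\<^bsub>M\<^esub> n)"
      using S_mult[OF u(3) v(3)] by blast
    then show ?thesis using u v m S_mult by (subst fraction_eq_iff) (simp_all add: frac_rel_iff)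
  qed
  then show ?thesis unfolding localize_module_def using Q.fraction_self[of a s] m sel
    by (simp, intro UN_const[OF _ fraction_self[OF m(3,4)]]) auto
qed

lemma common_multiple:
  assumes "finite T" "T \<subseteq> S" shows "\<exists>s\<in>S. \<forall>t\<in>T. \<exists>r\<in>carrier R. s = r \<otimes> t"
  using assms
proof (induct set: finite)
  case empty then show ?case using S_one by auto
next
  case (insert t T)
  then obtain s where s: "s \<in> S" "\<forall>t\<in>T. \<exists>r\<in>carrier R. s = r \<otimes> t" by auto
  have t: "t \<in> S" using insert by auto
  have "\<exists>r\<in>carrier R. s \<otimes> t = r \<otimes> t'" if t': "t' \<in> insert t T" for t'
  proof (cases "t' = t")
    case True then show ?thesis using s by auto
  next
    case False
    then obtain r where r: "r \<in> carrier R" "s = r \<otimes> t'" using s(2) t' by auto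
    have "t' \<in> carrier R" using t' insert by auto
    then have "s \<otimes> t = (r \<otimes> t) \<otimes> t'" using r t by (simp add: m_ac)
    then show ?thesis using r t by auto
  qed
  then show ?case using S_mult[OF s(1) t] by blast
qed

end

text \<open>
  A surjection from a power of \<open>M\<^sub>p\<close> onto \<open>R\<^sub>p\<close> takes the value \<open>1\<close>, hence a unit value at the image
  of some \<open>v\<close> in \<open>M\<^sup>n\<close>. Its values on \<open>M\<^sup>n\<close> have a common denominator \<open>T\<close>, and the numerators are unique
  up to the ideal \<open>c\<close> of elements killed by something outside \<open>p\<close>. As \<open>c\<close> is finitely generated, one
  element \<open>u0\<close> outside \<open>p\<close> kills it, so multiplying the numerators by \<open>u0\<close> gives a homomorphism
  \<open>g\<close> from \<open>M\<^sup>n\<close> to \<open>R\<close>. Then \<open>g v\<close> lies in the trace ideal but not in \<open>p\<close>.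
\<close>

lemma trace_ideal_not_below:
  fixes R :: "('a, 'r) ring_scheme" (structure) and M :: "('a, 'm, 'x) module_scheme"
  assumes R: "cring R" "noetherian_ring R" and M: "left_module R M" "finitely_generated_module R M"
    and p: "p \<in> Spec R" and gen: "generator_at R M p"
  shows "\<not> trace_ideal R M \<subseteq> p"
proof
  assume below: "trace_ideal R M \<subseteq> p"
  define S where "S = carrier R - p"
  have pp: "primeideal p R" using p by (simp add: Spec_def)
  interpret p: primeideal p R by (rule pp)
  interpret N: noetherian_ring R by fact
  interpret M: left_module R M by fact
  have one: "\<one> \<notin> p" using p.I_notcarr p.one_imp_carrier by auto
  interpret FM: fraction_setup R M S
    by (intro fraction_setup.intro fraction_setup_axioms.intro) (use R M one p.I_prime in \<open>auto simp: S_def\<close>)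
  let ?RR = "regular_module R"
  have RR: "left_module R ?RR" by (rule regular_left_module) (rule p.ring_axioms)
  interpret FR: fraction_setup R ?RR S
    by (intro fraction_setup.intro fraction_setup_axioms.intro RR) (use R FM.S_sub FM.S_one FM.S_mult in auto)
  have sel: "carrier ?RR = carrier R" "smult ?RR = monoid.mult R" "ring.add ?RR = ring.add R" "ring.zero ?RR = \<zero>"
    by (auto simp: regular_module_def fun_eq_iff)
  let ?L = "localize_ring R S" and ?LM = "localize_module R S M"
  have Lc: "carrier ?L = (carrier R \<times> S) // frac_rel R S ?RR" by (simp add: localize_ring_def)
  have Lone: "\<one>\<^bsub>?L\<^esub> = fraction R S ?RR \<one> \<one>" by (simp add: localize_ring_def)
  have Lfrac: "fraction R S ?RR a s \<in> carrier ?L" if "a \<in> carrier R" "s \<in> S" for a s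
    using that unfolding Lc fraction_def by (intro quotientI) auto
  from gen[unfolded generator_at_def is_generator_def, folded S_def]
  obtain n :: nat and f where f: "f \<in> mod_hom ?L (copower {..<n} ?LM) (regular_module ?L)"
    "f ` carrier (copower {..<n} ?LM) = carrier ?L" by (elim exE bexE)
  note fD = mod_homD[OF f(1)]
  have selL: "carrier (regular_module ?L) = carrier ?L" "smult (regular_module ?L) = monoid.mult ?L"
    "ring.add (regular_module ?L) = ring.add ?L"
    by (auto simp: regular_module_def fun_eq_iff)
  let ?C = "copower {..<n} M"
  have C: "left_module R ?C" by (rule copower_left_module[OF M(1)])
  interpret C: left_module R ?C by fact
  interpret CR: module_pair R ?C ?RR by (rule module_pair.intro[OF C RR])
  define \<theta> where "\<theta> y = (\<lambda>i\<in>{..<n}. fraction R S M (y i) \<one>)" for y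
  have yc: "y i \<in> carrier M" if "y \<in> carrier ?C" "i < n" for y i using that by (auto simp: copower_carrier)
  have \<theta>c: "\<theta> y \<in> carrier (copower {..<n} ?LM)" if "y \<in> carrier ?C" for y
    unfolding \<theta>_def copower_carrier using yc[OF that] FM.fraction_carrier[OF _ FM.S_one] by auto
  have \<theta>_add: "\<theta> (y \<oplus>\<^bsub>?C\<^esub> y') = \<theta> y \<oplus>\<^bsub>copower {..<n} ?LM\<^esub> \<theta> y'" if "y \<in> carrier ?C" "y' \<in> carrier ?C" for y y'
    unfolding \<theta>_def copower_simps
    by (rule restrict_ext) (use yc[OF that(1)] yc[OF that(2)] FM.fraction_add[OF _ FM.S_one _ FM.S_one] in simp)
  have \<theta>_smult: "\<theta> (r \<odot>\<^bsub>?C\<^esub> y) = fraction R S ?RR r \<one> \<odot>\<^bsub>copower {..<n} ?LM\<^esub> \<theta> y" if "y \<in> carrier ?C" "r \<in> carrier R" for r y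
    unfolding \<theta>_def copower_simps
    by (rule restrict_ext) (use yc[OF that(1)] FM.fraction_smult[OF that(2) FM.S_one _ FM.S_one] in simp)
  \<comment> \<open>The fraction \<open>a/t\<close> is the image of \<open>y\<close>.\<close>
  define P where "P y a t \<longleftrightarrow> y \<in> carrier ?C \<and> a \<in> carrier R \<and> t \<in> S \<and> (a, t) \<in> f (\<theta> y)" for y a t
  have fL: "f (\<theta> y) \<in> carrier ?L" if "y \<in> carrier ?C" for y using fD(1)[OF \<theta>c[OF that]] selL by simp
  have eqv: "equiv (carrier R \<times> S) (frac_rel R S ?RR)" using FR.frac_equiv sel by simp
  have P_ex: "\<exists>a t. P y a t" if y: "y \<in> carrier ?C" for y
  proof -
    have "f (\<theta> y) \<in> (carrier R \<times> S) // frac_rel R S ?RR" using fL[OF y] Lc by simp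
    then have "f (\<theta> y) \<noteq> {}" "f (\<theta> y) \<subseteq> carrier R \<times> S"
      using in_quotient_imp_non_empty[OF eqv] in_quotient_imp_subset[OF eqv] by blast+
    then show ?thesis unfolding P_def using y by auto
  qed
  have P_rel: "\<exists>u\<in>S. (u \<otimes> t') \<otimes> a = (u \<otimes> t) \<otimes> a'" if h: "P y a t" "P y a' t'" for y a t a' t'
  proof -
    have "f (\<theta> y) \<in> (carrier R \<times> S) // frac_rel R S ?RR" using fL h Lc by (simp add: P_def)
    then have "((a, t), (a', t')) \<in> frac_rel R S ?RR"
      using in_quotient_imp_in_rel[OF eqv] h unfolding P_def by blast
    then show ?thesis unfolding FR.frac_rel_iff sel by blast
  qed
  have P_conv: "P y a' t'" if h: "P y a t" "a' \<in> carrier R" "t' \<in> S" "u \<in> S" "(u \<otimes> t') \<otimes> a = (u \<otimes> t) \<otimes> a'" for y a t a' t' u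
  proof -
    have "f (\<theta> y) \<in> (carrier R \<times> S) // frac_rel R S ?RR" using fL h Lc by (simp add: P_def)
    moreover have "((a, t), (a', t')) \<in> frac_rel R S ?RR"
      unfolding FR.frac_rel_iff sel using h unfolding P_def by blast
    ultimately have "(a', t') \<in> f (\<theta> y)" using in_quotient_imp_closed[OF eqv] h unfolding P_def by blast
    then show ?thesis using h by (simp add: P_def)
  qed
  have P_add: "P (y \<oplus>\<^bsub>?C\<^esub> y') (t' \<otimes> a \<oplus> t \<otimes> a') (t \<otimes> t')" if h: "P y a t" "P y' a' t'" for y a t y' a' t'
  proof -
    have hc: "y \<in> carrier ?C" "y' \<in> carrier ?C" "a \<in> carrier R" "a' \<in> carrier R" "t \<in> S" "t' \<in> S"
      "(a, t) \<in> f (\<theta> y)" "(a', t') \<in> f (\<theta> y')" using h by (auto simp: P_def)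
    have "f (\<theta> (y \<oplus>\<^bsub>?C\<^esub> y')) = f (\<theta> y) \<oplus>\<^bsub>?L\<^esub> f (\<theta> y')"
      unfolding \<theta>_add[OF hc(1,2)] using fD(2)[OF \<theta>c[OF hc(1)] \<theta>c[OF hc(2)]] selL by simp
    moreover have "(t' \<otimes> a \<oplus> t \<otimes> a', t \<otimes> t') \<in> fraction R S ?RR (t' \<otimes> a \<oplus> t \<otimes> a') (t \<otimes> t')"
      by (rule FR.fraction_self) (use hc FM.S_mult sel in auto)
    ultimately have "(t' \<otimes> a \<oplus> t \<otimes> a', t \<otimes> t') \<in> f (\<theta> (y \<oplus>\<^bsub>?C\<^esub> y'))"
      using hc(7,8) by (auto simp: localize_ring_def)
    then show ?thesis using hc FM.S_mult C.M.a_closed by (simp add: P_def)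
  qed
  have P_smult: "P (r \<odot>\<^bsub>?C\<^esub> y) (r \<otimes> a) t" if h: "r \<in> carrier R" "P y a t" for r y a t
  proof -
    have hc: "y \<in> carrier ?C" "a \<in> carrier R" "t \<in> S" "(a, t) \<in> f (\<theta> y)" using h by (auto simp: P_def)
    have "f (\<theta> (r \<odot>\<^bsub>?C\<^esub> y)) = fraction R S ?RR r \<one> \<otimes>\<^bsub>?L\<^esub> f (\<theta> y)"
      unfolding \<theta>_smult[OF hc(1) h(1)] using fD(3)[OF Lfrac[OF h(1) FM.S_one] \<theta>c[OF hc(1)]] selL by simp
    moreover have "(r \<otimes> a, \<one> \<otimes> t) \<in> fraction R S ?RR (r \<otimes> a) (\<one> \<otimes> t)"
      by (rule FR.fraction_self) (use hc h(1) FM.S_mult FM.S_one sel in auto)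
    moreover have "(r, \<one>) \<in> fraction R S ?RR r \<one>"
      by (rule FR.fraction_self) (use h(1) FM.S_one sel in auto)
    ultimately have "(r \<otimes> a, \<one> \<otimes> t) \<in> f (\<theta> (r \<odot>\<^bsub>?C\<^esub> y))"
      using hc(4) by (auto simp: localize_ring_def)
    then show ?thesis using hc h(1) by (simp add: P_def)
  qed
  have P_scale: "P y (r \<otimes> a) (r \<otimes> t)" if h: "P y a t" "r \<in> carrier R" "r \<otimes> t \<in> S" for y a t r
    by (rule P_conv[OF h(1) _ h(3) FM.S_one]) (use h in \<open>auto simp: P_def p.m_ac\<close>)
  have "\<one>\<^bsub>?L\<^esub> \<in> f ` carrier (copower {..<n} ?LM)" unfolding f(2) Lone using Lfrac FM.S_one by simp
  then obtain w where w: "w \<in> carrier (copower {..<n} ?LM)" "f w = \<one>\<^bsub>?L\<^esub>" by force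
  have "\<forall>i\<in>{..<n}. \<exists>m s. m \<in> carrier M \<and> s \<in> S \<and> w i = fraction R S M m s"
    using w(1) FM.fraction_ex unfolding copower_carrier by (metis PiE_mem)
  then obtain m s where ms: "\<And>i. i < n \<Longrightarrow> m i \<in> carrier M \<and> s i \<in> S \<and> w i = fraction R S M (m i) (s i)"
    by (metis lessThan_iff)
  obtain \<sigma> where \<sigma>: "\<sigma> \<in> S" "\<forall>t\<in>s ` {..<n}. \<exists>r\<in>carrier R. \<sigma> = r \<otimes> t"
    using FM.common_multiple[of "s ` {..<n}"] ms by auto
  then have "\<forall>i\<in>{..<n}. \<exists>r. r \<in> carrier R \<and> \<sigma> = r \<otimes> s i" by auto
  from bchoice[OF this] obtain r where r: "\<And>i. i < n \<Longrightarrow> r i \<in> carrier R \<and> \<sigma> = r i \<otimes> s i" by auto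
  define v where "v = (\<lambda>i\<in>{..<n}. r i \<odot>\<^bsub>M\<^esub> m i)"
  have v: "v \<in> carrier ?C" unfolding v_def copower_carrier using r ms by auto
  have \<theta>v: "\<theta> v = fraction R S ?RR \<sigma> \<one> \<odot>\<^bsub>copower {..<n} ?LM\<^esub> w"
    unfolding \<theta>_def copower_simps
  proof (rule restrict_ext)
    fix i assume "i \<in> {..<n}"
    then have i: "i < n" by simp
    have h: "m i \<in> carrier M" "s i \<in> S" "r i \<in> carrier R" "\<sigma> = r i \<otimes> s i" "\<sigma> \<in> carrier R" using ms[OF i] r[OF i] \<sigma>(1) by auto
    have "fraction R S ?RR \<sigma> \<one> \<odot>\<^bsub>?LM\<^esub> w i = fraction R S M (\<sigma> \<odot>\<^bsub>M\<^esub> m i) (\<one> \<otimes> s i)"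
      using FM.fraction_smult[OF h(5) FM.S_one h(1,2)] ms[OF i] by simp
    also have "\<dots> = fraction R S M (v i) \<one>"
    proof (subst FM.fraction_eq_iff)
      show "((\<sigma> \<odot>\<^bsub>M\<^esub> m i, \<one> \<otimes> s i), (v i, \<one>)) \<in> frac_rel R S M"
        unfolding FM.frac_rel_iff
      proof (intro conjI bexI[OF _ FM.S_one])
        have "(s i \<otimes> r i) = \<sigma>" using h p.m_comm by (metis FM.S_carrier)
        then show "(\<one> \<otimes> \<one>) \<odot>\<^bsub>M\<^esub> (\<sigma> \<odot>\<^bsub>M\<^esub> m i) = (\<one> \<otimes> (\<one> \<otimes> s i)) \<odot>\<^bsub>M\<^esub> v i"
          using h i M.smult_assoc1[of "s i" "r i" "m i"] by (simp add: v_def)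
      qed (use h i FM.S_one in \<open>auto simp: v_def\<close>)
    qed (use h i FM.S_one in \<open>auto simp: v_def\<close>)
    finally show "fraction R S M (v i) \<one> = fraction R S ?RR \<sigma> \<one> \<odot>\<^bsub>?LM\<^esub> w i" by simp
  qed
  have "P v \<sigma> \<one>"
  proof -
    have "f (\<theta> v) = fraction R S ?RR \<sigma> \<one> \<otimes>\<^bsub>?L\<^esub> \<one>\<^bsub>?L\<^esub>"
      unfolding \<theta>v using fD(3)[OF Lfrac[OF _ FM.S_one] w(1), of \<sigma>] \<sigma>(1) w(2) selL by simp
    moreover have "(\<sigma> \<otimes> \<one>, \<one> \<otimes> \<one>) \<in> fraction R S ?RR (\<sigma> \<otimes> \<one>) (\<one> \<otimes> \<one>)"
      by (rule FR.fraction_self) (use \<sigma> FM.S_mult FM.S_one sel in auto)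
    moreover have "(\<sigma>, \<one>) \<in> fraction R S ?RR \<sigma> \<one>" "(\<one>, \<one>) \<in> fraction R S ?RR \<one> \<one>"
      by (rule FR.fraction_self, use \<sigma> FM.S_one sel in auto)+
    ultimately have "(\<sigma> \<otimes> \<one>, \<one> \<otimes> \<one>) \<in> f (\<theta> v)" unfolding Lone
      by (simp add: localize_ring_def, intro bexI[of _ "(\<sigma>, \<one>)"]) (auto intro: bexI[of _ "(\<one>, \<one>)"])
    then show ?thesis using \<sigma>(1) FM.S_one v by (simp add: P_def)
  qed
  obtain Y where Y: "finite Y" "Y \<subseteq> carrier ?C" "span R ?C Y = carrier ?C"
    using copower_fg[OF M, of n] unfolding finitely_generated_module_def span_def by auto
  have "\<forall>y\<in>carrier ?C. \<exists>q. P y (fst q) (snd q)" using P_ex by simp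
  from bchoice[OF this] obtain q where "\<forall>y\<in>carrier ?C. P y (fst (q y)) (snd (q y))" ..
  then obtain a t where at: "\<And>y. y \<in> carrier ?C \<Longrightarrow> P y (a y) (t y)"
    using that[of "\<lambda>y. fst (q y)" "\<lambda>y. snd (q y)"] by simp
  obtain T where T: "T \<in> S" "\<forall>s\<in>t ` Y. \<exists>r\<in>carrier R. T = r \<otimes> s"
  proof -
    have "t ` Y \<subseteq> S" using at Y(2) by (auto simp: P_def)
    then show thesis using FM.common_multiple[of "t ` Y"] Y(1) that by blast
  qed
  have Tc: "T \<in> carrier R" using T(1) by simp
  let ?D = "{y \<in> carrier ?C. \<exists>b. P y b T}"
  have P0: "P \<zero>\<^bsub>?C\<^esub> \<zero> T"
  proof -
    have "P (\<zero> \<odot>\<^bsub>?C\<^esub> v) (\<zero> \<otimes> \<sigma>) \<one>" by (rule P_smult) (use \<open>P v \<sigma> \<one>\<close> in auto)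
    then have "P \<zero>\<^bsub>?C\<^esub> \<zero> \<one>" using v \<sigma>(1) by simp
    then show ?thesis by (rule P_conv[OF _ _ T(1) FM.S_one]) (use Tc in auto)
  qed
  have PT_add: "P (y \<oplus>\<^bsub>?C\<^esub> y') (b \<oplus> b') T" if h: "P y b T" "P y' b' T" for y y' b b'
  proof -
    have bc: "b \<in> carrier R" "b' \<in> carrier R" using h by (auto simp: P_def)
    show ?thesis
    proof (rule P_conv[OF P_add[OF h] _ T(1) FM.S_one])
      show "(\<one> \<otimes> T) \<otimes> (T \<otimes> b \<oplus> T \<otimes> b') = (\<one> \<otimes> (T \<otimes> T)) \<otimes> (b \<oplus> b')"
        using bc Tc by (simp add: p.r_distr p.m_assoc)
    qed (use bc in simp)
  qed
  have "?D = carrier ?C"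
  proof -
    have D: "submodule ?D R ?C"
    proof (rule C.submodI)
      show "\<zero>\<^bsub>?C\<^esub> \<in> ?D" using P0 by auto
      show "y \<oplus>\<^bsub>?C\<^esub> y' \<in> ?D" if "y \<in> ?D" "y' \<in> ?D" for y y' using that PT_add by blast
      show "r \<odot>\<^bsub>?C\<^esub> y \<in> ?D" if "r \<in> carrier R" "y \<in> ?D" for r y using that P_smult by blast
    qed auto
    have "Y \<subseteq> ?D"
    proof
      fix y assume y: "y \<in> Y"
      obtain r where r: "r \<in> carrier R" "T = r \<otimes> t y" using T(2) y by auto
      have "P y (r \<otimes> a y) (r \<otimes> t y)" by (rule P_scale) (use at y Y(2) r T(1) in auto)
      then show "y \<in> ?D" using r(2) y Y(2) by auto
    qed
    then show ?thesis using C.span_least[OF _ D] Y(3) by auto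
  qed
  then have PT_ex: "\<exists>b. P y b T" if "y \<in> carrier ?C" for y using that by blast
  define c where "c = {b \<in> carrier R. \<exists>u\<in>S. u \<otimes> b = \<zero>}"
  have c: "ideal c R"
  proof (rule p.ring_idealI)
    show "\<zero> \<in> c" unfolding c_def using FM.S_one by auto
    fix x y assume "x \<in> c" "y \<in> c"
    then obtain u w where uw: "u \<in> S" "w \<in> S" "u \<otimes> x = \<zero>" "w \<otimes> y = \<zero>" "x \<in> carrier R" "y \<in> carrier R" unfolding c_def by blast
    have "(u \<otimes> w) \<otimes> (x \<oplus> y) = w \<otimes> (u \<otimes> x) \<oplus> u \<otimes> (w \<otimes> y)" using uw(1,2,5,6) by (simp add: p.r_distr p.m_ac)
    also have "\<dots> = \<zero>" using uw by simp
    finally show "x \<oplus> y \<in> c" unfolding c_def using uw FM.S_mult by blast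
  next
    fix r x assume rx: "r \<in> carrier R" "x \<in> c"
    then obtain u where u: "u \<in> S" "u \<otimes> x = \<zero>" "x \<in> carrier R" unfolding c_def by blast
    have "u \<otimes> (r \<otimes> x) = r \<otimes> (u \<otimes> x)" using u(1,3) rx(1) by (simp add: p.m_ac)
    then show "r \<otimes> x \<in> c" unfolding c_def using u rx by auto
  qed (auto simp: c_def)
  obtain u0 where u0: "u0 \<in> S" "\<And>b. b \<in> c \<Longrightarrow> u0 \<otimes> b = \<zero>"
  proof -
    obtain B where B: "B \<subseteq> carrier R" "finite B" "c = Idl B" using N.finetely_gen[OF c] by blast
    then have "B \<subseteq> c" using p.genideal_self by simp
    then have "\<forall>b\<in>B. \<exists>u. u \<in> S \<and> u \<otimes> b = \<zero>" unfolding c_def by blast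
    from bchoice[OF this] obtain u where u: "\<And>b. b \<in> B \<Longrightarrow> u b \<in> S \<and> u b \<otimes> b = \<zero>" by blast
    obtain u0 where u0: "u0 \<in> S" "\<forall>t\<in>u ` B. \<exists>r\<in>carrier R. u0 = r \<otimes> t"
      using FM.common_multiple[of "u ` B"] B(2) u by blast
    let ?I = "{b \<in> carrier R. u0 \<otimes> b = \<zero>}"
    have u0c: "u0 \<in> carrier R" using u0(1) by simp
    have "ideal ?I R"
      by (rule p.ring_idealI) (use u0c in \<open>auto simp: p.r_distr p.m_lcomm\<close>)
    moreover have "B \<subseteq> ?I"
    proof
      fix b assume b: "b \<in> B"
      obtain r where r: "r \<in> carrier R" "u0 = r \<otimes> u b" using u0(2) b by auto
      have "u0 \<otimes> b = r \<otimes> (u b \<otimes> b)" unfolding r(2) using r(1) u[OF b] b B(1) by (intro p.m_assoc) auto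
      then show "b \<in> ?I" using u[OF b] r(1) b B(1) by auto
    qed
    ultimately have "c \<subseteq> ?I" unfolding B(3) by (rule p.genideal_minimal)
    then show thesis using that[OF u0(1)] by blast
  qed
  have u0c: "u0 \<in> carrier R" using u0(1) by simp
  define \<Gamma> where "\<Gamma> y z \<longleftrightarrow> (\<exists>b. P y b T \<and> z = u0 \<otimes> b)" for y z
  obtain g where g: "g \<in> mod_hom R ?C ?RR" "\<And>y z. \<Gamma> y z \<Longrightarrow> g y = z"
  proof (rule CR.hom_of_relation[of \<Gamma>])
    show "\<exists>z. \<Gamma> y z" if "y \<in> carrier ?C" for y using PT_ex[OF that] unfolding \<Gamma>_def by blast
    show "y \<in> carrier ?C \<and> z \<in> carrier ?RR" if "\<Gamma> y z" for y z using that u0c unfolding \<Gamma>_def P_def sel by auto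
    show "\<Gamma> (y \<oplus>\<^bsub>?C\<^esub> y') (z \<oplus>\<^bsub>?RR\<^esub> z')" if yz: "\<Gamma> y z" "\<Gamma> y' z'" for y z y' z'
    proof -
      obtain b b' where b: "P y b T" "z = u0 \<otimes> b" "P y' b' T" "z' = u0 \<otimes> b'" using yz unfolding \<Gamma>_def by blast
      then have "z \<oplus> z' = u0 \<otimes> (b \<oplus> b')" using u0c by (simp add: P_def p.r_distr)
      then show ?thesis unfolding \<Gamma>_def sel using PT_add[OF b(1,3)] by blast
    qed
    show "\<Gamma> (r \<odot>\<^bsub>?C\<^esub> y) (r \<odot>\<^bsub>?RR\<^esub> z)" if r: "r \<in> carrier R" and yz: "\<Gamma> y z" for r y z
    proof -
      obtain b where b: "P y b T" "z = u0 \<otimes> b" using yz unfolding \<Gamma>_def by blast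
      then have "r \<otimes> z = u0 \<otimes> (r \<otimes> b)" using u0c r by (simp add: P_def p.m_lcomm)
      then show ?thesis unfolding \<Gamma>_def sel using P_smult[OF r b(1)] by blast
    qed
    show "z = \<zero>\<^bsub>?RR\<^esub>" if z: "\<Gamma> \<zero>\<^bsub>?C\<^esub> z" for z
    proof -
      obtain b where b: "P \<zero>\<^bsub>?C\<^esub> b T" "z = u0 \<otimes> b" using z unfolding \<Gamma>_def by blast
      obtain u where u: "u \<in> S" "(u \<otimes> T) \<otimes> b = (u \<otimes> T) \<otimes> \<zero>" using P_rel[OF b(1) P0] by blast
      then have "(u \<otimes> T) \<otimes> b = \<zero>" using Tc by simp
      then have "b \<in> c" unfolding c_def using FM.S_mult[OF u(1) T(1)] b(1) by (auto simp: P_def)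
      then show ?thesis using u0(2) b(2) sel by simp
    qed
  qed blast
  have "g v \<notin> p"
  proof
    assume gv: "g v \<in> p"
    obtain b where b: "P v b T" using PT_ex[OF v] by blast
    then have bc: "b \<in> carrier R" by (simp add: P_def)
    have "g v = u0 \<otimes> b" by (rule g(2)) (use b in \<open>auto simp: \<Gamma>_def\<close>)
    then have bp: "b \<in> p" using gv p.I_prime[OF u0c bc] u0(1) by (auto simp: S_def)
    obtain u where u: "u \<in> S" "(u \<otimes> \<one>) \<otimes> b = (u \<otimes> T) \<otimes> \<sigma>" using P_rel[OF b \<open>P v \<sigma> \<one>\<close>] by blast
    have "(u \<otimes> \<one>) \<otimes> b \<in> p" using p.I_l_closed[OF bp] u(1) FM.S_one by simp
    moreover have "(u \<otimes> T) \<otimes> \<sigma> \<in> S" using FM.S_mult u(1) T(1) \<sigma>(1) by blast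
    ultimately show False using u(2) by (simp add: S_def)
  qed
  moreover have "g v \<in> trace_ideal R M"
  proof -
    let ?E = "{g x |g x. g \<in> mod_hom R M ?RR \<and> x \<in> carrier M}"
    have Ec: "?E \<subseteq> carrier R" using mod_homD(1)[of _ R M ?RR] sel by auto
    have I: "ideal (trace_ideal R M) R" unfolding trace_ideal_def by (rule p.genideal_ideal[OF Ec])
    have IS: "submodule (trace_ideal R M) R ?RR" using I ideal_iff_submodule[OF R(1)] by simp
    have "g (copower_inj n M j (v j)) \<in> trace_ideal R M" if j: "j < n" for j
    proof -
      have "(\<lambda>x. g (copower_inj n M j x)) \<in> mod_hom R M ?RR" by (rule mod_hom_comp[OF M.copower_inj_hom[OF j] g(1)])
      then have "g (copower_inj n M j (v j)) \<in> ?E" using yc[OF v j]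
        by (intro CollectI exI[of _ "\<lambda>x. g (copower_inj n M j x)"] exI[of _ "v j"]) simp
      then show ?thesis unfolding trace_ideal_def using p.genideal_self[OF Ec] by blast
    qed
    then have "(\<Oplus>\<^bsub>?RR\<^esub>j\<in>{..<n}. g (copower_inj n M j (v j))) \<in> trace_ideal R M"
      by (intro left_module.finsum_in_submodule[OF RR IS]) auto
    moreover have "(\<lambda>j. copower_inj n M j (v j)) \<in> {..<n} \<rightarrow> carrier ?C"
      using mod_homD(1)[OF M.copower_inj_hom] yc[OF v] by auto
    ultimately show ?thesis
      using CR.hom_finsum[OF g(1) finite_lessThan, of "\<lambda>j. copower_inj n M j (v j)" n] M.copower_decomp[OF v] by simp
  qed
  ultimately show False using below by blast
qed

section \<open>Lifting along surjections\<close>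

lemma copower_finsum_hom:
  fixes B :: "('a, 'b, 'x) module_scheme" and I :: "'i set"
  assumes A: "ring A" and B: "left_module A B" and b: "\<And>i. i \<in> I \<Longrightarrow> b i \<in> carrier B"
  shows "(\<lambda>v. \<Oplus>\<^bsub>B\<^esub>i\<in>{i \<in> I. v i \<noteq> \<zero>\<^bsub>A\<^esub>}. v i \<odot>\<^bsub>B\<^esub> b i) \<in> mod_hom A (copower I (regular_module A)) B"
proof -
  interpret A: ring A by fact
  interpret B: left_module A B by fact
  let ?F = "copower I (regular_module A)"
  have sel: "carrier (regular_module A) = carrier A" "\<zero>\<^bsub>regular_module A\<^esub> = \<zero>\<^bsub>A\<^esub>"
    "a \<oplus>\<^bsub>regular_module A\<^esub> c = a \<oplus>\<^bsub>A\<^esub> c" "a \<odot>\<^bsub>regular_module A\<^esub> c = a \<otimes>\<^bsub>A\<^esub> c" for a c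
    by (auto simp: regular_module_def)
  have F: "v \<in> carrier ?F \<longleftrightarrow> v \<in> I \<rightarrow>\<^sub>E carrier A \<and> finite {i \<in> I. v i \<noteq> \<zero>\<^bsub>A\<^esub>}" for v
    by (simp add: copower_def sel)
  define \<Phi> where "\<Phi> v = (\<Oplus>\<^bsub>B\<^esub>i\<in>{i \<in> I. v i \<noteq> \<zero>\<^bsub>A\<^esub>}. v i \<odot>\<^bsub>B\<^esub> b i)" for v
  have \<Phi>: "\<Phi> v = (\<Oplus>\<^bsub>B\<^esub>i\<in>T. v i \<odot>\<^bsub>B\<^esub> b i)"
    if v: "v \<in> carrier ?F" "finite T" "T \<subseteq> I" "{i \<in> I. v i \<noteq> \<zero>\<^bsub>A\<^esub>} \<subseteq> T" for v T
    unfolding \<Phi>_def by (rule B.M.add.finprod_mono_neutral_cong_left) (use v b F in \<open>auto simp: Pi_iff PiE_iff\<close>)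
  have c: "v i \<odot>\<^bsub>B\<^esub> b i \<in> carrier B" if "v \<in> carrier ?F" "i \<in> I" for v i
    using that b F by (auto simp: PiE_iff)
  have "\<Phi> \<in> mod_hom A ?F B"
  proof (rule mod_homI)
    show "\<Phi> v \<in> carrier B" if "v \<in> carrier ?F" for v
      unfolding \<Phi>_def by (rule B.M.finsum_closed) (use c that in auto)
    fix v w assume vw: "v \<in> carrier ?F" "w \<in> carrier ?F"
    interpret F: left_module A ?F by (rule copower_left_module[OF regular_left_module[OF A]])
    let ?T = "{i \<in> I. v i \<noteq> \<zero>\<^bsub>A\<^esub>} \<union> {i \<in> I. w i \<noteq> \<zero>\<^bsub>A\<^esub>}"
    have T: "finite ?T" "?T \<subseteq> I" using vw F by auto
    have vwc: "v \<oplus>\<^bsub>?F\<^esub> w \<in> carrier ?F" using vw by simp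
    have "\<Phi> (v \<oplus>\<^bsub>?F\<^esub> w) = (\<Oplus>\<^bsub>B\<^esub>i\<in>?T. (v \<oplus>\<^bsub>?F\<^esub> w) i \<odot>\<^bsub>B\<^esub> b i)"
      by (rule \<Phi>[OF vwc T]) (auto simp: copower_simps sel)
    also have "\<dots> = (\<Oplus>\<^bsub>B\<^esub>i\<in>?T. v i \<odot>\<^bsub>B\<^esub> b i \<oplus>\<^bsub>B\<^esub> w i \<odot>\<^bsub>B\<^esub> b i)"
      by (rule B.M.finsum_cong') (use vw b c F in \<open>auto simp: copower_simps sel PiE_iff B.smult_l_distr\<close>)
    also have "\<dots> = (\<Oplus>\<^bsub>B\<^esub>i\<in>?T. v i \<odot>\<^bsub>B\<^esub> b i) \<oplus>\<^bsub>B\<^esub> (\<Oplus>\<^bsub>B\<^esub>i\<in>?T. w i \<odot>\<^bsub>B\<^esub> b i)"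
      by (rule B.M.finsum_addf) (use vw c in auto)
    also have "\<dots> = \<Phi> v \<oplus>\<^bsub>B\<^esub> \<Phi> w" using \<Phi>[OF vw(1) T] \<Phi>[OF vw(2) T] by simp
    finally show "\<Phi> (v \<oplus>\<^bsub>?F\<^esub> w) = \<Phi> v \<oplus>\<^bsub>B\<^esub> \<Phi> w" .
  next
    fix a v assume av: "a \<in> carrier A" "v \<in> carrier ?F"
    interpret F: left_module A ?F by (rule copower_left_module[OF regular_left_module[OF A]])
    let ?T = "{i \<in> I. v i \<noteq> \<zero>\<^bsub>A\<^esub>}"
    have T: "finite ?T" "?T \<subseteq> I" using av F by auto
    have avc: "a \<odot>\<^bsub>?F\<^esub> v \<in> carrier ?F" using av by simp
    have "\<Phi> (a \<odot>\<^bsub>?F\<^esub> v) = (\<Oplus>\<^bsub>B\<^esub>i\<in>?T. (a \<odot>\<^bsub>?F\<^esub> v) i \<odot>\<^bsub>B\<^esub> b i)"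
      by (rule \<Phi>[OF avc T]) (use av in \<open>auto simp: copower_simps sel\<close>)
    also have "\<dots> = (\<Oplus>\<^bsub>B\<^esub>i\<in>?T. a \<odot>\<^bsub>B\<^esub> (v i \<odot>\<^bsub>B\<^esub> b i))"
      by (rule B.M.finsum_cong') (use av b c F in \<open>auto simp: copower_simps sel PiE_iff B.smult_assoc1\<close>)
    also have "\<dots> = a \<odot>\<^bsub>B\<^esub> (\<Oplus>\<^bsub>B\<^esub>i\<in>?T. v i \<odot>\<^bsub>B\<^esub> b i)"
      by (rule B.finsum_smult_l[symmetric]) (use av c T in auto)
    finally show "\<Phi> (a \<odot>\<^bsub>?F\<^esub> v) = a \<odot>\<^bsub>B\<^esub> \<Phi> v" unfolding \<Phi>_def .
  qed
  then show ?thesis unfolding \<Phi>_def .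
qed

lemma copower_hom_eqI:
  fixes I :: "'i set"
  assumes A: "ring A" and C: "left_module A C"
    and f: "f \<in> mod_hom A (copower I (regular_module A)) C" and g: "g \<in> mod_hom A (copower I (regular_module A)) C"
    and eq: "\<And>i. i \<in> I \<Longrightarrow> f (\<lambda>k\<in>I. if k = i then \<one>\<^bsub>A\<^esub> else \<zero>\<^bsub>A\<^esub>) = g (\<lambda>k\<in>I. if k = i then \<one>\<^bsub>A\<^esub> else \<zero>\<^bsub>A\<^esub>)"
    and v: "v \<in> carrier (copower I (regular_module A))"
  shows "f v = g v"
proof -
  interpret A: ring A by fact
  let ?F = "copower I (regular_module A)"
  interpret F: left_module A ?F by (rule copower_left_module[OF regular_left_module[OF A]])
  interpret FC: module_pair A ?F C by (rule module_pair.intro[OF F.left_module_axioms C])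
  interpret Q: left_module A "regular_module A" by (rule regular_left_module[OF A])
  interpret FQ: module_pair A ?F "regular_module A" by (rule module_pair.intro[OF F.left_module_axioms Q.left_module_axioms])
  have sel: "carrier (regular_module A) = carrier A" "\<zero>\<^bsub>regular_module A\<^esub> = \<zero>\<^bsub>A\<^esub>"
    "a \<oplus>\<^bsub>regular_module A\<^esub> c = a \<oplus>\<^bsub>A\<^esub> c" "a \<odot>\<^bsub>regular_module A\<^esub> c = a \<otimes>\<^bsub>A\<^esub> c" for a c
    by (auto simp: regular_module_def)
  have vF: "v \<in> I \<rightarrow>\<^sub>E carrier A" and fin: "finite {i \<in> I. v i \<noteq> \<zero>\<^bsub>A\<^esub>}"
    using v by (auto simp: copower_def sel)
  let ?e = "\<lambda>i. \<lambda>k\<in>I. if k = i then \<one>\<^bsub>A\<^esub> else \<zero>\<^bsub>A\<^esub>"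
  have e: "?e i \<in> carrier ?F" if "i \<in> I" for i
  proof -
    have "{k \<in> I. ?e i k \<noteq> \<zero>\<^bsub>A\<^esub>} \<subseteq> {i}" by auto
    then have "finite {k \<in> I. ?e i k \<noteq> \<zero>\<^bsub>A\<^esub>}" by (rule finite_subset) simp
    then show ?thesis by (auto simp: copower_def sel)
  qed
  let ?T = "{i \<in> I. v i \<noteq> \<zero>\<^bsub>A\<^esub>}"
  have vi: "v i \<in> carrier A" if "i \<in> I" for i using vF that by auto
  have te: "(\<lambda>i. v i \<odot>\<^bsub>?F\<^esub> ?e i) \<in> ?T \<rightarrow> carrier ?F" using e vi F.smult_closed by auto
  let ?s = "\<Oplus>\<^bsub>?F\<^esub>i\<in>?T. v i \<odot>\<^bsub>?F\<^esub> ?e i"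
  have s: "?s \<in> carrier ?F" by (rule F.M.finsum_closed[OF te])
  have "v = ?s"
  proof (rule extensionalityI[of _ I])
    show "v \<in> extensional I" "?s \<in> extensional I" using v s unfolding copower_def by (simp_all only: partial_object.simps PiE_iff mem_Collect_eq simp_thms)
    fix k assume k: "k \<in> I"
    have "?s k = (\<Oplus>\<^bsub>regular_module A\<^esub>i\<in>?T. (v i \<odot>\<^bsub>?F\<^esub> ?e i) k)"
      using FQ.hom_finsum[OF copower_proj_hom[OF k, of A "regular_module A"] fin te] .
    also have "\<dots> = (\<Oplus>\<^bsub>regular_module A\<^esub>i\<in>?T. if k = i then v i else \<zero>\<^bsub>regular_module A\<^esub>)"
      by (rule Q.M.finsum_cong') (use k vi in \<open>auto simp: copower_simps sel\<close>)
    also have "\<dots> = v k"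
    proof (cases "v k = \<zero>\<^bsub>A\<^esub>")
      case True
      have "(\<Oplus>\<^bsub>regular_module A\<^esub>i\<in>?T. if k = i then v i else \<zero>\<^bsub>regular_module A\<^esub>) = (\<Oplus>\<^bsub>regular_module A\<^esub>i\<in>?T. \<zero>\<^bsub>regular_module A\<^esub>)"
        by (rule Q.M.finsum_cong') (use True in auto)
      also have "\<dots> = \<zero>\<^bsub>regular_module A\<^esub>" by simp
      finally show ?thesis using True sel(2) by simp
    next
      case False
      show ?thesis by (rule Q.M.add.finprod_singleton) (use k False fin vi in \<open>auto simp: sel\<close>)
    qed
    finally show "v k = ?s k" by simp
  qed
  moreover have "f ?s = g ?s"
  proof -
    have "f ?s = (\<Oplus>\<^bsub>C\<^esub>i\<in>?T. f (v i \<odot>\<^bsub>?F\<^esub> ?e i))" by (rule FC.hom_finsum[OF f fin te])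
    also have "\<dots> = (\<Oplus>\<^bsub>C\<^esub>i\<in>?T. g (v i \<odot>\<^bsub>?F\<^esub> ?e i))"
    proof (rule FC.W.M.finsum_cong')
      show "f (v i \<odot>\<^bsub>?F\<^esub> ?e i) = g (v i \<odot>\<^bsub>?F\<^esub> ?e i)" if "i \<in> ?T" for i
        using that mod_homD(3)[OF f vi e] mod_homD(3)[OF g vi e] eq by simp
    qed (use te mod_homD(1)[OF g] in auto)
    also have "\<dots> = g ?s" by (rule FC.hom_finsum[OF g fin te, symmetric])
    finally show ?thesis .
  qed
  ultimately show ?thesis by simp
qed

text \<open>
  The maps \<open>s\<close> and \<open>q\<close> make \<open>P\<close> a direct summand of a free module; a lift is chosen on the images of
  the basis vectors and extended linearly. A whole family of homomorphisms is lifted at once, which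
  stands for lifting a single one into a product.
\<close>

lemma lift_dual_basis:
  fixes I :: "'i set"
  assumes A: "ring A" and P: "left_module A P"
    and s: "s \<in> mod_hom A P (copower I (regular_module A))" and q: "q \<in> mod_hom A (copower I (regular_module A)) P"
    and qs: "\<And>x. x \<in> carrier P \<Longrightarrow> q (s x) = x"
    and B: "left_module A B" and C: "\<And>j. j \<in> J \<Longrightarrow> left_module A (C j)"
    and f: "\<And>j. j \<in> J \<Longrightarrow> f j \<in> mod_hom A P (C j)" and g: "\<And>j. j \<in> J \<Longrightarrow> g j \<in> mod_hom A B (C j)"
    and ex: "\<And>y. y \<in> carrier P \<Longrightarrow> \<exists>b\<in>carrier B. \<forall>j\<in>J. g j b = f j y"
  shows "\<exists>h\<in>mod_hom A P B. \<forall>y\<in>carrier P. \<forall>j\<in>J. g j (h y) = f j y"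
proof -
  interpret A: ring A by fact
  interpret B: left_module A B by fact
  let ?F = "copower I (regular_module A)"
  have sel: "carrier (regular_module A) = carrier A" "\<zero>\<^bsub>regular_module A\<^esub> = \<zero>\<^bsub>A\<^esub>"
    by (auto simp: regular_module_def)
  let ?e = "\<lambda>i. \<lambda>k\<in>I. if k = i then \<one>\<^bsub>A\<^esub> else \<zero>\<^bsub>A\<^esub>"
  have supp: "{k \<in> I. ?e i k \<noteq> \<zero>\<^bsub>A\<^esub>} \<subseteq> {i}" for i by auto
  have e: "?e i \<in> carrier ?F" if "i \<in> I" for i
  proof -
    have "finite {k \<in> I. ?e i k \<noteq> \<zero>\<^bsub>A\<^esub>}" by (rule finite_subset[OF supp]) simp
    then show ?thesis by (auto simp: copower_def sel)
  qed
  have "\<forall>i\<in>I. \<exists>b. b \<in> carrier B \<and> (\<forall>j\<in>J. g j b = f j (q (?e i)))"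
    using ex[OF mod_homD(1)[OF q e]] by blast
  from bchoice[OF this] obtain b where b: "\<And>i. i \<in> I \<Longrightarrow> b i \<in> carrier B" "\<And>i j. i \<in> I \<Longrightarrow> j \<in> J \<Longrightarrow> g j (b i) = f j (q (?e i))" by auto
  define \<Phi> where "\<Phi> v = (\<Oplus>\<^bsub>B\<^esub>i\<in>{i \<in> I. v i \<noteq> \<zero>\<^bsub>A\<^esub>}. v i \<odot>\<^bsub>B\<^esub> b i)" for v
  have \<Phi>: "\<Phi> \<in> mod_hom A ?F B" unfolding \<Phi>_def by (rule copower_finsum_hom[OF A B b(1)])
  have \<Phi>e: "\<Phi> (?e i) = b i" if i: "i \<in> I" for i
  proof -
    have "\<Phi> (?e i) = (\<Oplus>\<^bsub>B\<^esub>k\<in>{i}. ?e i k \<odot>\<^bsub>B\<^esub> b k)"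
      unfolding \<Phi>_def
    proof (rule B.M.add.finprod_mono_neutral_cong_left)
      show "?e i k \<odot>\<^bsub>B\<^esub> b k = \<zero>\<^bsub>B\<^esub>" if k: "k \<in> {i} - {k \<in> I. ?e i k \<noteq> \<zero>\<^bsub>A\<^esub>}" for k
      proof -
        have "?e i k = \<zero>\<^bsub>A\<^esub>" "k \<in> I" using k i by auto
        then show ?thesis using b(1) by simp
      qed
    qed (use i b supp in auto)
    also have "\<dots> = b i" using i b(1) by simp
    finally show ?thesis .
  qed
  show ?thesis
  proof (rule bexI[of _ "\<lambda>y. \<Phi> (s y)"], intro ballI)
    show "(\<lambda>y. \<Phi> (s y)) \<in> mod_hom A P B" by (rule mod_hom_comp[OF s \<Phi>])
    fix y j assume yj: "y \<in> carrier P" "j \<in> J"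
    have 1: "(\<lambda>v. g j (\<Phi> v)) \<in> mod_hom A ?F (C j)" by (rule mod_hom_comp[OF \<Phi> g[OF yj(2)]])
    have 2: "(\<lambda>v. f j (q v)) \<in> mod_hom A ?F (C j)" by (rule mod_hom_comp[OF q f[OF yj(2)]])
    have 3: "g j (\<Phi> (?e i)) = f j (q (?e i))" if "i \<in> I" for i using \<Phi>e[OF that] b(2)[OF that yj(2)] by simp
    have "g j (\<Phi> (s y)) = f j (q (s y))"
      by (rule copower_hom_eqI[OF A C[OF yj(2)] 1 2 3 mod_homD(1)[OF s yj(1)]])
    then show "g j (\<Phi> (s y)) = f j y" using qs[OF yj(1)] by simp
  qed
qed

lemma projective_lift:
  fixes P :: "('a, 'p, 'x) module_scheme"
  assumes A: "ring A" and P: "projective_module A P" and B: "left_module A B" and C: "left_module A C"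
    and f: "f \<in> mod_hom A P C" and g: "g \<in> mod_hom A B C"
    and im: "\<And>y. y \<in> carrier P \<Longrightarrow> f y \<in> g ` carrier B"
  shows "\<exists>h\<in>mod_hom A P B. \<forall>y\<in>carrier P. g (h y) = f y"
proof -
  from P[unfolded projective_module_def] obtain I :: "'p set" and s q where "left_module A P"
    "s \<in> mod_hom A P (copower I (regular_module A))" "q \<in> mod_hom A (copower I (regular_module A)) P"
    "\<forall>x\<in>carrier P. q (s x) = x" by (elim exE bexE conjE)
  note P' = this
  have "\<exists>h\<in>mod_hom A P B. \<forall>y\<in>carrier P. \<forall>j\<in>{()}. g (h y) = f y"
  proof (rule lift_dual_basis[OF A P'(1-3), of B "{()}" "\<lambda>_. C" "\<lambda>_. f" "\<lambda>_. g"])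
    show "q (s x) = x" if "x \<in> carrier P" for x using P'(4) that by simp
    show "\<exists>b\<in>carrier B. \<forall>j\<in>{()}. g b = f y" if y: "y \<in> carrier P" for y
    proof -
      obtain b where "b \<in> carrier B" "f y = g b" using im[OF y] by (elim imageE)
      then show ?thesis by (intro bexI[of _ b]) simp_all
    qed
  qed (use B C f g in simp_all)
  then show ?thesis by simp
qed

section \<open>The modules Hom(M, N) over the endomorphism ring\<close>

text \<open>
  Endomorphisms of \<open>M\<close> act on the right by precomposition, that is, the opposite ring acts on the left.
\<close>

definition Hom_module :: "('a, 'r) ring_scheme \<Rightarrow> ('a, 'm, 'x) module_scheme \<Rightarrow> ('a, 'n, 'y) module_scheme \<Rightarrow>
    ('m \<Rightarrow> 'm, 'm \<Rightarrow> 'n) module" where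
  "Hom_module R M N = \<lparr>carrier = mod_hom R M N \<inter> extensional (carrier M),
     monoid.mult = undefined, monoid.one = undefined,
     ring.zero = (\<lambda>x\<in>carrier M. \<zero>\<^bsub>N\<^esub>), ring.add = (\<lambda>f g. \<lambda>x\<in>carrier M. f x \<oplus>\<^bsub>N\<^esub> g x),
     smult = (\<lambda>a f. compose (carrier M) f a)\<rparr>"

lemma Hom_simps:
  "carrier (Hom_module R M N) = mod_hom R M N \<inter> extensional (carrier M)"
  "\<zero>\<^bsub>Hom_module R M N\<^esub> = (\<lambda>x\<in>carrier M. \<zero>\<^bsub>N\<^esub>)"
  "f \<oplus>\<^bsub>Hom_module R M N\<^esub> g = (\<lambda>x\<in>carrier M. f x \<oplus>\<^bsub>N\<^esub> g x)"
  "a \<odot>\<^bsub>Hom_module R M N\<^esub> f = compose (carrier M) f a"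
  by (simp_all add: Hom_module_def)

lemma End_op_simps:
  "carrier (opposite_ring (End_ring R M)) = mod_hom R M M \<inter> extensional (carrier M)"
  "\<zero>\<^bsub>opposite_ring (End_ring R M)\<^esub> = (\<lambda>x\<in>carrier M. \<zero>\<^bsub>M\<^esub>)"
  "\<one>\<^bsub>opposite_ring (End_ring R M)\<^esub> = (\<lambda>x\<in>carrier M. x)"
  "a \<oplus>\<^bsub>opposite_ring (End_ring R M)\<^esub> b = (\<lambda>x\<in>carrier M. a x \<oplus>\<^bsub>M\<^esub> b x)"
  "a \<otimes>\<^bsub>opposite_ring (End_ring R M)\<^esub> b = compose (carrier M) b a"
  by (simp_all add: opposite_ring_def End_ring_def)

lemma mod_hom_restrict: "f \<in> mod_hom R V W \<Longrightarrow> left_module R V \<Longrightarrow> restrict f (carrier V) \<in> mod_hom R V W"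
  by (rule mod_homI) (auto simp: mod_hom_def left_module_def left_module_axioms_def abelian_group_def abelian_monoid.a_closed)

lemma mod_hom_compose:
  "f \<in> mod_hom R V W \<Longrightarrow> g \<in> mod_hom R W U \<Longrightarrow> left_module R V \<Longrightarrow> compose (carrier V) g f \<in> mod_hom R V U"
  unfolding compose_def by (rule mod_hom_restrict[OF mod_hom_comp])

context
  fixes R :: "('a, 'r) ring_scheme" and M :: "('a, 'm, 'x) module_scheme"
  assumes M: "left_module R M"
begin

interpretation M: left_module R M by (rule M)

lemma hom_abelian_group:
  assumes N: "left_module R N" shows "abelian_group (Hom_module R M N)"
proof (rule abelian_groupI)
  interpret N: left_module R N by fact
  interpret MN: module_pair R M N by (rule module_pair.intro[OF M N])
  show "\<zero>\<^bsub>Hom_module R M N\<^esub> \<in> carrier (Hom_module R M N)"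
    using mod_hom_restrict[OF MN.zero_hom M] by (simp add: Hom_simps)
  fix f assume f: "f \<in> carrier (Hom_module R M N)"
  then have fh: "f \<in> mod_hom R M N" "f \<in> extensional (carrier M)" by (auto simp: Hom_simps)
  note fD = mod_homD[OF fh(1)]
  show "\<zero>\<^bsub>Hom_module R M N\<^esub> \<oplus>\<^bsub>Hom_module R M N\<^esub> f = f"
    by (rule extensionalityI[of _ "carrier M"]) (use fh fD(1) in \<open>auto simp: Hom_simps\<close>)
  have "(\<lambda>x\<in>carrier M. \<zero>\<^bsub>N\<^esub> \<ominus>\<^bsub>N\<^esub> f x) \<in> carrier (Hom_module R M N)"
    using mod_hom_restrict[OF MN.minus_hom[OF MN.zero_hom fh(1)] M] by (simp add: Hom_simps)
  moreover have "(\<lambda>x\<in>carrier M. \<zero>\<^bsub>N\<^esub> \<ominus>\<^bsub>N\<^esub> f x) \<oplus>\<^bsub>Hom_module R M N\<^esub> f = \<zero>\<^bsub>Hom_module R M N\<^esub>"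
    unfolding Hom_simps by (rule restrict_ext) (use fD(1) in \<open>simp add: N.minus_plus\<close>)
  ultimately show "\<exists>g\<in>carrier (Hom_module R M N). g \<oplus>\<^bsub>Hom_module R M N\<^esub> f = \<zero>\<^bsub>Hom_module R M N\<^esub>" by blast
  fix g assume g: "g \<in> carrier (Hom_module R M N)"
  then have gh: "g \<in> mod_hom R M N" by (auto simp: Hom_simps)
  note gD = mod_homD[OF gh]
  show "f \<oplus>\<^bsub>Hom_module R M N\<^esub> g \<in> carrier (Hom_module R M N)"
    using mod_hom_restrict[OF MN.add_hom[OF fh(1) gh] M] by (simp add: Hom_simps)
  show "f \<oplus>\<^bsub>Hom_module R M N\<^esub> g = g \<oplus>\<^bsub>Hom_module R M N\<^esub> f"
    unfolding Hom_simps by (rule restrict_ext) (use fD(1) gD(1) in \<open>simp add: N.M.a_comm\<close>)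
  fix h assume h: "h \<in> carrier (Hom_module R M N)"
  then have hh: "h \<in> mod_hom R M N" by (auto simp: Hom_simps)
  show "f \<oplus>\<^bsub>Hom_module R M N\<^esub> g \<oplus>\<^bsub>Hom_module R M N\<^esub> h = f \<oplus>\<^bsub>Hom_module R M N\<^esub> (g \<oplus>\<^bsub>Hom_module R M N\<^esub> h)"
    unfolding Hom_simps by (rule restrict_ext) (use fD(1) gD(1) mod_homD(1)[OF hh] in \<open>simp add: N.M.a_assoc\<close>)
qed

lemma End_op_ring: "ring (opposite_ring (End_ring R M))" (is "ring ?A")
proof (rule ringI)
  interpret MM: module_pair R M M by (rule module_pair.intro[OF M M])
  interpret H: abelian_group "Hom_module R M M" by (rule hom_abelian_group[OF M])
  have eq: "carrier ?A = carrier (Hom_module R M M)" "\<zero>\<^bsub>?A\<^esub> = \<zero>\<^bsub>Hom_module R M M\<^esub>"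
    "a \<oplus>\<^bsub>?A\<^esub> b = a \<oplus>\<^bsub>Hom_module R M M\<^esub> b" for a b by (simp_all add: End_op_simps Hom_simps)
  show "abelian_group ?A"
    by (rule abelian_groupI) (auto simp: eq H.a_ac intro: bexI[of _ "\<ominus>\<^bsub>Hom_module R M M\<^esub> _"] H.l_neg)
  have mem: "a \<in> mod_hom R M M" "\<And>x. x \<in> carrier M \<Longrightarrow> a x \<in> carrier M" "a \<in> extensional (carrier M)" if "a \<in> carrier ?A" for a
    using that mod_homD(1)[of a R M M] by (auto simp: End_op_simps)
  show "monoid ?A"
  proof (rule monoidI)
    show "a \<otimes>\<^bsub>?A\<^esub> b \<in> carrier ?A" if "a \<in> carrier ?A" "b \<in> carrier ?A" for a b
      using mod_hom_compose[OF mem(1)[OF that(1)] mem(1)[OF that(2)] M] by (simp add: End_op_simps)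
    show "\<one>\<^bsub>?A\<^esub> \<in> carrier ?A" using mod_hom_restrict[OF mod_hom_id M] by (simp add: End_op_simps)
    show "a \<otimes>\<^bsub>?A\<^esub> b \<otimes>\<^bsub>?A\<^esub> c = a \<otimes>\<^bsub>?A\<^esub> (b \<otimes>\<^bsub>?A\<^esub> c)" if "a \<in> carrier ?A" "b \<in> carrier ?A" "c \<in> carrier ?A" for a b c
      using mem(2)[OF that(1)] by (auto simp: End_op_simps compose_def restrict_def fun_eq_iff)
    show "\<one>\<^bsub>?A\<^esub> \<otimes>\<^bsub>?A\<^esub> a = a" if "a \<in> carrier ?A" for a
      using mem[OF that] by (auto simp: End_op_simps compose_def restrict_def fun_eq_iff extensional_def)
    show "a \<otimes>\<^bsub>?A\<^esub> \<one>\<^bsub>?A\<^esub> = a" if "a \<in> carrier ?A" for a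
      using mem[OF that] by (auto simp: End_op_simps compose_def restrict_def fun_eq_iff extensional_def)
  qed
  fix a b c assume abc: "a \<in> carrier ?A" "b \<in> carrier ?A" "c \<in> carrier ?A"
  show "(a \<oplus>\<^bsub>?A\<^esub> b) \<otimes>\<^bsub>?A\<^esub> c = a \<otimes>\<^bsub>?A\<^esub> c \<oplus>\<^bsub>?A\<^esub> b \<otimes>\<^bsub>?A\<^esub> c"
    using mem[OF abc(1)] mem[OF abc(2)] mod_homD(2)[OF mem(1)[OF abc(3)]]
    by (auto simp: End_op_simps compose_def restrict_def fun_eq_iff)
  show "c \<otimes>\<^bsub>?A\<^esub> (a \<oplus>\<^bsub>?A\<^esub> b) = c \<otimes>\<^bsub>?A\<^esub> a \<oplus>\<^bsub>?A\<^esub> c \<otimes>\<^bsub>?A\<^esub> b"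
    using mem[OF abc(3)] by (auto simp: End_op_simps compose_def restrict_def fun_eq_iff)
qed

lemma Hom_left_module:
  assumes N: "left_module R N" shows "left_module (opposite_ring (End_ring R M)) (Hom_module R M N)" (is "left_module ?A ?H")
proof (intro left_module.intro left_module_axioms.intro)
  interpret N: left_module R N by fact
  show "ring ?A" by (rule End_op_ring)
  show "abelian_group ?H" by (rule hom_abelian_group[OF N])
  have mem: "a \<in> mod_hom R M M" "\<And>x. x \<in> carrier M \<Longrightarrow> a x \<in> carrier M" if "a \<in> carrier ?A" for a
    using that mod_homD(1)[of a R M M] by (auto simp: End_op_simps)
  have memH: "f \<in> mod_hom R M N" "f \<in> extensional (carrier M)" if "f \<in> carrier ?H" for f
    using that by (auto simp: Hom_simps)
  show "\<one>\<^bsub>?A\<^esub> \<odot>\<^bsub>?H\<^esub> f = f" if f: "f \<in> carrier ?H" for f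
    using memH[OF f] by (auto simp: End_op_simps Hom_simps compose_def restrict_def fun_eq_iff extensional_def)
  fix a f assume a: "a \<in> carrier ?A" and f: "f \<in> carrier ?H"
  show "a \<odot>\<^bsub>?H\<^esub> f \<in> carrier ?H"
    using mod_hom_compose[OF mem(1)[OF a] memH(1)[OF f] M] by (simp add: Hom_simps)
  fix g assume g: "g \<in> carrier ?H"
  show "a \<odot>\<^bsub>?H\<^esub> (f \<oplus>\<^bsub>?H\<^esub> g) = a \<odot>\<^bsub>?H\<^esub> f \<oplus>\<^bsub>?H\<^esub> a \<odot>\<^bsub>?H\<^esub> g"
    using mem[OF a] by (auto simp: Hom_simps compose_def restrict_def fun_eq_iff)
next
  interpret N: left_module R N by fact
  have mem: "a \<in> mod_hom R M M" "\<And>x. x \<in> carrier M \<Longrightarrow> a x \<in> carrier M" if "a \<in> carrier ?A" for a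
    using that mod_homD(1)[of a R M M] by (auto simp: End_op_simps)
  fix a b f assume a: "a \<in> carrier ?A" and b: "b \<in> carrier ?A" and f: "f \<in> carrier ?H"
  have fh: "f \<in> mod_hom R M N" using f by (auto simp: Hom_simps)
  show "(a \<oplus>\<^bsub>?A\<^esub> b) \<odot>\<^bsub>?H\<^esub> f = a \<odot>\<^bsub>?H\<^esub> f \<oplus>\<^bsub>?H\<^esub> b \<odot>\<^bsub>?H\<^esub> f"
    using mem[OF a] mem[OF b] mod_homD(2)[OF fh] by (auto simp: End_op_simps Hom_simps compose_def restrict_def fun_eq_iff)
  show "a \<otimes>\<^bsub>?A\<^esub> b \<odot>\<^bsub>?H\<^esub> f = a \<odot>\<^bsub>?H\<^esub> (b \<odot>\<^bsub>?H\<^esub> f)"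
    using mem[OF a] by (auto simp: End_op_simps Hom_simps compose_def restrict_def fun_eq_iff)
qed

lemma Hom_push:
  assumes f: "f \<in> mod_hom R N N'"
  shows "(\<lambda>h. compose (carrier M) f h) \<in> mod_hom (opposite_ring (End_ring R M)) (Hom_module R M N) (Hom_module R M N')"
proof (rule mod_homI)
  fix h assume h: "h \<in> carrier (Hom_module R M N)"
  then have hh: "h \<in> mod_hom R M N" by (simp add: Hom_simps)
  show "compose (carrier M) f h \<in> carrier (Hom_module R M N')"
    using mod_hom_compose[OF hh f M] by (simp add: Hom_simps)
  fix g assume g: "g \<in> carrier (Hom_module R M N)"
  then have gh: "g \<in> mod_hom R M N" by (simp add: Hom_simps)
  show "compose (carrier M) f (h \<oplus>\<^bsub>Hom_module R M N\<^esub> g) = compose (carrier M) f h \<oplus>\<^bsub>Hom_module R M N'\<^esub> compose (carrier M) f g"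
    using mod_homD(1)[OF hh] mod_homD(1)[OF gh] mod_homD(2)[OF f] by (auto simp: Hom_simps compose_def restrict_def fun_eq_iff)
next
  fix a h assume a: "a \<in> carrier (opposite_ring (End_ring R M))" and h: "h \<in> carrier (Hom_module R M N)"
  have "a x \<in> carrier M" if "x \<in> carrier M" for x using a that mod_homD(1)[of a R M M] by (auto simp: End_op_simps)
  then show "compose (carrier M) f (a \<odot>\<^bsub>Hom_module R M N\<^esub> h) = a \<odot>\<^bsub>Hom_module R M N'\<^esub> compose (carrier M) f h"
    by (auto simp: Hom_simps compose_def restrict_def fun_eq_iff)
qed

lemma Hom_finsum_eval:
  assumes N: "left_module R N" and J: "finite J" and f: "f \<in> J \<rightarrow> carrier (Hom_module R M N)" and x: "x \<in> carrier M"
  shows "(\<Oplus>\<^bsub>Hom_module R M N\<^esub>j\<in>J. f j) x = (\<Oplus>\<^bsub>N\<^esub>j\<in>J. f j x)"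
  using J f
proof (induct set: finite)
  interpret N: left_module R N by fact
  interpret H: abelian_group "Hom_module R M N" by (rule hom_abelian_group[OF N])
  case empty then show ?case using x by (simp add: Hom_simps)
next
  interpret N: left_module R N by fact
  interpret H: abelian_group "Hom_module R M N" by (rule hom_abelian_group[OF N])
  case (insert j J)
  have c: "f i x \<in> carrier N" if "i \<in> insert j J" for i
    using insert(4) that mod_homD(1)[of "f i" R M N] x by (auto simp: Hom_simps)
  have s: "(\<Oplus>\<^bsub>Hom_module R M N\<^esub>i\<in>insert j J. f i) = f j \<oplus>\<^bsub>Hom_module R M N\<^esub> (\<Oplus>\<^bsub>Hom_module R M N\<^esub>i\<in>J. f i)"
    by (rule H.finsum_insert) (use insert in auto)
  have "(\<Oplus>\<^bsub>N\<^esub>i\<in>insert j J. f i x) = f j x \<oplus>\<^bsub>N\<^esub> (\<Oplus>\<^bsub>N\<^esub>i\<in>J. f i x)"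
    by (rule N.M.finsum_insert) (use insert c in auto)
  moreover have "(\<Oplus>\<^bsub>Hom_module R M N\<^esub>i\<in>J. f i) x = (\<Oplus>\<^bsub>N\<^esub>i\<in>J. f i x)" by (rule insert(3)) (use insert(4) in auto)
  ultimately show ?case unfolding s using x by (simp add: Hom_simps)
qed

end

locale hom_setup =
  fixes R :: "('a, 'r) ring_scheme" and M :: "('a, 'm, 'x) module_scheme"
  assumes R: "cring R" "noetherian_ring R" and M: "left_module R M" "finitely_generated_module R M"
begin

abbreviation A where "A \<equiv> opposite_ring (End_ring R M)"
abbreviation Mn where "Mn n \<equiv> copower {..<n::nat} M"

sublocale R: cring R by (rule R)
sublocale M: left_module R M by (rule M)

lemma A: "ring A" by (rule End_op_ring[OF M(1)])

lemma Mn: "left_module R (Mn n)" "finitely_generated_module R (Mn n)"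
  by (rule copower_left_module[OF M(1)], rule copower_fg[OF M])

lemma Hom: "left_module R N \<Longrightarrow> left_module A (Hom_module R M N)"
  by (rule Hom_left_module[OF M(1)])

text \<open>
  The structure map from \<open>R\<close> to the centre of \<open>A\<close>.
\<close>

definition scalar where "scalar r = (\<lambda>x\<in>carrier M. r \<odot>\<^bsub>M\<^esub> x)"

lemma scalar_hom: "r \<in> carrier R \<Longrightarrow> scalar r \<in> carrier A"
proof -
  assume r: "r \<in> carrier R"
  have "(\<lambda>x. r \<odot>\<^bsub>M\<^esub> x) \<in> mod_hom R M M"
    by (rule mod_homI) (use r in \<open>auto simp: M.smult_r_distr M.smult_assoc1[symmetric] R.m_comm\<close>)
  then show ?thesis unfolding scalar_def using mod_hom_restrict[OF _ M(1)] by (simp add: End_op_simps)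
qed

lemma scalar_ring_hom: "scalar \<in> ring_hom R A"
proof (rule ring_hom_memI)
  fix r s assume r: "r \<in> carrier R" and s: "s \<in> carrier R"
  show "scalar (r \<otimes>\<^bsub>R\<^esub> s) = scalar r \<otimes>\<^bsub>A\<^esub> scalar s"
    unfolding End_op_simps scalar_def compose_def
    by (rule restrict_ext) (use r s in \<open>simp add: M.smult_assoc1[symmetric] R.m_comm\<close>)
  show "scalar (r \<oplus>\<^bsub>R\<^esub> s) = scalar r \<oplus>\<^bsub>A\<^esub> scalar s"
    unfolding End_op_simps scalar_def
    by (rule restrict_ext) (use r s in \<open>simp add: M.smult_l_distr\<close>)
qed (use scalar_hom in \<open>auto simp: scalar_def End_op_simps intro: restrict_ext\<close>)

lemma scalar_central:
  assumes r: "r \<in> carrier R" and a: "a \<in> carrier A" shows "scalar r \<otimes>\<^bsub>A\<^esub> a = a \<otimes>\<^bsub>A\<^esub> scalar r"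
proof -
  have ah: "a \<in> mod_hom R M M" using a by (simp add: End_op_simps)
  show ?thesis unfolding End_op_simps scalar_def compose_def
    by (rule restrict_ext) (use r mod_homD(1,3)[OF ah] in simp)
qed

lemma Hom_scalar:
  assumes N: "left_module R N" and r: "r \<in> carrier R" and f: "f \<in> carrier (Hom_module R M N)" and x: "x \<in> carrier M"
  shows "(scalar r \<odot>\<^bsub>Hom_module R M N\<^esub> f) x = r \<odot>\<^bsub>N\<^esub> f x"
  using mod_homD(3)[of f R M N r x] f r x by (simp add: Hom_simps compose_def scalar_def)

lemma Hom_mem:
  assumes "f \<in> carrier (Hom_module R M N)"
  shows "f \<in> mod_hom R M N" "f \<in> extensional (carrier M)" "\<And>x. x \<in> carrier M \<Longrightarrow> f x \<in> carrier N"
  using assms mod_homD(1)[of f R M N] by (auto simp: Hom_simps)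

lemma Hom_eqI:
  assumes "f \<in> carrier (Hom_module R M N)" "g \<in> carrier (Hom_module R M N)" "\<And>x. x \<in> carrier M \<Longrightarrow> f x = g x"
  shows "f = g"
  by (rule extensionalityI[OF Hom_mem(2)[OF assms(1)] Hom_mem(2)[OF assms(2)] assms(3)])

lemma Hom_restrictI: "f \<in> mod_hom R M N \<Longrightarrow> restrict f (carrier M) \<in> carrier (Hom_module R M N)"
  using mod_hom_restrict[OF _ M(1)] by (simp add: Hom_simps)

lemma Hom_R_module: "left_module R N \<Longrightarrow> left_module R (restrict_scalars scalar (Hom_module R M N))"
  by (rule restrict_scalars_left_module[OF R.ring_axioms Hom scalar_ring_hom])

text \<open>A homomorphism on \<open>M\<close> is determined by its values on generators, which embeds \<open>Hom(M, N)\<close>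
  into a power of \<open>N\<close>.\<close>

lemma Hom_fg:
  assumes N: "left_module R N" "finitely_generated_module R N"
  shows "finitely_generated_module R (restrict_scalars scalar (Hom_module R M N))" (is "finitely_generated_module R ?H")
proof -
  interpret N: left_module R N by fact
  obtain G where G: "finite G" "G \<subseteq> carrier M" "span R M G = carrier M"
    using M(2) unfolding finitely_generated_module_def span_def by auto
  obtain xs where xs: "set xs = G" using G(1) finite_list by auto
  let ?n = "length xs"
  have xc: "xs ! i \<in> carrier M" if "i < ?n" for i using that xs G(2) by auto
  have H: "left_module R ?H" by (rule Hom_R_module[OF N(1)])
  interpret H: left_module R ?H by (rule H)
  let ?C = "copower {..<?n} N"
  have C: "left_module R ?C" "finitely_generated_module R ?C" by (rule copower_left_module[OF N(1)], rule copower_fg[OF N])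
  interpret HC: module_pair R ?H ?C by (rule module_pair.intro[OF H C(1)])
  let ?ev = "\<lambda>f. \<lambda>i\<in>{..<?n}. f (xs ! i)"
  have ev: "?ev \<in> mod_hom R ?H ?C"
  proof (rule mod_homI)
    fix f assume f: "f \<in> carrier ?H"
    then have f': "f \<in> carrier (Hom_module R M N)" by simp
    show "?ev f \<in> carrier ?C" unfolding copower_carrier using Hom_mem(3)[OF f'] xc by auto
    show "?ev (f \<oplus>\<^bsub>?H\<^esub> g) = ?ev f \<oplus>\<^bsub>?C\<^esub> ?ev g" for g
      unfolding copower_simps by (rule restrict_ext) (use xc in \<open>simp add: Hom_simps\<close>)
  next
    fix r f assume r: "r \<in> carrier R" and f: "f \<in> carrier ?H"
    show "?ev (r \<odot>\<^bsub>?H\<^esub> f) = r \<odot>\<^bsub>?C\<^esub> ?ev f"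
      unfolding copower_simps by (rule restrict_ext) (use xc Hom_scalar[OF N(1) r] f in simp)
  qed
  have inj: "inj_on ?ev (carrier ?H)"
  proof (rule inj_onI)
    fix f g assume f: "f \<in> carrier ?H" and g: "g \<in> carrier ?H" and eq: "?ev f = ?ev g"
    have f': "f \<in> carrier (Hom_module R M N)" and g': "g \<in> carrier (Hom_module R M N)" using f g by simp_all
    have MN: "module_pair R M N" by (rule module_pair.intro[OF M(1) N(1)])
    have S: "submodule {x \<in> carrier M. f x \<ominus>\<^bsub>N\<^esub> g x = \<zero>\<^bsub>N\<^esub>} R M"
      by (rule module_pair.hom_kernel_submodule[OF MN module_pair.minus_hom[OF MN Hom_mem(1)[OF f'] Hom_mem(1)[OF g']]])
    have "G \<subseteq> {x \<in> carrier M. f x \<ominus>\<^bsub>N\<^esub> g x = \<zero>\<^bsub>N\<^esub>}"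
    proof
      fix x assume x: "x \<in> G"
      then obtain i where i: "i < ?n" "x = xs ! i" using xs by (auto simp: in_set_conv_nth)
      have "f x = g x" using fun_cong[OF eq, of i] i by simp
      then show "x \<in> {x \<in> carrier M. f x \<ominus>\<^bsub>N\<^esub> g x = \<zero>\<^bsub>N\<^esub>}" using x G(2) Hom_mem(3)[OF g'] N.minus_self by auto
    qed
    from M.span_least[OF this S] have "carrier M \<subseteq> {x \<in> carrier M. f x \<ominus>\<^bsub>N\<^esub> g x = \<zero>\<^bsub>N\<^esub>}"
      unfolding G(3) .
    then have "f x = g x" if "x \<in> carrier M" for x
      using that N.minus_eq_zero_iff[OF Hom_mem(3)[OF f'] Hom_mem(3)[OF g']] by blast
    then show "f = g" by (rule Hom_eqI[OF f' g'])
  qed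
  let ?W = "?ev ` carrier ?H"
  have W: "submodule ?W R ?C" by (rule HC.hom_image_submodule[OF ev H.submod_carrier])
  have Wfg: "finitely_generated_module R (?C\<lparr>carrier := ?W\<rparr>)"
    unfolding HC.W.fg_submodule_iff[OF W] by (rule fg_submodule[OF R C W])
  have WM: "left_module R (?C\<lparr>carrier := ?W\<rparr>)" by (rule HC.W.submodule_left_module[OF W])
  have ev': "?ev \<in> mod_hom R ?H (?C\<lparr>carrier := ?W\<rparr>)" by (rule mod_hom_cod[OF ev]) (rule imageI)
  have bij: "bij_betw ?ev (carrier ?H) (carrier (?C\<lparr>carrier := ?W\<rparr>))" using inj by (simp add: bij_betw_def)
  note inv = inv_hom[OF H ev' bij]
  show ?thesis by (rule fg_image[OF WM Wfg H inv(1)]) (use inv(2) in \<open>simp only: bij_betw_def\<close>)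
qed

lemma A_fg: "finitely_generated_module R (restrict_scalars scalar (regular_module A))"
proof -
  have H: "left_module R (restrict_scalars scalar (Hom_module R M M))" by (rule Hom_R_module[OF M(1)])
  have AR: "left_module R (restrict_scalars scalar (regular_module A))"
    by (rule restrict_scalars_left_module[OF R.ring_axioms regular_left_module[OF A] scalar_ring_hom])
  have id: "(\<lambda>x. x) \<in> mod_hom R (restrict_scalars scalar (Hom_module R M M)) (restrict_scalars scalar (regular_module A))"
    by (rule mod_homI) (auto simp: Hom_simps End_op_simps regular_module_def)
  show ?thesis
    by (rule fg_image[OF H Hom_fg[OF M] AR id]) (auto simp: Hom_simps End_op_simps regular_module_def)
qed

lemma Hom_fg_A:
  assumes N: "left_module R N" "finitely_generated_module R N"
  shows "finitely_generated_module A (Hom_module R M N)"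
proof -
  let ?H = "Hom_module R M N"
  interpret H: left_module A ?H by (rule Hom[OF N(1)])
  interpret HR: left_module R "restrict_scalars scalar ?H" by (rule Hom_R_module[OF N(1)])
  obtain G where G: "finite G" "G \<subseteq> carrier ?H" "span R (restrict_scalars scalar ?H) G = carrier ?H"
    using Hom_fg[OF N] unfolding finitely_generated_module_def span_def by auto
  have S: "submodule (span A ?H G) A ?H" by (rule H.span_submodule[OF G(2)])
  have "span R (restrict_scalars scalar ?H) G \<subseteq> span A ?H G"
    by (rule HR.span_least[OF _ restrict_scalars_submodule[OF R.ring_axioms H.left_module_axioms scalar_ring_hom S]])
      (auto intro: span_inc)
  then have "span A ?H G = carrier ?H" using G(3) H.submodD(1)[OF S] by simp
  then show ?thesis unfolding finitely_generated_module_def span_def[symmetric]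
    using G(1,2) by (intro exI[of _ G]) simp
qed

text \<open>
  Right approximations: every homomorphism from \<open>M\<close> to \<open>N\<close> factors through \<open>\<phi>\<close>, so \<open>Hom(M, \<phi>)\<close> is onto
  although \<open>\<phi>\<close> may fail to be.
\<close>

definition approximation :: "nat \<Rightarrow> ((nat \<Rightarrow> 'm) \<Rightarrow> 'n) \<Rightarrow> ('a, 'n, 'y) module_scheme \<Rightarrow> bool" where
  "approximation k \<phi> N \<longleftrightarrow> \<phi> \<in> mod_hom R (Mn k) N \<and>
     (\<forall>h\<in>carrier (Hom_module R M N). \<exists>w\<in>carrier (Hom_module R M (Mn k)). compose (carrier M) \<phi> w = h)"

text \<open>
  With generators \<open>h\<^sub>j\<close> of \<open>Hom(M, N)\<close>, take the sum of all \<open>h\<^sub>j(v\<^sub>j)\<close> as \<open>\<phi> v\<close>.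
\<close>

lemma ex_approximation:
  assumes N: "left_module R N" "finitely_generated_module R N"
  shows "\<exists>k \<phi>. approximation k \<phi> N"
proof -
  let ?H = "Hom_module R M N"
  interpret N: left_module R N by fact
  interpret H: left_module A ?H by (rule Hom[OF N(1)])
  obtain G where G: "finite G" "G \<subseteq> carrier ?H" "span A ?H G = carrier ?H"
    using Hom_fg_A[OF N] unfolding finitely_generated_module_def span_def by auto
  obtain hs where hs: "set hs = G" using G(1) finite_list by auto
  let ?k = "length hs"
  have hc: "hs ! j \<in> carrier ?H" if "j < ?k" for j using that hs G(2) by auto
  let ?\<phi> = "\<lambda>v. \<Oplus>\<^bsub>N\<^esub>j\<in>{..<?k}. (hs ! j) (v j)"
  have \<phi>: "?\<phi> \<in> mod_hom R (Mn ?k) N" "\<And>j x. j < ?k \<Longrightarrow> x \<in> carrier M \<Longrightarrow> ?\<phi> (copower_inj ?k M j x) = (hs ! j) x"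
    using copower_hom[OF M(1) N(1), of ?k "\<lambda>j. hs ! j"] Hom_mem(1)[OF hc] by simp_all
  let ?F = "Hom_module R M (Mn ?k)"
  interpret FH: module_pair A ?F ?H by (rule module_pair.intro[OF Hom[OF Mn(1)] H.left_module_axioms])
  let ?p = "\<lambda>w. compose (carrier M) ?\<phi> w"
  have p: "?p \<in> mod_hom A ?F ?H" by (rule Hom_push[OF M(1) \<phi>(1)])
  have im: "submodule (?p ` carrier ?F) A ?H" by (rule FH.hom_image_submodule[OF p FH.V.submod_carrier])
  have "G \<subseteq> ?p ` carrier ?F"
  proof
    fix h assume "h \<in> G"
    then obtain j where j: "j < ?k" "h = hs ! j" using hs by (auto simp: in_set_conv_nth)
    have w: "restrict (copower_inj ?k M j) (carrier M) \<in> carrier ?F"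
      by (rule Hom_restrictI[OF M.copower_inj_hom[OF j(1)]])
    have "?p (restrict (copower_inj ?k M j) (carrier M)) = h"
    proof (rule Hom_eqI)
      show "?p (restrict (copower_inj ?k M j) (carrier M)) \<in> carrier ?H" by (rule mod_homD(1)[OF p w])
      show "h \<in> carrier ?H" using hc j by simp
      show "?p (restrict (copower_inj ?k M j) (carrier M)) x = h x" if "x \<in> carrier M" for x
        using that \<phi>(2)[OF j(1) that] j(2) by (simp add: compose_def)
    qed
    then show "h \<in> ?p ` carrier ?F" using w by (rule image_eqI[OF sym])
  qed
  from H.span_least[OF this im] have "carrier ?H \<subseteq> ?p ` carrier ?F" unfolding G(3) .
  then have sub: "h \<in> ?p ` carrier ?F" if "h \<in> carrier ?H" for h using that by (rule subsetD)
  have "approximation ?k ?\<phi> N"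
    unfolding approximation_def
  proof (intro conjI ballI)
    fix h assume "h \<in> carrier ?H"
    from sub[OF this] obtain w where "h = ?p w" "w \<in> carrier ?F" by (rule imageE)
    then show "\<exists>w\<in>carrier ?F. ?p w = h" by (intro bexI[of _ w]) (rule sym)
  qed (fact \<phi>(1))
  then show ?thesis by (intro exI)
qed

subsection \<open>Direct summands of powers of M\<close>

definition idem :: "nat \<Rightarrow> ((nat \<Rightarrow> 'm) \<Rightarrow> (nat \<Rightarrow> 'm)) \<Rightarrow> bool" where
  "idem k e \<longleftrightarrow> e \<in> mod_hom R (Mn k) (Mn k) \<and> (\<forall>v\<in>carrier (Mn k). e (e v) = e v)"

definition summand :: "nat \<Rightarrow> ((nat \<Rightarrow> 'm) \<Rightarrow> (nat \<Rightarrow> 'm)) \<Rightarrow> ('a, nat \<Rightarrow> 'm) module" where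
  "summand k e = (Mn k)\<lparr>carrier := e ` carrier (Mn k)\<rparr>"

lemma summand_sub:
  assumes e: "idem k e"
  shows "submodule (e ` carrier (Mn k)) R (Mn k)" "left_module R (summand k e)" "finitely_generated_module R (summand k e)"
    "e \<in> mod_hom R (Mn k) (summand k e)" "\<And>y. y \<in> carrier (summand k e) \<Longrightarrow> y \<in> carrier (Mn k)"
    "\<And>y. y \<in> carrier (summand k e) \<Longrightarrow> e y = y"
proof -
  have eh: "e \<in> mod_hom R (Mn k) (Mn k)" using e by (simp add: idem_def)
  interpret C: left_module R "Mn k" by (rule Mn)
  interpret CC: module_pair R "Mn k" "Mn k" by (rule module_pair.intro[OF Mn(1) Mn(1)])
  show S: "submodule (e ` carrier (Mn k)) R (Mn k)" by (rule CC.hom_image_submodule[OF eh C.submod_carrier])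
  show "left_module R (summand k e)" unfolding summand_def by (rule C.submodule_left_module[OF S])
  show "finitely_generated_module R (summand k e)"
    unfolding summand_def C.fg_submodule_iff[OF S] by (rule fg_submodule[OF R Mn S])
  show "e \<in> mod_hom R (Mn k) (summand k e)" unfolding summand_def by (rule mod_hom_cod[OF eh]) (rule imageI)
  show "y \<in> carrier (Mn k)" if "y \<in> carrier (summand k e)" for y
    using that C.submodD(1)[OF S] by (auto simp: summand_def)
  show "e y = y" if "y \<in> carrier (summand k e)" for y
    using that e by (auto simp: summand_def idem_def)
qed

text \<open>
  Together with the coordinate maps below, these elements form a dual basis of \<open>Hom(M, e(M\<^sup>k))\<close> over
  \<open>A\<close>, which shows that this module is finitely generated projective.
\<close>

definition basis :: "nat \<Rightarrow> ((nat \<Rightarrow> 'm) \<Rightarrow> (nat \<Rightarrow> 'm)) \<Rightarrow> nat \<Rightarrow> 'm \<Rightarrow> (nat \<Rightarrow> 'm)" where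
  "basis k e j = (\<lambda>x\<in>carrier M. e (copower_inj k M j x))"

lemma basis_mem:
  assumes e: "idem k e" and j: "j < k" shows "basis k e j \<in> carrier (Hom_module R M (summand k e))"
  unfolding basis_def
  by (rule Hom_restrictI[OF mod_hom_comp[OF M.copower_inj_hom[OF j] summand_sub(4)[OF e]]])

definition coord :: "nat \<Rightarrow> ('m \<Rightarrow> (nat \<Rightarrow> 'm)) \<Rightarrow> 'm \<Rightarrow> 'm" where
  "coord j h = (\<lambda>x\<in>carrier M. h x j)"

lemma coord_hom:
  assumes e: "idem k e" and j: "j < k"
  shows "coord j \<in> mod_hom A (Hom_module R M (summand k e)) (regular_module A)"
proof (rule mod_homI)
  have H: "h \<in> mod_hom R M (Mn k)" if "h \<in> carrier (Hom_module R M (summand k e))" for h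
    by (rule mod_hom_cod'[OF Hom_mem(1)[OF that, unfolded summand_def]])
      (use summand_sub(5)[OF e] in \<open>auto simp: summand_def\<close>)
  have pj: "(\<lambda>v. v j) \<in> mod_hom R (Mn k) M" by (rule copower_proj_hom) (use j in simp)
  fix h assume h: "h \<in> carrier (Hom_module R M (summand k e))"
  show "coord j h \<in> carrier (regular_module A)"
    using Hom_restrictI[OF mod_hom_comp[OF H[OF h] pj]] by (simp add: coord_def regular_module_def End_op_simps Hom_simps)
  fix g assume g: "g \<in> carrier (Hom_module R M (summand k e))"
  show "coord j (h \<oplus>\<^bsub>Hom_module R M (summand k e)\<^esub> g) = coord j h \<oplus>\<^bsub>regular_module A\<^esub> coord j g"
    using j by (auto simp: coord_def regular_module_def End_op_simps Hom_simps summand_def copower_simps fun_eq_iff)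
next
  fix a h assume a: "a \<in> carrier A" and h: "h \<in> carrier (Hom_module R M (summand k e))"
  have "a x \<in> carrier M" if "x \<in> carrier M" for x using a that mod_homD(1)[of a R M M] by (auto simp: End_op_simps)
  then show "coord j (a \<odot>\<^bsub>Hom_module R M (summand k e)\<^esub> h) = a \<odot>\<^bsub>regular_module A\<^esub> coord j h"
    by (auto simp: coord_def regular_module_def End_op_simps Hom_simps compose_def fun_eq_iff)
qed

lemma basis_decomp:
  assumes e: "idem k e" and h: "h \<in> carrier (Hom_module R M (summand k e))"
  shows "h = (\<Oplus>\<^bsub>Hom_module R M (summand k e)\<^esub>j\<in>{..<k}. coord j h \<odot>\<^bsub>Hom_module R M (summand k e)\<^esub> basis k e j)"
proof -
  let ?Y = "summand k e" and ?H = "Hom_module R M (summand k e)"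
  have Y: "left_module R ?Y" by (rule summand_sub(2)[OF e])
  interpret H: left_module A ?H by (rule Hom[OF Y])
  interpret CY: module_pair R "Mn k" ?Y by (rule module_pair.intro[OF Mn(1) Y])
  have cj: "coord j h \<in> carrier A" if "j < k" for j
    using mod_homD(1)[OF coord_hom[OF e that] h] by (simp add: regular_module_def)
  have t: "(\<lambda>j. coord j h \<odot>\<^bsub>?H\<^esub> basis k e j) \<in> {..<k} \<rightarrow> carrier ?H"
    using cj basis_mem[OF e] H.smult_closed by auto
  show ?thesis
  proof (rule Hom_eqI[OF h H.M.finsum_closed[OF t]])
    fix x assume x: "x \<in> carrier M"
    have hx: "h x \<in> carrier ?Y" by (rule Hom_mem(3)[OF h x])
    then have hxM: "h x \<in> carrier (Mn k)" by (rule summand_sub(5)[OF e])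
    then have hxj: "h x j \<in> carrier M" if "j < k" for j using that by (auto simp: copower_carrier)
    have ij: "(\<lambda>j. copower_inj k M j (h x j)) \<in> {..<k} \<rightarrow> carrier (Mn k)"
      using mod_homD(1)[OF M.copower_inj_hom] hxj by auto
    have "(\<Oplus>\<^bsub>?H\<^esub>j\<in>{..<k}. coord j h \<odot>\<^bsub>?H\<^esub> basis k e j) x = (\<Oplus>\<^bsub>?Y\<^esub>j\<in>{..<k}. (coord j h \<odot>\<^bsub>?H\<^esub> basis k e j) x)"
      by (rule Hom_finsum_eval[OF M(1) Y finite_lessThan t x])
    also have "\<dots> = (\<Oplus>\<^bsub>?Y\<^esub>j\<in>{..<k}. e (copower_inj k M j (h x j)))"
    proof (rule CY.W.M.finsum_cong')
      show "(coord j h \<odot>\<^bsub>?H\<^esub> basis k e j) x = e (copower_inj k M j (h x j))" if "j \<in> {..<k}" for j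
        using that x hxj by (simp add: Hom_simps compose_def coord_def basis_def)
      show "(\<lambda>j. e (copower_inj k M j (h x j))) \<in> {..<k} \<rightarrow> carrier ?Y"
        using ij mod_homD(1)[OF summand_sub(4)[OF e]] by auto
    qed simp
    also have "\<dots> = e (\<Oplus>\<^bsub>Mn k\<^esub>j\<in>{..<k}. copower_inj k M j (h x j))"
      by (rule CY.hom_finsum[OF summand_sub(4)[OF e] finite_lessThan ij, symmetric])
    also have "\<dots> = e (h x)" using M.copower_decomp[OF hxM] by simp
    also have "\<dots> = h x" by (rule summand_sub(6)[OF e hx])
    finally show "h x = (\<Oplus>\<^bsub>?H\<^esub>j\<in>{..<k}. coord j h \<odot>\<^bsub>?H\<^esub> basis k e j) x" by simp
  qed
qed

text \<open>
  The functor \<open>Hom(M, -)\<close> is full on summands of powers of \<open>M\<close>: an \<open>A\<close>-linear map is determined by its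
  values on the basis, and these values are homomorphisms from \<open>M\<close> to \<open>N\<close>, which add up to one from \<open>M\<^sup>k\<close>.
\<close>

lemma yoneda:
  assumes e: "idem k e" and N: "left_module R N"
    and g: "g \<in> mod_hom A (Hom_module R M (summand k e)) (Hom_module R M N)"
  obtains G where "G \<in> mod_hom R (Mn k) N"
    "\<And>h. h \<in> carrier (Hom_module R M (summand k e)) \<Longrightarrow> compose (carrier M) G h = g h"
proof -
  let ?Y = "summand k e" and ?H = "Hom_module R M (summand k e)" and ?HN = "Hom_module R M N"
  have Y: "left_module R ?Y" by (rule summand_sub(2)[OF e])
  interpret N: left_module R N by fact
  interpret HN: module_pair A ?H ?HN by (rule module_pair.intro[OF Hom[OF Y] Hom[OF N]])
  have gb: "g (basis k e j) \<in> carrier ?HN" if "j < k" for j by (rule mod_homD(1)[OF g basis_mem[OF e that]])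
  let ?G = "\<lambda>v. \<Oplus>\<^bsub>N\<^esub>j\<in>{..<k}. g (basis k e j) (v j)"
  have G: "?G \<in> mod_hom R (Mn k) N" by (rule copower_hom(1)[OF M(1) N Hom_mem(1)[OF gb]])
  have eq: "compose (carrier M) ?G h = g h" if h: "h \<in> carrier ?H" for h
  proof -
    have cj: "coord j h \<in> carrier A" if "j < k" for j
      using mod_homD(1)[OF coord_hom[OF e that] h] by (simp add: regular_module_def)
    have t: "(\<lambda>j. coord j h \<odot>\<^bsub>?H\<^esub> basis k e j) \<in> {..<k} \<rightarrow> carrier ?H"
      using cj basis_mem[OF e] HN.V.smult_closed by auto
    have t': "(\<lambda>j. coord j h \<odot>\<^bsub>?HN\<^esub> g (basis k e j)) \<in> {..<k} \<rightarrow> carrier ?HN"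
      using cj gb HN.W.smult_closed by auto
    have hM: "h x \<in> carrier (Mn k)" if "x \<in> carrier M" for x
      using summand_sub(5)[OF e Hom_mem(3)[OF h that]] .
    have hxj: "h x j \<in> carrier M" if "x \<in> carrier M" "j < k" for x j
      using hM[OF that(1)] that(2) by (auto simp: copower_carrier)
    have gh: "g h = (\<Oplus>\<^bsub>?HN\<^esub>j\<in>{..<k}. coord j h \<odot>\<^bsub>?HN\<^esub> g (basis k e j))"
    proof -
      have "g h = g (\<Oplus>\<^bsub>?H\<^esub>j\<in>{..<k}. coord j h \<odot>\<^bsub>?H\<^esub> basis k e j)"
        by (rule arg_cong[OF basis_decomp[OF e h]])
      also have "\<dots> = (\<Oplus>\<^bsub>?HN\<^esub>j\<in>{..<k}. g (coord j h \<odot>\<^bsub>?H\<^esub> basis k e j))"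
        by (rule HN.hom_finsum[OF g finite_lessThan t])
      also have "\<dots> = (\<Oplus>\<^bsub>?HN\<^esub>j\<in>{..<k}. coord j h \<odot>\<^bsub>?HN\<^esub> g (basis k e j))"
        by (rule HN.W.M.finsum_cong'[OF refl t']) (use mod_homD(3)[OF g cj basis_mem[OF e]] in simp)
      finally show ?thesis .
    qed
    show ?thesis
    proof (rule Hom_eqI)
      show "g h \<in> carrier ?HN" by (rule mod_homD(1)[OF g h])
      have hMn: "h \<in> mod_hom R M (Mn k)"
        by (rule mod_homI) (use hM mod_homD(2,3)[OF Hom_mem(1)[OF h]] in \<open>simp_all add: summand_def\<close>)
      show "compose (carrier M) ?G h \<in> carrier ?HN"
        using Hom_restrictI[OF mod_hom_comp[OF hMn G]] by (simp add: compose_def)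
      fix x assume x: "x \<in> carrier M"
      have "g h x = (\<Oplus>\<^bsub>N\<^esub>j\<in>{..<k}. (coord j h \<odot>\<^bsub>?HN\<^esub> g (basis k e j)) x)"
        unfolding gh by (rule Hom_finsum_eval[OF M(1) N finite_lessThan t' x])
      also have "\<dots> = (\<Oplus>\<^bsub>N\<^esub>j\<in>{..<k}. g (basis k e j) (h x j))"
        by (rule N.M.finsum_cong') (use x hxj Hom_mem(3)[OF gb] in \<open>auto simp: Hom_simps compose_def coord_def\<close>)
      finally show "compose (carrier M) ?G h x = g h x" using x by (simp add: compose_def)
    qed
  qed
  show thesis by (rule that[OF G eq])
qed

lemma Hom_summand_lift:
  assumes e: "idem k e" and B: "left_module A B" and C: "\<And>j. j \<in> J \<Longrightarrow> left_module A (C j)"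
    and f: "\<And>j. j \<in> J \<Longrightarrow> f j \<in> mod_hom A (Hom_module R M (summand k e)) (C j)"
    and g: "\<And>j. j \<in> J \<Longrightarrow> g j \<in> mod_hom A B (C j)"
    and ex: "\<And>y. y \<in> carrier (Hom_module R M (summand k e)) \<Longrightarrow> \<exists>b\<in>carrier B. \<forall>j\<in>J. g j b = f j y"
  shows "\<exists>h\<in>mod_hom A (Hom_module R M (summand k e)) B.
    \<forall>y\<in>carrier (Hom_module R M (summand k e)). \<forall>j\<in>J. g j (h y) = f j y"
proof -
  let ?H = "Hom_module R M (summand k e)" and ?F = "copower {..<k} (regular_module A)"
  interpret H: left_module A ?H by (rule Hom[OF summand_sub(2)[OF e]])
  interpret RA: left_module A "regular_module A" by (rule regular_left_module[OF A])
  define s where "s h = (\<lambda>j\<in>{..<k}. coord j h)" for h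
  define q where "q a = (\<Oplus>\<^bsub>?H\<^esub>j\<in>{..<k}. a j \<odot>\<^bsub>?H\<^esub> basis k e j)" for a
  have s: "s \<in> mod_hom A ?H ?F"
  proof (rule mod_homI)
    show "s h \<in> carrier ?F" if "h \<in> carrier ?H" for h
      unfolding s_def copower_carrier using mod_homD(1)[OF coord_hom[OF e] that] by auto
    show "s (h \<oplus>\<^bsub>?H\<^esub> h') = s h \<oplus>\<^bsub>?F\<^esub> s h'" if "h \<in> carrier ?H" "h' \<in> carrier ?H" for h h'
      unfolding s_def copower_simps by (rule restrict_ext) (use mod_homD(2)[OF coord_hom[OF e] that] in simp)
    show "s (a \<odot>\<^bsub>?H\<^esub> h) = a \<odot>\<^bsub>?F\<^esub> s h" if "a \<in> carrier A" "h \<in> carrier ?H" for a h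
      unfolding s_def copower_simps by (rule restrict_ext) (use mod_homD(3)[OF coord_hom[OF e] that] in simp)
  qed
  have q: "q \<in> mod_hom A ?F ?H"
    unfolding q_def
  proof (rule copower_hom(1)[OF RA.left_module_axioms H.left_module_axioms, of k "\<lambda>j a. a \<odot>\<^bsub>?H\<^esub> basis k e j"])
    fix j assume "j < k"
    then have b: "basis k e j \<in> carrier ?H" by (rule basis_mem[OF e])
    show "(\<lambda>a. a \<odot>\<^bsub>?H\<^esub> basis k e j) \<in> mod_hom A (regular_module A) ?H"
    proof (rule mod_homI)
      fix a c assume "a \<in> carrier A" "c \<in> carrier (regular_module A)"
      then show "(a \<odot>\<^bsub>regular_module A\<^esub> c) \<odot>\<^bsub>?H\<^esub> basis k e j = a \<odot>\<^bsub>?H\<^esub> (c \<odot>\<^bsub>?H\<^esub> basis k e j)"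
        using H.smult_assoc1[OF _ _ b, of a c] by (simp add: regular_module_def)
    next
      fix a c assume "a \<in> carrier (regular_module A)" "c \<in> carrier (regular_module A)"
      then show "(a \<oplus>\<^bsub>regular_module A\<^esub> c) \<odot>\<^bsub>?H\<^esub> basis k e j = a \<odot>\<^bsub>?H\<^esub> basis k e j \<oplus>\<^bsub>?H\<^esub> c \<odot>\<^bsub>?H\<^esub> basis k e j"
        using H.smult_l_distr[OF _ _ b, of a c] by (simp add: regular_module_def)
    next
      fix a assume "a \<in> carrier (regular_module A)"
      then show "a \<odot>\<^bsub>?H\<^esub> basis k e j \<in> carrier ?H" using H.smult_closed[OF _ b, of a] by (simp add: regular_module_def)
    qed
  qed
  have qs: "q (s h) = h" if h: "h \<in> carrier ?H" for h
  proof -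
    have cj: "coord j h \<in> carrier A" if "j < k" for j
      using mod_homD(1)[OF coord_hom[OF e that] h] by (simp add: regular_module_def)
    have "q (s h) = (\<Oplus>\<^bsub>?H\<^esub>j\<in>{..<k}. coord j h \<odot>\<^bsub>?H\<^esub> basis k e j)"
      unfolding q_def by (rule H.M.finsum_cong') (use cj basis_mem[OF e] H.smult_closed in \<open>auto simp: s_def\<close>)
    then show ?thesis using basis_decomp[OF e h] by simp
  qed
  note L = lift_dual_basis[where J = J and C = C and f = f and g = g and B = B and s = s and q = q and I = "{..<k}",
      OF A H.left_module_axioms s q qs B C f g ex]
  show ?thesis by (rule L) assumption+
qed

end

section \<open>Resolutions by powers of M\<close>

locale resolution_setup = hom_setup R M + K0_subgroup R H
  for R :: "('a, 'r) ring_scheme" and M :: "('a, 'm, 'x) module_scheme"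
    and H :: "(('a, 'a mod_univ) module \<Rightarrow>\<^sub>0 int) set" +
  assumes class_summand: "\<And>k e. idem k e \<Longrightarrow> class_in (summand k e)"
    and class_prime: "\<And>p. p \<in> Spec R \<Longrightarrow> trace_ideal R M \<subseteq> p \<Longrightarrow> class_in (quotient_module (regular_module R) p)"
begin

lemma idem_id: "idem k (\<lambda>v. v)" "summand k (\<lambda>v. v) = Mn k"
  by (auto simp: idem_def mod_hom_id summand_def)

lemma class_power: "class_in (Mn k)"
  using class_summand[OF idem_id(1), of k] by (simp only: idem_id)

text \<open>
  For \<open>g\<close> from \<open>M\<close> to \<open>R\<close>, the element \<open>g(x)y\<close> is the value at \<open>x\<close> of the homomorphism \<open>z \<mapsto> g(z)y\<close>.
\<close>

lemma trace_ideal_smult: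
  assumes N: "left_module R N" and I: "submodule I R N"
    and h: "\<And>h x. h \<in> carrier (Hom_module R M N) \<Longrightarrow> x \<in> carrier M \<Longrightarrow> h x \<in> I"
    and t: "t \<in> trace_ideal R M" and y: "y \<in> carrier N"
  shows "t \<odot>\<^bsub>N\<^esub> y \<in> I"
proof -
  interpret N: left_module R N by fact
  note I' = N.submodD[OF I]
  let ?J = "{t \<in> carrier R. t \<odot>\<^bsub>N\<^esub> y \<in> I}"
  have J: "ideal ?J R"
    by (rule R.ring_idealI) (use I' y N.smult_l_distr N.smult_assoc1 in auto)
  have "{g x |g x. g \<in> mod_hom R M (regular_module R) \<and> x \<in> carrier M} \<subseteq> ?J"
  proof
    fix s assume "s \<in> {g x |g x. g \<in> mod_hom R M (regular_module R) \<and> x \<in> carrier M}"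
    then obtain g x where s: "s = g x" "g \<in> mod_hom R M (regular_module R)" "x \<in> carrier M" by auto
    note gD = mod_homD[OF s(2)]
    have gc: "g z \<in> carrier R" if "z \<in> carrier M" for z using gD(1)[OF that] by (simp add: regular_module_def)
    have "(\<lambda>z. g z \<odot>\<^bsub>N\<^esub> y) \<in> mod_hom R M N"
      by (rule mod_homI) (use gD(2,3) gc y in \<open>auto simp: regular_module_def N.smult_l_distr N.smult_assoc1\<close>)
    from h[OF Hom_restrictI[OF this] s(3)] have "g x \<odot>\<^bsub>N\<^esub> y \<in> I" using s(3) by simp
    then show "s \<in> ?J" using s(1) gc[OF s(3)] by simp
  qed
  from R.genideal_minimal[OF J this] have "trace_ideal R M \<subseteq> ?J" unfolding trace_ideal_def .
  then show ?thesis using t by blast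
qed

lemma trace_ideal_carrier: "trace_ideal R M \<subseteq> carrier R"
proof -
  have "{g x |g x. g \<in> mod_hom R M (regular_module R) \<and> x \<in> carrier M} \<subseteq> carrier R"
    using mod_homD(1)[of _ R M "regular_module R"] by (auto simp: regular_module_def)
  from R.genideal_ideal[OF this] show ?thesis unfolding trace_ideal_def by (rule R.ring_idealD(1))
qed

text \<open>
  If \<open>I\<close> contains the images of all homomorphisms from \<open>M\<close>, the quotient \<open>N/I\<close> is killed by the trace
  ideal, so devissage applies to it.
\<close>

lemma class_extend:
  assumes N: "left_module R N" "finitely_generated_module R N" and I: "submodule I R N" "class_in (N\<lparr>carrier := I\<rparr>)"
    and h: "\<And>h x. h \<in> carrier (Hom_module R M N) \<Longrightarrow> x \<in> carrier M \<Longrightarrow> h x \<in> I"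
  shows "class_in N"
proof -
  interpret N: left_module R N by fact
  let ?Q = "quotient_module N I"
  obtain \<pi> where Q: "left_module R ?Q" "\<pi> \<in> mod_hom R N ?Q" "\<pi> ` carrier N = carrier ?Q"
    "\<And>x. x \<in> carrier N \<Longrightarrow> \<pi> x = \<zero>\<^bsub>?Q\<^esub> \<longleftrightarrow> x \<in> I"
    using N.quotient_module[OF I(1)] by metis
  have "class_in ?Q"
  proof (rule devissage[OF Q(1) fg_image[OF N Q(1-3)] _ trace_ideal_carrier class_prime])
    fix t q assume t: "t \<in> trace_ideal R M" and q: "q \<in> carrier ?Q"
    obtain y where y: "y \<in> carrier N" "q = \<pi> y" using q Q(3) by blast
    have tc: "t \<in> carrier R" using t trace_ideal_carrier by blast
    have "t \<odot>\<^bsub>?Q\<^esub> q = \<pi> (t \<odot>\<^bsub>N\<^esub> y)" using mod_homD(3)[OF Q(2) tc y(1)] y(2) by simp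
    moreover have "t \<odot>\<^bsub>N\<^esub> y \<in> I" by (rule trace_ideal_smult[OF N(1) I(1) _ t y(1)]) (rule h)
    then have "\<pi> (t \<odot>\<^bsub>N\<^esub> y) = \<zero>\<^bsub>?Q\<^esub>" using Q(4) tc y(1) by simp
    ultimately show "t \<odot>\<^bsub>?Q\<^esub> q = \<zero>\<^bsub>?Q\<^esub>" by simp
  qed
  moreover have "{x \<in> carrier N. \<pi> x = \<zero>\<^bsub>?Q\<^esub>} = I" using Q(4) N.submodD(1)[OF I(1)] by auto
  ultimately show ?thesis using class_in_middle[OF N Q(2,3)] I(2) by simp
qed

text \<open>
  The power of \<open>M\<close> and the kernel determine the class of the image of \<open>\<phi>\<close>, which contains all images of
  homomorphisms from \<open>M\<close>.
\<close>

lemma class_from_kernel: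
  assumes N: "left_module R N" "finitely_generated_module R N" and \<phi>: "approximation k \<phi> N"
    and ker: "class_in ((Mn k)\<lparr>carrier := {v \<in> carrier (Mn k). \<phi> v = \<zero>\<^bsub>N\<^esub>}\<rparr>)"
  shows "class_in N"
proof -
  have \<phi>h: "\<phi> \<in> mod_hom R (Mn k) N" using \<phi> by (simp add: approximation_def)
  interpret N: left_module R N by fact
  interpret CN: module_pair R "Mn k" N by (rule module_pair.intro[OF Mn(1) N(1)])
  let ?I = "\<phi> ` carrier (Mn k)"
  have I: "submodule ?I R N" by (rule CN.hom_image_submodule[OF \<phi>h CN.V.submod_carrier])
  have "class_in (N\<lparr>carrier := ?I\<rparr>)"
  proof (rule class_in_image[OF class_power N.submodule_left_module[OF I] mod_hom_cod[OF \<phi>h]])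
    show "class_in ((Mn k)\<lparr>carrier := {v \<in> carrier (Mn k). \<phi> v = \<zero>\<^bsub>N\<lparr>carrier := ?I\<rparr>\<^esub>}\<rparr>)" using ker by simp
  qed auto
  then show ?thesis
  proof (rule class_extend[OF N I])
    fix h x assume h: "h \<in> carrier (Hom_module R M N)" and x: "x \<in> carrier M"
    obtain w where w: "w \<in> carrier (Hom_module R M (Mn k))" "compose (carrier M) \<phi> w = h"
      using \<phi> h unfolding approximation_def by auto
    have "h x = \<phi> (w x)" using w(2) x by (auto simp: compose_def)
    then show "h x \<in> ?I" using Hom_mem(3)[OF w(1) x] by blast
  qed
qed

lemma Hom_sub:
  assumes "W \<subseteq> carrier V"
  shows "Hom_module R M (V\<lparr>carrier := W\<rparr>) = (Hom_module R M V)\<lparr>carrier := {h \<in> carrier (Hom_module R M V). \<forall>x\<in>carrier M. h x \<in> W}\<rparr>"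
  unfolding Hom_module_def mod_hom_def using assms by (auto simp: Pi_iff)

lemma Mn_hom_eqI:
  assumes N: "left_module R N" and f: "f \<in> mod_hom R (Mn k) N" and g: "g \<in> mod_hom R (Mn k) N"
    and eq: "\<And>h x. h \<in> carrier (Hom_module R M (Mn k)) \<Longrightarrow> x \<in> carrier M \<Longrightarrow> f (h x) = g (h x)"
    and v: "v \<in> carrier (Mn k)"
  shows "f v = g v"
proof -
  interpret CN: module_pair R "Mn k" N by (rule module_pair.intro[OF Mn(1) N])
  have vj: "v j \<in> carrier M" if "j < k" for j using v that by (auto simp: copower_carrier)
  have ij: "(\<lambda>j. copower_inj k M j (v j)) \<in> {..<k} \<rightarrow> carrier (Mn k)"
    using mod_homD(1)[OF M.copower_inj_hom] vj by auto
  let ?s = "\<Oplus>\<^bsub>Mn k\<^esub>j\<in>{..<k}. copower_inj k M j (v j)"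
  have "f ?s = (\<Oplus>\<^bsub>N\<^esub>j\<in>{..<k}. f (copower_inj k M j (v j)))" by (rule CN.hom_finsum[OF f finite_lessThan ij])
  also have "\<dots> = (\<Oplus>\<^bsub>N\<^esub>j\<in>{..<k}. g (copower_inj k M j (v j)))"
  proof (rule CN.W.M.finsum_cong'[OF refl])
    show "(\<lambda>j. g (copower_inj k M j (v j))) \<in> {..<k} \<rightarrow> carrier N" using mod_homD(1)[OF g] ij by auto
    show "f (copower_inj k M j (v j)) = g (copower_inj k M j (v j))" if j: "j \<in> {..<k}" for j
    proof -
      have jk: "j < k" using j by simp
      show ?thesis using eq[OF Hom_restrictI[OF M.copower_inj_hom[OF jk]] vj[OF jk]] vj[OF jk] by simp
    qed
  qed
  also have "\<dots> = g ?s" by (rule CN.hom_finsum[OF g finite_lessThan ij, symmetric])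
  finally show ?thesis using M.copower_decomp[OF v] by simp
qed

text \<open>
  By fullness, \<open>\<sigma>\<close> composed with \<open>Hom(M, \<phi>)\<close> comes from an endomorphism \<open>E\<close> of \<open>M\<^sup>l\<close>. It is idempotent,
  \<open>\<phi>E = \<phi>\<close>, and \<open>Eh = 0\<close> for every \<open>h\<close> from \<open>M\<close> to the kernel of \<open>\<phi>\<close>. So the image of \<open>1 - E\<close> is a
  summand of \<open>M\<^sup>l\<close> inside the kernel and contains the images of all such \<open>h\<close>.
\<close>

lemma split_approximation:
  assumes N: "left_module R N" and \<phi>: "\<phi> \<in> mod_hom R (Mn l) N"
    and \<sigma>: "\<sigma> \<in> mod_hom A (Hom_module R M N) (Hom_module R M (Mn l))"
    and split: "\<And>f. f \<in> carrier (Hom_module R M N) \<Longrightarrow> compose (carrier M) \<phi> (\<sigma> f) = f"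
  shows "class_in ((Mn l)\<lparr>carrier := {v \<in> carrier (Mn l). \<phi> v = \<zero>\<^bsub>N\<^esub>}\<rparr>)" (is "class_in ?N1")
proof -
  interpret C: left_module R "Mn l" by (rule Mn)
  interpret CC: module_pair R "Mn l" "Mn l" by (rule module_pair.intro[OF Mn(1) Mn(1)])
  interpret CN: module_pair R "Mn l" N by (rule module_pair.intro[OF Mn(1) N])
  let ?F = "Hom_module R M (Mn l)" and ?HN = "Hom_module R M N"
  interpret HNF: module_pair A ?HN ?F by (rule module_pair.intro[OF Hom[OF N] Hom[OF Mn(1)]])
  have push: "(\<lambda>h. compose (carrier M) \<phi> h) \<in> mod_hom A ?F ?HN" by (rule Hom_push[OF M(1) \<phi>])
  have "(\<lambda>h. \<sigma> (compose (carrier M) \<phi> h)) \<in> mod_hom A (Hom_module R M (summand l (\<lambda>v. v))) ?F"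
    unfolding idem_id by (rule mod_hom_comp[OF push \<sigma>])
  from yoneda[OF idem_id(1) Mn(1) this] obtain E where E: "E \<in> mod_hom R (Mn l) (Mn l)"
    and Eh: "\<And>h. h \<in> carrier ?F \<Longrightarrow> compose (carrier M) E h = \<sigma> (compose (carrier M) \<phi> h)"
    unfolding idem_id by metis
  have ph: "compose (carrier M) \<phi> h \<in> carrier ?HN" if "h \<in> carrier ?F" for h by (rule mod_homD(1)[OF push that])
  have Ehx: "E (h x) = \<sigma> (compose (carrier M) \<phi> h) x" if "h \<in> carrier ?F" "x \<in> carrier M" for h x
    using fun_cong[OF Eh[OF that(1)], of x] that(2) by (simp add: compose_def)
  have phx: "\<phi> (\<sigma> (compose (carrier M) \<phi> h) x) = \<phi> (h x)" if "h \<in> carrier ?F" "x \<in> carrier M" for h x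
    using fun_cong[OF split[OF ph[OF that(1)]], of x] that(2) by (simp add: compose_def)
  have \<phi>E: "\<phi> (E v) = \<phi> v" if "v \<in> carrier (Mn l)" for v
    by (rule Mn_hom_eqI[OF N mod_hom_comp[OF E \<phi>] \<phi> _ that]) (simp add: Ehx phx)
  have EE: "E (E v) = E v" if "v \<in> carrier (Mn l)" for v
  proof (rule Mn_hom_eqI[OF Mn(1) mod_hom_comp[OF E E] E _ that])
    fix h x assume h: "h \<in> carrier ?F" and x: "x \<in> carrier M"
    let ?g = "\<sigma> (compose (carrier M) \<phi> h)"
    have g: "?g \<in> carrier ?F" by (rule mod_homD(1)[OF \<sigma> ph[OF h]])
    have "E (E (h x)) = E (?g x)" using Ehx[OF h x] by simp
    also have "\<dots> = \<sigma> (compose (carrier M) \<phi> ?g) x" by (rule Ehx[OF g x])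
    also have "compose (carrier M) \<phi> ?g = compose (carrier M) \<phi> h" by (rule split[OF ph[OF h]])
    finally show "E (E (h x)) = E (h x)" using Ehx[OF h x] by simp
  qed
  let ?E = "\<lambda>v. v \<ominus>\<^bsub>Mn l\<^esub> E v"
  have Ec: "E v \<in> carrier (Mn l)" if "v \<in> carrier (Mn l)" for v by (rule mod_homD(1)[OF E that])
  have E': "?E \<in> mod_hom R (Mn l) (Mn l)" by (rule CC.minus_hom[OF mod_hom_id E])
  have EE': "E (?E v) = \<zero>\<^bsub>Mn l\<^esub>" if "v \<in> carrier (Mn l)" for v
    using CC.hom_minus[OF E that Ec[OF that]] EE[OF that] C.minus_self[OF Ec[OF that]] by simp
  have idem: "idem l ?E"
    unfolding idem_def using E' EE' C.minus_zero mod_homD(1)[OF E'] by auto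
  let ?W = "{v \<in> carrier (Mn l). \<phi> v = \<zero>\<^bsub>N\<^esub>}"
  have W: "submodule ?W R (Mn l)" by (rule CN.hom_kernel_submodule[OF \<phi>])
  have N1: "left_module R ?N1" by (rule C.submodule_left_module[OF W])
  have N1fg: "finitely_generated_module R ?N1" unfolding C.fg_submodule_iff[OF W] by (rule fg_submodule[OF R Mn W])
  let ?I = "?E ` carrier (Mn l)"
  have "?I \<subseteq> ?W"
  proof
    fix y assume "y \<in> ?I"
    then obtain v where v: "v \<in> carrier (Mn l)" "y = ?E v" by blast
    have "\<phi> (?E v) = \<phi> v \<ominus>\<^bsub>N\<^esub> \<phi> (E v)" by (rule CN.hom_minus[OF \<phi> v(1) Ec[OF v(1)]])
    also have "\<dots> = \<zero>\<^bsub>N\<^esub>" using \<phi>E[OF v(1)] CN.W.minus_self[OF mod_homD(1)[OF \<phi> v(1)]] by simp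
    finally show "y \<in> ?W" using v mod_homD(1)[OF E' v(1)] by simp
  qed
  then have I: "submodule ?I R ?N1"
    using C.submodule_restrict_iff[OF W] summand_sub(1)[OF idem] by simp
  show ?thesis
  proof (rule class_extend[OF N1 N1fg I])
    show "class_in (?N1\<lparr>carrier := ?I\<rparr>)" using class_summand[OF idem] by (simp add: summand_def)
    fix h x assume h: "h \<in> carrier (Hom_module R M ?N1)" and x: "x \<in> carrier M"
    have hF: "h \<in> carrier ?F" and hW: "\<And>x. x \<in> carrier M \<Longrightarrow> h x \<in> ?W"
      using h Hom_sub[of ?W "Mn l"] by auto
    have hx: "h x \<in> carrier (Mn l)" using hW[OF x] by simp
    have "compose (carrier M) \<phi> h = \<zero>\<^bsub>?HN\<^esub>"
      unfolding compose_def Hom_simps by (rule restrict_ext) (use hW in simp)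
    then have "\<sigma> (compose (carrier M) \<phi> h) = \<zero>\<^bsub>?F\<^esub>" using HNF.hom_zero[OF \<sigma>] by simp
    then have "E (h x) = \<zero>\<^bsub>Mn l\<^esub>" using Ehx[OF hF x] x by (simp add: Hom_simps)
    then have eq: "h x = ?E (h x)" using C.minus_zero[OF hx] by simp
    show "h x \<in> ?I" by (rule image_eqI[where x = "h x"]) (rule eq, rule hx)
  qed
qed

lemma projective_resolution_Suc:
  assumes "projective_resolution B K (Suc n) P d e"
  shows "projective_resolution B ((P 0)\<lparr>carrier := a_kernel (P 0) K e\<rparr>) n (\<lambda>i. P (Suc i)) (\<lambda>i. d (Suc i)) (d 0)"
proof -
  let ?K = "(P 0)\<lparr>carrier := a_kernel (P 0) K e\<rparr>"
  have pr: "\<And>i. i \<le> Suc n \<Longrightarrow> projective_module B (P i)"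
    and dh: "\<And>i. i < Suc n \<Longrightarrow> d i \<in> mod_hom B (P (Suc i)) (P i)"
    and im: "\<And>i. i < Suc n \<Longrightarrow> d i ` carrier (P (Suc i)) =
        (case i of 0 \<Rightarrow> a_kernel (P 0) K e | Suc j \<Rightarrow> a_kernel (P (Suc j)) (P j) (d j))"
    and inj: "inj_on (d n) (carrier (P (Suc n)))"
    using assms unfolding projective_resolution_def by auto
  have k: "a_kernel (P (Suc 0)) ?K (d 0) = a_kernel (P (Suc 0)) (P 0) (d 0)" by (simp add: a_kernel_def kernel_def)
  have im0: "d 0 ` carrier (P (Suc 0)) = a_kernel (P 0) K e" using im[of 0] by simp
  have d0: "d 0 \<in> mod_hom B (P (Suc 0)) ?K"
    by (rule mod_hom_cod[OF dh]) (use im0 in auto)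
  show ?thesis
    unfolding projective_resolution_def
  proof (intro conjI allI impI)
    show "d (Suc i) ` carrier (P (Suc (Suc i))) =
      (case i of 0 \<Rightarrow> a_kernel (P (Suc 0)) ?K (d 0) | Suc j \<Rightarrow> a_kernel (P (Suc (Suc j))) (P (Suc j)) (d (Suc j)))" if "i < n" for i
      using im[of "Suc i"] that k by (cases i) simp_all
    show "case n of 0 \<Rightarrow> inj_on (d 0) (carrier (P (Suc 0))) | Suc j \<Rightarrow> inj_on (d (Suc j)) (carrier (P (Suc (Suc j))))"
      using inj by (cases n) simp_all
  qed (use pr dh im0 d0 in auto)
qed

text \<open>
  The terms \<open>P i\<close> of the given resolution need not be finitely generated. It is therefore compared with
  the kernels of successive approximations \<open>M\<^sup>l \<rightarrow> N\<close>, and only as many of these are taken as the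
  resolution is long. The maps \<open>\<alpha>\<close> and \<open>\<beta>\<close> compare \<open>Hom(M, N)\<close> with the resolved module \<open>K\<close>, and \<open>s\<close> is a
  homotopy: \<open>\<beta>\<alpha> - 1\<close> factors through \<open>Hom(M, \<phi>)\<close>. Passing to the kernels on both sides preserves such
  data and shortens the resolution by one. Once \<open>K\<close> is projective, \<open>\<beta>\<close> lifts along \<open>Hom(M, \<phi>)\<close> as well;
  then so does the identity, that is, \<open>Hom(M, \<phi>)\<close> splits.

  The homotopy condition is written additively, since addition is the same function on a module and on
  a submodule, while subtraction is defined through the carrier.
\<close>

lemma class_by_resolution:
  fixes N :: "('a, nat \<Rightarrow> 'm) module" and K :: "('m \<Rightarrow> 'm, 'u) module"
  assumes "projective_resolution A K n P d e" and "left_module A K"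
    and "left_module R N" "finitely_generated_module R N" and "approximation l \<phi> N"
    and "\<alpha> \<in> mod_hom A (Hom_module R M N) K" and "\<beta> \<in> mod_hom A K (Hom_module R M N)"
    and "s \<in> mod_hom A (Hom_module R M N) (Hom_module R M (Mn l))"
    and "\<And>f. f \<in> carrier (Hom_module R M N) \<Longrightarrow> compose (carrier M) \<phi> (s f) \<oplus>\<^bsub>Hom_module R M N\<^esub> f = \<beta> (\<alpha> f)"
  shows "class_in N"
  using assms
proof (induct n arbitrary: K P d e N l \<phi> \<alpha> \<beta> s)
  case (0 K P d e N l \<phi> \<alpha> \<beta> s)
  note res = 0(1) and K = 0(2) and N = 0(3,4) and \<phi> = 0(5) and \<alpha> = 0(6) and \<beta> = 0(7) and s = 0(8) and eq = 0(9)
  have \<phi>h: "\<phi> \<in> mod_hom R (Mn l) N" using \<phi> by (simp add: approximation_def)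
  let ?F = "Hom_module R M (Mn l)" and ?HN = "Hom_module R M N"
  have pr: "projective_module A (P 0)" and e: "e \<in> mod_hom A (P 0) K" and bij: "bij_betw e (carrier (P 0)) (carrier K)"
    using res unfolding projective_resolution_def bij_betw_def by auto
  have P0: "left_module A (P 0)" using pr by (simp add: projective_module_def)
  note inv = inv_hom[OF P0 e bij]
  let ?ei = "inv_into (carrier (P 0)) e"
  interpret HN: left_module A ?HN by (rule Hom[OF N(1)])
  interpret F: left_module A ?F by (rule Hom[OF Mn(1)])
  interpret HNF: module_pair A ?HN ?F by (rule module_pair.intro[OF HN.left_module_axioms F.left_module_axioms])
  interpret FHN: module_pair A ?F ?HN by (rule module_pair.intro[OF F.left_module_axioms HN.left_module_axioms])
  have push: "(\<lambda>h. compose (carrier M) \<phi> h) \<in> mod_hom A ?F ?HN" by (rule Hom_push[OF M(1) \<phi>h])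
  have surj: "h \<in> (\<lambda>h. compose (carrier M) \<phi> h) ` carrier ?F" if h: "h \<in> carrier ?HN" for h
  proof -
    obtain w where "w \<in> carrier ?F" "compose (carrier M) \<phi> w = h" using \<phi> h unfolding approximation_def by auto
    then show ?thesis by (intro image_eqI[of _ _ w]) simp_all
  qed
  have "\<exists>\<gamma>\<in>mod_hom A (P 0) ?F. \<forall>p\<in>carrier (P 0). compose (carrier M) \<phi> (\<gamma> p) = \<beta> (e p)"
    by (rule projective_lift[OF A pr F.left_module_axioms HN.left_module_axioms mod_hom_comp[OF e \<beta>] push])
      (rule surj, rule mod_homD(1)[OF \<beta> mod_homD(1)[OF e]])
  then obtain \<gamma> where \<gamma>: "\<gamma> \<in> mod_hom A (P 0) ?F" "\<And>p. p \<in> carrier (P 0) \<Longrightarrow> compose (carrier M) \<phi> (\<gamma> p) = \<beta> (e p)" by auto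
  let ?\<gamma> = "\<lambda>f. \<gamma> (?ei (\<alpha> f))"
  have \<gamma>': "?\<gamma> \<in> mod_hom A ?HN ?F" by (rule mod_hom_comp[OF mod_hom_comp[OF \<alpha> inv(1)] \<gamma>(1)])
  let ?\<sigma> = "\<lambda>f. ?\<gamma> f \<ominus>\<^bsub>?F\<^esub> s f"
  have \<sigma>: "?\<sigma> \<in> mod_hom A ?HN ?F" by (rule HNF.minus_hom[OF \<gamma>' s])
  have "compose (carrier M) \<phi> (?\<sigma> f) = f" if f: "f \<in> carrier ?HN" for f
  proof -
    have sf: "s f \<in> carrier ?F" and gf: "?\<gamma> f \<in> carrier ?F" by (rule mod_homD(1)[OF s f], rule mod_homD(1)[OF \<gamma>' f])
    have af: "\<alpha> f \<in> carrier K" by (rule mod_homD(1)[OF \<alpha> f])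
    have psf: "compose (carrier M) \<phi> (s f) \<in> carrier ?HN" by (rule mod_homD(1)[OF push sf])
    have "compose (carrier M) \<phi> (?\<sigma> f) = compose (carrier M) \<phi> (?\<gamma> f) \<ominus>\<^bsub>?HN\<^esub> compose (carrier M) \<phi> (s f)"
      by (rule FHN.hom_minus[OF push gf sf])
    also have "compose (carrier M) \<phi> (?\<gamma> f) = \<beta> (\<alpha> f)" using \<gamma>(2)[OF inv(5)[OF af]] inv(4)[OF af] by simp
    also have "\<beta> (\<alpha> f) = f \<oplus>\<^bsub>?HN\<^esub> compose (carrier M) \<phi> (s f)" using eq[OF f] HN.M.a_comm[OF psf f] by simp
    also have "\<dots> \<ominus>\<^bsub>?HN\<^esub> compose (carrier M) \<phi> (s f) = f" by (rule HN.plus_minus[OF f psf])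
    finally show ?thesis .
  qed
  from split_approximation[OF N(1) \<phi>h \<sigma> this] show ?case by (rule class_from_kernel[OF N \<phi>])
next
  case (Suc n K P d e N l \<phi> \<alpha> \<beta> s)
  note IH = Suc(1)
  note res = Suc(2) and K = Suc(3) and N = Suc(4,5) and \<phi> = Suc(6) and \<alpha> = Suc(7) and \<beta> = Suc(8) and s = Suc(9) and eq = Suc(10)
  have \<phi>h: "\<phi> \<in> mod_hom R (Mn l) N" using \<phi> by (simp add: approximation_def)
  let ?F = "Hom_module R M (Mn l)" and ?HN = "Hom_module R M N"
  have pr: "projective_module A (P 0)" and e: "e \<in> mod_hom A (P 0) K" and esurj: "e ` carrier (P 0) = carrier K"
    using res unfolding projective_resolution_def by auto
  have P0: "left_module A (P 0)" using pr by (simp add: projective_module_def)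
  interpret P0: left_module A "P 0" by fact
  interpret K: left_module A K by fact
  interpret PK: module_pair A "P 0" K by (rule module_pair.intro[OF P0 K])
  interpret HN: left_module A ?HN by (rule Hom[OF N(1)])
  interpret F: left_module A ?F by (rule Hom[OF Mn(1)])
  interpret HNF: module_pair A ?HN ?F by (rule module_pair.intro[OF HN.left_module_axioms F.left_module_axioms])
  interpret FHN: module_pair A ?F ?HN by (rule module_pair.intro[OF F.left_module_axioms HN.left_module_axioms])
  interpret FF: module_pair A ?F ?F by (rule module_pair.intro[OF F.left_module_axioms F.left_module_axioms])
  interpret HNK: module_pair A ?HN K by (rule module_pair.intro[OF HN.left_module_axioms K])
  interpret KHN: module_pair A K ?HN by (rule module_pair.intro[OF K HN.left_module_axioms])
  interpret CN: module_pair R "Mn l" N by (rule module_pair.intro[OF Mn(1) N(1)])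
  let ?p = "\<lambda>h. compose (carrier M) \<phi> h"
  have push: "?p \<in> mod_hom A ?F ?HN" by (rule Hom_push[OF M(1) \<phi>h])
  have surj: "h \<in> ?p ` carrier ?F" if h: "h \<in> carrier ?HN" for h
  proof -
    obtain w where "w \<in> carrier ?F" "compose (carrier M) \<phi> w = h" using \<phi> h unfolding approximation_def by auto
    then show ?thesis by (intro image_eqI[of _ _ w]) simp_all
  qed
  let ?W = "{v \<in> carrier (Mn l). \<phi> v = \<zero>\<^bsub>N\<^esub>}"
  let ?N1 = "(Mn l)\<lparr>carrier := ?W\<rparr>"
  have W: "submodule ?W R (Mn l)" by (rule CN.hom_kernel_submodule[OF \<phi>h])
  have N1: "left_module R ?N1" by (rule CN.V.submodule_left_module[OF W])
  have N1fg: "finitely_generated_module R ?N1" unfolding CN.V.fg_submodule_iff[OF W] by (rule fg_submodule[OF R Mn W])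
  let ?L1 = "{h \<in> carrier ?F. \<forall>x\<in>carrier M. h x \<in> ?W}"
  have HN1: "Hom_module R M ?N1 = ?F\<lparr>carrier := ?L1\<rparr>" by (rule Hom_sub) auto
  have L1: "h \<in> ?L1 \<longleftrightarrow> h \<in> carrier ?F \<and> ?p h = \<zero>\<^bsub>?HN\<^esub>" for h
  proof -
    have "(\<forall>x\<in>carrier M. \<phi> (h x) = \<zero>\<^bsub>N\<^esub>) \<longleftrightarrow> ?p h = \<zero>\<^bsub>?HN\<^esub>"
      by (auto simp: compose_def Hom_simps restrict_def fun_eq_iff)
    then show ?thesis using Hom_mem(3)[of h "Mn l"] by blast
  qed
  let ?ker = "a_kernel (P 0) K e"
  let ?K1 = "(P 0)\<lparr>carrier := ?ker\<rparr>"
  have ker: "?ker = {p \<in> carrier (P 0). e p = \<zero>\<^bsub>K\<^esub>}" by (auto simp: a_kernel_def kernel_def)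
  have K1: "left_module A ?K1"
    unfolding ker by (rule P0.submodule_left_module[OF PK.hom_kernel_submodule[OF e]])
  \<comment> \<open>The comparison maps \<open>a\<close> and \<open>b\<close> in degree zero; both restrict to the kernels.\<close>
  have Fs: "Hom_module R M (summand l (\<lambda>v. v)) = ?F" by (simp only: idem_id)
  have "\<exists>a\<in>mod_hom A ?F (P 0). \<forall>y\<in>carrier ?F. \<forall>j\<in>{()}. e (a y) = \<alpha> (?p y)"
  proof (rule Hom_summand_lift[OF idem_id(1), of "P 0" "{()}" "\<lambda>_. K" "\<lambda>_ y. \<alpha> (?p y)" l "\<lambda>_. e", unfolded Fs])
    fix y assume "y \<in> carrier ?F"
    then have "\<alpha> (?p y) \<in> e ` carrier (P 0)" unfolding esurj using mod_homD(1)[OF mod_hom_comp[OF push \<alpha>]] by simp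
    then obtain b where "\<alpha> (?p y) = e b" "b \<in> carrier (P 0)" by (rule imageE)
    then show "\<exists>b\<in>carrier (P 0). \<forall>j\<in>{()}. e b = \<alpha> (?p y)" by (intro bexI[of _ b]) simp_all
  qed (use P0 K mod_hom_comp[OF push \<alpha>] e in simp_all)
  then obtain a where a: "a \<in> mod_hom A ?F (P 0)" and ea: "\<And>y. y \<in> carrier ?F \<Longrightarrow> e (a y) = \<alpha> (?p y)" by auto
  have "\<exists>b\<in>mod_hom A (P 0) ?F. \<forall>p\<in>carrier (P 0). ?p (b p) = \<beta> (e p)"
    by (rule projective_lift[OF A pr F.left_module_axioms HN.left_module_axioms mod_hom_comp[OF e \<beta>] push])
      (rule surj, rule mod_homD(1)[OF \<beta> mod_homD(1)[OF e]])
  then obtain b where b: "b \<in> mod_hom A (P 0) ?F" and pb: "\<And>p. p \<in> carrier (P 0) \<Longrightarrow> ?p (b p) = \<beta> (e p)" by auto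
  have a1: "a \<in> mod_hom A (Hom_module R M ?N1) ?K1"
    unfolding HN1
  proof (rule mod_hom_cod[OF mod_hom_dom[OF a]])
    show "?L1 \<subseteq> carrier ?F" by auto
    fix f assume "f \<in> carrier (?F\<lparr>carrier := ?L1\<rparr>)"
    then have f: "f \<in> carrier ?F" "?p f = \<zero>\<^bsub>?HN\<^esub>" using L1 by simp_all
    then show "a f \<in> ?ker" unfolding ker using mod_homD(1)[OF a] ea HNK.hom_zero[OF \<alpha>] by simp
  qed
  have b1: "b \<in> mod_hom A ?K1 (Hom_module R M ?N1)"
    unfolding HN1
  proof (rule mod_hom_cod[OF mod_hom_dom[OF b]])
    show "?ker \<subseteq> carrier (P 0)" unfolding ker by auto
    fix q assume "q \<in> carrier ?K1"
    then have q: "q \<in> carrier (P 0)" "e q = \<zero>\<^bsub>K\<^esub>" unfolding ker by simp_all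
    then have "b q \<in> carrier ?F" "?p (b q) = \<zero>\<^bsub>?HN\<^esub>"
      using mod_homD(1)[OF b] pb KHN.hom_zero[OF \<beta>] by simp_all
    then show "b q \<in> ?L1" using L1 by blast
  qed
  \<comment> \<open>The next homotopy: \<open>ba - s\<phi> - 1\<close> maps into the kernel of \<open>\<phi>\<close> and is lifted along \<open>\<phi>1\<close>.\<close>
  let ?t = "\<lambda>f. b (a f) \<ominus>\<^bsub>?F\<^esub> (s (?p f) \<oplus>\<^bsub>?F\<^esub> f)"
  have sp: "(\<lambda>f. s (?p f)) \<in> mod_hom A ?F ?F" by (rule mod_hom_comp[OF push s])
  have sp': "(\<lambda>f. s (?p f) \<oplus>\<^bsub>?F\<^esub> f) \<in> mod_hom A ?F ?F" by (rule FF.add_hom[OF sp mod_hom_id])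
  have ba: "(\<lambda>f. b (a f)) \<in> mod_hom A ?F ?F" by (rule mod_hom_comp[OF a b])
  have tF: "?t \<in> mod_hom A ?F ?F" by (rule FF.minus_hom[OF ba sp'])
  have t: "?t \<in> mod_hom A ?F (Hom_module R M ?N1)"
    unfolding HN1
  proof (rule mod_hom_cod[OF tF])
    fix f assume f: "f \<in> carrier ?F"
    have pf: "?p f \<in> carrier ?HN" by (rule mod_homD(1)[OF push f])
    have 1: "?p (b (a f)) = \<beta> (\<alpha> (?p f))" using pb[OF mod_homD(1)[OF a f]] ea[OF f] by simp
    have "?p (s (?p f) \<oplus>\<^bsub>?F\<^esub> f) = ?p (s (?p f)) \<oplus>\<^bsub>?HN\<^esub> ?p f"
      by (rule mod_homD(2)[OF push mod_homD(1)[OF sp f] f])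
    also have "\<dots> = \<beta> (\<alpha> (?p f))" by (rule eq[OF pf])
    finally have 2: "?p (s (?p f) \<oplus>\<^bsub>?F\<^esub> f) = \<beta> (\<alpha> (?p f))" .
    have "?p (?t f) = ?p (b (a f)) \<ominus>\<^bsub>?HN\<^esub> ?p (s (?p f) \<oplus>\<^bsub>?F\<^esub> f)"
      by (rule FHN.hom_minus[OF push mod_homD(1)[OF ba f] mod_homD(1)[OF sp' f]])
    also have "\<dots> = \<zero>\<^bsub>?HN\<^esub>" unfolding 1 2 by (rule HN.minus_self[OF mod_homD(1)[OF \<beta> mod_homD(1)[OF \<alpha> pf]]])
    finally show "?t f \<in> ?L1" using L1 mod_homD(1)[OF tF f] by blast
  qed
  obtain l1 \<phi>1 where \<phi>1: "approximation l1 \<phi>1 ?N1" using ex_approximation[OF N1 N1fg] by blast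
  have \<phi>1h: "\<phi>1 \<in> mod_hom R (Mn l1) ?N1" using \<phi>1 by (simp add: approximation_def)
  have "\<exists>s1\<in>mod_hom A ?F (Hom_module R M (Mn l1)). \<forall>y\<in>carrier ?F. \<forall>j\<in>{()}. compose (carrier M) \<phi>1 (s1 y) = ?t y"
  proof (rule Hom_summand_lift[OF idem_id(1), of "Hom_module R M (Mn l1)" "{()}" "\<lambda>_. Hom_module R M ?N1" "\<lambda>_. ?t" l
        "\<lambda>_ h. compose (carrier M) \<phi>1 h", unfolded Fs])
    fix y assume "y \<in> carrier ?F"
    then have "?t y \<in> carrier (Hom_module R M ?N1)" by (rule mod_homD(1)[OF t])
    then obtain w where "w \<in> carrier (Hom_module R M (Mn l1))" "compose (carrier M) \<phi>1 w = ?t y"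
      using \<phi>1 unfolding approximation_def by blast
    then show "\<exists>w\<in>carrier (Hom_module R M (Mn l1)). \<forall>j\<in>{()}. compose (carrier M) \<phi>1 w = ?t y" by (intro bexI[of _ w]) simp_all
  qed (use Hom[OF Mn(1)] Hom[OF N1] t Hom_push[OF M(1) \<phi>1h] in simp_all)
  then obtain s1 where s1: "s1 \<in> mod_hom A ?F (Hom_module R M (Mn l1))"
    "\<And>y. y \<in> carrier ?F \<Longrightarrow> compose (carrier M) \<phi>1 (s1 y) = ?t y" by auto
  have s1': "s1 \<in> mod_hom A (Hom_module R M ?N1) (Hom_module R M (Mn l1))"
    unfolding HN1 by (rule mod_hom_dom[OF s1(1)]) auto
  have "class_in ?N1"
  proof (rule IH[OF projective_resolution_Suc[OF res] K1 N1 N1fg \<phi>1 a1 b1 s1'])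
    fix f assume "f \<in> carrier (Hom_module R M ?N1)"
    then have f: "f \<in> carrier ?F" "?p f = \<zero>\<^bsub>?HN\<^esub>" unfolding HN1 using L1 by simp_all
    have "s (?p f) = \<zero>\<^bsub>?F\<^esub>" unfolding f(2) by (rule HNF.hom_zero[OF s])
    then have "?t f = b (a f) \<ominus>\<^bsub>?F\<^esub> f" using f(1) by simp
    then have "compose (carrier M) \<phi>1 (s1 f) \<oplus>\<^bsub>?F\<^esub> f = b (a f)"
      using s1(2)[OF f(1)] F.minus_plus[OF mod_homD(1)[OF ba f(1)] f(1)] by simp
    then show "compose (carrier M) \<phi>1 (s1 f) \<oplus>\<^bsub>Hom_module R M ?N1\<^esub> f = b (a f)" unfolding HN1 by simp
  qed
  then show ?case by (rule class_from_kernel[OF N \<phi>])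
qed

text \<open>
  The comparison starts with the kernel of an approximation of \<open>N\<close> and not with \<open>N\<close> itself, so that all
  modules in the induction are submodules of powers of \<open>M\<close> and have elements of one type.
\<close>

theorem class_in_all:
  fixes N :: "('a, 'n, 'y) module_scheme"
  assumes gd: "right_global_dimension (End_ring R M) < \<infinity>"
    and N: "left_module R N" "finitely_generated_module R N"
  shows "class_in N"
proof -
  obtain k \<phi> where \<phi>: "approximation k \<phi> N" using ex_approximation[OF N] by blast
  have \<phi>h: "\<phi> \<in> mod_hom R (Mn k) N" using \<phi> by (simp add: approximation_def)
  interpret CN: module_pair R "Mn k" N by (rule module_pair.intro[OF Mn(1) N(1)])
  let ?W = "{v \<in> carrier (Mn k). \<phi> v = \<zero>\<^bsub>N\<^esub>}"
  let ?N1 = "(Mn k)\<lparr>carrier := ?W\<rparr>"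
  have W: "submodule ?W R (Mn k)" by (rule CN.hom_kernel_submodule[OF \<phi>h])
  have N1: "left_module R ?N1" by (rule CN.V.submodule_left_module[OF W])
  have N1fg: "finitely_generated_module R ?N1" unfolding CN.V.fg_submodule_iff[OF W] by (rule fg_submodule[OF R Mn W])
  let ?HN = "Hom_module R M ?N1"
  interpret HN: left_module A ?HN by (rule Hom[OF N1])
  obtain K :: "('m \<Rightarrow> 'm, ('m \<Rightarrow> 'm) mod_univ) module" and \<alpha> where K: "left_module A K" "\<alpha> \<in> mod_hom A ?HN K"
    "\<alpha> ` carrier ?HN = carrier K" "\<forall>x\<in>carrier ?HN. \<alpha> x = \<zero>\<^bsub>K\<^esub> \<longleftrightarrow> x \<in> {\<zero>\<^bsub>?HN\<^esub>}"
    by (rule universe_copy[OF HN.left_module_axioms Hom_fg_A[OF N1 N1fg] HN.submod_zero])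
  interpret HK: module_pair A ?HN K by (rule module_pair.intro[OF HN.left_module_axioms K(1)])
  have bij: "bij_betw \<alpha> (carrier ?HN) (carrier K)"
    unfolding bij_betw_def using HK.hom_inj_iff[OF K(2)] K(3,4) by simp
  note inv = inv_hom[OF HN.left_module_axioms K(2) bij]
  have "projective_dimension A K \<le> left_global_dimension A"
    unfolding left_global_dimension_def by (rule SUP_upper) (use K(1) in simp)
  then have fin: "projective_dimension A K < \<infinity>" using gd unfolding right_global_dimension_def by (rule le_less_trans)
  have "{n. \<exists>P d e. projective_resolution A K n P d e} \<noteq> {}"
  proof
    assume none: "{n. \<exists>P d e. projective_resolution A K n P d e} = {}"
    have "projective_dimension A K = \<infinity>"
      unfolding projective_dimension_def none by (simp add: top_enat_def)
    with fin show False by simp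
  qed
  then obtain n P d e where res: "projective_resolution A K n P d e" by auto
  obtain l \<psi> where \<psi>: "approximation l \<psi> ?N1" using ex_approximation[OF N1 N1fg] by blast
  have \<psi>h: "\<psi> \<in> mod_hom R (Mn l) ?N1" using \<psi> by (simp add: approximation_def)
  interpret HF: module_pair A ?HN "Hom_module R M (Mn l)" by (rule module_pair.intro[OF HN.left_module_axioms Hom[OF Mn(1)]])
  interpret FH: module_pair A "Hom_module R M (Mn l)" ?HN by (rule module_pair.intro[OF Hom[OF Mn(1)] HN.left_module_axioms])
  have "class_in ?N1"
  proof (rule class_by_resolution[OF res K(1) N1 N1fg \<psi> K(2) inv(1) HF.zero_hom])
    fix f assume f: "f \<in> carrier ?HN"
    have "compose (carrier M) \<psi> \<zero>\<^bsub>Hom_module R M (Mn l)\<^esub> = \<zero>\<^bsub>?HN\<^esub>" by (rule FH.hom_zero[OF Hom_push[OF M(1) \<psi>h]])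
    then show "compose (carrier M) \<psi> \<zero>\<^bsub>Hom_module R M (Mn l)\<^esub> \<oplus>\<^bsub>?HN\<^esub> f = inv_into (carrier ?HN) \<alpha> (\<alpha> f)"
      using inv(3)[OF f] f HN.M.l_zero by simp
  qed
  then show ?thesis by (rule class_from_kernel[OF N \<phi>])
qed

end

section \<open>Finitely many summands suffice\<close>

text \<open>
  Dickson's lemma. A finite set that serves for the first \<open>r\<close> coordinates also serves for all elements
  whose next coordinate is at least the bound \<open>b\<close> of its own; for each of the finitely many smaller values
  of that coordinate another finite set is added.
\<close>

lemma dickson:
  fixes v :: "'s \<Rightarrow> nat \<Rightarrow> nat"
  shows "\<exists>F. finite F \<and> F \<subseteq> S \<and> (\<forall>y\<in>S. \<exists>x\<in>F. \<forall>i<r. v x i \<le> v y i)"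
proof (induct r arbitrary: S)
  case 0
  show ?case
  proof (cases "S = {}")
    case False
    then obtain x where "x \<in> S" by auto
    then show ?thesis by (intro exI[of _ "{x}"]) auto
  qed auto
next
  case (Suc r)
  obtain F where F: "finite F" "F \<subseteq> S" "\<forall>y\<in>S. \<exists>x\<in>F. \<forall>i<r. v x i \<le> v y i" using Suc[of S] by (elim exE conjE)
  define b where "b = Max (insert 0 ((\<lambda>x. v x r) ` F))"
  have b: "v x r \<le> b" if "x \<in> F" for x unfolding b_def using F(1) that by (intro Max_ge) auto
  have "\<forall>c. \<exists>G. finite G \<and> G \<subseteq> {y \<in> S. v y r = c} \<and> (\<forall>y\<in>{y \<in> S. v y r = c}. \<exists>x\<in>G. \<forall>i<r. v x i \<le> v y i)"
    by (intro allI Suc)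
  from choice[OF this] obtain G where G0: "\<forall>c. finite (G c) \<and> G c \<subseteq> {y \<in> S. v y r = c} \<and>
    (\<forall>y\<in>{y \<in> S. v y r = c}. \<exists>x\<in>G c. \<forall>i<r. v x i \<le> v y i)" ..
  have G: "finite (G c)" "G c \<subseteq> {y \<in> S. v y r = c}" "\<And>y. y \<in> {y \<in> S. v y r = c} \<Longrightarrow> \<exists>x\<in>G c. \<forall>i<r. v x i \<le> v y i" for c
    using G0[rule_format, of c] by simp_all
  let ?F = "F \<union> (\<Union>c<b. G c)"
  have "\<exists>x\<in>?F. \<forall>i<Suc r. v x i \<le> v y i" if y: "y \<in> S" for y
  proof (cases "v y r < b")
    case True
    obtain x where x: "x \<in> G (v y r)" "\<forall>i<r. v x i \<le> v y i" using G(3)[of y "v y r"] y by auto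
    have "v x r = v y r" using x(1) G(2) by blast
    then show ?thesis using x True by (auto simp: less_Suc_eq)
  next
    case False
    obtain x where x: "x \<in> F" "\<forall>i<r. v x i \<le> v y i" using F(3) y by blast
    then show ?thesis using b[OF x(1)] False by (intro bexI[of _ x]) (auto simp: less_Suc_eq)
  qed
  moreover have "finite ?F" using F(1) G(1) by auto
  moreover have "?F \<subseteq> S" using F(2) G(2) by blast
  ultimately show ?case by (intro exI[of _ ?F]) simp
qed

subsection \<open>Simple modules\<close>

text \<open>
  Remove members of \<open>\<U>\<close> until the intersection of the remaining ones is no longer contained in \<open>N\<close>; \<open>U\<close> is
  the last one removed and \<open>E\<close> the intersection of the rest.
\<close>

lemma maximal_above_Inter:
  assumes V: "left_module A V" and fin: "finite \<U>" and max: "\<And>U. U \<in> \<U> \<Longrightarrow> submodule U A V"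
    and N: "submodule N A V" "N \<noteq> carrier V" and sub: "carrier V \<inter> \<Inter>\<U> \<subseteq> N"
  shows "\<exists>U\<in>\<U>. \<exists>E. submodule E A V \<and> \<not> E \<subseteq> N \<and> \<not> E \<subseteq> U \<and> E \<inter> U \<subseteq> N"
  using fin max sub
proof (induct set: finite)
  interpret V: left_module A V by fact
  case empty
  then show ?case using N V.submodD(1)[OF N(1)] by auto
next
  interpret V: left_module A V by fact
  case (insert U \<U>)
  let ?E = "carrier V \<inter> \<Inter>\<U>"
  have E: "submodule ?E A V" by (rule V.submod_Inter) (use insert(4) in auto)
  show ?case
  proof (cases "?E \<subseteq> N")
    case True
    then have "\<exists>U\<in>\<U>. \<exists>E. submodule E A V \<and> \<not> E \<subseteq> N \<and> \<not> E \<subseteq> U \<and> E \<inter> U \<subseteq> N"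
      using insert(3) insert(4) by simp
    then show ?thesis by blast
  next
    case False
    have "?E \<inter> U \<subseteq> N" using insert(5) by auto
    moreover from this have "\<not> ?E \<subseteq> U" using False by blast
    ultimately show ?thesis using E False by blast
  qed
qed

text \<open>
  If finitely many maximal left ideals \<open>\<U>\<close> have the radical as their intersection, every simple module is
  isomorphic to some \<open>A/U\<close>. Let \<open>P/N\<close> be generated by \<open>x\<close>, with annihilator \<open>I\<close>. For \<open>U\<close> and \<open>E\<close> as
  above, \<open>E \<inter> U = E \<inter> I\<close>, because both are maximal in \<open>E\<close>. So \<open>P/N\<close> and \<open>A/U\<close> are both isomorphic to
  \<open>E/(E \<inter> U)\<close>; the homomorphism \<open>f\<close> sends \<open>\<epsilon>x + n\<close> to the class of \<open>\<epsilon>\<close>.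
\<close>

lemma nonzero_hom_to_simple:
  fixes P :: "('a, 'p, 'x) module_scheme"
  assumes A: "ring A" and P: "left_module A P" and N: "maximal_submodule N A P"
    and fin: "finite \<U>" and max: "\<And>U. U \<in> \<U> \<Longrightarrow> maximal_submodule U A (regular_module A)"
    and all: "\<And>I. maximal_submodule I A (regular_module A) \<Longrightarrow> carrier A \<inter> \<Inter>\<U> \<subseteq> I"
  shows "\<exists>U\<in>\<U>. \<exists>f\<in>mod_hom A P (quotient_module (regular_module A) U).
    (\<forall>y\<in>N. f y = \<zero>\<^bsub>quotient_module (regular_module A) U\<^esub>) \<and> (\<exists>y\<in>carrier P. f y \<noteq> \<zero>\<^bsub>quotient_module (regular_module A) U\<^esub>)"
proof -
  let ?A = "regular_module A"
  interpret P: left_module A P by fact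
  interpret Q: left_module A ?A by (rule regular_left_module[OF A])
  have sel: "carrier ?A = carrier A" "a \<oplus>\<^bsub>?A\<^esub> b = a \<oplus>\<^bsub>A\<^esub> b" "a \<odot>\<^bsub>?A\<^esub> b = a \<otimes>\<^bsub>A\<^esub> b" "\<zero>\<^bsub>?A\<^esub> = \<zero>\<^bsub>A\<^esub>" for a b
    by (auto simp: regular_module_def)
  have Ns: "submodule N A P" "N \<noteq> carrier P" using N by (auto simp: maximal_submodule_def)
  note N' = P.submodD[OF Ns(1)]
  obtain x where x: "x \<in> carrier P" "x \<notin> N" using Ns(2) N'(1) by blast
  let ?I = "{a \<in> carrier A. a \<odot>\<^bsub>P\<^esub> x \<in> N}"
  have I: "maximal_submodule ?I A ?A" by (rule P.annihilator_maximal[OF N x])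
  then have Is: "submodule ?I A ?A" "?I \<noteq> carrier ?A" by (simp_all add: maximal_submodule_def)
  have Us: "submodule U A ?A" if "U \<in> \<U>" for U using max[OF that] by (simp add: maximal_submodule_def)
  obtain U E where U: "U \<in> \<U>" and E: "submodule E A ?A" and EI: "\<not> E \<subseteq> ?I" and EU: "\<not> E \<subseteq> U" and EUI: "E \<inter> U \<subseteq> ?I"
    using maximal_above_Inter[OF Q.left_module_axioms fin Us Is] all[OF I] sel(1) by auto
  note E' = Q.submodD[OF E, unfolded sel] and U' = Q.submodD[OF Us[OF U], unfolded sel]
  have Umax: "maximal_submodule U A ?A" by (rule max[OF U])
  have EIU: "E \<inter> ?I \<subseteq> U"
  proof (rule ccontr)
    assume not: "\<not> E \<inter> ?I \<subseteq> U"
    have EIs: "submodule (E \<inter> ?I) A ?A" by (rule Q.submod_Int[OF E Is(1)])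
    let ?T = "{u \<oplus>\<^bsub>?A\<^esub> n |u n. u \<in> U \<and> n \<in> E \<inter> ?I}"
    have T: "submodule ?T A ?A" by (rule Q.submod_sum[OF Us[OF U] EIs])
    have "U \<subseteq> ?T"
    proof
      fix u assume u: "u \<in> U"
      then have "u = u \<oplus>\<^bsub>?A\<^esub> \<zero>\<^bsub>?A\<^esub>" using U'(3) by (simp add: sel)
      moreover have "\<zero>\<^bsub>?A\<^esub> \<in> E \<inter> ?I" by (rule Q.submodD(2)[OF EIs])
      ultimately show "u \<in> ?T" using u by blast
    qed
    moreover have "E \<inter> ?I \<subseteq> ?T"
    proof
      fix n assume n: "n \<in> E \<inter> ?I"
      then have "n = \<zero>\<^bsub>?A\<^esub> \<oplus>\<^bsub>?A\<^esub> n" by (simp add: sel)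
      moreover have "\<zero>\<^bsub>?A\<^esub> \<in> U" by (rule Q.submodD(2)[OF Us[OF U]])
      ultimately show "n \<in> ?T" using n by blast
    qed
    ultimately have "?T = carrier ?A" using Umax T not unfolding maximal_submodule_def by blast
    have "E \<subseteq> ?I"
    proof
      fix \<epsilon> assume \<epsilon>: "\<epsilon> \<in> E"
      then have "\<epsilon> \<in> ?T" using \<open>?T = carrier ?A\<close> E'(3) sel(1) by simp
      then obtain u n where un: "\<epsilon> = u \<oplus>\<^bsub>?A\<^esub> n" "u \<in> U" "n \<in> E \<inter> ?I" by blast
      have nc: "n \<in> carrier ?A" "u \<in> carrier ?A" using un U'(3) by (auto simp: sel)
      have "u = \<epsilon> \<ominus>\<^bsub>?A\<^esub> n" using un(1) Q.plus_minus[OF nc(2,1)] by simp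
      then have "u \<in> E" using Q.submodD(6)[OF E \<epsilon>] un(3) by simp
      then have "u \<in> ?I" using EUI un(2) by blast
      then show "\<epsilon> \<in> ?I" using Q.submodD(4)[OF Is(1)] un(1,3) by blast
    qed
    with EI show False by simp
  qed
  obtain \<epsilon>0 where \<epsilon>0: "\<epsilon>0 \<in> E" "\<epsilon>0 \<notin> ?I" using EI by blast
  then have \<epsilon>0c: "\<epsilon>0 \<in> carrier A" "\<epsilon>0 \<odot>\<^bsub>P\<^esub> x \<notin> N" using E'(3) by auto
  have ev: "(\<lambda>a. a \<odot>\<^bsub>P\<^esub> x) \<in> mod_hom A ?A P"
    by (rule mod_homI) (use x(1) in \<open>auto simp: sel P.smult_l_distr P.smult_assoc1\<close>)
  interpret QP: module_pair A ?A P by (rule module_pair.intro[OF Q.left_module_axioms P])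
  have Ex: "submodule ((\<lambda>a. a \<odot>\<^bsub>P\<^esub> x) ` E) A P" by (rule QP.hom_image_submodule[OF ev E])
  let ?T = "{y \<oplus>\<^bsub>P\<^esub> n |y n. y \<in> (\<lambda>a. a \<odot>\<^bsub>P\<^esub> x) ` E \<and> n \<in> N}"
  have T: "submodule ?T A P" by (rule P.submod_sum[OF Ex Ns(1)])
  have Tc: "?T = carrier P"
  proof -
    have "N \<subseteq> ?T"
    proof
      fix n assume n: "n \<in> N"
      then have "n = \<zero>\<^bsub>P\<^esub> \<oplus>\<^bsub>P\<^esub> n" using N'(3) by simp
      then show "n \<in> ?T" using n P.submodD(2)[OF Ex] by blast
    qed
    moreover have "\<epsilon>0 \<odot>\<^bsub>P\<^esub> x \<in> ?T"
    proof -
      have "\<epsilon>0 \<odot>\<^bsub>P\<^esub> x = \<epsilon>0 \<odot>\<^bsub>P\<^esub> x \<oplus>\<^bsub>P\<^esub> \<zero>\<^bsub>P\<^esub>" using \<epsilon>0c(1) x(1) by simp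
      then show ?thesis using \<epsilon>0(1) N'(2) by blast
    qed
    ultimately show ?thesis using N T \<epsilon>0c(2) unfolding maximal_submodule_def by blast
  qed
  let ?Q = "quotient_module ?A U"
  obtain \<pi> where QQ: "left_module A ?Q" and \<pi>: "\<pi> \<in> mod_hom A ?A ?Q" "\<And>a. a \<in> carrier ?A \<Longrightarrow> \<pi> a = \<zero>\<^bsub>?Q\<^esub> \<longleftrightarrow> a \<in> U"
    using Q.quotient_module[OF Us[OF U]] by metis
  interpret PQ: module_pair A P ?Q by (rule module_pair.intro[OF P QQ])
  define \<Gamma> where "\<Gamma> y t \<longleftrightarrow> (\<exists>\<epsilon>\<in>E. \<exists>n\<in>N. y = \<epsilon> \<odot>\<^bsub>P\<^esub> x \<oplus>\<^bsub>P\<^esub> n \<and> t = \<pi> \<epsilon>)" for y t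
  obtain f where f: "f \<in> mod_hom A P ?Q" "\<And>y t. \<Gamma> y t \<Longrightarrow> f y = t"
  proof (rule PQ.hom_of_relation[of \<Gamma>])
    show "\<exists>t. \<Gamma> y t" if "y \<in> carrier P" for y
    proof -
      have "y \<in> ?T" using that Tc by simp
      then show ?thesis unfolding \<Gamma>_def by auto
    qed
    show "y \<in> carrier P \<and> t \<in> carrier ?Q" if yt: "\<Gamma> y t" for y t
      using yt E'(3) N'(3) x(1) mod_homD(1)[OF \<pi>(1)] unfolding \<Gamma>_def by (auto simp: sel)
    show "\<Gamma> (y \<oplus>\<^bsub>P\<^esub> y') (t \<oplus>\<^bsub>?Q\<^esub> t')" if yt: "\<Gamma> y t" "\<Gamma> y' t'" for y t y' t'
    proof -
      obtain a n where a: "a \<in> E" "n \<in> N" "y = a \<odot>\<^bsub>P\<^esub> x \<oplus>\<^bsub>P\<^esub> n" "t = \<pi> a" using yt(1) unfolding \<Gamma>_def by blast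
      obtain b m where b: "b \<in> E" "m \<in> N" "y' = b \<odot>\<^bsub>P\<^esub> x \<oplus>\<^bsub>P\<^esub> m" "t' = \<pi> b" using yt(2) unfolding \<Gamma>_def by blast
      have "y \<oplus>\<^bsub>P\<^esub> y' = (a \<oplus>\<^bsub>A\<^esub> b) \<odot>\<^bsub>P\<^esub> x \<oplus>\<^bsub>P\<^esub> (n \<oplus>\<^bsub>P\<^esub> m)"
        unfolding a(3) b(3) using a(1,2) b(1,2) E'(3) N'(3) x(1) by (simp add: P.smult_l_distr P.M.a_ac)
      moreover have "t \<oplus>\<^bsub>?Q\<^esub> t' = \<pi> (a \<oplus>\<^bsub>A\<^esub> b)"
        using mod_homD(2)[OF \<pi>(1), of a b] a b E'(3) by (simp add: sel)
      ultimately show ?thesis unfolding \<Gamma>_def using E'(4)[OF a(1) b(1)] N'(4)[OF a(2) b(2)] by blast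
    qed
    show "\<Gamma> (c \<odot>\<^bsub>P\<^esub> y) (c \<odot>\<^bsub>?Q\<^esub> t)" if c: "c \<in> carrier A" and yt: "\<Gamma> y t" for c y t
    proof -
      obtain a n where a: "a \<in> E" "n \<in> N" "y = a \<odot>\<^bsub>P\<^esub> x \<oplus>\<^bsub>P\<^esub> n" "t = \<pi> a" using yt unfolding \<Gamma>_def by blast
      have "c \<odot>\<^bsub>P\<^esub> y = (c \<otimes>\<^bsub>A\<^esub> a) \<odot>\<^bsub>P\<^esub> x \<oplus>\<^bsub>P\<^esub> c \<odot>\<^bsub>P\<^esub> n"
        unfolding a(3) using a(1,2) c E'(3) N'(3) x(1) by (simp add: P.smult_r_distr P.smult_assoc1)
      moreover have "c \<odot>\<^bsub>?Q\<^esub> t = \<pi> (c \<otimes>\<^bsub>A\<^esub> a)"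
        using mod_homD(3)[OF \<pi>(1) c, of a] a E'(3) by (simp add: sel)
      ultimately show ?thesis unfolding \<Gamma>_def using E'(7)[OF c a(1)] N'(7)[OF c a(2)] by blast
    qed
    show "t = \<zero>\<^bsub>?Q\<^esub>" if yt: "\<Gamma> \<zero>\<^bsub>P\<^esub> t" for t
    proof -
      obtain a n where a: "a \<in> E" "n \<in> N" "\<zero>\<^bsub>P\<^esub> = a \<odot>\<^bsub>P\<^esub> x \<oplus>\<^bsub>P\<^esub> n" "t = \<pi> a" using yt unfolding \<Gamma>_def by blast
      have ac: "a \<in> carrier A" using E'(3) a(1) by simp
      have "a \<odot>\<^bsub>P\<^esub> x = \<ominus>\<^bsub>P\<^esub> n" using P.M.minus_equality[of "a \<odot>\<^bsub>P\<^esub> x" n] ac x(1) N'(3)[OF a(2)] a(3) by simp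
      then have "a \<in> ?I" using N'(5)[OF a(2)] ac by simp
      then have "a \<in> U" using EIU a(1) by blast
      then show ?thesis using \<pi>(2)[of a] ac a(4) sel(1) by simp
    qed
  qed blast
  have "f y = \<zero>\<^bsub>?Q\<^esub>" if y: "y \<in> N" for y
  proof -
    have "y = \<zero>\<^bsub>A\<^esub> \<odot>\<^bsub>P\<^esub> x \<oplus>\<^bsub>P\<^esub> y" using y N'(3) x(1) by simp
    then have "\<Gamma> y (\<pi> \<zero>\<^bsub>A\<^esub>)" unfolding \<Gamma>_def using E'(2) y by blast
    moreover have "\<pi> \<zero>\<^bsub>A\<^esub> = \<zero>\<^bsub>?Q\<^esub>" using \<pi>(2)[of "\<zero>\<^bsub>A\<^esub>"] U'(2) by (simp add: sel)
    ultimately show ?thesis using f(2) by simp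
  qed
  moreover have "\<exists>y\<in>carrier P. f y \<noteq> \<zero>\<^bsub>?Q\<^esub>"
  proof -
    obtain \<epsilon> where \<epsilon>: "\<epsilon> \<in> E" "\<epsilon> \<notin> U" using EU by blast
    have \<epsilon>c: "\<epsilon> \<in> carrier A" using E'(3) \<epsilon>(1) by simp
    have "\<epsilon> \<odot>\<^bsub>P\<^esub> x = \<epsilon> \<odot>\<^bsub>P\<^esub> x \<oplus>\<^bsub>P\<^esub> \<zero>\<^bsub>P\<^esub>" using \<epsilon>c x(1) by simp
    then have "\<Gamma> (\<epsilon> \<odot>\<^bsub>P\<^esub> x) (\<pi> \<epsilon>)" unfolding \<Gamma>_def using \<epsilon>(1) N'(2) by blast
    then have "f (\<epsilon> \<odot>\<^bsub>P\<^esub> x) = \<pi> \<epsilon>" by (rule f(2))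
    then show ?thesis using \<pi>(2)[of \<epsilon>] \<epsilon>c \<epsilon>(2) x(1) sel(1) by (intro bexI[of _ "\<epsilon> \<odot>\<^bsub>P\<^esub> x"]) simp_all
  qed
  ultimately show ?thesis using U f(1) by blast
qed

lemma quotient_simple:
  assumes V: "left_module A V" and N: "maximal_submodule N A V" and S: "submodule S A (quotient_module V N)"
    and nz: "\<exists>x\<in>S. x \<noteq> \<zero>\<^bsub>quotient_module V N\<^esub>"
  shows "S = carrier (quotient_module V N)"
proof -
  let ?Q = "quotient_module V N"
  interpret V: left_module A V by fact
  have Ns: "submodule N A V" using N by (simp add: maximal_submodule_def)
  obtain \<pi> where Q: "left_module A ?Q" "\<pi> \<in> mod_hom A V ?Q" "\<pi> ` carrier V = carrier ?Q"
    "\<And>x. x \<in> carrier V \<Longrightarrow> \<pi> x = \<zero>\<^bsub>?Q\<^esub> \<longleftrightarrow> x \<in> N" using V.quotient_module[OF Ns] by metis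
  interpret VQ: module_pair A V ?Q by (rule module_pair.intro[OF V Q(1)])
  let ?K = "{x \<in> carrier V. \<pi> x \<in> S}"
  have K: "submodule ?K A V" by (rule VQ.hom_vimage_submodule[OF Q(2) S])
  have "N \<subseteq> ?K"
  proof
    fix x assume x: "x \<in> N"
    have xc: "x \<in> carrier V" by (rule V.submodD(3)[OF Ns x])
    then have "\<pi> x = \<zero>\<^bsub>?Q\<^esub>" using Q(4) x by blast
    then show "x \<in> ?K" using xc VQ.W.submodD(2)[OF S] by simp
  qed
  moreover have "?K \<noteq> N"
  proof -
    obtain s where s: "s \<in> S" "s \<noteq> \<zero>\<^bsub>?Q\<^esub>" using nz by blast
    then have "s \<in> \<pi> ` carrier V" using VQ.W.submodD(3)[OF S] Q(3) by simp
    then obtain x where "s = \<pi> x" "x \<in> carrier V" by (rule imageE)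
    then show ?thesis using s Q(4) by auto
  qed
  ultimately have "?K = carrier V" using N K unfolding maximal_submodule_def by blast
  then have "carrier ?Q \<subseteq> S" unfolding Q(3)[symmetric] by auto
  then show ?thesis using VQ.W.submodD(1)[OF S] by simp
qed

locale semilocal_setup = hom_setup R M for R :: "('a, 'r) ring_scheme" and M :: "('a, 'm, 'x) module_scheme" +
  assumes SL: "semilocal_ring R"
begin

lemma jacobson_smult:
  assumes P: "left_module A P" "finitely_generated_module R (restrict_scalars scalar P)"
    and N: "maximal_submodule N A P" and r: "r \<in> jacobson R" and x: "x \<in> carrier P"
  shows "scalar r \<odot>\<^bsub>P\<^esub> x \<in> N"
  by (rule maximal_contains_jacobson[OF R(1) P(1) scalar_ring_hom scalar_central P(2) N r x])

text \<open>
  Among the finite sets of maximal left ideals, take one whose intersection has the largest measure.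
  Intersecting with a further maximal left ideal cannot shrink it.
\<close>

lemma ex_simple_ideals:
  "\<exists>\<U>. finite \<U> \<and> (\<forall>U\<in>\<U>. maximal_submodule U A (regular_module A)) \<and>
     (\<forall>I. maximal_submodule I A (regular_module A) \<longrightarrow> carrier A \<inter> \<Inter>\<U> \<subseteq> I)"
proof -
  let ?A = "regular_module A"
  interpret Q: left_module A ?A by (rule regular_left_module[OF A])
  have sel: "carrier ?A = carrier A" by (simp add: regular_module_def)
  have QR: "left_module R (restrict_scalars scalar ?A)"
    by (rule restrict_scalars_left_module[OF R.ring_axioms Q.left_module_axioms scalar_ring_hom])
  obtain \<mu> :: "('m \<Rightarrow> 'm) set \<Rightarrow> nat" and B where \<mu>: "\<And>W W'. \<lbrakk>submodule W R (restrict_scalars scalar ?A); submodule W' R (restrict_scalars scalar ?A); W' \<subset> W;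
      \<And>r x. r \<in> jacobson R \<Longrightarrow> x \<in> carrier (restrict_scalars scalar ?A) \<Longrightarrow> r \<odot>\<^bsub>restrict_scalars scalar ?A\<^esub> x \<in> W'\<rbrakk> \<Longrightarrow> \<mu> W < \<mu> W'"
    and B: "\<And>W. \<mu> W \<le> B"
    using semilocal_length[OF SL QR A_fg] by blast
  define good where "good \<U> \<longleftrightarrow> finite \<U> \<and> (\<forall>U\<in>\<U>. maximal_submodule U A ?A)" for \<U> :: "('m \<Rightarrow> 'm) set set"
  define D where "D \<U> = carrier A \<inter> \<Inter>\<U>" for \<U> :: "('m \<Rightarrow> 'm) set set"
  have "good {}" by (simp add: good_def)
  have "\<exists>\<U>. good \<U> \<and> (\<forall>\<V>. good \<V> \<longrightarrow> \<mu> (D \<V>) \<le> \<mu> (D \<U>))"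
    using ex_has_greatest_nat[of good "{}" "\<lambda>\<U>. \<mu> (D \<U>)" "Suc B"] \<open>good {}\<close> B by (auto simp: less_Suc_eq_le)
  then obtain \<U> where \<U>: "good \<U>" "\<And>\<V>. good \<V> \<Longrightarrow> \<mu> (D \<V>) \<le> \<mu> (D \<U>)" by blast
  have sub: "submodule (D \<V>) A ?A" if "good \<V>" for \<V>
    using Q.submod_Inter[of \<V>] that unfolding D_def good_def maximal_submodule_def sel by blast
  have subR: "submodule (D \<V>) R (restrict_scalars scalar ?A)" if "good \<V>" for \<V>
    by (rule restrict_scalars_submodule[OF R.ring_axioms Q.left_module_axioms scalar_ring_hom sub[OF that]])
  have "D \<U> \<subseteq> I" if I: "maximal_submodule I A ?A" for I
  proof (rule ccontr)
    assume not: "\<not> D \<U> \<subseteq> I"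
    have g: "good (insert I \<U>)" using \<U>(1) I by (simp add: good_def)
    have psub: "D (insert I \<U>) \<subset> D \<U>" using not unfolding D_def by blast
    have "\<mu> (D \<U>) < \<mu> (D (insert I \<U>))"
    proof (rule \<mu>[OF subR[OF \<U>(1)] subR[OF g] psub])
      fix r x assume r: "r \<in> jacobson R" and x: "x \<in> carrier (restrict_scalars scalar ?A)"
      have xc: "x \<in> carrier ?A" using x by simp
      have "scalar r \<odot>\<^bsub>?A\<^esub> x \<in> U" if "U \<in> insert I \<U>" for U
        by (rule jacobson_smult[OF Q.left_module_axioms A_fg _ r xc]) (use g that in \<open>auto simp: good_def\<close>)
      moreover have "scalar r \<odot>\<^bsub>?A\<^esub> x \<in> carrier ?A"
        using Q.smult_closed[OF scalar_hom xc, of r] r by (simp add: jacobson_def)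
      ultimately show "r \<odot>\<^bsub>restrict_scalars scalar ?A\<^esub> x \<in> D (insert I \<U>)" unfolding D_def sel by simp
    qed
    with \<U>(2)[OF g] show False by simp
  qed
  then show ?thesis using \<U>(1) unfolding good_def D_def by blast
qed

definition simple_ideals :: "('m \<Rightarrow> 'm) set list" where
  "simple_ideals = (SOME us. (\<forall>U\<in>set us. maximal_submodule U A (regular_module A)) \<and>
     (\<forall>I. maximal_submodule I A (regular_module A) \<longrightarrow> carrier A \<inter> \<Inter>(set us) \<subseteq> I))"

lemma simple_ideals:
  "\<And>U. U \<in> set simple_ideals \<Longrightarrow> maximal_submodule U A (regular_module A)"
  "\<And>I. maximal_submodule I A (regular_module A) \<Longrightarrow> carrier A \<inter> \<Inter>(set simple_ideals) \<subseteq> I"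
proof -
  obtain \<U> where \<U>: "finite \<U>" "\<forall>U\<in>\<U>. maximal_submodule U A (regular_module A)"
    "\<forall>I. maximal_submodule I A (regular_module A) \<longrightarrow> carrier A \<inter> \<Inter>\<U> \<subseteq> I"
    using ex_simple_ideals by blast
  obtain us where "set us = \<U>" using \<U>(1) finite_list by auto
  then have "\<exists>us. (\<forall>U\<in>set us. maximal_submodule U A (regular_module A)) \<and>
     (\<forall>I. maximal_submodule I A (regular_module A) \<longrightarrow> carrier A \<inter> \<Inter>(set us) \<subseteq> I)" using \<U> by (intro exI[of _ us]) simp
  from someI_ex[OF this, folded simple_ideals_def]
  show "\<And>U. U \<in> set simple_ideals \<Longrightarrow> maximal_submodule U A (regular_module A)"
    "\<And>I. maximal_submodule I A (regular_module A) \<Longrightarrow> carrier A \<inter> \<Inter>(set simple_ideals) \<subseteq> I" by blast+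
qed

definition simple :: "nat \<Rightarrow> ('m \<Rightarrow> 'm, ('m \<Rightarrow> 'm) set) module" where
  "simple c = quotient_module (regular_module A) (simple_ideals ! c)"

lemma simple_max: "c < length simple_ideals \<Longrightarrow> maximal_submodule (simple_ideals ! c) A (regular_module A)"
  using simple_ideals(1) by simp

lemma simple_left_module:
  assumes c: "c < length simple_ideals" shows "left_module A (simple c)"
proof -
  interpret Q: left_module A "regular_module A" by (rule regular_left_module[OF A])
  show ?thesis unfolding simple_def
    by (rule Q.quotient_module) (use simple_max[OF c] in \<open>simp_all add: maximal_submodule_def\<close>)
qed

lemma simple_submodule:
  "\<lbrakk>c < length simple_ideals; submodule S A (simple c); \<exists>x\<in>S. x \<noteq> \<zero>\<^bsub>simple c\<^esub>\<rbrakk> \<Longrightarrow> S = carrier (simple c)"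
  unfolding simple_def by (rule quotient_simple[OF regular_left_module[OF A] simple_max])

lemma simple_jacobson:
  assumes c: "c < length simple_ideals" and r: "r \<in> jacobson R" and q: "q \<in> carrier (simple c)"
  shows "scalar r \<odot>\<^bsub>simple c\<^esub> q = \<zero>\<^bsub>simple c\<^esub>"
proof -
  let ?A = "regular_module A"
  interpret Q: left_module A ?A by (rule regular_left_module[OF A])
  have s: "submodule (simple_ideals ! c) A ?A" using simple_max[OF c] by (simp add: maximal_submodule_def)
  obtain \<pi> where \<pi>: "\<pi> \<in> mod_hom A ?A (simple c)" "\<pi> ` carrier ?A = carrier (simple c)"
    "\<And>a. a \<in> carrier ?A \<Longrightarrow> \<pi> a = \<zero>\<^bsub>simple c\<^esub> \<longleftrightarrow> a \<in> simple_ideals ! c"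
    using Q.quotient_module[OF s] unfolding simple_def by metis
  obtain a where a: "q = \<pi> a" "a \<in> carrier ?A" using q unfolding \<pi>(2)[symmetric] by (rule imageE)
  have sr: "scalar r \<in> carrier A" using scalar_hom r by (simp add: jacobson_def)
  have "scalar r \<odot>\<^bsub>simple c\<^esub> q = \<pi> (scalar r \<odot>\<^bsub>?A\<^esub> a)" unfolding a(1) by (rule mod_homD(3)[OF \<pi>(1) sr a(2), symmetric])
  also have "\<dots> = \<zero>\<^bsub>simple c\<^esub>"
    using \<pi>(3)[OF Q.smult_closed[OF sr a(2)]] jacobson_smult[OF Q.left_module_axioms A_fg simple_max[OF c] r a(2)] by simp
  finally show ?thesis .
qed

lemma nonzero_hom_simple:
  assumes P: "left_module A P" and N: "maximal_submodule N A P"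
  shows "\<exists>c<length simple_ideals. \<exists>f\<in>mod_hom A P (simple c). (\<forall>y\<in>N. f y = \<zero>\<^bsub>simple c\<^esub>) \<and> (\<exists>y\<in>carrier P. f y \<noteq> \<zero>\<^bsub>simple c\<^esub>)"
proof -
  obtain U where U: "U \<in> set simple_ideals" and f: "\<exists>f\<in>mod_hom A P (quotient_module (regular_module A) U).
    (\<forall>y\<in>N. f y = \<zero>\<^bsub>quotient_module (regular_module A) U\<^esub>) \<and> (\<exists>y\<in>carrier P. f y \<noteq> \<zero>\<^bsub>quotient_module (regular_module A) U\<^esub>)"
    using nonzero_hom_to_simple[OF A P N finite_set simple_ideals] by blast
  obtain c where c: "c < length simple_ideals" "U = simple_ideals ! c" using U by (auto simp: in_set_conv_nth)
  from f[unfolded c(2), folded simple_def] show ?thesis using c(1) by blast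
qed

subsection \<open>Tops of modules\<close>

text \<open>
  Copies of simple modules: \<open>(c, i)\<close> stands for copy number \<open>i\<close> of the simple module \<open>c\<close>, so \<open>v\<close> is a
  vector of multiplicities. The set grows with \<open>v\<close>, which is what compares two tops.
\<close>

definition index :: "(nat \<Rightarrow> nat) \<Rightarrow> (nat \<times> nat) set" where
  "index v = {(c, i). c < length simple_ideals \<and> i < v c}"

definition joint_kernel where
  "joint_kernel P v F = {x \<in> carrier P. \<forall>j\<in>index v. F j x = \<zero>\<^bsub>simple (fst j)\<^esub>}"

definition jointly_onto where
  "jointly_onto P v F \<longleftrightarrow> (\<forall>j\<in>index v. F j \<in> mod_hom A P (simple (fst j))) \<and>
     (\<forall>t. (\<forall>j\<in>index v. t j \<in> carrier (simple (fst j))) \<longrightarrow> (\<exists>x\<in>carrier P. \<forall>j\<in>index v. F j x = t j))"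

text \<open>
  The homomorphisms \<open>F j\<close> identify the largest semisimple quotient of \<open>P\<close> with the direct sum of \<open>v c\<close>
  copies of each simple module \<open>c\<close>.
\<close>

definition top_of where
  "top_of P v F \<longleftrightarrow> jointly_onto P v F \<and>
     (\<forall>c<length simple_ideals. \<forall>f\<in>mod_hom A P (simple c). \<forall>x\<in>joint_kernel P v F. f x = \<zero>\<^bsub>simple c\<^esub>)"

lemma index_simple: "j \<in> index v \<Longrightarrow> fst j < length simple_ideals" by (auto simp: index_def)

lemma joint_kernel_submodule:
  assumes P: "left_module A P" and F: "jointly_onto P v F"
  shows "submodule (joint_kernel P v F) A P"
proof -
  interpret P: left_module A P by fact
  have "submodule {x \<in> carrier P. F j x = \<zero>\<^bsub>simple (fst j)\<^esub>} A P" if j: "j \<in> index v" for j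
    by (rule module_pair.hom_kernel_submodule[OF module_pair.intro[OF P simple_left_module[OF index_simple[OF j]]]])
      (use F j in \<open>simp add: jointly_onto_def\<close>)
  then have "submodule (carrier P \<inter> \<Inter>((\<lambda>j. {x \<in> carrier P. F j x = \<zero>\<^bsub>simple (fst j)\<^esub>}) ` index v)) A P"
    by (intro P.submod_Inter) auto
  moreover have "carrier P \<inter> \<Inter>((\<lambda>j. {x \<in> carrier P. F j x = \<zero>\<^bsub>simple (fst j)\<^esub>}) ` index v) = joint_kernel P v F"
    unfolding joint_kernel_def by auto
  ultimately show ?thesis by simp
qed

text \<open>
  Choose a jointly surjective family whose joint kernel has the largest measure. If some homomorphism to
  a simple module were nonzero on the joint kernel, it would map the joint kernel onto that simple
  module and could be added to the family.
\<close>

lemma ex_top: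
  fixes P :: "('m \<Rightarrow> 'm, 'p, 'y) module_scheme"
  assumes P: "left_module A P" "finitely_generated_module R (restrict_scalars scalar P)"
  shows "\<exists>v F. top_of P v F"
proof -
  interpret P: left_module A P by fact
  let ?PR = "restrict_scalars scalar P"
  have PR: "left_module R ?PR"
    by (rule restrict_scalars_left_module[OF R.ring_axioms P(1) scalar_ring_hom])
  obtain \<mu> :: "'p set \<Rightarrow> nat" and B where \<mu>: "\<And>W W'. \<lbrakk>submodule W R ?PR; submodule W' R ?PR; W' \<subset> W;
      \<And>r x. r \<in> jacobson R \<Longrightarrow> x \<in> carrier ?PR \<Longrightarrow> r \<odot>\<^bsub>?PR\<^esub> x \<in> W'\<rbrakk> \<Longrightarrow> \<mu> W < \<mu> W'"
    and B: "\<And>W. \<mu> W \<le> B"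
    using semilocal_length[OF SL PR P(2)] by blast
  let ?good = "\<lambda>vF. jointly_onto P (fst vF) (snd vF)"
  let ?D = "\<lambda>vF. joint_kernel P (fst vF) (snd vF)"
  have "index (\<lambda>_. 0) = {}" by (auto simp: index_def)
  then have "?good (\<lambda>_. 0, undefined)" unfolding jointly_onto_def using P.M.zero_closed by auto
  then have "\<exists>vF. ?good vF \<and> (\<forall>wG. ?good wG \<longrightarrow> \<mu> (?D wG) \<le> \<mu> (?D vF))"
    using ex_has_greatest_nat[of ?good "(\<lambda>_. 0, undefined)" "\<lambda>vF. \<mu> (?D vF)" "Suc B"] B by (auto simp: less_Suc_eq_le)
  then obtain v F where F: "jointly_onto P v F" and Fmax: "\<And>w G. jointly_onto P w G \<Longrightarrow> \<mu> (joint_kernel P w G) \<le> \<mu> (joint_kernel P v F)"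
    by auto
  let ?K = "joint_kernel P v F"
  have K: "submodule ?K A P" by (rule joint_kernel_submodule[OF P(1) F])
  note K' = P.submodD[OF K]
  have Fh: "F j \<in> mod_hom A P (simple (fst j))" if "j \<in> index v" for j using F that by (simp add: jointly_onto_def)
  have "f x = \<zero>\<^bsub>simple c\<^esub>" if c: "c < length simple_ideals" and f: "f \<in> mod_hom A P (simple c)" and x: "x \<in> ?K" for c f x
  proof (rule ccontr)
    assume fx: "f x \<noteq> \<zero>\<^bsub>simple c\<^esub>"
    interpret PS: module_pair A P "simple c" by (rule module_pair.intro[OF P(1) simple_left_module[OF c]])
    have fK: "f ` ?K = carrier (simple c)"
      by (rule simple_submodule[OF c PS.hom_image_submodule[OF f K]]) (use x fx in blast)
    let ?w = "v(c := Suc (v c))" and ?G = "F((c, v c) := f)"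
    have idx: "index ?w = insert (c, v c) (index v)" using c by (auto simp: index_def less_Suc_eq split: if_splits)
    have nin: "(c, v c) \<notin> index v" by (simp add: index_def)
    have G: "jointly_onto P ?w ?G"
      unfolding jointly_onto_def
    proof (intro conjI ballI allI impI)
      fix j assume "j \<in> index ?w"
      then show "?G j \<in> mod_hom A P (simple (fst j))" using Fh[of j] f unfolding idx by (cases "j = (c, v c)") simp_all
    next
      fix t assume t: "\<forall>j\<in>index ?w. t j \<in> carrier (simple (fst j))"
      then have "\<forall>j\<in>index v. t j \<in> carrier (simple (fst j))" unfolding idx by simp
      then obtain y where y: "y \<in> carrier P" "\<forall>j\<in>index v. F j y = t j" using F unfolding jointly_onto_def by blast
      have tc: "t (c, v c) \<in> carrier (simple c)" using t unfolding idx by simp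
      have fy: "f y \<in> carrier (simple c)" by (rule mod_homD(1)[OF f y(1)])
      have "t (c, v c) \<ominus>\<^bsub>simple c\<^esub> f y \<in> f ` ?K" unfolding fK using tc fy by (rule PS.W.M.minus_closed)
      then obtain d where d: "t (c, v c) \<ominus>\<^bsub>simple c\<^esub> f y = f d" "d \<in> ?K" by (rule imageE)
      have dc: "d \<in> carrier P" by (rule K'(3)[OF d(2)])
      have "?G j (d \<oplus>\<^bsub>P\<^esub> y) = t j" if j: "j \<in> index ?w" for j
      proof (cases "j = (c, v c)")
        case True
        have "f (d \<oplus>\<^bsub>P\<^esub> y) = (t (c, v c) \<ominus>\<^bsub>simple c\<^esub> f y) \<oplus>\<^bsub>simple c\<^esub> f y" using mod_homD(2)[OF f dc y(1)] d(1) by simp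
        also have "\<dots> = t (c, v c)" by (rule PS.W.minus_plus[OF tc fy])
        finally show ?thesis using True by simp
      next
        case False
        then have j: "j \<in> index v" using j unfolding idx by simp
        interpret S: left_module A "simple (fst j)" by (rule simple_left_module[OF index_simple[OF j]])
        have "F j (d \<oplus>\<^bsub>P\<^esub> y) = F j d \<oplus>\<^bsub>simple (fst j)\<^esub> F j y" by (rule mod_homD(2)[OF Fh[OF j] dc y(1)])
        also have "F j d = \<zero>\<^bsub>simple (fst j)\<^esub>" using d(2) j by (simp add: joint_kernel_def)
        also have "\<zero>\<^bsub>simple (fst j)\<^esub> \<oplus>\<^bsub>simple (fst j)\<^esub> F j y = F j y" by (rule S.M.l_zero[OF mod_homD(1)[OF Fh[OF j] y(1)]])
        finally show ?thesis using False y(2) j by simp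
      qed
      then show "\<exists>x\<in>carrier P. \<forall>j\<in>index ?w. ?G j x = t j" using dc y(1) by (intro bexI[of _ "d \<oplus>\<^bsub>P\<^esub> y"]) auto
    qed
    have Gh: "?G j \<in> mod_hom A P (simple (fst j))" if "j \<in> index ?w" for j using G that by (simp add: jointly_onto_def)
    have "joint_kernel P ?w ?G \<subset> ?K"
    proof
      show "joint_kernel P ?w ?G \<subseteq> ?K"
      proof
        fix y assume y: "y \<in> joint_kernel P ?w ?G"
        have "F j y = \<zero>\<^bsub>simple (fst j)\<^esub>" if j: "j \<in> index v" for j
        proof -
          have "?G j y = \<zero>\<^bsub>simple (fst j)\<^esub>" using y j unfolding joint_kernel_def idx by blast
          moreover have "?G j = F j" using j nin by auto
          ultimately show ?thesis by simp
        qed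
        then show "y \<in> ?K" using y by (simp add: joint_kernel_def)
      qed
      have "x \<notin> joint_kernel P ?w ?G" using fx unfolding joint_kernel_def idx by auto
      then show "joint_kernel P ?w ?G \<noteq> ?K" using x by blast
    qed
    then have "\<mu> ?K < \<mu> (joint_kernel P ?w ?G)"
    proof (rule \<mu>[OF restrict_scalars_submodule[OF R.ring_axioms P(1) scalar_ring_hom K]
          restrict_scalars_submodule[OF R.ring_axioms P(1) scalar_ring_hom joint_kernel_submodule[OF P(1) G]]])
      fix r y assume r: "r \<in> jacobson R" and y: "y \<in> carrier ?PR"
      have yc: "y \<in> carrier P" using y by simp
      have sr: "scalar r \<in> carrier A" using scalar_hom r by (simp add: jacobson_def)
      have "?G j (scalar r \<odot>\<^bsub>P\<^esub> y) = \<zero>\<^bsub>simple (fst j)\<^esub>" if j: "j \<in> index ?w" for j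
        using mod_homD(3)[OF Gh[OF j] sr yc] simple_jacobson[OF index_simple[OF j] r mod_homD(1)[OF Gh[OF j] yc]] by simp
      then show "r \<odot>\<^bsub>?PR\<^esub> y \<in> joint_kernel P ?w ?G"
        unfolding joint_kernel_def using P.smult_closed[OF sr yc] by simp
    qed
    with Fmax[OF G] show False by simp
  qed
  then have "top_of P v F" unfolding top_of_def using F by blast
  then show ?thesis by blast
qed

text \<open>
  The top of \<open>Hom(M, e'(M\<^sup>k'))\<close> is a quotient of that of \<open>Hom(M, e(M\<^sup>k))\<close>. Since the latter module is
  projective, the map of tops lifts to a homomorphism \<open>g\<close>. Its image together with the joint kernel of
  \<open>F'\<close> is everything; as that kernel lies in all maximal submodules, \<open>g\<close> is onto. By fullness \<open>g\<close> comes
  from a homomorphism of the summands, and preimages of the basis elements under \<open>g\<close> give a section.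
\<close>

lemma split_of_tops:
  assumes e: "idem k e" and e': "idem k' e'"
    and top: "top_of (Hom_module R M (summand k e)) v F" and top': "top_of (Hom_module R M (summand k' e')) v' F'"
    and le: "\<And>c. c < length simple_ideals \<Longrightarrow> v' c \<le> v c"
  shows "\<exists>G\<in>mod_hom R (Mn k) (summand k' e'). \<exists>U\<in>mod_hom R (Mn k') (summand k e).
    \<forall>x\<in>carrier (summand k' e'). G (U x) = x"
proof -
  let ?Y = "summand k e" and ?Z = "summand k' e'"
  let ?Q = "Hom_module R M ?Y" and ?P = "Hom_module R M ?Z"
  note Y = summand_sub[OF e] and Z = summand_sub[OF e']
  have Q: "left_module A ?Q" and P: "left_module A ?P" by (rule Hom[OF Y(2)], rule Hom[OF Z(2)])
  interpret QP: module_pair A ?Q ?P by (rule module_pair.intro[OF Q P])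
  have sub: "index v' \<subseteq> index v" using le by (force simp: index_def)
  have Fh: "\<And>j. j \<in> index v \<Longrightarrow> F j \<in> mod_hom A ?Q (simple (fst j))" and Fh': "\<And>j. j \<in> index v' \<Longrightarrow> F' j \<in> mod_hom A ?P (simple (fst j))"
    using top top' by (auto simp: top_of_def jointly_onto_def)
  have onto: "\<exists>x\<in>carrier ?Q. \<forall>j\<in>index v. F j x = t j" if "\<forall>j\<in>index v. t j \<in> carrier (simple (fst j))" for t
    using top that by (simp add: top_of_def jointly_onto_def)
  have onto': "\<exists>x\<in>carrier ?P. \<forall>j\<in>index v'. F' j x = t j" if "\<forall>j\<in>index v'. t j \<in> carrier (simple (fst j))" for t
    using top' that by (simp add: top_of_def jointly_onto_def)
  have kill: "f x = \<zero>\<^bsub>simple c\<^esub>"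
    if "c < length simple_ideals" "f \<in> mod_hom A ?P (simple c)" "x \<in> joint_kernel ?P v' F'" for c f x
    using top' that by (simp add: top_of_def)
  have "\<exists>g\<in>mod_hom A ?Q ?P. \<forall>y\<in>carrier ?Q. \<forall>j\<in>index v'. F' j (g y) = F j y"
  proof (rule Hom_summand_lift[OF e P])
    show "left_module A (simple (fst j))" if "j \<in> index v'" for j by (rule simple_left_module[OF index_simple[OF that]])
    show "F j \<in> mod_hom A ?Q (simple (fst j))" if "j \<in> index v'" for j using Fh that sub by blast
    show "F' j \<in> mod_hom A ?P (simple (fst j))" if "j \<in> index v'" for j by (rule Fh'[OF that])
    show "\<exists>b\<in>carrier ?P. \<forall>j\<in>index v'. F' j b = F j y" if y: "y \<in> carrier ?Q" for y
      by (rule onto') (use mod_homD(1)[OF Fh y] sub in blast)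
  qed
  then obtain g where g: "g \<in> mod_hom A ?Q ?P" and gF: "\<And>y j. y \<in> carrier ?Q \<Longrightarrow> j \<in> index v' \<Longrightarrow> F' j (g y) = F j y" by blast
  have im: "submodule (g ` carrier ?Q) A ?P" by (rule QP.hom_image_submodule[OF g QP.V.submod_carrier])
  have surj: "g ` carrier ?Q = carrier ?P"
  proof (rule ccontr)
    assume ne: "g ` carrier ?Q \<noteq> carrier ?P"
    obtain B where B: "finite B" "B \<subseteq> carrier ?P" "span A ?P B = carrier ?P"
      using Hom_fg_A[OF Z(2,3)] unfolding finitely_generated_module_def span_def by auto
    obtain N where N: "maximal_submodule N A ?P" "g ` carrier ?Q \<subseteq> N" using QP.W.ex_maximal_submodule[OF B im ne] by blast
    obtain c f where c: "c < length simple_ideals" and f: "f \<in> mod_hom A ?P (simple c)"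
      and fN: "\<forall>y\<in>N. f y = \<zero>\<^bsub>simple c\<^esub>" and fnz: "\<exists>y\<in>carrier ?P. f y \<noteq> \<zero>\<^bsub>simple c\<^esub>"
      using nonzero_hom_simple[OF P N(1)] by blast
    interpret PS: module_pair A ?P "simple c" by (rule module_pair.intro[OF P simple_left_module[OF c]])
    have "f p = \<zero>\<^bsub>simple c\<^esub>" if p: "p \<in> carrier ?P" for p
    proof -
      \<comment> \<open>Values of an element of \<open>Hom(M, e(M\<^sup>k))\<close> whose image under \<open>g\<close> agrees with \<open>p\<close> in the top.\<close>
      let ?t = "\<lambda>j. if j \<in> index v' then F' j p else \<zero>\<^bsub>simple (fst j)\<^esub>"
      have "?t j \<in> carrier (simple (fst j))" if j: "j \<in> index v" for j
      proof -
        interpret S: left_module A "simple (fst j)" by (rule simple_left_module[OF index_simple[OF j]])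
        show ?thesis using mod_homD(1)[OF Fh' p] by simp
      qed
      then have "\<exists>x\<in>carrier ?Q. \<forall>j\<in>index v. F j x = ?t j" by (intro onto) blast
      then obtain y where y: "y \<in> carrier ?Q" "\<And>j. j \<in> index v \<Longrightarrow> F j y = ?t j" by blast
      have gy: "g y \<in> carrier ?P" by (rule mod_homD(1)[OF g y(1)])
      have "p \<ominus>\<^bsub>?P\<^esub> g y \<in> joint_kernel ?P v' F'"
      proof -
        have "F' j (p \<ominus>\<^bsub>?P\<^esub> g y) = \<zero>\<^bsub>simple (fst j)\<^esub>" if j: "j \<in> index v'" for j
        proof -
          interpret PSj: module_pair A ?P "simple (fst j)" by (rule module_pair.intro[OF P simple_left_module[OF index_simple[OF j]]])
          have "F' j (g y) = F' j p" using gF[OF y(1) j] y(2)[of j] j sub by auto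
          then show ?thesis
            using PSj.hom_minus[OF Fh'[OF j] p gy] PSj.W.minus_self[OF mod_homD(1)[OF Fh'[OF j] p]] by simp
        qed
        then show ?thesis unfolding joint_kernel_def using QP.W.M.minus_closed[OF p gy] by simp
      qed
      then have "f (p \<ominus>\<^bsub>?P\<^esub> g y) = \<zero>\<^bsub>simple c\<^esub>" by (rule kill[OF c f])
      moreover have "g y \<in> N" using N(2) y(1) by blast
      then have "f (g y) = \<zero>\<^bsub>simple c\<^esub>" using fN by simp
      ultimately show ?thesis
        using PS.hom_minus[OF f p gy] PS.W.minus_zero[OF mod_homD(1)[OF f p]] by simp
    qed
    then show False using fnz by blast
  qed
  obtain G where G: "G \<in> mod_hom R (Mn k) ?Z" and Gh: "\<And>h. h \<in> carrier ?Q \<Longrightarrow> compose (carrier M) G h = g h"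
    using yoneda[OF e Z(2) g] by metis
  have "\<forall>j\<in>{..<k'}. \<exists>h. h \<in> carrier ?Q \<and> g h = basis k' e' j"
  proof
    fix j assume "j \<in> {..<k'}"
    then have "basis k' e' j \<in> g ` carrier ?Q" unfolding surj using basis_mem[OF e'] by simp
    then obtain h where "basis k' e' j = g h" "h \<in> carrier ?Q" by (rule imageE)
    then show "\<exists>h. h \<in> carrier ?Q \<and> g h = basis k' e' j" by auto
  qed
  from bchoice[OF this] obtain h where h: "\<And>j. j < k' \<Longrightarrow> h j \<in> carrier ?Q" "\<And>j. j < k' \<Longrightarrow> g (h j) = basis k' e' j" by auto
  let ?U = "\<lambda>x. \<Oplus>\<^bsub>?Y\<^esub>j\<in>{..<k'}. h j (x j)"
  have U: "?U \<in> mod_hom R (Mn k') ?Y" by (rule copower_hom(1)[OF M(1) Y(2) Hom_mem(1)[OF h(1)]])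
  have GY: "G \<in> mod_hom R ?Y ?Z" using mod_hom_dom[OF G summand_sub(1)[OF e, THEN left_module.submodD(1)[OF Mn(1)]]] by (simp add: summand_def)
  interpret YZ: module_pair R ?Y ?Z by (rule module_pair.intro[OF Y(2) Z(2)])
  interpret CZ: module_pair R "Mn k'" ?Z by (rule module_pair.intro[OF Mn(1) Z(2)])
  have "G (?U x) = x" if x: "x \<in> carrier ?Z" for x
  proof -
    have xM: "x \<in> carrier (Mn k')" by (rule Z(5)[OF x])
    have xj: "x j \<in> carrier M" if "j < k'" for j using xM that by (auto simp: copower_carrier)
    have hx: "(\<lambda>j. h j (x j)) \<in> {..<k'} \<rightarrow> carrier ?Y" using Hom_mem(3)[OF h(1)] xj by auto
    have ij: "(\<lambda>j. copower_inj k' M j (x j)) \<in> {..<k'} \<rightarrow> carrier (Mn k')"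
      using mod_homD(1)[OF M.copower_inj_hom] xj by auto
    have "G (?U x) = (\<Oplus>\<^bsub>?Z\<^esub>j\<in>{..<k'}. G (h j (x j)))" by (rule YZ.hom_finsum[OF GY finite_lessThan hx])
    also have "\<dots> = (\<Oplus>\<^bsub>?Z\<^esub>j\<in>{..<k'}. e' (copower_inj k' M j (x j)))"
    proof (rule YZ.W.M.finsum_cong'[OF refl])
      show "(\<lambda>j. e' (copower_inj k' M j (x j))) \<in> {..<k'} \<rightarrow> carrier ?Z" using ij mod_homD(1)[OF Z(4)] by auto
      fix j assume "j \<in> {..<k'}"
      then have j: "j < k'" by simp
      have "G (h j (x j)) = g (h j) (x j)" using fun_cong[OF Gh[OF h(1)[OF j]], of "x j"] xj[OF j] by (simp add: compose_def)
      also have "\<dots> = e' (copower_inj k' M j (x j))" unfolding h(2)[OF j] basis_def using xj[OF j] by simp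
      finally show "G (h j (x j)) = e' (copower_inj k' M j (x j))" .
    qed
    also have "\<dots> = e' (\<Oplus>\<^bsub>Mn k'\<^esub>j\<in>{..<k'}. copower_inj k' M j (x j))"
      by (rule CZ.hom_finsum[OF Z(4) finite_lessThan ij, symmetric])
    also have "\<dots> = x" using M.copower_decomp[OF xM] Z(6)[OF x] by simp
    finally show ?thesis .
  qed
  then show ?thesis by (intro bexI[OF _ G] bexI[OF _ U] ballI)
qed

lemma finitely_many_summands:
  "\<exists>F. finite F \<and> (\<forall>(k', e')\<in>F. idem k' e' \<and> carrier (summand k' e') \<noteq> {\<zero>\<^bsub>summand k' e'\<^esub>}) \<and>
    (\<forall>k e. idem k e \<longrightarrow> carrier (summand k e) \<noteq> {\<zero>\<^bsub>summand k e\<^esub>} \<longrightarrow>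
      (\<exists>(k', e')\<in>F. \<exists>G\<in>mod_hom R (Mn k) (summand k' e'). \<exists>U\<in>mod_hom R (Mn k') (summand k e).
        \<forall>x\<in>carrier (summand k' e'). G (U x) = x))"
proof -
  let ?S = "{(k, e). idem k e \<and> carrier (summand k e) \<noteq> {\<zero>\<^bsub>summand k e\<^esub>}}"
  have "\<exists>v F. top_of (Hom_module R M (summand k e)) v F" if "idem k e" for k e
    by (rule ex_top[OF Hom[OF summand_sub(2)[OF that]] Hom_fg[OF summand_sub(2,3)[OF that]]])
  then have "\<forall>ke\<in>?S. \<exists>v. \<exists>F. top_of (Hom_module R M (summand (fst ke) (snd ke))) v F" by auto
  from bchoice[OF this] obtain v where v: "\<And>k e. (k, e) \<in> ?S \<Longrightarrow> \<exists>F. top_of (Hom_module R M (summand k e)) (v (k, e)) F" by auto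
  obtain F where F: "finite F" "F \<subseteq> ?S" "\<forall>y\<in>?S. \<exists>x\<in>F. \<forall>i<length simple_ideals. v x i \<le> v y i"
    using dickson[of ?S "length simple_ideals" v] by (elim exE conjE)
  have "\<exists>(k', e')\<in>F. \<exists>G\<in>mod_hom R (Mn k) (summand k' e'). \<exists>U\<in>mod_hom R (Mn k') (summand k e).
        \<forall>x\<in>carrier (summand k' e'). G (U x) = x" if ke: "(k, e) \<in> ?S" for k e
  proof -
    obtain x where x: "x \<in> F" "\<forall>i<length simple_ideals. v x i \<le> v (k, e) i" using F(3) ke by blast
    obtain k' e' where xe: "x = (k', e')" by (cases x)
    have S': "(k', e') \<in> ?S" using x(1) F(2) xe by blast
    obtain H where H: "top_of (Hom_module R M (summand k e)) (v (k, e)) H" using v[OF ke] by blast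
    obtain H' where H': "top_of (Hom_module R M (summand k' e')) (v (k', e')) H'" using v[OF S'] by blast
    have "\<exists>G\<in>mod_hom R (Mn k) (summand k' e'). \<exists>U\<in>mod_hom R (Mn k') (summand k e).
        \<forall>x\<in>carrier (summand k' e'). G (U x) = x"
      by (rule split_of_tops[OF _ _ H H']) (use ke S' x(2) xe in auto)
    then show ?thesis using x(1) xe by (intro bexI[of _ "(k', e')"]) simp_all
  qed
  moreover have "\<forall>(k', e')\<in>F. idem k' e' \<and> carrier (summand k' e') \<noteq> {\<zero>\<^bsub>summand k' e'\<^esub>}" using F(2) by auto
  ultimately show ?thesis using F(1) by (intro exI[of _ F]) simp
qed

end

section \<open>The theorem\<close>

context K0_subgroup
begin

text \<open>
  Let every nonzero summand split off one from \<open>F\<close>. Consider the decompositions of \<open>e(M\<^sup>k)\<close> into the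
  kernel and the image of an idempotent \<open>f\<close>, with the class of the kernel in \<open>H\<close>, and choose one whose
  kernel is maximal. If \<open>f\<close> were not zero, its image would split off a member of \<open>F\<close> by maps \<open>G\<close> and
  \<open>U\<close>; replacing \<open>f\<close> by \<open>f - UGf\<close> moves that member to the kernel and makes the kernel larger.
\<close>

lemma class_in_summands:
  fixes M :: "('a, 'm, 'x) module_scheme"
  assumes M: "left_module R M" "finitely_generated_module R M"
    and F: "\<And>k' e'. (k', e') \<in> F \<Longrightarrow> hom_setup.idem R M k' e' \<and> class_in (hom_setup.summand M k' e') \<and>
       carrier (hom_setup.summand M k' e') \<noteq> {\<zero>\<^bsub>hom_setup.summand M k' e'\<^esub>}"
    and split: "\<And>k e. hom_setup.idem R M k e \<Longrightarrow> carrier (hom_setup.summand M k e) \<noteq> {\<zero>\<^bsub>hom_setup.summand M k e\<^esub>} \<Longrightarrow>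
      \<exists>(k', e')\<in>F. \<exists>G\<in>mod_hom R (copower {..<k} M) (hom_setup.summand M k' e').
        \<exists>U\<in>mod_hom R (copower {..<k'} M) (hom_setup.summand M k e).
        \<forall>x\<in>carrier (hom_setup.summand M k' e'). G (U x) = x"
    and e: "hom_setup.idem R M k e"
  shows "class_in (hom_setup.summand M k e)"
proof -
  interpret hom_setup R M by (rule hom_setup.intro[OF R M])
  let ?X = "summand k e"
  note Xs = summand_sub[OF e]
  interpret C: left_module R "Mn k" by (rule Mn)
  interpret X: left_module R ?X by (rule Xs(2))
  interpret CC: module_pair R "Mn k" "Mn k" by (rule module_pair.intro[OF Mn(1) Mn(1)])
  have Xc: "carrier ?X = e ` carrier (Mn k)" by (simp add: summand_def)
  have Xops: "\<zero>\<^bsub>?X\<^esub> = \<zero>\<^bsub>Mn k\<^esub>" by (simp add: summand_def)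
  have eh: "e \<in> mod_hom R (Mn k) (Mn k)" using e by (simp add: idem_def)
  \<comment> \<open>Idempotents of \<open>e(M\<^sup>k)\<close>, extended to \<open>M\<^sup>k\<close> by zero on the complement.\<close>
  define good where "good f \<longleftrightarrow> idem k f \<and> (\<forall>v\<in>carrier (Mn k). e (f v) = f v \<and> f (e v) = f v)" for f
  define Ker where "Ker f = {x \<in> carrier ?X. f x = \<zero>\<^bsub>Mn k\<^esub>}" for f :: "(nat \<Rightarrow> 'm) \<Rightarrow> nat \<Rightarrow> 'm"
  have goodD: "f \<in> mod_hom R (Mn k) (Mn k)" "\<And>v. v \<in> carrier (Mn k) \<Longrightarrow> f v \<in> carrier (Mn k)"
    "\<And>v. v \<in> carrier (Mn k) \<Longrightarrow> f (f v) = f v" "\<And>v. v \<in> carrier (Mn k) \<Longrightarrow> e (f v) = f v"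
    "\<And>v. v \<in> carrier (Mn k) \<Longrightarrow> f (e v) = f v" if "good f" for f
    using that mod_homD(1)[of f R "Mn k" "Mn k"] unfolding good_def idem_def by auto
  have Ker: "submodule (Ker f) R (Mn k)" if "good f" for f
  proof -
    have "Ker f = e ` carrier (Mn k) \<inter> {x \<in> carrier (Mn k). f x = \<zero>\<^bsub>Mn k\<^esub>}"
      unfolding Ker_def Xc using C.submodD(1)[OF Xs(1)] by auto
    then show ?thesis using C.submod_Int[OF Xs(1) CC.hom_kernel_submodule[OF goodD(1)[OF that]]] by simp
  qed
  let ?S = "{W. \<exists>f. good f \<and> W = Ker f \<and> class_in ((Mn k)\<lparr>carrier := Ker f\<rparr>)}"
  \<comment> \<open>The trivial decomposition, with zero kernel.\<close>
  have "good e" using e unfolding good_def idem_def by simp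
  have "Ker e = {\<zero>\<^bsub>Mn k\<^esub>}"
    unfolding Ker_def using Xs(6) CC.hom_zero[OF eh] X.M.zero_closed Xops by auto
  then have "class_in ((Mn k)\<lparr>carrier := Ker e\<rparr>)"
    by (intro class_in_zero C.submodule_left_module Ker[OF \<open>good e\<close>]) simp
  then have ne: "?S \<noteq> {}" using \<open>good e\<close> by blast
  have "\<exists>W\<in>?S. \<forall>K\<in>?S. W \<subseteq> K \<longrightarrow> K = W"
    by (rule C.ex_max_fg_submodule[OF _ ne]) (use fg_submodule[OF R Mn] Ker in auto)
  then obtain f where f: "good f" "class_in ((Mn k)\<lparr>carrier := Ker f\<rparr>)"
    and max: "\<And>K. K \<in> ?S \<Longrightarrow> Ker f \<subseteq> K \<Longrightarrow> K = Ker f" by blast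
  have fi: "idem k f" using f(1) by (simp add: good_def)
  note fD = goodD[OF f(1)] and fs = summand_sub[OF fi]
  have "carrier (summand k f) = {\<zero>\<^bsub>summand k f\<^esub>}"
  proof (rule ccontr)
    assume "carrier (summand k f) \<noteq> {\<zero>\<^bsub>summand k f\<^esub>}"
    from split[OF fi this] obtain k' e' G U where F': "(k', e') \<in> F"
      and G: "G \<in> mod_hom R (Mn k) (summand k' e')" and U: "U \<in> mod_hom R (Mn k') (summand k f)"
      and GU: "\<forall>x\<in>carrier (summand k' e'). G (U x) = x" by blast
    have e': "idem k' e'" and cl: "class_in (summand k' e')"
      and nz: "carrier (summand k' e') \<noteq> {\<zero>\<^bsub>summand k' e'\<^esub>}" using F[OF F'] by simp_all
    let ?Z = "summand k' e'"
    note Zs = summand_sub[OF e']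
    interpret Z: left_module R ?Z by (rule Zs(2))
    interpret CZ: module_pair R "Mn k" ?Z by (rule module_pair.intro[OF Mn(1) Zs(2)])
    have UC: "U \<in> mod_hom R (Mn k') (Mn k)"
      by (rule mod_hom_cod'[OF U[unfolded summand_def]]) (use fs(5) in \<open>auto simp: summand_def\<close>)
    have Uf: "f (U y) = U y" if "y \<in> carrier (Mn k')" for y by (rule fs(6)[OF mod_homD(1)[OF U that]])
    have Uc: "U y \<in> carrier (Mn k)" if "y \<in> carrier (Mn k')" for y by (rule mod_homD(1)[OF UC that])
    have Ue: "e (U y) = U y" if "y \<in> carrier (Mn k')" for y
      using fD(4)[OF Uc[OF that]] Uf[OF that] by simp
    have GZ: "G (f v) \<in> carrier ?Z" if "v \<in> carrier (Mn k)" for v by (rule mod_homD(1)[OF G fD(2)[OF that]])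
    have GM: "G (f v) \<in> carrier (Mn k')" if "v \<in> carrier (Mn k)" for v by (rule Zs(5)[OF GZ[OF that]])
    let ?u = "\<lambda>v. U (G (f v))"
    have u: "?u \<in> mod_hom R (Mn k) (Mn k)"
    proof -
      have "U \<in> mod_hom R ?Z (Mn k)"
        using mod_hom_dom[OF UC] Zs(5) by (simp add: summand_def subset_iff)
      then show ?thesis by (rule mod_hom_comp[OF mod_hom_comp[OF fD(1) G]])
    qed
    have uc: "?u v \<in> carrier (Mn k)" if "v \<in> carrier (Mn k)" for v by (rule mod_homD(1)[OF u that])
    let ?g = "\<lambda>v. f v \<ominus>\<^bsub>Mn k\<^esub> ?u v"
    have g: "?g \<in> mod_hom R (Mn k) (Mn k)" by (rule CC.minus_hom[OF fD(1) u])
    have gc: "?g v \<in> carrier (Mn k)" if "v \<in> carrier (Mn k)" for v by (rule mod_homD(1)[OF g that])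
    have fg: "f (?g v) = ?g v" if v: "v \<in> carrier (Mn k)" for v
      using CC.hom_minus[OF fD(1) fD(2)[OF v] uc[OF v]] fD(3)[OF v] Uf[OF GM[OF v]] by simp
    have gf: "?g (f v) = ?g v" if v: "v \<in> carrier (Mn k)" for v using fD(3)[OF v] by simp
    have gU: "?g (U y) = \<zero>\<^bsub>Mn k\<^esub>" if y: "y \<in> carrier ?Z" for y
    proof -
      have yc: "y \<in> carrier (Mn k')" by (rule Zs(5)[OF y])
      have "?g (U y) = U y \<ominus>\<^bsub>Mn k\<^esub> U (G (U y))" using Uf[OF yc] by simp
      also have "G (U y) = y" using GU y by blast
      finally show ?thesis using C.minus_self[OF Uc[OF yc]] by simp
    qed
    have gg: "?g (?g v) = ?g v" if v: "v \<in> carrier (Mn k)" for v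
    proof -
      have "?g (f v \<ominus>\<^bsub>Mn k\<^esub> ?u v) = ?g (f v) \<ominus>\<^bsub>Mn k\<^esub> ?g (?u v)"
        by (rule CC.hom_minus[OF g fD(2)[OF v] uc[OF v]])
      also have "?g (?u v) = \<zero>\<^bsub>Mn k\<^esub>" by (rule gU[OF GZ[OF v]])
      also have "?g (f v) = ?g v" by (rule gf[OF v])
      finally show ?thesis using C.minus_zero[OF gc[OF v]] by simp
    qed
    have eg: "e (?g v) = ?g v" if v: "v \<in> carrier (Mn k)" for v
      using CC.hom_minus[OF eh fD(2)[OF v] uc[OF v]] fD(4)[OF v] Ue[OF GM[OF v]] by simp
    have ge: "?g (e v) = ?g v" if v: "v \<in> carrier (Mn k)" for v using fD(5)[OF v] by simp
    have good: "good ?g" unfolding good_def idem_def using g gg eg ge by simp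
    let ?K = "Ker ?g"
    have K: "submodule ?K R (Mn k)" by (rule Ker[OF good])
    have Kc: "x \<in> carrier (Mn k)" "x \<in> carrier ?X" if "x \<in> ?K" for x
      using that Xs(5) by (auto simp: Ker_def)
    let ?B = "(Mn k)\<lparr>carrier := ?K\<rparr>"
    have B: "left_module R ?B" by (rule C.submodule_left_module[OF K])
    have Bfg: "finitely_generated_module R ?B" unfolding C.fg_submodule_iff[OF K] by (rule fg_submodule[OF R Mn K])
    have UK: "U y \<in> ?K" if y: "y \<in> carrier ?Z" for y
    proof -
      have yc: "y \<in> carrier (Mn k')" by (rule Zs(5)[OF y])
      have "U y = e (U y)" using Ue[OF yc] by simp
      then have "U y \<in> carrier ?X" unfolding Xc using Uc[OF yc] by (rule image_eqI)
      then show ?thesis using gU[OF y] by (simp add: Ker_def)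
    qed
    let ?q = "\<lambda>x. G (f x)"
    have q: "?q \<in> mod_hom R ?B ?Z"
      by (rule mod_hom_dom[OF mod_hom_comp[OF fD(1) G]]) (use Kc in blast)
    have qs: "?q ` carrier ?B = carrier ?Z"
    proof
      show "?q ` carrier ?B \<subseteq> carrier ?Z" using mod_homD(1)[OF q] by blast
      show "carrier ?Z \<subseteq> ?q ` carrier ?B"
      proof
        fix y assume y: "y \<in> carrier ?Z"
        have eq: "y = ?q (U y)" using Uf[OF Zs(5)[OF y]] GU y by simp
        have "U y \<in> carrier ?B" using UK[OF y] by simp
        then show "y \<in> ?q ` carrier ?B" by (rule image_eqI[where x = "U y", rotated]) (rule eq)
      qed
    qed
    have sub: "Ker f \<subseteq> ?K"
    proof
      fix x assume x: "x \<in> Ker f"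
      then have xX: "x \<in> carrier ?X" "f x = \<zero>\<^bsub>Mn k\<^esub>" by (auto simp: Ker_def)
      have xc: "x \<in> carrier (Mn k)" by (rule Xs(5)[OF xX(1)])
      have "?u x = \<zero>\<^bsub>Mn k\<^esub>"
      proof -
        have "f x = f \<zero>\<^bsub>Mn k\<^esub>" using xX(2) CC.hom_zero[OF fD(1)] by simp
        then have "?u x = ?u \<zero>\<^bsub>Mn k\<^esub>" by simp
        then show ?thesis using CC.hom_zero[OF u] by simp
      qed
      then show "x \<in> ?K" using xX C.minus_zero[OF C.M.zero_closed] by (simp add: Ker_def)
    qed
    have ker: "{x \<in> carrier ?B. ?q x = \<zero>\<^bsub>?Z\<^esub>} = Ker f"
    proof
      show "{x \<in> carrier ?B. ?q x = \<zero>\<^bsub>?Z\<^esub>} \<subseteq> Ker f"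
      proof
        fix x assume "x \<in> {x \<in> carrier ?B. ?q x = \<zero>\<^bsub>?Z\<^esub>}"
        then have x: "x \<in> ?K" "?q x = \<zero>\<^bsub>?Z\<^esub>" by auto
        have xc: "x \<in> carrier (Mn k)" "x \<in> carrier ?X" using Kc x(1) by auto
        have "?u x = \<zero>\<^bsub>Mn k\<^esub>"
        proof -
          have "?q \<zero>\<^bsub>Mn k\<^esub> = \<zero>\<^bsub>?Z\<^esub>" by (rule CZ.hom_zero[OF mod_hom_comp[OF fD(1) G]])
          then have "?u x = ?u \<zero>\<^bsub>Mn k\<^esub>" using x(2) by simp
          then show ?thesis using CC.hom_zero[OF u] by simp
        qed
        moreover have "?g x = \<zero>\<^bsub>Mn k\<^esub>" using x(1) by (simp add: Ker_def)
        ultimately have "f x = \<zero>\<^bsub>Mn k\<^esub>" using C.minus_zero[OF fD(2)[OF xc(1)]] by simp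
        then show "x \<in> Ker f" using xc(2) by (simp add: Ker_def)
      qed
      show "Ker f \<subseteq> {x \<in> carrier ?B. ?q x = \<zero>\<^bsub>?Z\<^esub>}"
      proof
        fix x assume x: "x \<in> Ker f"
        have "f x = f \<zero>\<^bsub>Mn k\<^esub>" using x CC.hom_zero[OF fD(1)] by (simp add: Ker_def)
        then have "?q x = ?q \<zero>\<^bsub>Mn k\<^esub>" by simp
        also have "?q \<zero>\<^bsub>Mn k\<^esub> = \<zero>\<^bsub>?Z\<^esub>" by (rule CZ.hom_zero[OF mod_hom_comp[OF fD(1) G]])
        finally have "?q x = \<zero>\<^bsub>?Z\<^esub>" .
        moreover have "x \<in> carrier ?B" using subsetD[OF sub x] by simp
        ultimately show "x \<in> {x \<in> carrier ?B. ?q x = \<zero>\<^bsub>?Z\<^esub>}" by simp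
      qed
    qed
    have "class_in ?B"
      by (rule class_in_middle[OF B Bfg q qs _ cl], unfold ker) (use f(2) in simp)
    then have "?K \<in> ?S" using good by blast
    then have "?K = Ker f" by (rule max[OF _ sub])
    moreover obtain y where y: "y \<in> carrier ?Z" "y \<noteq> \<zero>\<^bsub>?Z\<^esub>" using nz Z.M.zero_closed by blast
    ultimately have "U y \<in> Ker f" using UK by simp
    then have "U y = \<zero>\<^bsub>Mn k\<^esub>" using Uf[OF Zs(5)[OF y(1)]] by (simp add: Ker_def)
    then have "G (U y) = G \<zero>\<^bsub>Mn k\<^esub>" by simp
    then show False using GU y CZ.hom_zero[OF G] by simp
  qed
  then have "f v = \<zero>\<^bsub>Mn k\<^esub>" if "v \<in> carrier (Mn k)" for v using that by (auto simp: summand_def)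
  then have "Ker f = carrier ?X" using Xs(5) by (auto simp: Ker_def)
  then show ?thesis using f(2) by (simp add: summand_def)
qed

end

lemma quotient_prime_fg:
  assumes R: "cring R" and p: "p \<in> Spec R"
  shows "left_module R (quotient_module (regular_module R) p)"
    and "finitely_generated_module R (quotient_module (regular_module R) p)"
proof -
  interpret cring R by fact
  interpret Q: left_module R "regular_module R" by (rule regular_left_module[OF ring_axioms])
  have c: "carrier (regular_module R) = carrier R" by (simp add: regular_module_def)
  have "ideal p R" using p by (auto simp: Spec_def primeideal_def)
  then have s: "submodule p R (regular_module R)" using ideal_iff_submodule[OF R] by simp
  have fg: "finitely_generated_module R (regular_module R)"
    unfolding finitely_generated_module_def span_def[symmetric] using regular_span_one[OF R] c
    by (intro exI[of _ "{\<one>\<^bsub>R\<^esub>}"]) auto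
  obtain \<pi> where \<pi>: "left_module R (quotient_module (regular_module R) p)"
    "\<pi> \<in> mod_hom R (regular_module R) (quotient_module (regular_module R) p)"
    "\<pi> ` carrier (regular_module R) = carrier (quotient_module (regular_module R) p)"
    using Q.quotient_module[OF s] by metis
  show "left_module R (quotient_module (regular_module R) p)" by (rule \<pi>(1))
  show "finitely_generated_module R (quotient_module (regular_module R) p)"
    by (rule fg_image[OF Q.left_module_axioms fg \<pi>])
qed

lemma K0_fg_if_generated:
  assumes R: "cring R" "noetherian_ring R" and F: "finite F" "F \<subseteq> fg_modules R"
    and all: "\<And>H. K0_subgroup R H \<Longrightarrow> (\<And>N. N \<in> F \<Longrightarrow> Poly_Mapping.single N 1 \<in> H) \<Longrightarrow>
      (\<And>N. N \<in> fg_modules R \<Longrightarrow> Poly_Mapping.single N 1 \<in> H)"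
  shows "finitely_generated_abelian_group (K0 R)"
proof -
  let ?G = "free_Abelian_group (fg_modules R)"
  let ?K = "generate ?G (K0_relations R)"
  interpret G: comm_group ?G by (rule abelian_free_Abelian_group)
  have single: "Poly_Mapping.single N 1 \<in> carrier ?G" if "N \<in> fg_modules R" for N
    using that by simp
  have rel: "K0_relations R \<subseteq> carrier ?G"
  proof
    fix x assume "x \<in> K0_relations R"
    then obtain A B C where x: "x = Poly_Mapping.single B 1 - Poly_Mapping.single A 1 - Poly_Mapping.single C 1"
      "A \<in> fg_modules R" "B \<in> fg_modules R" "C \<in> fg_modules R" unfolding K0_relations_def by blast
    have "Poly_Mapping.keys x \<subseteq> {A, B, C}"
      unfolding x(1) using keys_diff[of "Poly_Mapping.single B 1 - Poly_Mapping.single A 1" "Poly_Mapping.single C (1::int)"]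
        keys_diff[of "Poly_Mapping.single B 1" "Poly_Mapping.single A (1::int)"] by auto
    then show "x \<in> carrier ?G" using x(2-4) by auto
  qed
  have K: "subgroup ?K ?G" by (rule G.generate_is_subgroup[OF rel])
  have nK: "?K \<lhd> ?G" by (rule G.subgroup_imp_normal[OF K])
  interpret nK: normal ?K ?G by (rule nK)
  let ?S = "K0_relations R \<union> (\<lambda>N. Poly_Mapping.single N 1) ` F"
  have S: "?S \<subseteq> carrier ?G" using rel single F(2) by blast
  let ?H = "generate ?G ?S"
  have Hs: "subgroup ?H ?G" by (rule G.generate_is_subgroup[OF S])
  have Hin: "x \<in> ?H" if "x \<in> ?S" for x using that by (rule generate.incl)
  have H: "K0_subgroup R ?H"
  proof (rule K0_subgroup.intro[OF R])
    show "0 \<in> ?H" using subgroup.one_closed[OF Hs] by simp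
    show "x + y \<in> ?H" if "x \<in> ?H" "y \<in> ?H" for x y using subgroup.m_closed[OF Hs that] by simp
    show "- x \<in> ?H" if x: "x \<in> ?H" for x
    proof -
      have "Poly_Mapping.keys x \<subseteq> fg_modules R" using subgroup.mem_carrier[OF Hs x] by simp
      then show ?thesis using subgroup.m_inv_closed[OF Hs x] by simp
    qed
    show "K0_relations R \<subseteq> ?H" using Hin by blast
  qed
  have singles: "Poly_Mapping.single N 1 \<in> ?H" if "N \<in> fg_modules R" for N
    by (rule all[OF H _ that]) (use Hin in blast)
  have Hc: "?H = carrier ?G"
  proof
    show "?H \<subseteq> carrier ?G" by (rule subgroup.subset[OF Hs])
    show "carrier ?G \<subseteq> ?H"
    proof
      fix c assume "c \<in> carrier ?G"
      then have "Poly_Mapping.keys c \<subseteq> fg_modules R" by simp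
      then show "c \<in> ?H"
      proof (induction c rule: frag_induction)
        case zero then show ?case using subgroup.one_closed[OF Hs] by simp
      next
        case (one x) then show ?case using singles by simp
      next
        case (diff a b)
        have "- b \<in> ?H" by (rule K0_subgroup.H_uminus[OF H diff(2)])
        from K0_subgroup.H_add[OF H diff(1) this] show ?case by simp
      qed
    qed
  qed
  let ?\<phi> = "\<lambda>x. ?K #>\<^bsub>?G\<^esub> x"
  have hom: "group_hom ?G (K0 R) ?\<phi>"
    unfolding K0_def group_hom_def group_hom_axioms_def
    using nK.r_coset_hom_Mod nK.factorgroup_is_group G.is_group by simp
  interpret \<phi>: group_hom ?G "K0 R" ?\<phi> by (rule hom)
  let ?A = "insert \<one>\<^bsub>K0 R\<^esub> (?\<phi> ` (\<lambda>N. Poly_Mapping.single N 1) ` F)"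
  have Ac: "?A \<subseteq> carrier (K0 R)" using F(2) single \<phi>.hom_closed by (auto simp del: single)
  have img: "?\<phi> ` ?S \<subseteq> ?A"
  proof
    fix y assume "y \<in> ?\<phi> ` ?S"
    then obtain x where x: "x \<in> ?S" "y = ?\<phi> x" by blast
    show "y \<in> ?A"
    proof (cases "x \<in> K0_relations R")
      case True
      then have "x \<in> ?K" by (rule generate.incl)
      then have "?\<phi> x = ?K" by (rule nK.rcos_const[OF G.is_group])
      then show ?thesis using x(2) by (simp add: K0_def)
    next
      case False then show ?thesis using x by blast
    qed
  qed
  have "carrier (K0 R) = ?\<phi> ` carrier ?G" by (auto simp: K0_def FactGroup_def RCOSETS_def)
  also have "\<dots> = ?\<phi> ` generate ?G ?S" using Hc by simp
  also have "\<dots> = generate (K0 R) (?\<phi> ` ?S)" by (rule \<phi>.generate_img[OF S, symmetric])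
  also have "\<dots> \<subseteq> generate (K0 R) ?A" by (rule \<phi>.H.mono_generate[OF img])
  finally have "generate (K0 R) ?A = carrier (K0 R)"
    using \<phi>.H.generate_incl[OF Ac] by blast
  moreover have "comm_group (K0 R)" unfolding K0_def by (rule G.abelian_FactGroup[OF K])
  moreover have "finite ?A" using F(1) by simp
  ultimately show ?thesis unfolding finitely_generated_abelian_group_def using Ac by blast
qed

theorem corollary2p2:
  fixes R :: "('a, 'r) ring_scheme" and M :: "('a, 'm, 'x) module_scheme"
  assumes "cring R" and "noetherian_ring R" and "semilocal_ring R"
    and "module R M" and "finitely_generated_module R M"
    and "gives_NCR R M"
    and "\<exists>Z. closed_in_Spec R Z \<and> krull_dimension Z \<le> 1 \<and>
           (\<forall>p \<in> Spec R - Z. generator_at R M p)"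
  shows "finitely_generated_abelian_group (K0 R)"
proof -
  have lm: "left_module R M" by (rule module_imp_left_module[OF assms(4)])
  interpret semilocal_setup R M
    by (intro semilocal_setup.intro hom_setup.intro semilocal_setup_axioms.intro assms lm)
  obtain Z where Z: "closed_in_Spec R Z" "krull_dimension Z \<le> 1" "\<forall>p\<in>Spec R - Z. generator_at R M p"
    using assms(7) by blast
  let ?V = "{p \<in> Spec R. trace_ideal R M \<subseteq> p}"
  have "?V \<subseteq> Z"
    using trace_ideal_not_below[OF assms(1,2) lm assms(5)] Z(3) by blast
  then have V: "finite ?V" using finite_closed_dim_one[OF assms(1-3) Z(1,2)] by (rule finite_subset)
  obtain F where F: "finite F" "\<forall>(k', e')\<in>F. idem k' e' \<and> carrier (summand k' e') \<noteq> {\<zero>\<^bsub>summand k' e'\<^esub>}"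
    and split: "\<forall>k e. idem k e \<longrightarrow> carrier (summand k e) \<noteq> {\<zero>\<^bsub>summand k e\<^esub>} \<longrightarrow>
      (\<exists>(k', e')\<in>F. \<exists>G\<in>mod_hom R (Mn k) (summand k' e'). \<exists>U\<in>mod_hom R (Mn k') (summand k e).
        \<forall>x\<in>carrier (summand k' e'). G (U x) = x)"
    using finitely_many_summands by (elim exE conjE)
  \<comment> \<open>The generators are classes of isomorphic copies, chosen before the subgroup \<open>H\<close> is given.\<close>
  have "\<forall>x\<in>F. \<exists>N. N \<in> fg_modules R \<and>
    (\<exists>f\<in>mod_hom R (summand (fst x) (snd x)) N. bij_betw f (carrier (summand (fst x) (snd x))) (carrier N))"
  proof
    fix x assume "x \<in> F"
    then have "idem (fst x) (snd x)" using F(2) by auto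
    note s = summand_sub(2,3)[OF this]
    obtain N f where "N \<in> fg_modules R" "f \<in> mod_hom R (summand (fst x) (snd x)) N"
      "bij_betw f (carrier (summand (fst x) (snd x))) (carrier N)" by (rule fg_modules_copy[OF assms(1) s])
    then show "\<exists>N. N \<in> fg_modules R \<and>
      (\<exists>f\<in>mod_hom R (summand (fst x) (snd x)) N. bij_betw f (carrier (summand (fst x) (snd x))) (carrier N))" by auto
  qed
  from bchoice[OF this] obtain c where c: "\<forall>x\<in>F. c x \<in> fg_modules R \<and>
    (\<exists>f\<in>mod_hom R (summand (fst x) (snd x)) (c x). bij_betw f (carrier (summand (fst x) (snd x))) (carrier (c x)))" ..
  let ?Q = "\<lambda>p. quotient_module (regular_module R) p"
  have "\<forall>p\<in>?V. \<exists>N. N \<in> fg_modules R \<and> (\<exists>f\<in>mod_hom R (?Q p) N. bij_betw f (carrier (?Q p)) (carrier N))"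
  proof
    fix p assume "p \<in> ?V"
    then have "p \<in> Spec R" by simp
    note q = quotient_prime_fg[OF assms(1) this]
    obtain N f where "N \<in> fg_modules R" "f \<in> mod_hom R (?Q p) N" "bij_betw f (carrier (?Q p)) (carrier N)"
      by (rule fg_modules_copy[OF assms(1) q])
    then show "\<exists>N. N \<in> fg_modules R \<and> (\<exists>f\<in>mod_hom R (?Q p) N. bij_betw f (carrier (?Q p)) (carrier N))" by auto
  qed
  from bchoice[OF this] obtain d where d: "\<forall>p\<in>?V. d p \<in> fg_modules R \<and>
    (\<exists>f\<in>mod_hom R (?Q p) (d p). bij_betw f (carrier (?Q p)) (carrier (d p)))" ..
  show ?thesis
  proof (rule K0_fg_if_generated[OF assms(1,2), of "c ` F \<union> d ` ?V"])
    show "finite (c ` F \<union> d ` ?V)" using F(1) V by simp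
    show "c ` F \<union> d ` ?V \<subseteq> fg_modules R" using c d by blast
    fix H N assume H: "K0_subgroup R H" and gens: "\<And>N. N \<in> c ` F \<union> d ` ?V \<Longrightarrow> Poly_Mapping.single N 1 \<in> H"
      and N: "N \<in> fg_modules R"
    interpret H: K0_subgroup R H by (rule H)
    have cF: "idem k' e' \<and> H.class_in (summand k' e') \<and> carrier (summand k' e') \<noteq> {\<zero>\<^bsub>summand k' e'\<^esub>}" if x: "(k', e') \<in> F" for k' e'
    proof -
      have i: "idem k' e'" "carrier (summand k' e') \<noteq> {\<zero>\<^bsub>summand k' e'\<^esub>}" using F(2) x by auto
      obtain f where f: "c (k', e') \<in> fg_modules R" "f \<in> mod_hom R (summand k' e') (c (k', e'))"
        "bij_betw f (carrier (summand k' e')) (carrier (c (k', e')))" using bspec[OF c x] by auto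
      have "Poly_Mapping.single (c (k', e')) 1 \<in> H" using gens x by blast
      then have "H.class_in (summand k' e')" unfolding H.class_in_def using summand_sub(2)[OF i(1)] f by blast
      then show ?thesis using i by simp
    qed
    have cs: "H.class_in (summand k e)" if "idem k e" for k e
      by (rule H.class_in_summands[OF lm assms(5) cF split[rule_format] that])
    have cp: "H.class_in (?Q p)" if p: "p \<in> Spec R" "trace_ideal R M \<subseteq> p" for p
    proof -
      have pV: "p \<in> ?V" using p by simp
      obtain f where f: "d p \<in> fg_modules R" "f \<in> mod_hom R (?Q p) (d p)" "bij_betw f (carrier (?Q p)) (carrier (d p))"
        using bspec[OF d pV] by auto
      have "Poly_Mapping.single (d p) 1 \<in> H" using gens pV by blast
      then show ?thesis unfolding H.class_in_def using quotient_prime_fg(1)[OF assms(1) p(1)] f by blast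
    qed
    interpret resolution_setup R M H
      by (intro resolution_setup.intro hom_setup_axioms H resolution_setup_axioms.intro cs cp)
    have "right_global_dimension (End_ring R M) < \<infinity>" using assms(6) by (simp add: gives_NCR_def)
    from class_in_all[OF this H.fg_modulesD[OF N]] show "Poly_Mapping.single N 1 \<in> H"
      by (rule H.class_in_fg_modules[OF N])
  qed
qed

end
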